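(* Let $\mathcal M$ be a graded manifold, $\mathcal E$ a graded vector bundle over $\mathcal M$ and $k\in\mathbb N_0$. Let $U\subseteq M$ be an open set for which there are a graded local chart $(U,\varphi)$ for $\mathcal M$ (with coordinate functions $z^1,\dots,z^n$) and a local frame $\{\Phi_\lambda\}_{\lambda=1}^r$ for $\mathcal E$ over $U$. Let $D\in\mathrm{Dif}^k_{\mathcal E}(U)$. Then $D$ can be uniquely decomposed as $$D=\sum_{q=0}^{k}\ \sum_{\mathbf I\in\overline{\mathbb N}{}^n(q)}\frac{1}{\mathbf I!}\,[\mathbf D^{\mathbf I}]^{\mu}{}_{\lambda}\cdot\mathfrak P_{\mathbf I}{}^{\lambda}{}_{\mu},$$ where the functions $[\mathbf D^{\mathbf I}]^\mu{}_\lambda\in\mathcal C^\infty_{\mathcal M}(U)$ are obtained from $D$ by $$D(\Phi_\lambda)=[\mathbf D^{\mathbf 0}]^\mu{}_\lambda\cdot\Phi_\mu,\qquad D^{(w(\mathbf I))}_{(z^1,\dots,z^1,\dots,z^n,\dots,z^n)}(\Phi_\lambda)=[\mathbf D^{\mathbf I}]^\mu{}_\lambda\cdot\Phi_\mu\quad (\mathbf I\neq\mathbf 0),$$ each $z^A$ being repeated $i_A$ times, and $\mathfrak P_{\mathbf I}{}^\lambda{}_\mu\in\mathrm{Dif}^k_{\mathcal E}(U)$ are differential operators of degree $|\vartheta_\mu|-|\vartheta_\lambda|-|z^{\mathbf I}|$ defined by $$\mathfrak P_{\mathbf I}{}^\lambda{}_\mu(\psi)=(-1)^{(|\vartheta_\mu|-|\vartheta_\lambda|)(|\psi^\lambda|-|z^{\mathbf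 I}|)}(\partial^{\mathrm{op}}_{\mathbf I}\psi^\lambda)\cdot\Phi_\mu\quad(\text{no summation over }\lambda,\mu)$$ for all $\psi=\sum_\lambda\psi^\lambda\cdot\Phi_\lambda\in\Gamma_{\mathcal E}(U)$. Consequently, $\mathrm{Dif}^k_{\mathcal E}$ is the sheaf of sections of a graded vector bundle $\mathfrak D^k_{\mathcal E}$ over $\mathcal M$. If $(\ell_j)_{j\in\mathbb Z}$ is its graded rank, then $$\ell_j=\#\Big\{(\mathbf I,\mu,\lambda)\in\bigcup_{q=0}^k\overline{\mathbb N}{}^n(q)\times\{1,\dots,r\}^2\ :\ |\vartheta_\mu|-|\vartheta_\lambda|-|z^{\mathbf I}|=j\Big\}.$$ The collection $\{\mathfrak P_{\mathbf I}{}^\lambda{}_\mu\}$, for all $\mathbf I\in\overline{\mathbb N}{}^n(q)$ with $q\in\{0,\dots,k\}$ and $\mu,\lambda\in\{1,\dots,r\}$, forms a local frame for $\mathfrak D^k_{\mathcal E}$ over $U$.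
   Context: Graded means $\mathbb{Z}$-graded. Graded vector spaces and modules are sequences indexed by $j\in\mathbb Z$; all elements are homogeneous and $|v|$ is the degree. A graded linear map $F$ of degree $|F|$ raises degree by $|F|$; it is linear over a graded commutative algebra if $F(f\cdot v)=(-1)^{|F||f|}f\cdot F(v)$. Graded manifold $\mathcal M$: a second countable Hausdorff space $M$ with a sheaf $\mathcal{C}^\infty_{\mathcal M}$ of graded commutative associative unital real algebras, locally isomorphic to the following model: an open subset of $\mathbb R^{n_0}$ with the sheaf of formal power series in graded commuting variables of nonzero degrees ($n_j$ of degree $j\neq 0$), with smooth coefficients. The total dimension $n=\sum_j n_j$ is finite. A graded local chart over $U$ gives coordinate functions $z^1,\dots,z^n$ and coordinate vector fields $\partial_A=\partial/\partial z^A$ of degree $-|z^A|$ (graded derivations with $\partial_A z^B=\delta_A^B$). Graded vector bundle $\mathcal E$: a sheaf $\Gamma_{\mathcal E}$ of graded $\mathcal{C}^\infty_{\mathcal M}$-modules locally isomorphic to $\mathcal{C}^\infty_{\mathcal M}\otimes_{\mathbb R}K$ for a fixed finite-dimensional graded vector space $K$; the graded rank is $(\dim K_j)_{j}$. A local frame over $U$ is a collection $\Phi_1,\dots,\Phi_r\in\Gamma_{\mathcal E}(U)$, $|\Phi_\lambda|=|\vartheta_\lambda|$ for a fixed homogeneous basis $(\vartheta_\lambda)$ of $K$, such that over every open $V\subseteq U$ every section is uniquely $\psi=\psi^\lambda\cdot\Phi_\lambda|_V$. Repeated indices are summed unless stated otherwise. Differential operators: for $f\in\mathcal C^\infty_{\mathcal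 M}(U)$ let $\lambda_f(\psi)=f\cdot\psi$, and let $[A,B]=A\circ B-(-1)^{|A||B|}B\circ A$. A graded $\mathbb R$-linear map $D:\Gamma_{\mathcal E}(U)\to\Gamma_{\mathcal E}(U)$ (of any degree $|D|$) is a $0$-th order differential operator if it is $\mathcal C^\infty_{\mathcal M}(U)$-linear, and a $k$-th order one ($k\geq1$) if $[D,\lambda_f]$ is a $(k-1)$-th order one for every $f$. They form $\mathrm{Dif}^k_{\mathcal E}(U)$, with $(f\cdot D)(\psi)=f\cdot D(\psi)$; they depend locally on sections and so restrict uniquely to smaller open sets. For $j\ge1$, $D^{(j)}_{(f_1,\dots,f_j)}=[\cdots[[D,\lambda_{f_1}],\lambda_{f_2}],\dots,\lambda_{f_j}]$. Multi-indices: $\overline{\mathbb N}{}^n$ is the set of $\mathbf I=(i_1,\dots,i_n)\in(\mathbb N_0)^n$ with $i_A\in\{0,1\}$ whenever $|z^A|$ is odd; $w(\mathbf I)=\sum_A i_A$; $\overline{\mathbb N}{}^n(q)=\{\mathbf I\in\overline{\mathbb N}{}^n: w(\mathbf I)=q\}$; $\mathbf 0=(0,\dots,0)$; $\mathbf I!=i_1!\cdots i_n!$; $z^{\mathbf I}=(z^1)^{i_1}\cdots(z^n)^{i_n}$; $\partial^{\mathrm{op}}_{\mathbf I}=(\partial_n)^{i_n}\circ\cdots\circ(\partial_1)^{i_1}$. *)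

theory Defs
  imports "HOL-Analysis.Analysis" "HOL-Library.Function_Algebras"
begin

instantiation "fun" :: (type, real_vector) real_vector
begin

definition scaleR_fun :: "real \<Rightarrow> ('a \<Rightarrow> 'b) \<Rightarrow> 'a \<Rightarrow> 'b"
  where "scaleR_fun a f = (\<lambda>x. a *\<^sub>R f x)"

instance
  by standard (simp_all add: scaleR_fun_def fun_eq_iff scaleR_add_right scaleR_add_left)

end


section \<open>Sheaves of graded vector spaces, algebras and modules\<close>

definition lin_on :: "'v::real_vector set \<Rightarrow> ('v \<Rightarrow> 'w::real_vector) \<Rightarrow> bool"
  where "lin_on A f \<longleftrightarrow>
    (\<forall>x\<in>A. \<forall>y\<in>A. f (x + y) = f x + f y) \<and> (\<forall>a. \<forall>x\<in>A. f (a *\<^sub>R x) = a *\<^sub>R f x)"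

text \<open>
  The components of degree \<open>j\<close> of all the section spaces, \<open>gsec S U j\<close>, are subspaces of one ambient
  real vector space \<open>'v\<close>, which has no further meaning; for any sheaf the direct sum over all
  \<open>U\<close> and \<open>j\<close> serves. Components of different degrees meet only in \<open>0\<close>, so that a
  nonzero element has a degree.
\<close>

record ('p, 'v) gpresheaf =
  gsec :: "'p set \<Rightarrow> int \<Rightarrow> 'v set"
  gres :: "'p set \<Rightarrow> 'p set \<Rightarrow> 'v \<Rightarrow> 'v"  \<comment> \<open>\<open>gres S U V\<close> restricts from \<open>U\<close> to \<open>V \<subseteq> U\<close>\<close>

definition graded_presheaf :: "'p topology \<Rightarrow> ('p, 'v::real_vector, 'm) gpresheaf_scheme \<Rightarrow> bool"
  where "graded_presheaf X S \<longleftrightarrow>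
    (\<forall>U j. openin X U \<longrightarrow> subspace (gsec S U j)) \<and>
    (\<forall>U i j. openin X U \<and> i \<noteq> j \<longrightarrow> gsec S U i \<inter> gsec S U j = {0}) \<and>
    (\<forall>U V j. openin X U \<and> openin X V \<and> V \<subseteq> U \<longrightarrow>
       gres S U V ` gsec S U j \<subseteq> gsec S V j \<and> lin_on (gsec S U j) (gres S U V)) \<and>
    (\<forall>U j. \<forall>s\<in>gsec S U j. openin X U \<longrightarrow> gres S U U s = s) \<and>
    (\<forall>U V W j. \<forall>s\<in>gsec S U j. openin X U \<and> openin X V \<and> openin X W \<and> W \<subseteq> V \<and> V \<subseteq> U \<longrightarrow>
       gres S V W (gres S U V s) = gres S U W s)"

definition graded_sheaf :: "'p topology \<Rightarrow> ('p, 'v::real_vector, 'm) gpresheaf_scheme \<Rightarrow> bool"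
  where "graded_sheaf X S \<longleftrightarrow> graded_presheaf X S \<and>
    (\<forall>\<U> j s. (\<forall>V\<in>\<U>. openin X V \<and> s V \<in> gsec S V j) \<and>
       (\<forall>V\<in>\<U>. \<forall>W\<in>\<U>. gres S V (V \<inter> W) (s V) = gres S W (V \<inter> W) (s W)) \<longrightarrow>
       (\<exists>!t. t \<in> gsec S (\<Union>\<U>) j \<and> (\<forall>V\<in>\<U>. gres S (\<Union>\<U>) V t = s V)))"

record ('p, 'c) galgebra = "('p, 'c) gpresheaf" +
  gmul :: "'c \<Rightarrow> 'c \<Rightarrow> 'c"
  gone :: "'p set \<Rightarrow> 'c"

definition graded_algebra_sheaf :: "'p topology \<Rightarrow> ('p, 'c::real_vector) galgebra \<Rightarrow> bool"
  where "graded_algebra_sheaf X C \<longleftrightarrow> graded_sheaf X C \<and>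
    (\<forall>U. openin X U \<longrightarrow>
       gone C U \<in> gsec C U 0 \<and>
       (\<forall>i. \<forall>f\<in>gsec C U i. gmul C (gone C U) f = f \<and>
          (\<forall>j. lin_on (gsec C U j) (gmul C f) \<and> lin_on (gsec C U j) (\<lambda>g. gmul C g f)) \<and>
          (\<forall>j. \<forall>g\<in>gsec C U j. gmul C f g \<in> gsec C U (i + j) \<and>
             gmul C f g = ((-1) powi (i * j)) *\<^sub>R gmul C g f \<and>
             (\<forall>l. \<forall>h\<in>gsec C U l. gmul C (gmul C f g) h = gmul C f (gmul C g h))))) \<and>
    (\<forall>U V. openin X U \<and> openin X V \<and> V \<subseteq> U \<longrightarrow>
       gres C U V (gone C U) = gone C V \<and>
       (\<forall>i j. \<forall>f\<in>gsec C U i. \<forall>g\<in>gsec C U j.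
          gres C U V (gmul C f g) = gmul C (gres C U V f) (gres C U V g)))"

record ('p, 'e, 'c) gmodule = "('p, 'e) gpresheaf" +
  gact :: "'c \<Rightarrow> 'e \<Rightarrow> 'e"

definition graded_module_sheaf ::
  "'p topology \<Rightarrow> ('p, 'c::real_vector) galgebra \<Rightarrow> ('p, 'e::real_vector, 'c) gmodule \<Rightarrow> bool"
  where "graded_module_sheaf X C E \<longleftrightarrow> graded_sheaf X E \<and>
    (\<forall>U. openin X U \<longrightarrow>
       (\<forall>j. \<forall>\<psi>\<in>gsec E U j. gact E (gone C U) \<psi> = \<psi> \<and>
          (\<forall>i. lin_on (gsec C U i) (\<lambda>f. gact E f \<psi>))) \<and>
       (\<forall>i. \<forall>f\<in>gsec C U i. \<forall>j. lin_on (gsec E U j) (gact E f) \<and>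
          (\<forall>\<psi>\<in>gsec E U j. gact E f \<psi> \<in> gsec E U (i + j) \<and>
             (\<forall>l. \<forall>g\<in>gsec C U l. gact E (gmul C g f) \<psi> = gact E g (gact E f \<psi>))))) \<and>
    (\<forall>U V. openin X U \<and> openin X V \<and> V \<subseteq> U \<longrightarrow>
       (\<forall>i j. \<forall>f\<in>gsec C U i. \<forall>\<psi>\<in>gsec E U j.
          gres E U V (gact E f \<psi>) = gact E (gres C U V f) (gres E U V \<psi>)))"

text \<open>\<open>degs\<close> lists the degrees of a homogeneous basis, indexed by \<open>L\<close>, of a graded vector
  space of graded dimension \<open>d\<close>.\<close>

definition has_degrees :: "'l set \<Rightarrow> ('l \<Rightarrow> int) \<Rightarrow> (int \<Rightarrow> nat) \<Rightarrow> bool"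
  where "has_degrees L degs d \<longleftrightarrow> finite L \<and> (\<forall>j. d j = card {l \<in> L. degs l = j})"


section \<open>Graded manifolds\<close>

text \<open>
  A local model has variables indexed by \<open>A < n\<close> (rather than from \<open>1\<close> to \<open>n\<close>), of degrees \<open>dz A\<close>. Those of degree \<open>0\<close>, in
  whatever positions they occur, are the coordinates of the underlying Euclidean space; its points are
  the functions supported on these positions, as for \<^const>\<open>Euclidean_space\<close>.
\<close>

definition body_space :: "nat \<Rightarrow> (nat \<Rightarrow> int) \<Rightarrow> (nat \<Rightarrow> real) topology"
  where "body_space n dz =
    subtopology (powertop_real UNIV) {x. \<forall>A. \<not> (A < n \<and> dz A = 0) \<longrightarrow> x A = 0}"

lemma body_space_Euclidean_space: "body_space n (\<lambda>_. 0) = Euclidean_space n"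
  by (simp add: body_space_def Euclidean_space_def not_less)

text \<open>\<open>C\<^sup>k\<close> on an open subset \<open>W\<close>: continuous, with \<open>C\<^sup>k\<^sup>-\<^sup>1\<close> first partial derivatives \<open>g A\<close>.\<close>

primrec Ck_on :: "nat \<Rightarrow> nat \<Rightarrow> (nat \<Rightarrow> int) \<Rightarrow> (nat \<Rightarrow> real) set \<Rightarrow> ((nat \<Rightarrow> real) \<Rightarrow> real) \<Rightarrow> bool"
  where
    "Ck_on 0 n dz W f \<longleftrightarrow> continuous_map (subtopology (body_space n dz) W) euclideanreal f"
  | "Ck_on (Suc k) n dz W f \<longleftrightarrow>
      continuous_map (subtopology (body_space n dz) W) euclideanreal f \<and>
      (\<exists>g. \<forall>A. A < n \<and> dz A = 0 \<longrightarrow>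
         (\<forall>x\<in>W. ((\<lambda>t. f (x(A := t))) has_real_derivative g A x) (at (x A))) \<and>
         Ck_on k n dz W (g A))"

definition smooth_on :: "nat \<Rightarrow> (nat \<Rightarrow> int) \<Rightarrow> (nat \<Rightarrow> real) set \<Rightarrow> ((nat \<Rightarrow> real) \<Rightarrow> real) \<Rightarrow> bool"
  where "smooth_on n dz W f \<longleftrightarrow> (\<forall>k. Ck_on k n dz W f)"

text \<open>Exponents of the monomials in the variables of nonzero degree.\<close>

definition formal_exponents :: "nat \<Rightarrow> (nat \<Rightarrow> int) \<Rightarrow> (nat \<Rightarrow> nat) set"
  where "formal_exponents n dz =
    {p. (\<forall>A. \<not> (A < n \<and> dz A \<noteq> 0) \<longrightarrow> p A = 0) \<and> (\<forall>A. odd (dz A) \<longrightarrow> p A \<le> 1)}"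

definition exponent_degree :: "nat \<Rightarrow> (nat \<Rightarrow> int) \<Rightarrow> (nat \<Rightarrow> nat) \<Rightarrow> int"
  where "exponent_degree n dz p = (\<Sum>A<n. int (p A) * dz A)"

text \<open>
  A power series is the family of its coefficient functions, extended by \<open>0\<close> outside of their domain.
  The sign in the product comes from reordering the increasingly ordered monomials \<open>\<xi>\<^sup>p \<xi>\<^sup>q\<close>, in which the
  factors \<open>\<xi>\<^sup>A\<close> of the first one move past the factors \<open>\<xi>\<^sup>B\<close> of the second one with \<open>B < A\<close>.
\<close>

type_synonym power_series = "(nat \<Rightarrow> nat) \<Rightarrow> (nat \<Rightarrow> real) \<Rightarrow> real"

definition reorder_sign :: "nat \<Rightarrow> (nat \<Rightarrow> int) \<Rightarrow> (nat \<Rightarrow> nat) \<Rightarrow> (nat \<Rightarrow> nat) \<Rightarrow> real"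
  where "reorder_sign n dz p q =
    (-1) powi (\<Sum>A<n. \<Sum>B<A. int (p A) * dz A * (int (q B) * dz B))"

definition graded_model :: "nat \<Rightarrow> (nat \<Rightarrow> int) \<Rightarrow> (nat \<Rightarrow> real, power_series) galgebra"
  where "graded_model n dz =
    \<lparr> gsec = (\<lambda>W j. {F. \<forall>p. smooth_on n dz W (F p) \<and> (\<forall>x. x \<notin> W \<longrightarrow> F p x = 0) \<and>
                (F p \<noteq> 0 \<longrightarrow> p \<in> formal_exponents n dz \<and> exponent_degree n dz p = j)}),
      gres = (\<lambda>W W' F p x. if x \<in> W' then F p x else 0),
      gmul = (\<lambda>F G s x. if s \<in> formal_exponents n dz
                then \<Sum>p | p \<le> s. reorder_sign n dz p (s - p) * F p x * G (s - p) x
                else 0),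
      gone = (\<lambda>W p x. if p = 0 \<and> x \<in> W then 1 else 0) \<rparr>"

definition model_coord :: "nat \<Rightarrow> (nat \<Rightarrow> int) \<Rightarrow> (nat \<Rightarrow> real) set \<Rightarrow> nat \<Rightarrow> power_series"
  where "model_coord n dz W A = (\<lambda>p x.
    if x \<notin> W then 0
    else if dz A = 0 then (if p = 0 then x A else 0)
    else (if p = (\<lambda>B. if B = A then 1 else 0) then 1 else 0))"

text \<open>
  A chart over \<open>U\<close> for a manifold of graded dimension \<open>nd\<close>: a homeomorphism \<open>\<phi>\<close> of \<open>U\<close> onto an open
  set of the model, with isomorphisms \<open>pb V\<close>, the pullbacks \<open>\<phi>\<^sup>*\<close> of functions from \<open>\<phi> ` V\<close> to \<open>V\<close>.
\<close>

definition graded_chart ::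
  "'p topology \<Rightarrow> ('p, 'c::real_vector) galgebra \<Rightarrow> (int \<Rightarrow> nat) \<Rightarrow> 'p set \<Rightarrow> nat \<Rightarrow> (nat \<Rightarrow> int) \<Rightarrow>
   ('p \<Rightarrow> nat \<Rightarrow> real) \<Rightarrow> ('p set \<Rightarrow> power_series \<Rightarrow> 'c) \<Rightarrow> bool"
  where "graded_chart X C nd U n dz \<phi> pb \<longleftrightarrow>
    openin X U \<and> has_degrees {..<n} dz nd \<and> openin (body_space n dz) (\<phi> ` U) \<and>
    homeomorphic_map (subtopology X U) (subtopology (body_space n dz) (\<phi> ` U)) \<phi> \<and>
    (\<forall>V. openin X V \<and> V \<subseteq> U \<longrightarrow>
       (\<forall>j. bij_betw (pb V) (gsec (graded_model n dz) (\<phi> ` V) j) (gsec C V j) \<and>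
            lin_on (gsec (graded_model n dz) (\<phi> ` V) j) (pb V)) \<and>
       pb V (gone (graded_model n dz) (\<phi> ` V)) = gone C V \<and>
       (\<forall>i j. \<forall>F\<in>gsec (graded_model n dz) (\<phi> ` V) i. \<forall>G\<in>gsec (graded_model n dz) (\<phi> ` V) j.
          pb V (gmul (graded_model n dz) F G) = gmul C (pb V F) (pb V G)) \<and>
       (\<forall>V' j. \<forall>F\<in>gsec (graded_model n dz) (\<phi> ` V) j. openin X V' \<and> V' \<subseteq> V \<longrightarrow>
          pb V' (gres (graded_model n dz) (\<phi> ` V) (\<phi> ` V') F) = gres C V V' (pb V F)))"

definition chart_coord ::
  "'p set \<Rightarrow> nat \<Rightarrow> (nat \<Rightarrow> int) \<Rightarrow> ('p \<Rightarrow> nat \<Rightarrow> real) \<Rightarrow> ('p set \<Rightarrow> power_series \<Rightarrow> 'c) \<Rightarrow> nat \<Rightarrow> 'c"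
  where "chart_coord U n dz \<phi> pb A = pb U (model_coord n dz (\<phi> ` U) A)"

definition graded_manifold ::
  "'p topology \<Rightarrow> ('p, 'c::real_vector) galgebra \<Rightarrow> (int \<Rightarrow> nat) \<Rightarrow> bool"
  where "graded_manifold X C nd \<longleftrightarrow>
    second_countable X \<and> Hausdorff_space X \<and> graded_algebra_sheaf X C \<and>
    (\<exists>n dz. has_degrees {..<n} dz nd \<and>
       (\<forall>x\<in>topspace X. \<exists>U \<phi> pb. x \<in> U \<and> graded_chart X C nd U n dz \<phi> pb))"


section \<open>Graded vector bundles\<close>

text \<open>The tensor product of \<open>C\<close> with the graded vector space with basis \<open>L\<close> of degrees \<open>degs\<close>;
  \<open>s\<close> stands for \<open>\<Sum>l\<in>L. s l \<otimes> l\<close>.\<close>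

definition tensor_module ::
  "('p, 'c::real_vector) galgebra \<Rightarrow> 'l set \<Rightarrow> ('l \<Rightarrow> int) \<Rightarrow> ('p, 'l \<Rightarrow> 'c, 'c) gmodule"
  where "tensor_module C L degs =
    \<lparr> gsec = (\<lambda>U j. {s. (\<forall>l\<in>L. s l \<in> gsec C U (j - degs l)) \<and> (\<forall>l. l \<notin> L \<longrightarrow> s l = 0)}),
      gres = (\<lambda>U V s l. if l \<in> L then gres C U V (s l) else 0),
      gact = (\<lambda>f s l. if l \<in> L then gmul C f (s l) else 0) \<rparr>"

definition module_iso_on ::
  "'p topology \<Rightarrow> ('p, 'c::real_vector) galgebra \<Rightarrow> ('p, 'e::real_vector, 'c) gmodule \<Rightarrow>
   ('p, 'f::real_vector, 'c) gmodule \<Rightarrow> 'p set \<Rightarrow> ('p set \<Rightarrow> 'e \<Rightarrow> 'f) \<Rightarrow> bool"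
  where "module_iso_on X C E F U T \<longleftrightarrow>
    (\<forall>V. openin X V \<and> V \<subseteq> U \<longrightarrow>
       (\<forall>j. bij_betw (T V) (gsec E V j) (gsec F V j) \<and> lin_on (gsec E V j) (T V)) \<and>
       (\<forall>i j. \<forall>f\<in>gsec C V i. \<forall>\<psi>\<in>gsec E V j. T V (gact E f \<psi>) = gact F f (T V \<psi>)) \<and>
       (\<forall>V' j. \<forall>\<psi>\<in>gsec E V j. openin X V' \<and> V' \<subseteq> V \<longrightarrow>
          T V' (gres E V V' \<psi>) = gres F V V' (T V \<psi>)))"

text \<open>Graded vector bundles of graded rank \<open>rk\<close>, identified with their sheaves of sections.\<close>

definition graded_vector_bundle ::
  "'p topology \<Rightarrow> ('p, 'c::real_vector) galgebra \<Rightarrow> ('p, 'e::real_vector, 'c) gmodule \<Rightarrow>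
   (int \<Rightarrow> nat) \<Rightarrow> bool"
  where "graded_vector_bundle X C E rk \<longleftrightarrow> graded_module_sheaf X C E \<and>
    (\<exists>r degs. has_degrees {..<r::nat} degs rk \<and>
       (\<forall>x\<in>topspace X. \<exists>U T. openin X U \<and> x \<in> U \<and>
          module_iso_on X C E (tensor_module C {..<r} degs) U T))"

definition frame_expansion ::
  "('p, 'c::real_vector) galgebra \<Rightarrow> ('p, 'e::real_vector, 'c) gmodule \<Rightarrow> 'l set \<Rightarrow> ('l \<Rightarrow> int) \<Rightarrow>
   'p set \<Rightarrow> ('l \<Rightarrow> 'e) \<Rightarrow> int \<Rightarrow> 'e \<Rightarrow> ('l \<Rightarrow> 'c) \<Rightarrow> bool"
  where "frame_expansion C E L degs U \<Phi> j \<psi> c \<longleftrightarrow>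
    (\<forall>l\<in>L. c l \<in> gsec C U (j - degs l)) \<and> (\<forall>l. l \<notin> L \<longrightarrow> c l = 0) \<and>
    \<psi> = (\<Sum>l\<in>L. gact E (c l) (\<Phi> l))"

definition local_frame ::
  "'p topology \<Rightarrow> ('p, 'c::real_vector) galgebra \<Rightarrow> ('p, 'e::real_vector, 'c) gmodule \<Rightarrow>
   (int \<Rightarrow> nat) \<Rightarrow> 'l set \<Rightarrow> ('l \<Rightarrow> int) \<Rightarrow> 'p set \<Rightarrow> ('l \<Rightarrow> 'e) \<Rightarrow> bool"
  where "local_frame X C E rk L degs U \<Phi> \<longleftrightarrow>
    has_degrees L degs rk \<and> openin X U \<and> (\<forall>l\<in>L. \<Phi> l \<in> gsec E U (degs l)) \<and>
    (\<forall>V j. \<forall>\<psi>\<in>gsec E V j. openin X V \<and> V \<subseteq> U \<longrightarrow>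
       (\<exists>!c. frame_expansion C E L degs V (\<lambda>l. gres E U V (\<Phi> l)) j \<psi> c))"

definition frame_components ::
  "('p, 'c::real_vector) galgebra \<Rightarrow> ('p, 'e::real_vector, 'c) gmodule \<Rightarrow> 'l set \<Rightarrow> ('l \<Rightarrow> int) \<Rightarrow>
   'p set \<Rightarrow> ('l \<Rightarrow> 'e) \<Rightarrow> int \<Rightarrow> 'e \<Rightarrow> 'l \<Rightarrow> 'c"
  where "frame_components C E L degs U \<Phi> j \<psi> = (THE c. frame_expansion C E L degs U \<Phi> j \<psi> c)"


section \<open>Graded maps and differential operators\<close>

text \<open>
  A graded map is the sequence of its components, \<open>F i\<close> being defined on elements of degree \<open>i\<close>
  and extended by \<open>0\<close>.
\<close>

type_synonym 'v gmap = "int \<Rightarrow> 'v \<Rightarrow> 'v"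

definition graded_maps :: "('p, 'v::real_vector, 'm) gpresheaf_scheme \<Rightarrow> 'p set \<Rightarrow> int \<Rightarrow> 'v gmap set"
  where "graded_maps S U d =
    {F. \<forall>i. lin_on (gsec S U i) (F i) \<and> F i ` gsec S U i \<subseteq> gsec S U (i + d) \<and>
            (\<forall>x. x \<notin> gsec S U i \<longrightarrow> F i x = 0)}"

definition graded_derivations :: "('p, 'c::real_vector) galgebra \<Rightarrow> 'p set \<Rightarrow> int \<Rightarrow> 'c gmap set"
  where "graded_derivations C U d =
    {Y \<in> graded_maps C U d. \<forall>i j. \<forall>f\<in>gsec C U i. \<forall>g\<in>gsec C U j.
       Y (i + j) (gmul C f g) = gmul C (Y i f) g + ((-1) powi (d * i)) *\<^sub>R gmul C f (Y j g)}"

definition coord_vector_field ::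
  "('p, 'c::real_vector) galgebra \<Rightarrow> 'p set \<Rightarrow> nat \<Rightarrow> (nat \<Rightarrow> int) \<Rightarrow> (nat \<Rightarrow> 'c) \<Rightarrow> nat \<Rightarrow> 'c gmap"
  where "coord_vector_field C U n dz z A =
    (THE Y. Y \<in> graded_derivations C U (- dz A) \<and>
       (\<forall>B<n. Y (dz B) (z B) = (if B = A then gone C U else 0)))"

text \<open>The graded commutator of graded maps of degrees \<open>a\<close> and \<open>b\<close>.\<close>

definition gcommutator :: "int \<Rightarrow> int \<Rightarrow> 'v::real_vector gmap \<Rightarrow> 'v gmap \<Rightarrow> 'v gmap"
  where "gcommutator a b F G =
    (\<lambda>i x. F (i + b) (G i x) - ((-1) powi (a * b)) *\<^sub>R G (i + a) (F i x))"

definition left_mult :: "('p, 'e::real_vector, 'c) gmodule \<Rightarrow> 'p set \<Rightarrow> 'c \<Rightarrow> 'e gmap"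
  where "left_mult E U f = (\<lambda>i \<psi>. if \<psi> \<in> gsec E U i then gact E f \<psi> else 0)"

primrec diff_ops ::
  "('p, 'c::real_vector) galgebra \<Rightarrow> ('p, 'e::real_vector, 'c) gmodule \<Rightarrow> nat \<Rightarrow> 'p set \<Rightarrow> int \<Rightarrow>
   'e gmap set"
  where
    "diff_ops C E 0 = (\<lambda>U d. {D \<in> graded_maps E U d. \<forall>i j. \<forall>f\<in>gsec C U i. \<forall>\<psi>\<in>gsec E U j.
       D (i + j) (gact E f \<psi>) = ((-1) powi (d * i)) *\<^sub>R gact E f (D j \<psi>)})"
  | "diff_ops C E (Suc k) = (\<lambda>U d. {D \<in> graded_maps E U d. \<forall>i. \<forall>f\<in>gsec C U i.
       gcommutator d i D (left_mult E U f) \<in> diff_ops C E k U (d + i)})"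

text \<open>
  The restriction of \<open>D\<close> from \<open>U\<close> to \<open>V\<close> is the operator over \<open>V\<close> that agrees with \<open>D\<close> on
  restricted sections.
\<close>

definition diff_op_sheaf ::
  "('p, 'c::real_vector) galgebra \<Rightarrow> ('p, 'e::real_vector, 'c) gmodule \<Rightarrow> nat \<Rightarrow> ('p, 'e gmap, 'c) gmodule"
  where "diff_op_sheaf C E k =
    \<lparr> gsec = diff_ops C E k,
      gres = (\<lambda>U V D. THE D'. \<exists>d. D \<in> diff_ops C E k U d \<and> D' \<in> diff_ops C E k V d \<and>
                (\<forall>i. \<forall>\<psi>\<in>gsec E U i. D' i (gres E U V \<psi>) = gres E U V (D i \<psi>))),
      gact = (\<lambda>f D i \<psi>. gact E f (D i \<psi>)) \<rparr>"

text \<open>\<open>[\<cdots>[[D, f\<^sub>1], f\<^sub>2], \<dots>, f\<^sub>j]\<close> for an operator \<open>D\<close> of degree \<open>d\<close> and the list of the pairs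
  \<open>(degree of f\<^sub>i, f\<^sub>i)\<close>; for the empty list this is \<open>D\<close>.\<close>

primrec iter_commutator ::
  "('p, 'e::real_vector, 'c) gmodule \<Rightarrow> 'p set \<Rightarrow> (int \<times> 'c) list \<Rightarrow> int \<Rightarrow> 'e gmap \<Rightarrow> 'e gmap"
  where
    "iter_commutator E U [] = (\<lambda>d D. D)"
  | "iter_commutator E U (fi # fs) = (\<lambda>d D.
       iter_commutator E U fs (d + fst fi) (gcommutator d (fst fi) D (left_mult E U (snd fi))))"


section \<open>Multi-indices\<close>

definition multi_indices :: "nat \<Rightarrow> (nat \<Rightarrow> int) \<Rightarrow> nat \<Rightarrow> (nat \<Rightarrow> nat) set"
  where "multi_indices n dz q =
    {I. (\<forall>A\<ge>n. I A = 0) \<and> (\<forall>A<n. odd (dz A) \<longrightarrow> I A \<le> 1) \<and> (\<Sum>A<n. I A) = q}"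

definition multi_fact :: "nat \<Rightarrow> (nat \<Rightarrow> nat) \<Rightarrow> real"
  where "multi_fact n I = (\<Prod>A<n. fact (I A))"

definition multi_list :: "nat \<Rightarrow> (nat \<Rightarrow> nat) \<Rightarrow> nat list"
  where "multi_list n I = concat (map (\<lambda>A. replicate (I A) A) [0..<n])"

text \<open>\<open>deriv_list pd dz [A\<^sub>1, \<dots>, A\<^sub>m] j f\<close> is \<open>(pd A\<^sub>m \<circ> \<cdots> \<circ> pd A\<^sub>1) f\<close> for \<open>f\<close> of degree \<open>j\<close>, where
  \<open>pd A\<close> has degree \<open>- dz A\<close>.\<close>

primrec deriv_list :: "(nat \<Rightarrow> 'c gmap) \<Rightarrow> (nat \<Rightarrow> int) \<Rightarrow> nat list \<Rightarrow> 'c gmap"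
  where
    "deriv_list pd dz [] = (\<lambda>j f. f)"
  | "deriv_list pd dz (A # As) = (\<lambda>j f. deriv_list pd dz As (j - dz A) (pd A j f))"

definition deriv_op ::
  "('p, 'c::real_vector) galgebra \<Rightarrow> 'p set \<Rightarrow> nat \<Rightarrow> (nat \<Rightarrow> int) \<Rightarrow> (nat \<Rightarrow> 'c) \<Rightarrow> (nat \<Rightarrow> nat) \<Rightarrow> 'c gmap"
  where "deriv_op C U n dz z I = deriv_list (coord_vector_field C U n dz z) dz (multi_list n I)"

text \<open>\<open>D\<^bsup>(w(I))\<^esup>\<close> at the coordinates, each \<open>z A\<close> being repeated \<open>I A\<close> times, for \<open>D\<close> of degree \<open>d\<close>.\<close>

definition coord_commutator ::
  "('p, 'e::real_vector, 'c) gmodule \<Rightarrow> 'p set \<Rightarrow> nat \<Rightarrow> (nat \<Rightarrow> int) \<Rightarrow> (nat \<Rightarrow> 'c) \<Rightarrow> (nat \<Rightarrow> nat) \<Rightarrow>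
   int \<Rightarrow> 'e gmap \<Rightarrow> 'e gmap"
  where "coord_commutator E U n dz z I =
    iter_commutator E U (map (\<lambda>A. (dz A, z A)) (multi_list n I))"

definition frame_op ::
  "('p, 'c::real_vector) galgebra \<Rightarrow> ('p, 'e::real_vector, 'c) gmodule \<Rightarrow> 'p set \<Rightarrow>
   nat \<Rightarrow> (nat \<Rightarrow> int) \<Rightarrow> (nat \<Rightarrow> 'c) \<Rightarrow> nat \<Rightarrow> (nat \<Rightarrow> int) \<Rightarrow> (nat \<Rightarrow> 'e) \<Rightarrow>
   (nat \<Rightarrow> nat) \<Rightarrow> nat \<Rightarrow> nat \<Rightarrow> 'e gmap"
  where "frame_op C E U n dz z r d\<theta> \<Phi> I l m = (\<lambda>i \<psi>.
    if \<psi> \<in> gsec E U i then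
      ((-1) powi ((d\<theta> m - d\<theta> l) * ((i - d\<theta> l) - exponent_degree n dz I))) *\<^sub>R
      gact E (deriv_op C U n dz z I (i - d\<theta> l) (frame_components C E {..<r} d\<theta> U \<Phi> i \<psi> l)) (\<Phi> m)
    else 0)"

end

theory Submission
  imports Defs
begin

text \<open>
  In coordinates, a graded map that commutes up to sign with multiplication by the coordinate functions and
  vanishes on \<open>1\<close> is \<open>0\<close>: by Hadamard's lemma, a function is, up to terms of higher order at a given
  point, a polynomial in the coordinates. Inductively, a differential operator of order \<open>k\<close> is \<open>0\<close> as soon as
  all its iterated commutators with at most \<open>k\<close> coordinate functions vanish on the frame. On the operators
  \<open>P I l m\<close> these commutators are computed explicitly: they are \<open>multi_fact n I\<close> times \<open>\<Phi> m\<close> for the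
  multi-index \<open>I\<close> and the frame element \<open>\<Phi> l\<close>, and \<open>0\<close> otherwise. Subtracting from an operator the combination of the
  \<open>P I l m\<close> with the same commutators therefore leaves \<open>0\<close>, which is the decomposition, and its
  uniqueness is read off in the same way. Bump functions make differential operators local, so that they
  restrict and glue; the \<open>P I l m\<close> restrict to the operators of the same kind over smaller open sets, hence they
  form a local frame.
\<close>


section \<open>Graded maps and differential operators over a fixed open set\<close>

text \<open>Functions in the formal variables are infinite series, so a polynomial argument can only
  be run one coefficient at a time: the coefficient of \<open>T f\<close> at an exponent
  \<open>p\<close> and a point \<open>a\<close> is reduced to coefficients at exponents of smaller
  weight, while the coordinates of degree 0 contribute the factor \<open>x A - a A\<close>, which
  vanishes at \<open>a\<close>. For this a coordinate of degree 0 has to commute with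
  \<open>T\<close> exactly, whereas for the others any scalar will do; hence the condition on the
  scalar \<open>s\<close> in \<open>zero_if_commutes\<close>. The same criterion identifies the
  coordinate vector fields, and it is applied to the matrix entries of an operator in the frame.

  The second obstacle is that sections over a smaller open set need not extend. After shrinking
  around a point they do, by a bump function with compact support; compact sets are closed in a
  Hausdorff space, so it can be extended by zero. Operators over different open sets are compared
  through the relation \<open>agree\<close>, which survives commutators; since order
  \<open>k\<close> is a condition on all (k + 1)-fold commutators, it can be checked
  locally.\<close>

lemma powi_minus_one_if: "(-1 :: real) powi a = (if even a then 1 else -1)"
  by (cases "a \<ge> 0") (auto simp: power_int_def even_nat_iff)

section \<open>Maps that are linear on a subspace\<close>

lemma lin_on_zero: "lin_on A f \<Longrightarrow> 0 \<in> A \<Longrightarrow> f 0 = 0"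
  unfolding lin_on_def by (metis scaleR_zero_left)

lemma lin_on_add: "lin_on A f \<Longrightarrow> x \<in> A \<Longrightarrow> y \<in> A \<Longrightarrow> f (x + y) = f x + f y"
  by (simp add: lin_on_def)

lemma lin_on_scaleR: "lin_on A f \<Longrightarrow> x \<in> A \<Longrightarrow> f (a *\<^sub>R x) = a *\<^sub>R f x"
  by (simp add: lin_on_def)

lemma lin_on_diff:
  assumes "subspace A" "lin_on A f" "x \<in> A" "y \<in> A" shows "f (x - y) = f x - f y"
proof -
  have "f (x + (-1) *\<^sub>R y) = f x + f ((-1) *\<^sub>R y)"
    using assms subspace_scale[of A y "-1"] by (intro lin_on_add[OF assms(2)]) auto
  also have "f ((-1) *\<^sub>R y) = (-1) *\<^sub>R f y" using assms lin_on_scaleR by blast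
  finally show ?thesis by simp
qed

lemma lin_on_sum:
  assumes "subspace A" "lin_on A f" "\<And>i. i \<in> S \<Longrightarrow> g i \<in> A"
  shows "f (\<Sum>i\<in>S. g i) = (\<Sum>i\<in>S. f (g i))"
  using assms(3)
proof (induction S rule: infinite_finite_induct)
  case (insert x F)
  then have "sum g F \<in> A" using subspace_sum[OF assms(1)] by blast
  with insert show ?case by (simp add: lin_on_add[OF assms(2)])
qed (use assms lin_on_zero[OF assms(2)] subspace_0 in auto)

lemma scaleR_fun_apply [simp]: "(a *\<^sub>R f) x = a *\<^sub>R f x"
  by (simp add: scaleR_fun_def)

lemma sum_fun_apply: "(\<Sum>i\<in>S. f i) x = (\<Sum>i\<in>S. f i x)"
  by (induction S rule: infinite_finite_induct) auto

text \<open>Fixing one open set keeps the algebra free of restriction maps and openness hypotheses;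
  \<open>graded_algebraI\<close> later supplies the axioms from the sheaf.\<close>

locale graded_algebra =
  fixes C :: "('p, 'c::real_vector) galgebra" and U :: "'p set"
  assumes A_subspace: "subspace (gsec C U j)"
    and A_disjoint: "i \<noteq> j \<Longrightarrow> gsec C U i \<inter> gsec C U j = {0}"
    and one_in: "gone C U \<in> gsec C U 0"
    and one_mul: "f \<in> gsec C U i \<Longrightarrow> gmul C (gone C U) f = f"
    and mul_lin_right: "f \<in> gsec C U i \<Longrightarrow> lin_on (gsec C U j) (gmul C f)"
    and mul_lin_left: "f \<in> gsec C U i \<Longrightarrow> lin_on (gsec C U j) (\<lambda>g. gmul C g f)"
    and mul_in_deg: "f \<in> gsec C U i \<Longrightarrow> g \<in> gsec C U j \<Longrightarrow> gmul C f g \<in> gsec C U (i + j)"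
    and mul_commute: "f \<in> gsec C U i \<Longrightarrow> g \<in> gsec C U j \<Longrightarrow>
      gmul C f g = ((-1) powi (i * j)) *\<^sub>R gmul C g f"
    and mul_assoc: "f \<in> gsec C U i \<Longrightarrow> g \<in> gsec C U j \<Longrightarrow> h \<in> gsec C U l \<Longrightarrow>
      gmul C (gmul C f g) h = gmul C f (gmul C g h)"
begin

text \<open>The degree of the product is a separate variable with an equation, since the degrees
  that occur agree only up to rearrangement of sums. The rules \<open>act_in\<close> and
  \<open>gmap_in\<close> are set up in the same way.\<close>

lemma mul_in: "f \<in> gsec C U i \<Longrightarrow> g \<in> gsec C U j \<Longrightarrow> k = i + j \<Longrightarrow> gmul C f g \<in> gsec C U k"
  using mul_in_deg by blast

lemma mul_one: "f \<in> gsec C U i \<Longrightarrow> gmul C f (gone C U) = f"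
  using mul_commute[of f i "gone C U" 0] one_in one_mul by simp

end

locale graded_module = graded_algebra C U
  for C :: "('p, 'c::real_vector) galgebra" and U :: "'p set" +
  fixes E :: "('p, 'e::real_vector, 'c) gmodule"
  assumes M_subspace: "subspace (gsec E U j)"
    and M_disjoint: "i \<noteq> j \<Longrightarrow> gsec E U i \<inter> gsec E U j = {0}"
    and one_act: "\<psi> \<in> gsec E U j \<Longrightarrow> gact E (gone C U) \<psi> = \<psi>"
    and act_lin_left: "\<psi> \<in> gsec E U j \<Longrightarrow> lin_on (gsec C U i) (\<lambda>f. gact E f \<psi>)"
    and act_lin_right: "f \<in> gsec C U i \<Longrightarrow> lin_on (gsec E U j) (gact E f)"
    and act_in_deg: "f \<in> gsec C U i \<Longrightarrow> \<psi> \<in> gsec E U j \<Longrightarrow> gact E f \<psi> \<in> gsec E U (i + j)"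
    and mul_act: "g \<in> gsec C U l \<Longrightarrow> f \<in> gsec C U i \<Longrightarrow> \<psi> \<in> gsec E U j \<Longrightarrow>
      gact E (gmul C g f) \<psi> = gact E g (gact E f \<psi>)"
begin

lemma act_in: "f \<in> gsec C U i \<Longrightarrow> \<psi> \<in> gsec E U j \<Longrightarrow> k = i + j \<Longrightarrow> gact E f \<psi> \<in> gsec E U k"
  using act_in_deg by blast

lemma M_zero [simp]: "0 \<in> gsec E U j"
  using M_subspace subspace_0 by blast

lemma M_add: "x \<in> gsec E U j \<Longrightarrow> y \<in> gsec E U j \<Longrightarrow> x + y \<in> gsec E U j"
  using M_subspace subspace_add by blast

lemma M_diff: "x \<in> gsec E U j \<Longrightarrow> y \<in> gsec E U j \<Longrightarrow> x - y \<in> gsec E U j"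
  using M_subspace subspace_diff by blast

lemma M_scale: "x \<in> gsec E U j \<Longrightarrow> a *\<^sub>R x \<in> gsec E U j"
  using M_subspace subspace_scale by blast

lemma M_sum: "(\<And>i. i \<in> S \<Longrightarrow> x i \<in> gsec E U j) \<Longrightarrow> sum x S \<in> gsec E U j"
  using M_subspace subspace_sum by blast

lemma A_zero [simp]: "0 \<in> gsec C U j"
  using A_subspace subspace_0 by blast

lemma A_scale: "x \<in> gsec C U j \<Longrightarrow> a *\<^sub>R x \<in> gsec C U j"
  using A_subspace subspace_scale by blast

lemma act_zero_right: "f \<in> gsec C U i \<Longrightarrow> gact E f 0 = 0"
  using act_lin_right[of f i 0] lin_on_zero M_zero by blast

lemma act_zero_left: "\<psi> \<in> gsec E U j \<Longrightarrow> gact E 0 \<psi> = 0"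
  using act_lin_left[of \<psi> j 0] lin_on_zero[of "gsec C U 0" "\<lambda>f. gact E f \<psi>"] A_zero by blast

lemma act_scale_right: "f \<in> gsec C U i \<Longrightarrow> \<psi> \<in> gsec E U j \<Longrightarrow> gact E f (a *\<^sub>R \<psi>) = a *\<^sub>R gact E f \<psi>"
  using act_lin_right lin_on_scaleR by blast

lemma act_add_right: "f \<in> gsec C U i \<Longrightarrow> \<psi> \<in> gsec E U j \<Longrightarrow> \<eta> \<in> gsec E U j \<Longrightarrow>
    gact E f (\<psi> + \<eta>) = gact E f \<psi> + gact E f \<eta>"
  using act_lin_right lin_on_add by blast

lemma act_diff_right: "f \<in> gsec C U i \<Longrightarrow> \<psi> \<in> gsec E U j \<Longrightarrow> \<eta> \<in> gsec E U j \<Longrightarrow>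
    gact E f (\<psi> - \<eta>) = gact E f \<psi> - gact E f \<eta>"
  using act_lin_right lin_on_diff M_subspace by blast

lemma act_sum_right: "f \<in> gsec C U i \<Longrightarrow> (\<And>l. l \<in> S \<Longrightarrow> \<psi> l \<in> gsec E U j) \<Longrightarrow>
    gact E f (\<Sum>l\<in>S. \<psi> l) = (\<Sum>l\<in>S. gact E f (\<psi> l))"
  by (rule lin_on_sum[OF M_subspace act_lin_right])

lemma act_scale_left: "f \<in> gsec C U i \<Longrightarrow> \<psi> \<in> gsec E U j \<Longrightarrow> gact E (a *\<^sub>R f) \<psi> = a *\<^sub>R gact E f \<psi>"
  using lin_on_scaleR[OF act_lin_left] by blast

lemma act_add_left: "f \<in> gsec C U i \<Longrightarrow> g \<in> gsec C U i \<Longrightarrow> \<psi> \<in> gsec E U j \<Longrightarrow>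
    gact E (f + g) \<psi> = gact E f \<psi> + gact E g \<psi>"
  using lin_on_add[OF act_lin_left] by blast

lemma act_diff_left: "f \<in> gsec C U i \<Longrightarrow> g \<in> gsec C U i \<Longrightarrow> \<psi> \<in> gsec E U j \<Longrightarrow>
    gact E (f - g) \<psi> = gact E f \<psi> - gact E g \<psi>"
  using lin_on_diff[OF A_subspace act_lin_left] by blast

lemma act_commute: "f \<in> gsec C U i \<Longrightarrow> g \<in> gsec C U j \<Longrightarrow> \<psi> \<in> gsec E U l \<Longrightarrow>
    gact E f (gact E g \<psi>) = ((-1) powi (i * j)) *\<^sub>R gact E g (gact E f \<psi>)"
  using mul_act[of f i g j \<psi> l] mul_act[of g j f i \<psi> l] mul_commute[of f i g j]
    act_scale_left[of "gmul C g f" "j + i" \<psi> l] mul_in_deg[of g j f i] by simp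

section \<open>Graded maps of a module\<close>

lemma gmap_lin: "F \<in> graded_maps E U d \<Longrightarrow> lin_on (gsec E U i) (F i)"
  by (simp add: graded_maps_def)

lemma gmap_in: "F \<in> graded_maps E U d \<Longrightarrow> x \<in> gsec E U i \<Longrightarrow> j = i + d \<Longrightarrow> F i x \<in> gsec E U j"
  by (auto simp: graded_maps_def)

lemma gmap_out: "F \<in> graded_maps E U d \<Longrightarrow> x \<notin> gsec E U i \<Longrightarrow> F i x = 0"
  by (auto simp: graded_maps_def)

lemma gmap_zero: "F \<in> graded_maps E U d \<Longrightarrow> F i 0 = 0"
  using lin_on_zero gmap_lin M_zero by blast

lemma gmap_add: "F \<in> graded_maps E U d \<Longrightarrow> x \<in> gsec E U i \<Longrightarrow> y \<in> gsec E U i \<Longrightarrow>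
    F i (x + y) = F i x + F i y"
  using gmap_lin lin_on_add by blast

lemma gmap_diff: "F \<in> graded_maps E U d \<Longrightarrow> x \<in> gsec E U i \<Longrightarrow> y \<in> gsec E U i \<Longrightarrow>
    F i (x - y) = F i x - F i y"
  using gmap_lin lin_on_diff M_subspace by blast

lemma gmap_scale: "F \<in> graded_maps E U d \<Longrightarrow> x \<in> gsec E U i \<Longrightarrow> F i (a *\<^sub>R x) = a *\<^sub>R F i x"
  using gmap_lin lin_on_scaleR by blast

lemma gmap_sum: "F \<in> graded_maps E U d \<Longrightarrow> (\<And>l. l \<in> S \<Longrightarrow> x l \<in> gsec E U i) \<Longrightarrow>
    F i (\<Sum>l\<in>S. x l) = (\<Sum>l\<in>S. F i (x l))"
  by (rule lin_on_sum[OF M_subspace gmap_lin])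

lemma gmapI:
  assumes "\<And>i x y. x \<in> gsec E U i \<Longrightarrow> y \<in> gsec E U i \<Longrightarrow> F i (x + y) = F i x + F i y"
    and "\<And>i x a. x \<in> gsec E U i \<Longrightarrow> F i (a *\<^sub>R x) = a *\<^sub>R F i x"
    and "\<And>i x. x \<in> gsec E U i \<Longrightarrow> F i x \<in> gsec E U (i + d)"
    and "\<And>i x. x \<notin> gsec E U i \<Longrightarrow> F i x = 0"
  shows "F \<in> graded_maps E U d"
  using assms by (auto simp: graded_maps_def lin_on_def)

lemma gmap_eqI:
  assumes "F \<in> graded_maps E U d" "G \<in> graded_maps E U d'"
    and "\<And>i x. x \<in> gsec E U i \<Longrightarrow> F i x = G i x"
  shows "F = G"
proof (intro ext)
  fix i x show "F i x = G i x"
    using assms gmap_out[OF assms(1), of x i] gmap_out[OF assms(2), of x i]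
    by (cases "x \<in> gsec E U i") auto
qed

text \<open>Each value lies in two components that meet only in 0. A graded map does not record its
  degree; this lemma makes operators of different degrees meet only in 0 and the restriction of an
  operator well defined.\<close>

lemma gmap_degree_unique:
  assumes "F \<in> graded_maps E U d" "F \<in> graded_maps E U d'" "d \<noteq> d'" shows "F = 0"
proof (intro ext)
  fix i x
  show "F i x = 0 i x"
  proof (cases "x \<in> gsec E U i")
    case True
    then have "F i x \<in> gsec E U (i + d) \<inter> gsec E U (i + d')" using assms gmap_in by blast
    also have "\<dots> = {0}" using assms(3) by (intro M_disjoint) auto
    finally show ?thesis by simp
  qed (use gmap_out[OF assms(1)] in auto)
qed

lemma gmaps_subspace: "subspace (graded_maps E U d)"
  unfolding subspace_def
proof (intro conjI ballI allI)
  show "0 \<in> graded_maps E U d" by (rule gmapI) auto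
  fix F G assume F: "F \<in> graded_maps E U d" and G: "G \<in> graded_maps E U d"
  show "F + G \<in> graded_maps E U d"
    by (rule gmapI)
      (simp_all add: gmap_add[OF F] gmap_add[OF G] gmap_scale[OF F] gmap_scale[OF G] scaleR_add_right
        M_add gmap_in[OF F] gmap_in[OF G] gmap_out[OF F] gmap_out[OF G])
next
  fix c F assume F: "F \<in> graded_maps E U d"
  show "c *\<^sub>R F \<in> graded_maps E U d"
    by (rule gmapI) (simp_all add: scaleR_fun_apply gmap_add[OF F] gmap_scale[OF F] scaleR_add_right
        M_scale gmap_in[OF F] gmap_out[OF F])
qed

lemma left_mult_apply: "\<psi> \<in> gsec E U j \<Longrightarrow> left_mult E U f j \<psi> = gact E f \<psi>"
  by (simp add: left_mult_def)

lemma left_mult_gmap: "f \<in> gsec C U i \<Longrightarrow> left_mult E U f \<in> graded_maps E U i"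
  by (rule gmapI)
    (simp_all add: left_mult_def act_add_right M_add M_scale act_scale_right act_in add.commute)

section \<open>Graded commutators with multiplication by functions\<close>

abbreviation br :: "int \<Rightarrow> int \<Rightarrow> 'e gmap \<Rightarrow> 'c \<Rightarrow> 'e gmap" where
  "br d i D f \<equiv> gcommutator d i D (left_mult E U f)"

lemma br_apply:
  assumes "D \<in> graded_maps E U d" "\<psi> \<in> gsec E U j"
  shows "br d i D f j \<psi> = D (j + i) (gact E f \<psi>) - ((-1) powi (d * i)) *\<^sub>R gact E f (D j \<psi>)"
  using assms gmap_in[OF assms(1,2), of "j + d"] by (simp add: gcommutator_def left_mult_apply)

lemma br_gmap:
  assumes D: "D \<in> graded_maps E U d" and f: "f \<in> gsec C U i" and e: "e = d + i"
  shows "br d i D f \<in> graded_maps E U e"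
  unfolding e
proof (rule gmapI)
  note a = br_apply[OF D] and g = gmap_in[OF D] and af = act_in[OF f]
  fix j \<psi> \<eta> and c :: real assume p: "\<psi> \<in> gsec E U j" and q: "\<eta> \<in> gsec E U j"
  have m: "gact E f \<psi> \<in> gsec E U (j + i)" "gact E f \<eta> \<in> gsec E U (j + i)"
    using act_in[OF f p, of "j + i"] act_in[OF f q, of "j + i"] by simp_all
  show "br d i D f j (\<psi> + \<eta>) = br d i D f j \<psi> + br d i D f j \<eta>"
    using p q m by (simp add: a M_add act_add_right[OF f] gmap_add[OF D]
        act_add_right[OF f g g] scaleR_add_right)
next
  note a = br_apply[OF D] and g = gmap_in[OF D] and af = act_in[OF f]
  fix j \<psi> and c :: real assume p: "\<psi> \<in> gsec E U j"
  have m: "gact E f \<psi> \<in> gsec E U (j + i)"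
    using act_in[OF f p, of "j + i"] by simp_all
  show "br d i D f j (c *\<^sub>R \<psi>) = c *\<^sub>R br d i D f j \<psi>"
    using p m by (simp add: a M_scale act_scale_right[OF f] gmap_scale[OF D]
        act_scale_right[OF f g] scaleR_diff_right)
  show "br d i D f j \<psi> \<in> gsec E U (j + (d + i))"
    using p m by (simp add: a) (intro M_diff M_scale g[OF m] act_in[OF f g[OF p]]; simp)
next
  fix j \<psi> assume "\<psi> \<notin> gsec E U j"
  then show "br d i D f j \<psi> = 0"
    by (simp add: gcommutator_def left_mult_def gmap_zero[OF D] gmap_out[OF D] act_zero_right[OF f])
qed

lemma diff_op_gmap: "D \<in> diff_ops C E k U d \<Longrightarrow> D \<in> graded_maps E U d"
  by (cases k) auto

lemma diff_op_Suc_iff: "D \<in> diff_ops C E (Suc k) U d \<longleftrightarrow>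
    D \<in> graded_maps E U d \<and> (\<forall>i. \<forall>f\<in>gsec C U i. br d i D f \<in> diff_ops C E k U (d + i))"
  by simp

text \<open>Linearity up to sign is the vanishing of all commutators. So order 0 fits the recursion
  for higher orders if only the zero map counts as an operator of order -1, and the inductions on
  the order start from this form.\<close>

lemma diff_op_zero_iff: "D \<in> diff_ops C E 0 U d \<longleftrightarrow>
    D \<in> graded_maps E U d \<and> (\<forall>i. \<forall>f\<in>gsec C U i. br d i D f = 0)"
proof (intro iffI conjI allI ballI)
  assume D: "D \<in> diff_ops C E 0 U d"
  then show g: "D \<in> graded_maps E U d" by simp
  fix i f assume f: "f \<in> gsec C U i"
  show "br d i D f = 0"
  proof (rule gmap_eqI[OF br_gmap[OF g f refl] subspace_0[OF gmaps_subspace]])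
    fix j \<psi> assume p: "\<psi> \<in> gsec E U j"
    then have "D (i + j) (gact E f \<psi>) = ((-1) powi (d * i)) *\<^sub>R gact E f (D j \<psi>)"
      using D f by simp
    then show "br d i D f j \<psi> = 0 j \<psi>" using p by (simp add: br_apply[OF g p] add.commute)
  qed
next
  assume R: "D \<in> graded_maps E U d \<and> (\<forall>i. \<forall>f\<in>gsec C U i. br d i D f = 0)"
  then have g: "D \<in> graded_maps E U d" by simp
  have "D (i + j) (gact E f \<psi>) = ((-1) powi (d * i)) *\<^sub>R gact E f (D j \<psi>)"
    if "f \<in> gsec C U i" "\<psi> \<in> gsec E U j" for i j f \<psi>
  proof -
    have "br d i D f = 0" using R that by blast
    then show ?thesis using br_apply[OF g that(2), of i f] by (simp add: add.commute)
  qed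
  then show "D \<in> diff_ops C E 0 U d" using g by simp
qed

lemma br_zero: "f \<in> gsec C U i \<Longrightarrow> br d i 0 f = 0"
  by (auto simp: fun_eq_iff gcommutator_def left_mult_def act_zero_right)

lemma br_add:
  assumes D: "D \<in> graded_maps E U d" and D': "D' \<in> graded_maps E U d" and f: "f \<in> gsec C U i"
  shows "br d i (D + D') f = br d i D f + br d i D' f"
proof (rule gmap_eqI)
  note S = subspace_add[OF gmaps_subspace]
  show "br d i (D + D') f \<in> graded_maps E U (d + i)" using S[OF D D'] f br_gmap by blast
  show "br d i D f + br d i D' f \<in> graded_maps E U (d + i)"
    by (rule S) (use D D' f br_gmap in blast)+
  fix j x assume x: "x \<in> gsec E U j"
  then show "br d i (D + D') f j x = (br d i D f + br d i D' f) j x"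
    by (simp add: br_apply[OF S[OF D D'] x] br_apply[OF D x] br_apply[OF D' x]
        act_add_right[OF f gmap_in[OF D] gmap_in[OF D']] scaleR_add_right)
qed

lemma br_scale:
  assumes D: "D \<in> graded_maps E U d" and f: "f \<in> gsec C U i"
  shows "br d i (a *\<^sub>R D) f = a *\<^sub>R br d i D f"
proof (rule gmap_eqI)
  note S = subspace_scale[OF gmaps_subspace]
  show "br d i (a *\<^sub>R D) f \<in> graded_maps E U (d + i)" using S[OF D] f br_gmap by blast
  show "a *\<^sub>R br d i D f \<in> graded_maps E U (d + i)"
    by (rule S) (use D f br_gmap in blast)+
  fix j x assume x: "x \<in> gsec E U j"
  then show "br d i (a *\<^sub>R D) f j x = (a *\<^sub>R br d i D f) j x"
    by (simp add: br_apply[OF S[OF D] x] scaleR_fun_apply br_apply[OF D x] 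
        act_scale_right[OF f gmap_in[OF D]] scaleR_diff_right)
qed

lemma diff_ops_subspace: "subspace (diff_ops C E k U d)"
proof (induction k arbitrary: d)
  case 0
  note S = gmaps_subspace
  show ?case
    unfolding subspace_def
    by (auto simp: diff_op_zero_iff br_zero br_add br_scale simp del: diff_ops.simps
        intro: subspace_0[OF S] subspace_add[OF S] subspace_scale[OF S])
next
  case (Suc k)
  note S = gmaps_subspace
  show ?case
    unfolding subspace_def
    by (auto simp: diff_op_Suc_iff br_zero br_add br_scale simp del: diff_ops.simps
        intro: subspace_0[OF S] subspace_add[OF S] subspace_scale[OF S]
        subspace_0[OF Suc] subspace_add[OF Suc] subspace_scale[OF Suc])
qed

lemma diff_op_mono_Suc: "D \<in> diff_ops C E k U d \<Longrightarrow> D \<in> diff_ops C E (Suc k) U d"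
proof (induction k arbitrary: d D)
  case 0
  then show ?case
    using subspace_0[OF gmaps_subspace] by (auto simp: br_zero diff_op_zero_iff diff_op_Suc_iff simp del: diff_ops.simps)
next
  case (Suc k)
  then show ?case
    unfolding diff_op_Suc_iff by blast
qed

lemma diff_op_mono: "D \<in> diff_ops C E k U d \<Longrightarrow> k \<le> k' \<Longrightarrow> D \<in> diff_ops C E k' U d"
  by (induction k') (auto simp: le_Suc_eq intro: diff_op_mono_Suc simp del: diff_ops.simps)

abbreviation fmul :: "'c \<Rightarrow> 'e gmap \<Rightarrow> 'e gmap" where
  "fmul f D \<equiv> \<lambda>i \<psi>. gact E f (D i \<psi>)"

lemma fmul_gmap:
  assumes D: "D \<in> graded_maps E U d" and f: "f \<in> gsec C U i" and e: "e = i + d"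
  shows "fmul f D \<in> graded_maps E U e"
  unfolding e using f
  by (intro gmapI)
    (simp_all add: gmap_add[OF D] gmap_scale[OF D] act_add_right[OF f gmap_in[OF D] gmap_in[OF D]]
      act_scale_right[OF f gmap_in[OF D]] act_in[OF f gmap_in[OF D]] gmap_out[OF D] act_zero_right)

text \<open>The sign for moving \<open>g\<close> past \<open>f\<close> is compensated by the degree
  of \<open>f\<close> contained in \<open>e\<close>. Hence coefficients on the left can be pulled
  out of commutators without a sign.\<close>

lemma br_fmul:
  assumes D: "D \<in> graded_maps E U d" and f: "f \<in> gsec C U i" and g: "g \<in> gsec C U j"
    and e: "e = i + d"
  shows "br e j (fmul f D) g = fmul f (br d j D g)"
proof (rule gmap_eqI)
  note F = fmul_gmap[OF D f e]
  show "br e j (fmul f D) g \<in> graded_maps E U (e + j)" using F g br_gmap by blast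
  show "fmul f (br d j D g) \<in> graded_maps E U (e + j)"
    by (rule fmul_gmap[OF br_gmap[OF D g refl] f]) (simp add: e)
  fix l x assume x: "x \<in> gsec E U l"
  have m: "gact E g x \<in> gsec E U (l + j)" using act_in[OF g x] by (simp add: add.commute)
  have n: "gact E g (D l x) \<in> gsec E U (l + j + d)"
    by (rule act_in[OF g gmap_in[OF D x refl]]) simp
  have "gact E g (gact E f (D l x)) = ((-1) powi (j * i)) *\<^sub>R gact E f (gact E g (D l x))"
    by (rule act_commute[OF g f gmap_in[OF D x refl]])
  moreover have "(-1 :: real) powi (e * j) * (-1) powi (j * i) = (-1) powi (d * j)"
    unfolding e by (auto simp: powi_minus_one_if)
  ultimately show "br e j (fmul f D) g l x = fmul f (br d j D g) l x"
    using m n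
    by (simp add: br_apply[OF F x] br_apply[OF D x] act_diff_right[OF f gmap_in[OF D] M_scale]
        act_scale_right[OF f])
qed

lemma fmul_diff_op:
  "D \<in> diff_ops C E k U d \<Longrightarrow> f \<in> gsec C U i \<Longrightarrow> e = i + d \<Longrightarrow> fmul f D \<in> diff_ops C E k U e"
proof (induction k arbitrary: d D e)
  case 0
  then have g: "D \<in> graded_maps E U d" by simp
  show ?case using 0
    by (auto simp: diff_op_zero_iff fmul_gmap[OF g] br_fmul[OF g] act_zero_right fun_eq_iff simp del: diff_ops.simps)
next
  case (Suc k)
  then have g: "D \<in> graded_maps E U d" by simp
  have "fmul f (br d j D h) \<in> diff_ops C E k U (e + j)" if "h \<in> gsec C U j" for j h
    using Suc.prems that by (intro Suc.IH[of _ "d + j"]) (auto simp: diff_op_Suc_iff simp del: diff_ops.simps)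
  then show ?case using Suc.prems
    by (auto simp: diff_op_Suc_iff fmul_gmap[OF g] br_fmul[OF g] simp del: diff_ops.simps)
qed

text \<open>Graded Jacobi identity: multiplication operators commute up to sign, so the term with
  their own commutator drops out.\<close>

lemma br_br:
  assumes D: "D \<in> graded_maps E U d" and f: "f \<in> gsec C U i" and g: "g \<in> gsec C U j"
  shows "br (d + i) j (br d i D f) g = ((-1) powi (i * j)) *\<^sub>R br (d + j) i (br d j D g) f"
proof (rule gmap_eqI)
  note b1 = br_gmap[OF D f refl] and b2 = br_gmap[OF D g refl]
  show "br (d + i) j (br d i D f) g \<in> graded_maps E U (d + i + j)" by (rule br_gmap[OF b1 g refl])
  show "((-1) powi (i * j)) *\<^sub>R br (d + j) i (br d j D g) f \<in> graded_maps E U (d + i + j)"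
    by (rule subspace_scale[OF gmaps_subspace], rule br_gmap[OF b2 f]) simp
  fix l x assume x: "x \<in> gsec E U l"
  have gx: "gact E g x \<in> gsec E U (l + j)" using act_in[OF g x] by (simp add: add.commute)
  have fx: "gact E f x \<in> gsec E U (l + i)" using act_in[OF f x] by (simp add: add.commute)
  have Dx: "D l x \<in> gsec E U (l + d)" by (rule gmap_in[OF D x refl])
  have Dgx: "D (l + j) (gact E g x) \<in> gsec E U (l + j + d)" by (rule gmap_in[OF D gx refl])
  have Dfx: "D (l + i) (gact E f x) \<in> gsec E U (l + i + d)" by (rule gmap_in[OF D fx refl])
  have gDx: "gact E g (D l x) \<in> gsec E U (l + j + d)" by (rule act_in[OF g Dx]) simp
  have fDx: "gact E f (D l x) \<in> gsec E U (l + i + d)" by (rule act_in[OF f Dx]) simp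
  have gfx: "gact E g (gact E f x) \<in> gsec E U (l + i + j)" by (rule act_in[OF g fx]) simp
  have c1: "gact E f (gact E g x) = ((-1) powi (i * j)) *\<^sub>R gact E g (gact E f x)"
    by (rule act_commute[OF f g x])
  have c2: "gact E f (gact E g (D l x)) = ((-1) powi (i * j)) *\<^sub>R gact E g (gact E f (D l x))"
    by (rule act_commute[OF f g Dx])
  have ix: "l + j + i = l + i + j" by simp
  have L: "br (d + i) j (br d i D f) g l x =
     ((-1) powi (i * j)) *\<^sub>R D (l + i + j) (gact E g (gact E f x))
      - ((-1) powi (d * i)) *\<^sub>R gact E f (D (l + j) (gact E g x))
      - ((-1) powi ((d + i) * j)) *\<^sub>R (gact E g (D (l + i) (gact E f x))
         - ((-1) powi (d * i)) *\<^sub>R gact E g (gact E f (D l x)))"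
    using act_diff_right[OF g Dfx M_scale[OF fDx]] act_scale_right[OF g fDx]
    by (simp add: br_apply[OF b1 x] br_apply[OF D gx] br_apply[OF D x] ix c1 gmap_scale[OF D gfx])
  have R: "br (d + j) i (br d j D g) f l x =
     D (l + i + j) (gact E g (gact E f x))
      - ((-1) powi (d * j)) *\<^sub>R gact E g (D (l + i) (gact E f x))
      - ((-1) powi ((d + j) * i)) *\<^sub>R (gact E f (D (l + j) (gact E g x))
         - ((-1) powi (d * j)) *\<^sub>R ((-1) powi (i * j)) *\<^sub>R gact E g (gact E f (D l x)))"
    using act_diff_right[OF f Dgx M_scale[OF gDx]] act_scale_right[OF f gDx]
    by (simp add: br_apply[OF b2 x] br_apply[OF D fx] br_apply[OF D x] c2)
  show "br (d + i) j (br d i D f) g l x = (((-1) powi (i * j)) *\<^sub>R br (d + j) i (br d j D g) f) l x"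
    unfolding scaleR_fun_apply L R
    by (auto simp: powi_minus_one_if scaleR_diff_right)
qed

text \<open>Exchanging the two copies of \<open>f\<close> by \<open>br_br\<close> produces a minus
  sign, so the double commutator is its own negative. This matches the bound 1 on the entries of a
  multi-index at odd coordinates.\<close>

lemma br_br_odd:
  assumes D: "D \<in> graded_maps E U d" and f: "f \<in> gsec C U i" and "odd i"
  shows "br (d + i) i (br d i D f) f = 0"
proof -
  have "br (d + i) i (br d i D f) f = - br (d + i) i (br d i D f) f"
    using br_br[OF D f f] \<open>odd i\<close> by (simp add: powi_minus_one_if scaleR_fun_apply fun_eq_iff)
  then have "2 *\<^sub>R br (d + i) i (br d i D f) f l x = 0" for l x
    by (metis (no_types, lifting) add.right_inverse scaleR_2 fun_Compl_def uminus_apply)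
  then show ?thesis by (auto simp: fun_eq_iff)
qed

section \<open>Iterated commutators\<close>

definition homogeneous :: "(int \<times> 'c) list \<Rightarrow> bool" where
  "homogeneous fs \<longleftrightarrow> (\<forall>(i, f)\<in>set fs. f \<in> gsec C U i)"

lemma homogeneous_simps [simp]:
  "homogeneous []" "homogeneous ((i, f) # fs) \<longleftrightarrow> f \<in> gsec C U i \<and> homogeneous fs"
  "homogeneous (fs @ gs) \<longleftrightarrow> homogeneous fs \<and> homogeneous gs"
  by (auto simp: homogeneous_def)

abbreviation iter where "iter \<equiv> iter_commutator E U"

lemma iter_gmap:
  "D \<in> graded_maps E U d \<Longrightarrow> homogeneous fs \<Longrightarrow> iter fs d D \<in> graded_maps E U (d + sum_list (map fst fs))"
proof (induction fs arbitrary: d D)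
  case (Cons a fs)
  then show ?case by (cases a) (simp add: add.assoc[symmetric] br_gmap)
qed simp

lemma iter_append: "iter (fs @ gs) d D = iter gs (d + sum_list (map fst fs)) (iter fs d D)"
  by (induction fs arbitrary: d D) (simp_all add: add.assoc)

lemma iter_zero: "homogeneous fs \<Longrightarrow> iter fs d 0 = 0"
proof (induction fs arbitrary: d)
  case (Cons a fs) then show ?case by (cases a) (simp add: br_zero del: zero_fun_apply)
qed simp

lemma iter_add: "D \<in> graded_maps E U d \<Longrightarrow> D' \<in> graded_maps E U d \<Longrightarrow> homogeneous fs \<Longrightarrow>
    iter fs d (D + D') = iter fs d D + iter fs d D'"
proof (induction fs arbitrary: d D D')
  case (Cons a fs) then show ?case by (cases a) (simp add: br_add br_gmap del: plus_fun_apply)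
qed simp

lemma iter_scale: "D \<in> graded_maps E U d \<Longrightarrow> homogeneous fs \<Longrightarrow>
    iter fs d (c *\<^sub>R D) = c *\<^sub>R iter fs d D"
proof (induction fs arbitrary: d D)
  case (Cons a fs) then show ?case by (cases a) (simp add: br_scale br_gmap del: scaleR_fun_apply)
qed simp

lemma iter_sum: "(\<And>s. s \<in> S \<Longrightarrow> D s \<in> graded_maps E U d) \<Longrightarrow> homogeneous fs \<Longrightarrow>
    iter fs d (\<Sum>s\<in>S. D s) = (\<Sum>s\<in>S. iter fs d (D s))"
proof (induction S rule: infinite_finite_induct)
  case (insert x F)
  then have "sum D F \<in> graded_maps E U d" using subspace_sum[OF gmaps_subspace] by blast
  with insert show ?case by (simp add: iter_add del: plus_fun_apply)
qed (simp_all add: iter_zero del: zero_fun_apply)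

lemma iter_fmul: "D \<in> graded_maps E U d \<Longrightarrow> f \<in> gsec C U i \<Longrightarrow> homogeneous fs \<Longrightarrow> e = i + d \<Longrightarrow>
    iter fs e (fmul f D) = fmul f (iter fs d D)"
proof (induction fs arbitrary: d D e)
  case (Cons a fs)
  obtain j g where a: "a = (j, g)" by (cases a)
  with Cons.prems Cons.IH[of "br d j D g" "d + j" "e + j"] show ?case
    by (simp add: br_fmul[where i = i and d = d] br_gmap)
qed simp

text \<open>The scalar is a product of signs from \<open>br_br\<close>; that it is nonzero suffices
  for deducing that commutators vanish.\<close>

lemma iter_move:
  "D \<in> graded_maps E U d \<Longrightarrow> f \<in> gsec C U i \<Longrightarrow> homogeneous gs \<Longrightarrow> homogeneous hs \<Longrightarrow>
    \<exists>s. s \<noteq> 0 \<and> iter (gs @ (i, f) # hs) d D = s *\<^sub>R iter ((i, f) # gs @ hs) d D"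
proof (induction gs arbitrary: d D)
  case Nil show ?case by (rule exI[of _ 1]) simp
next
  case (Cons a gs)
  obtain j g where a: "a = (j, g)" by (cases a)
  then have g: "g \<in> gsec C U j" and h: "homogeneous (gs @ hs)" using Cons.prems by simp_all
  obtain s where s: "s \<noteq> 0" "iter (gs @ (i, f) # hs) (d + j) (br d j D g) =
      s *\<^sub>R iter ((i, f) # gs @ hs) (d + j) (br d j D g)"
    using Cons.IH[of "br d j D g" "d + j"] Cons.prems a br_gmap
    by (auto simp del: scaleR_fun_apply)
  have "br (d + j) i (br d j D g) f = ((-1) powi (j * i)) *\<^sub>R br (d + i) j (br d i D f) g"
    by (rule br_br) (use Cons.prems g in auto)
  moreover have "iter (gs @ hs) (d + i + j) (c *\<^sub>R br (d + i) j (br d i D f) g) =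
      c *\<^sub>R iter (gs @ hs) (d + i + j) (br (d + i) j (br d i D f) g)" for c
    by (rule iter_scale[OF _ h]) (use Cons.prems g br_gmap in blast)
  ultimately have "iter ((a # gs) @ (i, f) # hs) d D =
      (s * ((-1) powi (j * i))) *\<^sub>R iter ((i, f) # (a # gs) @ hs) d D"
    using s(2) a by (simp add: algebra_simps del: scaleR_fun_apply)
  then show ?case using s by (intro exI[of _ "s * ((-1) powi (j * i))"]) auto
qed

text \<open>\<open>iter_move\<close> brings the second copy next to the first one, where
  \<open>br_br_odd\<close> applies.\<close>

lemma iter_repeat_odd:
  assumes D: "D \<in> graded_maps E U d" and f: "f \<in> gsec C U i" and o: "odd i"
    and h: "homogeneous gs" "homogeneous hs"
  shows "iter ((i, f) # gs @ (i, f) # hs) d D = 0"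
proof -
  obtain s where "iter (gs @ (i, f) # hs) (d + i) (br d i D f) =
      s *\<^sub>R iter ((i, f) # gs @ hs) (d + i) (br d i D f)"
    using iter_move[OF br_gmap[OF D f refl] f h] by blast
  then show ?thesis using iter_zero[of "gs @ hs"] h
    by (simp add: br_br_odd[OF D f o] scaleR_fun_apply fun_eq_iff)
qed

text \<open>Unrolls the recursion on the order. In this form the orders of operators on different
  modules or over different open sets can be related by comparing their iterated
  commutators.\<close>

lemma diff_op_iff_iter: "D \<in> diff_ops C E k U d \<longleftrightarrow> D \<in> graded_maps E U d \<and>
    (\<forall>fs. length fs = Suc k \<longrightarrow> homogeneous fs \<longrightarrow> iter fs d D = 0)"
proof (induction k arbitrary: d D)
  case 0
  show ?case unfolding diff_op_zero_iff
    by (force simp: length_Suc_conv simp del: zero_fun_apply)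
next
  case (Suc k)
  have "(\<forall>i. \<forall>f\<in>gsec C U i. \<forall>fs. length fs = Suc k \<longrightarrow> homogeneous fs \<longrightarrow> iter fs (d + i) (br d i D f) = 0)
    \<longleftrightarrow> (\<forall>fs. length fs = Suc (Suc k) \<longrightarrow> homogeneous fs \<longrightarrow> iter fs d D = 0)" (is "?L \<longleftrightarrow> ?R")
  proof
    assume L: ?L
    show ?R
    proof (intro allI impI)
      fix fs assume "length fs = Suc (Suc k)" "homogeneous fs"
      moreover from this obtain i f gs where "fs = (i, f) # gs" by (cases fs) auto
      ultimately show "iter fs d D = 0" using L by simp
    qed
  next
    assume R: ?R
    show ?L
    proof (intro allI impI ballI)
      fix i f fs assume "f \<in> gsec C U i" "length fs = Suc k" "homogeneous fs"
      then show "iter fs (d + i) (br d i D f) = 0" using R[rule_format, of "(i, f) # fs"] by simp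
    qed
  qed
  then show ?case unfolding diff_op_Suc_iff Suc.IH using br_gmap by blast
qed

end

section \<open>Composition and derivations\<close>

text \<open>The structure sheaf as a module over itself: the commutator calculus developed for
  \<open>E\<close> then applies to the coordinate derivatives of functions too.\<close>

definition self_module :: "('p, 'c::real_vector) galgebra \<Rightarrow> ('p, 'c, 'c) gmodule" where
  "self_module C = \<lparr>gsec = gsec C, gres = gres C, gact = gmul C\<rparr>"

lemma self_module_simps [simp]:
  "gsec (self_module C) = gsec C" "gres (self_module C) = gres C" "gact (self_module C) = gmul C"
  by (simp_all add: self_module_def)

lemma graded_maps_self_module [simp]: "graded_maps (self_module C) U d = graded_maps C U d"
  by (simp add: graded_maps_def)

lemma (in graded_algebra) self_module: "graded_module C U (self_module C)"
  by unfold_locales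
    (auto simp: A_subspace one_mul mul_lin_left mul_lin_right mul_in_deg mul_assoc A_disjoint)

context graded_module
begin

lemma left_mult_diff_op:
  assumes f: "f \<in> gsec C U i" shows "left_mult E U f \<in> diff_ops C E 0 U i"
proof -
  have "left_mult E U f (j + l) (gact E g \<psi>) = ((-1) powi (i * j)) *\<^sub>R gact E g (left_mult E U f l \<psi>)"
    if "g \<in> gsec C U j" "\<psi> \<in> gsec E U l" for j l g \<psi>
    using act_commute[OF f that] that by (simp only: left_mult_apply[OF act_in_deg] left_mult_apply)
  then show ?thesis by (simp add: left_mult_gmap[OF f])
qed

lemma left_mult_zero: "left_mult E U 0 = 0"
  by (auto simp: left_mult_def act_zero_left fun_eq_iff)

text \<open>\<open>y\<close> is the degree of \<open>Y\<close>. It has to be supplied because it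
  decides which component of \<open>D\<close> is to be applied.\<close>

definition gcomp :: "int \<Rightarrow> 'e gmap \<Rightarrow> 'e gmap \<Rightarrow> 'e gmap" where
  "gcomp y D Y = (\<lambda>i x. D (i + y) (Y i x))"

lemma gcomp_apply: "gcomp y D Y i x = D (i + y) (Y i x)"
  by (simp add: gcomp_def)

lemma gcomp_gmap:
  assumes D: "D \<in> graded_maps E U d" and Y: "Y \<in> graded_maps E U y" and e: "e = d + y"
  shows "gcomp y D Y \<in> graded_maps E U e"
  unfolding gcomp_def e
  by (rule gmapI)
    (simp_all add: gmap_add[OF Y] gmap_add[OF D gmap_in[OF Y] gmap_in[OF Y]] gmap_scale[OF Y]
      gmap_scale[OF D gmap_in[OF Y]] gmap_in[OF D gmap_in[OF Y]] gmap_out[OF Y] gmap_zero[OF D])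

lemma gcomp_zero: "D \<in> graded_maps E U d \<Longrightarrow> gcomp y D 0 = 0" "gcomp y 0 Y = 0"
  by (auto simp: gcomp_def gmap_zero fun_eq_iff)

text \<open>The graded Leibniz rule: \<open>f\<close> meets \<open>Y\<close> first and picks up a
  sign when it moves on to \<open>D\<close>.\<close>

lemma br_gcomp:
  assumes D: "D \<in> graded_maps E U d" and Y: "Y \<in> graded_maps E U y" and f: "f \<in> gsec C U i"
  shows "br (d + y) i (gcomp y D Y) f =
    gcomp (y + i) D (br y i Y f) + ((-1) powi (y * i)) *\<^sub>R gcomp y (br d i D f) Y"
proof (rule gmap_eqI)
  note DY = gcomp_gmap[OF D Y refl] and bY = br_gmap[OF Y f refl] and bD = br_gmap[OF D f refl]
  show "br (d + y) i (gcomp y D Y) f \<in> graded_maps E U (d + y + i)" by (rule br_gmap[OF DY f refl])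
  show "gcomp (y + i) D (br y i Y f) + ((-1) powi (y * i)) *\<^sub>R gcomp y (br d i D f) Y
      \<in> graded_maps E U (d + y + i)"
    by (intro subspace_add[OF gmaps_subspace] subspace_scale[OF gmaps_subspace]
        gcomp_gmap[OF D bY] gcomp_gmap[OF bD Y]) simp_all
  fix j x assume x: "x \<in> gsec E U j"
  have fx: "gact E f x \<in> gsec E U (j + i)" by (rule act_in[OF f x]) simp
  have Yx: "Y j x \<in> gsec E U (j + y)" by (rule gmap_in[OF Y x refl])
  have fYx: "gact E f (Y j x) \<in> gsec E U (j + y + i)" by (rule act_in[OF f Yx]) simp
  have Yfx: "Y (j + i) (gact E f x) \<in> gsec E U (j + y + i)" by (rule gmap_in[OF Y fx]) simp
  have L: "br (d + y) i (gcomp y D Y) f j x =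
      D (j + y + i) (Y (j + i) (gact E f x)) -
      ((-1) powi ((d + y) * i)) *\<^sub>R gact E f (D (j + y) (Y j x))"
    unfolding br_apply[OF DY x] gcomp_apply by (simp add: ac_simps)
  have M: "gcomp (y + i) D (br y i Y f) j x =
      D (j + y + i) (Y (j + i) (gact E f x)) - ((-1) powi (y * i)) *\<^sub>R D (j + y + i) (gact E f (Y j x))"
    unfolding gcomp_apply br_apply[OF Y x] add.assoc[symmetric]
      gmap_diff[OF D Yfx M_scale[OF fYx]] gmap_scale[OF D fYx] by simp
  have N: "gcomp y (br d i D f) Y j x = D (j + y + i) (gact E f (Y j x)) -
      ((-1) powi (d * i)) *\<^sub>R gact E f (D (j + y) (Y j x))"
    unfolding gcomp_apply br_apply[OF D Yx] by simp
  show "br (d + y) i (gcomp y D Y) f j x = (gcomp (y + i) D (br y i Y f) +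
      ((-1) powi (y * i)) *\<^sub>R gcomp y (br d i D f) Y) j x"
    unfolding plus_fun_apply scaleR_fun_apply L M N
    by (auto simp: powi_minus_one_if)
qed

text \<open>By \<open>br_gcomp\<close> each term of a commutator has the order of one of the two
  factors lowered, so the induction runs on the sum of the orders.\<close>

lemma gcomp_diff_op:
  "D \<in> diff_ops C E k U d \<Longrightarrow> Y \<in> diff_ops C E l U y \<Longrightarrow> e = d + y \<Longrightarrow>
    gcomp y D Y \<in> diff_ops C E (k + l) U e"
proof (induction "k + l" arbitrary: k l d D y Y e)
  case 0
  then have g: "D \<in> graded_maps E U d" "Y \<in> graded_maps E U y" using diff_op_gmap by blast+
  then show ?case using 0
    by (auto simp: diff_op_zero_iff gcomp_gmap br_gcomp gcomp_zero simp del: diff_ops.simps zero_fun_apply)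
next
  case (Suc q)
  note g = diff_op_gmap[OF Suc.prems(1)] diff_op_gmap[OF Suc.prems(2)]
  have *: "br e i (gcomp y D Y) f \<in> diff_ops C E q U (e + i)" if f: "f \<in> gsec C U i" for i f
  proof -
    have 1: "gcomp (y + i) D (br y i Y f) \<in> diff_ops C E q U (d + y + i)"
    proof (cases l)
      case 0
      then have "br y i Y f = 0" using Suc.prems(2) f diff_op_zero_iff[of Y y] by (simp only:)
      then show ?thesis using subspace_0[OF diff_ops_subspace] gcomp_zero(1)[OF g(1)] by simp
    next
      case (Suc l')
      then have "br y i Y f \<in> diff_ops C E l' U (y + i)"
        using Suc.prems(2) f by (simp add: diff_op_Suc_iff del: diff_ops.simps)
      then have "gcomp (y + i) D (br y i Y f) \<in> diff_ops C E (k + l') U (d + y + i)"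
        using Suc.hyps(1)[of k l' D d "br y i Y f" "y + i" "d + y + i"] \<open>Suc q = k + l\<close> Suc.prems(1) Suc by simp
      then show ?thesis using \<open>Suc q = k + l\<close> Suc by simp
    qed
    have 2: "gcomp y (br d i D f) Y \<in> diff_ops C E q U (d + y + i)"
    proof (cases k)
      case 0
      then have "br d i D f = 0" using Suc.prems(1) f diff_op_zero_iff[of D d] by (simp only:)
      then show ?thesis using subspace_0[OF diff_ops_subspace] gcomp_zero(2) by simp
    next
      case (Suc k')
      then have "br d i D f \<in> diff_ops C E k' U (d + i)"
        using Suc.prems(1) f by (simp add: diff_op_Suc_iff del: diff_ops.simps)
      then have "gcomp y (br d i D f) Y \<in> diff_ops C E (k' + l) U (d + y + i)"
        using Suc.hyps(1)[of k' l "br d i D f" "d + i" Y y "d + y + i"] \<open>Suc q = k + l\<close> Suc.prems(2) Suc by simp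
      then show ?thesis using \<open>Suc q = k + l\<close> Suc by simp
    qed
    show ?thesis unfolding Suc.prems(3) br_gcomp[OF g f]
      by (intro subspace_add[OF diff_ops_subspace] subspace_scale[OF diff_ops_subspace] 1 2)
  qed
  have "gcomp y D Y \<in> diff_ops C E (Suc q) U e"
    unfolding diff_op_Suc_iff using * gcomp_gmap[OF g] Suc.prems(3) by blast
  then show ?case using Suc.hyps(2) by simp
qed

end

text \<open>The last assumption is what the calculus on the local model contributes to the theorem.\<close>

locale graded_coordinates = graded_algebra C U
  for C :: "('p, 'c::real_vector) galgebra" and U :: "'p set" +
  fixes n :: nat and dz :: "nat \<Rightarrow> int" and z :: "nat \<Rightarrow> 'c" and pd :: "nat \<Rightarrow> 'c gmap"
  assumes z_in: "A < n \<Longrightarrow> z A \<in> gsec C U (dz A)"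
    and pd_derivation: "A < n \<Longrightarrow> pd A \<in> graded_derivations C U (- dz A)"
    and pd_z: "A < n \<Longrightarrow> B < n \<Longrightarrow> pd A (dz B) (z B) = (if B = A then gone C U else 0)"
    and zero_if_commutes: "T \<in> graded_maps C U d \<Longrightarrow> T 0 (gone C U) = 0 \<Longrightarrow>
      (\<And>A i f. A < n \<Longrightarrow> f \<in> gsec C U i \<Longrightarrow>
        \<exists>s::real. (dz A = 0 \<longrightarrow> s = 1) \<and>
          T (i + dz A) (gmul C (z A) f) = s *\<^sub>R gmul C (z A) (T i f)) \<Longrightarrow> T = 0"
begin

interpretation self: graded_module C U "self_module C" by (rule self_module)

section \<open>Derivations and the coordinate vector fields\<close>

lemma derivation_one:
  assumes "Y \<in> graded_derivations C U y" shows "Y 0 (gone C U) = 0"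
proof -
  have Y: "Y \<in> graded_maps C U y" using assms by (simp add: graded_derivations_def)
  have in1: "Y 0 (gone C U) \<in> gsec C U y" using self.gmap_in[of Y y "gone C U" 0] Y one_in by simp
  have "Y (0 + 0) (gmul C (gone C U) (gone C U)) = gmul C (Y 0 (gone C U)) (gone C U) +
      ((-1) powi (y * 0)) *\<^sub>R gmul C (gone C U) (Y 0 (gone C U))"
    using assms one_in unfolding graded_derivations_def by blast
  then show ?thesis using one_mul[OF one_in] one_mul[OF in1] mul_one[OF in1] by simp
qed

lemma derivation_mul: "Y \<in> graded_derivations C U y \<Longrightarrow> f \<in> gsec C U i \<Longrightarrow> g \<in> gsec C U j \<Longrightarrow>
    Y (i + j) (gmul C f g) = gmul C (Y i f) g + ((-1) powi (y * i)) *\<^sub>R gmul C f (Y j g)"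
  by (simp add: graded_derivations_def)

text \<open>This is the Leibniz rule of \<open>Y\<close>, read as an identity between operators on
  functions. It makes a derivation a first order operator.\<close>

lemma br_derivation:
  assumes Y: "Y \<in> graded_derivations C U y" and f: "f \<in> gsec C U i"
  shows "self.br y i Y f = left_mult (self_module C) U (Y i f)"
proof (rule self.gmap_eqI)
  have g: "Y \<in> graded_maps (self_module C) U y" using Y by (simp add: graded_derivations_def)
  have Yf: "Y i f \<in> gsec C U (i + y)" using self.gmap_in[OF g] f by simp
  show "self.br y i Y f \<in> graded_maps (self_module C) U (i + y)"
    by (rule self.br_gmap[OF g f]) simp
  show "left_mult (self_module C) U (Y i f) \<in> graded_maps (self_module C) U (i + y)"
    by (rule self.left_mult_gmap[OF Yf])
  fix j x assume x: "x \<in> gsec (self_module C) U j"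
  have "Y (i + j) (gmul C f x) = gmul C (Y i f) x + ((-1) powi (y * i)) *\<^sub>R gmul C f (Y j x)"
    using Y f x unfolding graded_derivations_def by simp
  then show "self.br y i Y f j x = left_mult (self_module C) U (Y i f) j x"
    unfolding self.br_apply[OF g x] self.left_mult_apply[OF x] by (simp add: add.commute)
qed

lemma derivation_diff_op:
  assumes "Y \<in> graded_derivations C U y" shows "Y \<in> diff_ops C (self_module C) 1 U y"
proof -
  have g: "Y \<in> graded_maps (self_module C) U y" using assms by (simp add: graded_derivations_def)
  have "self.br y i Y f \<in> diff_ops C (self_module C) 0 U (y + i)" if f: "f \<in> gsec C U i" for i f
    unfolding br_derivation[OF assms f]
    by (rule self.left_mult_diff_op) (use self.gmap_in[OF g, of f i] f in \<open>simp add: add.commute\<close>)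
  then show ?thesis
    unfolding One_nat_def self.diff_op_Suc_iff using g by blast
qed

text \<open>The vector field is defined by a unique description. The difference of two derivations
  with the same values on the coordinates kills 1 and commutes with every coordinate up to sign, so
  it is 0 by \<open>zero_if_commutes\<close>.\<close>

lemma coord_vector_field_eq:
  assumes A: "A < n" shows "coord_vector_field C U n dz z A = pd A"
  unfolding coord_vector_field_def
proof (rule the_equality)
  show "pd A \<in> graded_derivations C U (- dz A) \<and>
      (\<forall>B<n. pd A (dz B) (z B) = (if B = A then gone C U else 0))"
    using pd_derivation pd_z A by simp
  fix Y assume Y: "Y \<in> graded_derivations C U (- dz A) \<and>
      (\<forall>B<n. Y (dz B) (z B) = (if B = A then gone C U else 0))"
  then have Yg: "Y \<in> graded_maps C U (- dz A)" by (simp add: graded_derivations_def)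
  have Pd: "pd A \<in> graded_derivations C U (- dz A)" by (rule pd_derivation[OF A])
  then have Pg: "pd A \<in> graded_maps C U (- dz A)" by (simp add: graded_derivations_def)
  have T: "Y - pd A \<in> graded_maps C U (- dz A)"
    using subspace_diff[OF self.gmaps_subspace] Yg Pg by simp
  have "Y - pd A = 0"
  proof (rule zero_if_commutes[OF T])
    show "(Y - pd A) 0 (gone C U) = 0" using derivation_one[OF conjunct1[OF Y]] derivation_one[OF Pd] by simp
    fix B i f assume B: "B < n" and f: "f \<in> gsec C U i"
    have y: "Y (dz B + i) (gmul C (z B) f) =
        gmul C (Y (dz B) (z B)) f + ((-1) powi (- dz A * dz B)) *\<^sub>R gmul C (z B) (Y i f)"
      and p: "pd A (dz B + i) (gmul C (z B) f) =
        gmul C (pd A (dz B) (z B)) f + ((-1) powi (- dz A * dz B)) *\<^sub>R gmul C (z B) (pd A i f)"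
      using derivation_mul[OF conjunct1[OF Y] z_in[OF B] f] derivation_mul[OF Pd z_in[OF B] f]
      by blast+
    have "Y (dz B) (z B) = pd A (dz B) (z B)" using Y pd_z[OF A B] B by simp
    moreover have "gmul C (z B) (Y i f - pd A i f) = gmul C (z B) (Y i f) - gmul C (z B) (pd A i f)"
      using self.act_diff_right[OF z_in[OF B], of "Y i f" "i - dz A" "pd A i f"]
        self.gmap_in[of Y "- dz A" f i] self.gmap_in[of "pd A" "- dz A" f i] Yg Pg f by simp
    ultimately show "\<exists>s::real. (dz B = 0 \<longrightarrow> s = 1) \<and> (Y - pd A) (i + dz B) (gmul C (z B) f) = s *\<^sub>R gmul C (z B) ((Y - pd A) i f)"
      by (intro exI[of _ "(-1) powi (- dz A * dz B)"])
        (simp add: y p add.commute[of i] scaleR_diff_right)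
  qed
  then show "Y = pd A" by simp
qed

text \<open>Unlike those of \<open>deriv_list\<close>, these words in the derivatives vanish outside
  of the sections and so are graded maps: the empty word is multiplication by 1 instead of the bare
  identity. The head of the list is applied first, as in \<open>deriv_list\<close>.\<close>

primrec pdl :: "nat list \<Rightarrow> 'c gmap" where
  "pdl [] = left_mult (self_module C) U (gone C U)"
| "pdl (A # As) = self.gcomp (- dz A) (pdl As) (pd A)"

abbreviation ldeg :: "nat list \<Rightarrow> int" where "ldeg As \<equiv> sum_list (map dz As)"

lemma pdl_diff_op:
  "\<forall>A\<in>set As. A < n \<Longrightarrow> pdl As \<in> diff_ops C (self_module C) (length As) U (- ldeg As)"
proof (induction As)
  case Nil
  show ?case using self.left_mult_diff_op[OF one_in] by simp
next
  case (Cons A As)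
  have "self.gcomp (- dz A) (pdl As) (pd A) \<in> diff_ops C (self_module C) (length As + 1) U (- ldeg (A # As))"
    by (rule self.gcomp_diff_op[OF _ derivation_diff_op[OF pd_derivation]]) (use Cons in auto)
  then show ?case by simp
qed

lemma pdl_gmap: "\<forall>A\<in>set As. A < n \<Longrightarrow> pdl As \<in> graded_maps (self_module C) U (- ldeg As)"
  by (rule self.diff_op_gmap[OF pdl_diff_op])

lemma pd_gmap: "A < n \<Longrightarrow> pd A \<in> graded_maps (self_module C) U (- dz A)"
  using pd_derivation by (simp add: graded_derivations_def)

lemma pdl_apply:
  "\<forall>A\<in>set As. A < n \<Longrightarrow> f \<in> gsec C U i \<Longrightarrow>
    deriv_list (coord_vector_field C U n dz z) dz As i f = pdl As i f"
proof (induction As arbitrary: i f)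
  case Nil
  then show ?case by (simp add: left_mult_def one_mul)
next
  case (Cons A As)
  then have "pd A i f \<in> gsec C U (i - dz A)" using self.gmap_in[OF pd_gmap, of A f i] by simp
  then have "deriv_list (coord_vector_field C U n dz z) dz As (i - dz A) (pd A i f) =
      pdl As (i - dz A) (pd A i f)" using Cons by simp
  with Cons.prems show ?case by (simp add: coord_vector_field_eq self.gcomp_apply)
qed

section \<open>Commutators of iterated derivatives with the coordinates\<close>

lemma br_pd_same: "A < n \<Longrightarrow> self.br (- dz A) (dz A) (pd A) (z A) = pdl []"
  by (simp add: br_derivation[OF pd_derivation z_in] pd_z)

lemma br_pd_other: "A < n \<Longrightarrow> B < n \<Longrightarrow> A \<noteq> B \<Longrightarrow> self.br (- dz A) (dz B) (pd A) (z B) = 0"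
  by (simp add: br_derivation[OF pd_derivation z_in] pd_z self.left_mult_zero del: zero_fun_apply)

lemma gcomp_pdl_Nil:
  assumes D: "D \<in> graded_maps (self_module C) U d" shows "self.gcomp 0 D (pdl []) = D"
proof (intro ext)
  fix i x
  show "self.gcomp 0 D (pdl []) i x = D i x"
    by (cases "x \<in> gsec C U i")
      (auto simp: self.gcomp_def left_mult_def one_mul self.gmap_zero[OF D] self.gmap_out[OF D])
qed

text \<open>\<open>z B\<close> is either consumed by the innermost derivative \<open>pd A\<close>,
  which requires \<open>A = B\<close>, or it passes that derivative with a sign.\<close>

lemma br_pdl_Cons:
  assumes "\<forall>A\<in>set (A # As). A < n" "B < n"
  shows "self.br (- ldeg (A # As)) (dz B) (pdl (A # As)) (z B) =
    (if A = B then pdl As else 0) +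
    ((-1) powi (dz A * dz B)) *\<^sub>R self.gcomp (- dz A) (self.br (- ldeg As) (dz B) (pdl As) (z B)) (pd A)"
proof -
  have As: "\<forall>A\<in>set As. A < n" and A: "A < n" using assms by auto
  have "(-1 :: real) powi (- dz A * dz B) = (-1) powi (dz A * dz B)"
    by (simp add: powi_minus_one_if)
  moreover have "self.gcomp (- dz A + dz B) (pdl As) (self.br (- dz A) (dz B) (pd A) (z B)) =
      (if A = B then pdl As else 0)"
    using br_pd_same[OF A] br_pd_other[OF A assms(2)] gcomp_pdl_Nil[OF pdl_gmap[OF As]]
      self.gcomp_zero(1)[OF pdl_gmap[OF As]] by auto
  moreover have "- ldeg (A # As) = - ldeg As + - dz A" by simp
  ultimately show ?thesis
    by (simp only: pdl.simps self.br_gcomp[OF pdl_gmap[OF As] pd_gmap[OF A] z_in[OF assms(2)]])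
qed

lemma br_pdl_notin:
  "\<forall>A\<in>set As. A < n \<Longrightarrow> B < n \<Longrightarrow> B \<notin> set As \<Longrightarrow> self.br (- ldeg As) (dz B) (pdl As) (z B) = 0"
proof (induction As)
  case Nil
  have "left_mult (self_module C) U (gone C U) \<in> diff_ops C (self_module C) 0 U 0"
    by (rule self.left_mult_diff_op[OF one_in])
  then have "self.br 0 (dz B) (left_mult (self_module C) U (gone C U)) (z B) = 0"
    using z_in[OF \<open>B < n\<close>] unfolding self.diff_op_zero_iff by blast
  then show ?case by simp
next
  case (Cons A As)
  then have "self.br (- ldeg As) (dz B) (pdl As) (z B) = 0" by (simp del: zero_fun_apply)
  then show ?case using br_pdl_Cons[of A As B] Cons.prems self.gcomp_zero(2)[of "- dz A" "pd A"]
    by (simp del: pdl.simps zero_fun_apply)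
qed

text \<open>The rule for the derivative of a power: each of the \<open>i\<close> copies can be
  removed. An odd derivative must not be repeated, since its copies would contribute with
  alternating signs.\<close>

lemma br_pdl_replicate:
  assumes "\<forall>A\<in>set As. A < n" "B < n" "B \<notin> set As" "even (dz B) \<or> i \<le> 1"
  shows "self.br (- ldeg (replicate i B @ As)) (dz B) (pdl (replicate i B @ As)) (z B) =
    real i *\<^sub>R pdl (replicate (i - 1) B @ As)"
  using assms(4)
proof (induction i)
  case 0
  show ?case using br_pdl_notin[OF assms(1-3)] by (simp add: fun_eq_iff)
next
  case (Suc i)
  let ?L = "replicate i B @ As"
  have L: "\<forall>A\<in>set (B # ?L). A < n" using assms by auto
  have IH: "self.br (- ldeg ?L) (dz B) (pdl ?L) (z B) = real i *\<^sub>R pdl (replicate (i - 1) B @ As)"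
    by (rule Suc.IH) (use Suc.prems in auto)
  have "self.gcomp (- dz B) (real i *\<^sub>R pdl (replicate (i - 1) B @ As)) (pd B) =
      real i *\<^sub>R pdl ?L"
    by (cases i) (auto simp: self.gcomp_def fun_eq_iff)
  \<comment> \<open>For odd \<open>dz B\<close> the bound on \<open>Suc i\<close> forces
    \<open>i = 0\<close>, and both sides vanish.\<close>
  moreover have "((-1) powi (dz B * dz B)) * real i = real i"
    using Suc.prems by (auto simp: powi_minus_one_if)
  ultimately have "self.br (- ldeg (B # ?L)) (dz B) (pdl (B # ?L)) (z B) = pdl ?L + real i *\<^sub>R pdl ?L"
    unfolding br_pdl_Cons[OF L assms(2)] IH by (simp add: fun_eq_iff)
  then show ?case by (simp add: fun_eq_iff algebra_simps del: pdl.simps)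
qed

abbreviation zl :: "nat list \<Rightarrow> (int \<times> 'c) list" where "zl As \<equiv> map (\<lambda>A. (dz A, z A)) As"

lemma zl_homogeneous: "\<forall>A\<in>set As. A < n \<Longrightarrow> self.homogeneous (zl As)"
  using z_in by (auto simp: self.homogeneous_def)

lemma zl_degree [simp]: "sum_list (map fst (zl As)) = ldeg As"
  by (simp add: o_def)

text \<open>Once a factor \<open>\<partial>\<^sub>A\<close> that is applied first cannot be removed any more, it kills the unit.\<close>

lemma iter_gcomp_one:
  "D \<in> graded_maps (self_module C) U d \<Longrightarrow> A < n \<Longrightarrow> \<forall>B\<in>set Bs. B < n \<and> B \<noteq> A \<Longrightarrow> e = d - dz A \<Longrightarrow>
    self.iter (zl Bs) e (self.gcomp (- dz A) D (pd A)) 0 (gone C U) = 0"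
proof (induction Bs arbitrary: d D e)
  case Nil
  then show ?case using derivation_one[OF pd_derivation] self.gmap_zero by (simp add: self.gcomp_def)
next
  case (Cons B Bs)
  let ?b = "self.br d (dz B) D (z B)"
  have B: "B < n" "B \<noteq> A" using Cons.prems by auto
  have b: "?b \<in> graded_maps (self_module C) U (d + dz B)" by (rule self.br_gmap[OF _ z_in]) (use Cons B in auto)
  have "self.br (d + - dz A) (dz B) (self.gcomp (- dz A) D (pd A)) (z B) =
      ((-1) powi (- dz A * dz B)) *\<^sub>R self.gcomp (- dz A) ?b (pd A)"
    unfolding self.br_gcomp[OF Cons.prems(1) pd_gmap[OF Cons.prems(2)] z_in[OF B(1)]]
    using br_pd_other[of A B] Cons.prems B self.gcomp_zero(1)[OF Cons.prems(1)] by (simp del: zero_fun_apply)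
  moreover have "self.gcomp (- dz A) ?b (pd A) \<in> graded_maps (self_module C) U (d + dz B - dz A)"
    by (rule self.gcomp_gmap[OF b pd_gmap]) (use Cons.prems in auto)
  moreover have "self.homogeneous (zl Bs)" by (rule zl_homogeneous) (use Cons.prems in auto)
  moreover have "d + dz B - dz A = e + dz B" using Cons.prems by simp
  ultimately show ?case using Cons.IH[OF b, of "e + dz B"] Cons.prems self.iter_scale
    by (simp)
qed

text \<open>The quotient of factorials is the falling factorial i (i - 1) ... (i - j + 1) that
  accumulates from \<open>br_pdl_replicate\<close>.\<close>

lemma iter_pdl_replicate:
  assumes "\<forall>A\<in>set As. A < n" "B < n" "B \<notin> set As" "even (dz B) \<or> i \<le> 1" "j \<le> i"
  shows "self.iter (zl (replicate j B)) (- ldeg (replicate i B @ As)) (pdl (replicate i B @ As)) =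
    (fact i / fact (i - j)) *\<^sub>R pdl (replicate (i - j) B @ As)"
  using assms(4,5)
proof (induction j arbitrary: i)
  case 0
  then show ?case by simp
next
  case (Suc j)
  then obtain i' where i: "i = Suc i'" by (cases i) auto
  have L: "\<forall>A\<in>set (replicate i' B @ As). A < n" using assms by auto
  have "self.iter (zl (replicate j B)) (- ldeg (replicate i' B @ As))
      (real i *\<^sub>R pdl (replicate i' B @ As)) =
      real i *\<^sub>R ((fact i' / fact (i' - j)) *\<^sub>R pdl (replicate (i' - j) B @ As))"
    using self.iter_scale[OF pdl_gmap[OF L] zl_homogeneous, of "replicate j B"] Suc.IH[of i'] Suc.prems
      assms i by (auto simp del: scaleR_fun_apply)
  moreover have "self.br (- ldeg (replicate i B @ As)) (dz B) (pdl (replicate i B @ As)) (z B) =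
    real i *\<^sub>R pdl (replicate i' B @ As)"
    using br_pdl_replicate[OF assms(1-3) Suc.prems(1)] i by simp
  moreover have "- ldeg (replicate i B @ As) + dz B = - ldeg (replicate i' B @ As)" using i by simp
  moreover have "self.iter (zl (replicate (Suc j) B)) d D =
      self.iter (zl (replicate j B)) (d + dz B) (self.br d (dz B) D (z B))" for d D
    by simp
  moreover have "real i * (fact i' / fact (i' - j)) = fact i / fact (i - Suc j)" using i by simp
  moreover have "i' - j = i - Suc j" using i by simp
  ultimately show ?case by (simp only: scaleR_scaleR)
qed

abbreviation mlist_from :: "nat \<Rightarrow> (nat \<Rightarrow> nat) \<Rightarrow> nat list" where
  "mlist_from m I \<equiv> concat (map (\<lambda>A. replicate (I A) A) [m..<n])"

text \<open>Monomials in the coordinates are dual to iterated derivatives. \<open>z m\<close>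
  concerns only the block of derivatives at the front of the word, so one coordinate can be treated
  at a time; \<open>m\<close> runs downwards so that the remaining word is covered by the induction
  hypothesis.\<close>

lemma iter_pdl_mlist_from:
  assumes "m \<le> n" "\<And>A. A < n \<Longrightarrow> even (dz A) \<or> I A \<le> 1" "\<And>A. A < n \<Longrightarrow> even (dz A) \<or> J A \<le> 1"
  shows "self.iter (zl (mlist_from m J)) (- ldeg (mlist_from m I)) (pdl (mlist_from m I)) 0 (gone C U) =
    (if \<forall>A\<in>{m..<n}. I A = J A then (\<Prod>A=m..<n. fact (I A)) *\<^sub>R gone C U else 0)"
  using assms(1)
proof (induction m rule: inc_induct)
  case base
  show ?case using one_in by (simp add: left_mult_def one_mul)
next
  case (step m)
  define L where "L = mlist_from (Suc m) I"
  define K where "K = mlist_from (Suc m) J"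
  let ?i = "I m" and ?j = "J m"
  have e: "mlist_from m I = replicate ?i m @ L" "mlist_from m J = replicate ?j m @ K"
    using step(2) by (simp_all add: upt_conv_Cons L_def K_def)
  have L: "\<forall>A\<in>set L. A < n" "m \<notin> set L" "\<forall>A\<in>set K. A < n \<and> A \<noteq> m"
    by (auto simp: L_def K_def)
  note IH = step.IH[folded L_def K_def]
  have iv: "{m..<n} = insert m {Suc m..<n}" using step(2) by auto
  note R = iter_pdl_replicate[OF L(1) step(2) L(2) assms(2)[OF step(2)]]
  have hK: "self.homogeneous (zl K)" by (rule zl_homogeneous) (use L in auto)
  have gm: "pdl (replicate i m @ L) \<in> graded_maps (self_module C) U (- ldeg (replicate i m @ L))" for i
    by (rule pdl_gmap) (use L step(2) in \<open>auto simp del: replicate.simps\<close>)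
  consider (less) "?j < ?i" | (eq) "?j = ?i" | (gr) "?i < ?j" by linarith
  then show ?case
  proof cases
    \<comment> \<open>Some derivative by \<open>z m\<close> is left over. It is applied before all
      others and the later commutators do not remove it, so 1 is sent to 0.\<close>
    case less
    then obtain q where q: "?i - ?j = Suc q" by (metis Suc_diff_Suc)
    have d: "- ldeg (replicate ?i m @ L) + ldeg (replicate ?j m) = - ldeg (replicate (?i - ?j) m @ L)"
      using less by (simp add: sum_list_replicate algebra_simps of_nat_diff)
    have "self.iter (zl K) (- ldeg (replicate (?i - ?j) m @ L)) (pdl (replicate (?i - ?j) m @ L)) 0 (gone C U) = 0"
      unfolding q using iter_gcomp_one[OF gm[of q] step(2) L(3)] by simp
    then show ?thesis using less
      unfolding e map_append[of "\<lambda>A. (dz A, z A)"] self.iter_append zl_degree d R[OF less_imp_le[OF less]]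
        self.iter_scale[OF gm hK] scaleR_fun_apply by (auto simp: iv)
  next
    case eq
    have d: "- ldeg (replicate ?i m @ L) + ldeg (replicate ?j m) = - ldeg L" using eq by simp
    have "self.iter (zl K) (- ldeg L) (fact ?i *\<^sub>R pdl L) = fact ?i *\<^sub>R self.iter (zl K) (- ldeg L) (pdl L)"
      using self.iter_scale[OF gm[of 0] hK] by simp
    moreover have "self.iter (zl (replicate ?j m)) (- ldeg (replicate ?i m @ L)) (pdl (replicate ?i m @ L)) =
        fact ?i *\<^sub>R pdl L" using R[of ?j] eq by simp
    ultimately show ?thesis using IH eq
      unfolding e map_append[of "\<lambda>A. (dz A, z A)"] self.iter_append zl_degree d by (auto simp: iv)
  next
    \<comment> \<open>All derivatives by \<open>z m\<close> have been used up, so the next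
      commutator with \<open>z m\<close> vanishes.\<close>
    case gr
    have LL: "\<forall>A\<in>set (replicate 0 m @ L). A < n" using L by simp
    have "replicate ?j m = replicate ?i m @ m # replicate (?j - ?i - 1) m"
      using gr by (metis Suc_diff_1 le_add_diff_inverse less_imp_le_nat replicate_Suc replicate_add zero_less_diff)
    then have J: "zl (replicate ?j m @ K) = zl (replicate ?i m) @ (dz m, z m) # zl (replicate (?j - ?i - 1) m @ K)"
      by simp
    have h: "self.homogeneous (zl (replicate (?j - ?i - 1) m @ K))" by (rule zl_homogeneous) (use L step(2) in \<open>auto simp del: replicate.simps\<close>)
    have "self.iter (zl (replicate ?i m)) (- ldeg (replicate ?i m @ L)) (pdl (replicate ?i m @ L)) =
        fact ?i *\<^sub>R pdl L" using R[of ?i] by simp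
    moreover have "self.br (- ldeg L) (dz m) (fact ?i *\<^sub>R pdl L) (z m) = 0"
      using self.br_scale[OF gm[of 0] z_in[OF step(2)]] br_pdl_notin[OF L(1) step(2) L(2)]
      by (simp add: fun_eq_iff)
    moreover have "- ldeg (replicate ?i m @ L) + ldeg (replicate ?i m) = - ldeg L" by simp
    ultimately have "self.iter (zl (replicate ?j m @ K)) (- ldeg (replicate ?i m @ L)) (pdl (replicate ?i m @ L)) = 0"
      unfolding J self.iter_append zl_degree using self.iter_zero[OF h] by (simp del: zero_fun_apply)
    then show ?thesis using gr unfolding e by (auto simp: iv)
  qed
qed

end

section \<open>The decomposition over a fixed open set\<close>

lemma finite_multi_indices: "finite (multi_indices n dz q)"
proof -
  have "multi_indices n dz q \<subseteq> {I. (\<forall>A. A \<notin> {..<n} \<longrightarrow> I A = 0) \<and> (\<forall>A\<in>{..<n}. I A \<in> {..q})}"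
  proof clarify
    fix I assume I: "I \<in> multi_indices n dz q"
    then have "I A \<le> q" if "A < n" for A
      using member_le_sum[of A "{..<n}" I] that by (auto simp: multi_indices_def)
    then show "(\<forall>A. A \<notin> {..<n} \<longrightarrow> I A = 0) \<and> (\<forall>A\<in>{..<n}. I A \<in> {..q})"
      using I by (auto simp: multi_indices_def)
  qed
  moreover have "finite {I::nat \<Rightarrow> nat. (\<forall>A. A \<notin> {..<n} \<longrightarrow> I A = 0) \<and> (\<forall>A\<in>{..<n}. I A \<in> {..q})}"
    by (rule finite_subset[OF _ finite_set_of_finite_funs[of "{..<n}" "{..q}" 0]]) auto
  ultimately show ?thesis by (rule finite_subset)
qed

lemma multi_indices_eqI:
  "I \<in> multi_indices n dz q \<Longrightarrow> J \<in> multi_indices n dz q' \<Longrightarrow> (\<And>A. A < n \<Longrightarrow> I A = J A) \<Longrightarrow> I = J"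
  by (rule ext) (metis (mono_tags, lifting) mem_Collect_eq multi_indices_def not_le_imp_less)

lemma sum_multi_indices:
  "(\<Sum>q=0..k. \<Sum>I\<in>multi_indices n dz q. F I) = (\<Sum>I\<in>(\<Union>q\<in>{0..k}. multi_indices n dz q). F I)"
proof (rule sum.UNION_disjoint[symmetric])
  show "\<forall>i\<in>{0..k}. \<forall>j\<in>{0..k}. i \<noteq> j \<longrightarrow> multi_indices n dz i \<inter> multi_indices n dz j = {}"
    by (auto simp: multi_indices_def)
qed (simp_all add: finite_multi_indices)

lemma set_multi_list: "A \<in> set (multi_list n I) \<Longrightarrow> A < n"
  by (auto simp: multi_list_def)

lemma length_multi_list: "length (multi_list n I) = (\<Sum>A<n. I A)"
  by (simp add: multi_list_def length_concat o_def sum_list_sum_nth atLeast0LessThan)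

lemma multi_list_zero: "multi_list n (\<lambda>_. 0) = []"
  by (simp add: multi_list_def)

lemma degree_multi_list: "sum_list (map dz (multi_list n I)) = exponent_degree n dz I"
proof -
  have "sum_list (map dz (concat (map (\<lambda>A. replicate (I A) A) [0..<m]))) = (\<Sum>A<m. int (I A) * dz A)" for m
    by (induction m) (simp_all add: sum_list_replicate)
  then show ?thesis by (simp add: multi_list_def exponent_degree_def)
qed

text \<open>Isolates the block of \<open>A\<close>, so that raising the exponent at \<open>A\<close>
  can be compared with inserting one more commutator there.\<close>

lemma multi_list_split:
  assumes "A < n"
  obtains xs ys where "multi_list n I = xs @ replicate (I A) A @ ys"
    "\<And>i. multi_list n (I(A := i)) = xs @ replicate i A @ ys"
proof -
  let ?f = "\<lambda>I. concat \<circ> map (\<lambda>A. replicate (I A) A)"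
  have u: "[0..<n] = [0..<A] @ A # [Suc A..<n]"
    using assms by (metis le0 less_imp_le_nat upt_add_eq_append upt_conv_Cons le_add_diff_inverse)
  have "concat (map (\<lambda>B. replicate ((I(A := i)) B) B) L) = concat (map (\<lambda>B. replicate (I B) B) L)"
    if "A \<notin> set L" for i L using that by (induction L) auto
  then show ?thesis
    by (intro that[of "?f I [0..<A]" "?f I [Suc A..<n]"])
      (simp_all add: multi_list_def u fun_upd_same del: fun_upd_apply)
qed

text \<open>Asks for expansions over \<open>U\<close> itself only, in contrast to
  \<open>local_frame\<close>.\<close>

locale framed_module = graded_module C U E
  for C :: "('p, 'c::real_vector) galgebra" and U :: "'p set" and E :: "('p, 'e::real_vector, 'c) gmodule" +
  fixes r :: nat and d\<theta> :: "nat \<Rightarrow> int" and \<Phi> :: "nat \<Rightarrow> 'e"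
  assumes frame_in: "l < r \<Longrightarrow> \<Phi> l \<in> gsec E U (d\<theta> l)"
    and frame_ex1: "\<psi> \<in> gsec E U j \<Longrightarrow> \<exists>!c. frame_expansion C E {..<r} d\<theta> U \<Phi> j \<psi> c"
begin

interpretation self: graded_module C U "self_module C" by (rule self_module)

section \<open>Components with respect to the frame\<close>

abbreviation comp :: "int \<Rightarrow> 'e \<Rightarrow> nat \<Rightarrow> 'c" where
  "comp j \<psi> \<equiv> frame_components C E {..<r} d\<theta> U \<Phi> j \<psi>"

lemma comp_expansion:
  assumes "\<psi> \<in> gsec E U j" shows "frame_expansion C E {..<r} d\<theta> U \<Phi> j \<psi> (comp j \<psi>)"
  unfolding frame_components_def by (rule theI'[OF frame_ex1[OF assms]])

lemma comp_in: "\<psi> \<in> gsec E U j \<Longrightarrow> l < r \<Longrightarrow> i = j - d\<theta> l \<Longrightarrow> comp j \<psi> l \<in> gsec C U i"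
  using comp_expansion by (simp add: frame_expansion_def)

lemma expand: "\<psi> \<in> gsec E U j \<Longrightarrow> (\<Sum>l<r. gact E (comp j \<psi> l) (\<Phi> l)) = \<psi>"
  using comp_expansion by (simp add: frame_expansion_def)

lemma comp_unique:
  assumes "\<And>l. l < r \<Longrightarrow> c l \<in> gsec C U (j - d\<theta> l)" "\<psi> = (\<Sum>l<r. gact E (c l) (\<Phi> l))" "l < r"
  shows "comp j \<psi> l = c l"
proof -
  have p: "\<psi> \<in> gsec E U j"
    unfolding assms(2) by (rule M_sum) (auto intro!: act_in[OF assms(1) frame_in])
  have "frame_expansion C E {..<r} d\<theta> U \<Phi> j \<psi> (\<lambda>l. if l < r then c l else 0)"
    using assms by (simp add: frame_expansion_def)
  then have "comp j \<psi> = (\<lambda>l. if l < r then c l else 0)"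
    using frame_ex1[OF p] comp_expansion[OF p] by blast
  then show ?thesis using assms(3) by simp
qed

lemma comp_add:
  assumes "\<psi> \<in> gsec E U j" "\<eta> \<in> gsec E U j" "l < r"
  shows "comp j (\<psi> + \<eta>) l = comp j \<psi> l + comp j \<eta> l"
proof (rule comp_unique[OF _ _ assms(3)])
  show "comp j \<psi> l + comp j \<eta> l \<in> gsec C U (j - d\<theta> l)" if "l < r" for l
    using self.M_add comp_in assms that by simp
  have "\<psi> + \<eta> = (\<Sum>l<r. gact E (comp j \<psi> l) (\<Phi> l)) + (\<Sum>l<r. gact E (comp j \<eta> l) (\<Phi> l))"
    using expand assms by simp
  also have "\<dots> = (\<Sum>l<r. gact E (comp j \<psi> l + comp j \<eta> l) (\<Phi> l))"
    unfolding sum.distrib[symmetric]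
    by (rule sum.cong) (use act_add_left[OF comp_in[OF assms(1)] comp_in[OF assms(2)] frame_in] in auto)
  finally show "\<psi> + \<eta> = (\<Sum>l<r. gact E (comp j \<psi> l + comp j \<eta> l) (\<Phi> l))" .
qed

lemma comp_act:
  assumes f: "f \<in> gsec C U i" and p: "\<psi> \<in> gsec E U j" and k: "k = i + j" and l: "l < r"
  shows "comp k (gact E f \<psi>) l = gmul C f (comp j \<psi> l)"
proof (rule comp_unique[OF _ _ l])
  show "gmul C f (comp j \<psi> l) \<in> gsec C U (k - d\<theta> l)" if "l < r" for l
    by (rule mul_in[OF f comp_in[OF p that refl]]) (simp add: k)
  have "gact E f (\<Sum>l<r. gact E (comp j \<psi> l) (\<Phi> l)) = (\<Sum>l<r. gact E f (gact E (comp j \<psi> l) (\<Phi> l)))"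
    by (rule act_sum_right[OF f, of _ _ j]) (auto intro!: act_in[OF comp_in[OF p] frame_in])
  also have "\<dots> = (\<Sum>l<r. gact E (gmul C f (comp j \<psi> l)) (\<Phi> l))"
    by (rule sum.cong) (use mul_act[OF f comp_in[OF p] frame_in] in auto)
  finally show "gact E f \<psi> = (\<Sum>l<r. gact E (gmul C f (comp j \<psi> l)) (\<Phi> l))"
    using expand[OF p] by simp
qed

text \<open>Scaling by \<open>a\<close> is the action of the function \<open>a\<close> times 1, so
  \<open>comp_act\<close> applies.\<close>

lemma comp_scale:
  assumes p: "\<psi> \<in> gsec E U j" and l: "l < r"
  shows "comp j (a *\<^sub>R \<psi>) l = a *\<^sub>R comp j \<psi> l"
proof -
  have "gact E (a *\<^sub>R gone C U) \<psi> = a *\<^sub>R \<psi>" using act_scale_left[OF one_in p] one_act[OF p] by simp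
  moreover have "gmul C (a *\<^sub>R gone C U) (comp j \<psi> l) = a *\<^sub>R comp j \<psi> l"
    using self.act_scale_left[OF one_in, of "comp j \<psi> l"] comp_in[OF p l refl] one_mul by simp
  ultimately show ?thesis using comp_act[OF A_scale[OF one_in] p, of j l a] l by simp
qed

lemma comp_frame:
  assumes m: "m < r" and l: "l < r" shows "comp (d\<theta> m) (\<Phi> m) l = (if l = m then gone C U else 0)"
proof (rule comp_unique[OF _ _ l])
  show "(if l = m then gone C U else 0) \<in> gsec C U (d\<theta> m - d\<theta> l)" for l using one_in by simp
  have "(\<Sum>l<r. gact E (if l = m then gone C U else 0) (\<Phi> l)) = (\<Sum>l<r. if l = m then \<Phi> m else 0)"
    by (rule sum.cong) (use one_act[OF frame_in] act_zero_left[OF frame_in] in auto)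
  then show "\<Phi> m = (\<Sum>l<r. gact E (if l = m then gone C U else 0) (\<Phi> l))"
    using m by simp
qed

end

locale graded_frame = graded_coordinates C U n dz z pd + framed_module C U E r d\<theta> \<Phi>
  for C :: "('p, 'c::real_vector) galgebra" and U :: "'p set"
    and n dz z pd and E :: "('p, 'e::real_vector, 'c) gmodule" and r d\<theta> \<Phi>
begin

interpretation self: graded_module C U "self_module C" by (rule self_module)

text \<open>The criterion \<open>zero_if_commutes\<close> is applied to the matrix entries of
  \<open>D\<close>. They inherit the sign of moving \<open>D\<close> past \<open>z A\<close>, which
  is 1 for coordinates of degree 0.\<close>

lemma zero_if_commutes_frame:
  assumes D: "D \<in> graded_maps E U d"
    and br: "\<And>A. A < n \<Longrightarrow> br d (dz A) D (z A) = 0"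
    and fr: "\<And>l. l < r \<Longrightarrow> D (d\<theta> l) (\<Phi> l) = 0"
  shows "D = 0"
proof -
  define T where "T l m = (\<lambda>i f. if f \<in> gsec C U i then comp (i + d\<theta> l + d) (D (i + d\<theta> l) (gact E f (\<Phi> l))) m else 0)" for l m
  have a: "gact E f (\<Phi> l) \<in> gsec E U (i + d\<theta> l)" if "f \<in> gsec C U i" "l < r" for f i l
    using act_in[OF that(1) frame_in] that by simp
  note b = gmap_in[OF D a refl]
  have "T l m = 0" if l: "l < r" and m: "m < r" for l m
  proof (rule zero_if_commutes)
    show "T l m \<in> graded_maps C U (d\<theta> l + d - d\<theta> m)"
    proof (rule self.gmapI[simplified])
      fix i f g assume f: "f \<in> gsec C U i" and g: "g \<in> gsec C U i"
      show "T l m i (f + g) = T l m i f + T l m i g"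
        using f g self.M_add[of f i g] act_add_left[OF f g frame_in[OF l]]
          gmap_add[OF D a[OF f l] a[OF g l]] comp_add[OF b[OF f l] b[OF g l] m]
        by (simp add: T_def)
    next
      fix i f and c :: real assume f: "f \<in> gsec C U i"
      show "T l m i (c *\<^sub>R f) = c *\<^sub>R T l m i f"
        using f A_scale[OF f] act_scale_left[OF f frame_in[OF l]]
          gmap_scale[OF D a[OF f l]] comp_scale[OF b[OF f l] m]
        by (simp add: T_def)
    next
      fix i f assume f: "f \<in> gsec C U i"
      then show "T l m i f \<in> gsec C U (i + (d\<theta> l + d - d\<theta> m))"
        using comp_in[OF b[OF f l] m refl] by (simp add: T_def algebra_simps)
    qed (simp add: T_def)
    \<comment> \<open>Scaling by 0 in \<open>comp_scale\<close> shows that the components of the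
      zero section vanish.\<close>
    show "T l m 0 (gone C U) = 0"
      using one_in one_act[OF frame_in[OF l]] fr[OF l] comp_scale[OF M_zero m, of d 0]
        comp_scale[OF M_zero m, of "d\<theta> l + d" 0]
      by (simp add: T_def)
    fix A i f assume A: "A < n" and f: "f \<in> gsec C U i"
    have zf: "gmul C (z A) f \<in> gsec C U (i + dz A)" by (rule mul_in[OF z_in[OF A] f]) simp
    have "br d (dz A) D (z A) (i + d\<theta> l) (gact E f (\<Phi> l)) = 0" using br[OF A] by simp
    then have "D (i + d\<theta> l + dz A) (gact E (z A) (gact E f (\<Phi> l))) =
        ((-1) powi (d * dz A)) *\<^sub>R gact E (z A) (D (i + d\<theta> l) (gact E f (\<Phi> l)))"
      by (simp add: br_apply[OF D a[OF f l]])
    then have "D (i + dz A + d\<theta> l) (gact E (gmul C (z A) f) (\<Phi> l)) =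
        ((-1) powi (d * dz A)) *\<^sub>R gact E (z A) (D (i + d\<theta> l) (gact E f (\<Phi> l)))"
      using mul_act[OF z_in[OF A] f frame_in[OF l]] by (simp add: ac_simps)
    moreover have "gact E (z A) (D (i + d\<theta> l) (gact E f (\<Phi> l))) \<in> gsec E U (i + dz A + d\<theta> l + d)"
      by (rule act_in[OF z_in[OF A] b[OF f l]]) simp
    moreover have "comp (i + dz A + d\<theta> l + d) (gact E (z A) (D (i + d\<theta> l) (gact E f (\<Phi> l)))) m =
        gmul C (z A) (comp (i + d\<theta> l + d) (D (i + d\<theta> l) (gact E f (\<Phi> l))) m)"
      by (rule comp_act[OF z_in[OF A] b[OF f l] _ m]) simp
    ultimately have "T l m (i + dz A) (gmul C (z A) f) = ((-1) powi (d * dz A)) *\<^sub>R gmul C (z A) (T l m i f)"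
      using f zf comp_scale[OF _ m] by (simp add: T_def)
    then show "\<exists>s::real. (dz A = 0 \<longrightarrow> s = 1) \<and>
        T l m (i + dz A) (gmul C (z A) f) = s *\<^sub>R gmul C (z A) (T l m i f)"
      by (intro exI[of _ "(-1) powi (d * dz A)"]) simp
  qed
  then have *: "comp (i + d\<theta> l + d) (D (i + d\<theta> l) (gact E f (\<Phi> l))) m = 0"
    if "f \<in> gsec C U i" "l < r" "m < r" for f i l m
    using that by (metis T_def zero_fun_apply)
  have **: "D (i + d\<theta> l) (gact E f (\<Phi> l)) = 0" if f: "f \<in> gsec C U i" and l: "l < r" for f i l
    using expand[OF b[OF f l]] *[OF f l] act_zero_left[OF frame_in] by simp
  show ?thesis
  proof (rule gmap_eqI[OF D subspace_0[OF gmaps_subspace]])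
    fix i \<psi> assume p: "\<psi> \<in> gsec E U i"
    have "D i (\<Sum>l<r. gact E (comp i \<psi> l) (\<Phi> l)) = (\<Sum>l<r. D i (gact E (comp i \<psi> l) (\<Phi> l)))"
      by (rule gmap_sum[OF D]) (simp add: act_in[OF comp_in[OF p _ refl] frame_in])
    also have "\<dots> = 0"
    proof (intro sum.neutral ballI)
      fix l assume "l \<in> {..<r}"
      then show "D i (gact E (comp i \<psi> l) (\<Phi> l)) = 0" using **[OF comp_in[OF p _ refl], of l l] by simp
    qed
    finally show "D i \<psi> = 0 i \<psi>" using expand[OF p] by simp
  qed
qed

text \<open>The sign is that of moving the matrix unit from \<Phi> l to \<Phi> m, of degree
  \<open>d\<theta> m - d\<theta> l\<close>, past the image function, of degree
  \<open>i - d\<theta> l + \<delta>\<close>. With an iterated derivative for \<Delta> this is the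
  operator \<open>frame_op\<close>.\<close>

definition frame_lift :: "int \<Rightarrow> 'c gmap \<Rightarrow> nat \<Rightarrow> nat \<Rightarrow> 'e gmap" where
  "frame_lift \<delta> \<Delta> l m = (\<lambda>i \<psi>. if \<psi> \<in> gsec E U i then
     ((-1) powi ((d\<theta> m - d\<theta> l) * (i - d\<theta> l + \<delta>))) *\<^sub>R gact E (\<Delta> (i - d\<theta> l) (comp i \<psi> l)) (\<Phi> m) else 0)"

lemma frame_lift_apply: "\<psi> \<in> gsec E U i \<Longrightarrow> frame_lift \<delta> \<Delta> l m i \<psi> =
    ((-1) powi ((d\<theta> m - d\<theta> l) * (i - d\<theta> l + \<delta>))) *\<^sub>R gact E (\<Delta> (i - d\<theta> l) (comp i \<psi> l)) (\<Phi> m)"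
  by (simp add: frame_lift_def)

lemma frame_lift_zero: "m < r \<Longrightarrow> frame_lift \<delta> 0 l m = 0"
  by (auto simp: frame_lift_def fun_eq_iff act_zero_left[OF frame_in])

lemma frame_lift_gmap:
  assumes \<Delta>: "\<Delta> \<in> graded_maps (self_module C) U \<delta>" and l: "l < r" and m: "m < r"
    and e: "e = d\<theta> m - d\<theta> l + \<delta>"
  shows "frame_lift \<delta> \<Delta> l m \<in> graded_maps E U e"
proof (rule gmapI)
  fix i x y assume x: "x \<in> gsec E U i" and y: "y \<in> gsec E U i"
  have c: "comp i w l \<in> gsec C U (i - d\<theta> l)" "\<Delta> (i - d\<theta> l) (comp i w l) \<in> gsec C U (i - d\<theta> l + \<delta>)"
    if "w \<in> gsec E U i" for w
    using comp_in[OF that l refl] self.gmap_in[OF \<Delta>, of "comp i w l" "i - d\<theta> l"] by simp_all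
  show "frame_lift \<delta> \<Delta> l m i (x + y) = frame_lift \<delta> \<Delta> l m i x + frame_lift \<delta> \<Delta> l m i y"
    using c[OF x] c[OF y] x y
    by (simp add: frame_lift_def M_add comp_add[OF x y l] self.gmap_add[OF \<Delta>, simplified]
        act_add_left[OF c(2) c(2) frame_in[OF m]] scaleR_add_right)
next
  fix i x and a :: real assume x: "x \<in> gsec E U i"
  have c: "comp i x l \<in> gsec C U (i - d\<theta> l)" "\<Delta> (i - d\<theta> l) (comp i x l) \<in> gsec C U (i - d\<theta> l + \<delta>)"
    using comp_in[OF x l refl] self.gmap_in[OF \<Delta>, of "comp i x l" "i - d\<theta> l"] by simp_all
  show "frame_lift \<delta> \<Delta> l m i (a *\<^sub>R x) = a *\<^sub>R frame_lift \<delta> \<Delta> l m i x"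
    using c x
    by (simp add: frame_lift_def M_scale comp_scale[OF x l] self.gmap_scale[OF \<Delta>, simplified]
        act_scale_left[OF c(2) frame_in[OF m]])
  show "frame_lift \<delta> \<Delta> l m i x \<in> gsec E U (i + e)"
    using x act_in[OF c(2) frame_in[OF m], of "i + e"] M_scale e by (simp add: frame_lift_def)
qed (simp add: frame_lift_def)

text \<open>The sign in \<open>frame_lift\<close> is exactly the one for which commutators may be
  computed on functions before lifting, without further signs.\<close>

lemma br_frame_lift:
  assumes \<Delta>: "\<Delta> \<in> graded_maps (self_module C) U \<delta>" and l: "l < r" and m: "m < r"
    and f: "f \<in> gsec C U i" and e: "e = d\<theta> m - d\<theta> l + \<delta>"
  shows "br e i (frame_lift \<delta> \<Delta> l m) f = frame_lift (\<delta> + i) (self.br \<delta> i \<Delta> f) l m"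
proof (rule gmap_eqI)
  note L = frame_lift_gmap[OF \<Delta> l m e]
  show "br e i (frame_lift \<delta> \<Delta> l m) f \<in> graded_maps E U (e + i)" by (rule br_gmap[OF L f refl])
  show "frame_lift (\<delta> + i) (self.br \<delta> i \<Delta> f) l m \<in> graded_maps E U (e + i)"
    by (rule frame_lift_gmap[OF self.br_gmap[OF \<Delta> f refl] l m]) (simp add: e)
  fix j \<psi> assume p: "\<psi> \<in> gsec E U j"
  let ?u = "comp j \<psi> l" and ?i = "j - d\<theta> l"
  have u: "?u \<in> gsec C U ?i" using comp_in[OF p l refl] .
  have Du: "\<Delta> ?i ?u \<in> gsec C U (?i + \<delta>)" using self.gmap_in[OF \<Delta>, of ?u] u by simp
  have fDu: "gmul C f (\<Delta> ?i ?u) \<in> gsec C U (?i + \<delta> + i)" by (rule mul_in[OF f Du]) simp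
  have fu: "gmul C f ?u \<in> gsec C U (?i + i)" by (rule mul_in[OF f u]) simp
  have Dfu: "\<Delta> (?i + i) (gmul C f ?u) \<in> gsec C U (?i + \<delta> + i)"
    using self.gmap_in[OF \<Delta>, of "gmul C f ?u" "?i + i" "?i + \<delta> + i"] fu by simp
  have fp: "gact E f \<psi> \<in> gsec E U (j + i)" by (rule act_in[OF f p]) simp
  have cfp: "comp (j + i) (gact E f \<psi>) l = gmul C f ?u" by (rule comp_act[OF f p _ l]) simp
  have i: "j + i - d\<theta> l = ?i + i" and i': "?i + i + \<delta> = ?i + (\<delta> + i)" by simp_all
  have "gact E (self.br \<delta> i \<Delta> f ?i ?u) (\<Phi> m) = gact E (\<Delta> (?i + i) (gmul C f ?u)) (\<Phi> m) -
     ((-1) powi (\<delta> * i)) *\<^sub>R gact E f (gact E (\<Delta> ?i ?u) (\<Phi> m))"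
    using self.br_apply[OF \<Delta>, of ?u ?i i f] u act_diff_left[OF Dfu A_scale[OF fDu] frame_in[OF m]]
      act_scale_left[OF fDu frame_in[OF m]] mul_act[OF f Du frame_in[OF m]] by simp
  moreover have "gact E f (((-1) powi ((d\<theta> m - d\<theta> l) * (?i + \<delta>))) *\<^sub>R gact E (\<Delta> ?i ?u) (\<Phi> m)) =
      ((-1) powi ((d\<theta> m - d\<theta> l) * (?i + \<delta>))) *\<^sub>R gact E f (gact E (\<Delta> ?i ?u) (\<Phi> m))"
    by (rule act_scale_right[OF f act_in[OF Du frame_in[OF m] refl]])
  moreover have "(-1 :: real) powi (e * i) * (-1) powi ((d\<theta> m - d\<theta> l) * (?i + \<delta>)) =
      (-1) powi ((d\<theta> m - d\<theta> l) * (?i + (\<delta> + i))) * (-1) powi (\<delta> * i)"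
    unfolding e by (auto simp: powi_minus_one_if)
  ultimately show "br e i (frame_lift \<delta> \<Delta> l m) f j \<psi> = frame_lift (\<delta> + i) (self.br \<delta> i \<Delta> f) l m j \<psi>"
    using cfp unfolding br_apply[OF L p] frame_lift_apply[OF p] frame_lift_apply[OF fp] i i'
    by (simp add: scaleR_diff_right)
qed

lemma iter_frame_lift:
  "\<Delta> \<in> graded_maps (self_module C) U \<delta> \<Longrightarrow> l < r \<Longrightarrow> m < r \<Longrightarrow> homogeneous fs \<Longrightarrow> e = d\<theta> m - d\<theta> l + \<delta> \<Longrightarrow>
    iter fs e (frame_lift \<delta> \<Delta> l m) = frame_lift (\<delta> + sum_list (map fst fs)) (self.iter fs \<delta> \<Delta>) l m"
proof (induction fs arbitrary: \<delta> \<Delta> e)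
  case (Cons a fs)
  obtain i f where a: "a = (i, f)" by (cases a)
  then have f: "f \<in> gsec C U i" using Cons.prems by simp
  show ?case
    using Cons.IH[OF self.br_gmap[OF Cons.prems(1) f refl] Cons.prems(2,3), of "e + i"] Cons.prems a
      br_frame_lift[OF Cons.prems(1-3) f Cons.prems(5)] by (simp add: add.assoc)
qed simp

text \<open>By \<open>iter_frame_lift\<close> the vanishing of iterated commutators carries over
  from functions, and \<open>diff_op_iff_iter\<close> turns this into a statement on the
  order.\<close>

lemma frame_lift_diff_op:
  assumes \<Delta>: "\<Delta> \<in> diff_ops C (self_module C) k U \<delta>" and l: "l < r" and m: "m < r"
    and e: "e = d\<theta> m - d\<theta> l + \<delta>"
  shows "frame_lift \<delta> \<Delta> l m \<in> diff_ops C E k U e"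
proof -
  note g = self.diff_op_gmap[OF \<Delta>]
  have "iter fs e (frame_lift \<delta> \<Delta> l m) = 0" if fs: "length fs = Suc k" "homogeneous fs" for fs
  proof -
    have "self.homogeneous fs" using fs by (simp add: self.homogeneous_def homogeneous_def)
    then have "self.iter fs \<delta> \<Delta> = 0" using \<Delta> fs unfolding self.diff_op_iff_iter by blast
    then show ?thesis using iter_frame_lift[OF g l m fs(2) e] frame_lift_zero[OF m]
      by (simp del: zero_fun_apply)
  qed
  then show ?thesis unfolding diff_op_iff_iter using frame_lift_gmap[OF g l m e] by blast
qed

lemma frame_lift_frame:
  assumes \<Delta>: "\<Delta> \<in> graded_maps (self_module C) U \<delta>" and l: "l < r" and m: "m < r" and l': "l' < r"
  shows "frame_lift \<delta> \<Delta> l m (d\<theta> l') (\<Phi> l') =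
    (if l' = l then ((-1) powi ((d\<theta> m - d\<theta> l) * \<delta>)) *\<^sub>R gact E (\<Delta> 0 (gone C U)) (\<Phi> m) else 0)"
  using frame_in[OF l'] comp_frame[OF l' l] act_zero_left[OF frame_in[OF m]] self.gmap_zero[OF \<Delta>]
  by (auto simp: frame_lift_def)

section \<open>The operators of the frame and their coordinate commutators\<close>

abbreviation deg :: "(nat \<Rightarrow> nat) \<Rightarrow> int" where "deg I \<equiv> exponent_degree n dz I"
abbreviation P where "P \<equiv> frame_op C E U n dz z r d\<theta> \<Phi>"
abbreviation P_deg :: "(nat \<Rightarrow> nat) \<Rightarrow> nat \<Rightarrow> nat \<Rightarrow> int" where
  "P_deg I l m \<equiv> d\<theta> m - d\<theta> l - deg I"
abbreviation cc :: "(nat \<Rightarrow> nat) \<Rightarrow> int \<Rightarrow> 'e gmap \<Rightarrow> 'e gmap" where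
  "cc \<equiv> coord_commutator E U n dz z"
abbreviation indices :: "nat \<Rightarrow> (nat \<Rightarrow> nat) set" where
  "indices k \<equiv> (\<Union>q\<in>{0..k}. multi_indices n dz q)"

lemma pdl_multi_list: "pdl (multi_list n I) \<in> graded_maps (self_module C) U (- deg I)"
  using pdl_gmap[of "multi_list n I"] set_multi_list by (auto simp: degree_multi_list)

lemma frame_op_eq: "l < r \<Longrightarrow> P I l m = frame_lift (- deg I) (pdl (multi_list n I)) l m"
  using pdl_apply[of "multi_list n I", OF _ comp_in] set_multi_list
  by (auto simp: fun_eq_iff frame_op_def frame_lift_def deriv_op_def)

lemma zl_multi_list: "homogeneous (map (\<lambda>A. (dz A, z A)) (multi_list n I))"
  using z_in by (auto simp: homogeneous_def dest: set_multi_list)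

lemma frame_op_diff_op:
  assumes "I \<in> indices k" "l < r" "m < r" shows "P I l m \<in> diff_ops C E k U (P_deg I l m)"
proof -
  obtain q where q: "q \<le> k" "I \<in> multi_indices n dz q" using assms by auto
  have "pdl (multi_list n I) \<in> diff_ops C (self_module C) q U (- deg I)"
    using pdl_diff_op[of "multi_list n I"] set_multi_list q(2)
    by (auto simp: degree_multi_list length_multi_list multi_indices_def simp del: diff_ops.simps)
  then have "P I l m \<in> diff_ops C E q U (P_deg I l m)"
    unfolding frame_op_eq[OF assms(2)] by (rule frame_lift_diff_op) (use assms in auto)
  then show ?thesis by (rule diff_op_mono[OF _ q(1)])
qed

lemma cc_gmap: "D \<in> graded_maps E U d \<Longrightarrow> e = d + deg I \<Longrightarrow> cc I d D \<in> graded_maps E U e"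
  using iter_gmap[OF _ zl_multi_list, of D d I]
  by (simp add: coord_commutator_def o_def degree_multi_list)

text \<open>For \<open>I = J\<close> the lifted map has degree 0, so no sign survives and the factor
  is exactly the factorial. This is the duality of \<open>iter_pdl_mlist_from\<close>, carried to
  sections.\<close>

lemma cc_frame_op:
  assumes I: "I \<in> indices k" and J: "J \<in> indices k" and l: "l < r" and m: "m < r" and l': "l' < r"
  shows "cc J (P_deg I l m) (P I l m) (d\<theta> l') (\<Phi> l') =
    (if I = J \<and> l = l' then multi_fact n I *\<^sub>R \<Phi> m else 0)"
proof -
  let ?zs = "map (\<lambda>A. (dz A, z A)) (multi_list n J)"
  have h: "self.homogeneous ?zs" using zl_multi_list by (simp add: self.homogeneous_def homogeneous_def)
  have s: "sum_list (map fst ?zs) = deg J" by (simp add: o_def degree_multi_list)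
  have it: "self.iter ?zs (- deg I) (pdl (multi_list n I)) \<in> graded_maps (self_module C) U (- deg I + deg J)"
    using self.iter_gmap[OF pdl_multi_list h] s by simp
  have "cc J (P_deg I l m) (P I l m) = frame_lift (- deg I + deg J) (self.iter ?zs (- deg I) (pdl (multi_list n I))) l m"
    unfolding coord_commutator_def frame_op_eq[OF l] s[symmetric]
    by (rule iter_frame_lift[OF pdl_multi_list l m zl_multi_list]) simp
  moreover have "self.iter ?zs (- deg I) (pdl (multi_list n I)) 0 (gone C U) =
      (if I = J then multi_fact n I *\<^sub>R gone C U else 0)"
  proof -
    have "self.iter ?zs (- deg I) (pdl (multi_list n I)) 0 (gone C U) =
      (if \<forall>A\<in>{0..<n}. I A = J A then (\<Prod>A=0..<n. fact (I A)) *\<^sub>R gone C U else 0)"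
      unfolding degree_multi_list[symmetric] multi_list_def
      by (rule iter_pdl_mlist_from) (use I J in \<open>auto simp: multi_indices_def\<close>)
    moreover have "(\<forall>A\<in>{0..<n}. I A = J A) \<longleftrightarrow> I = J"
      using multi_indices_eqI I J by fastforce
    ultimately show ?thesis by (simp add: multi_fact_def atLeast0LessThan)
  qed
  ultimately show ?thesis
    using frame_lift_frame[OF it l m l'] act_scale_left[OF one_in frame_in[OF m]] one_act[OF frame_in[OF m]]
      act_zero_left[OF frame_in[OF m]] by auto
qed

text \<open>Induction on the order, applied to the commutators of \<open>D\<close> with the
  coordinates: if these vanish and so do the values on the frame, then \<open>D\<close> is 0. The
  commutator of \<open>[D, z A]\<close> for the multi-index \<open>I\<close> is, up to sign, that of
  \<open>D\<close> for \<open>I\<close> raised by one at \<open>A\<close>.\<close>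

lemma diff_op_zero_if_cc_frame_zero:
  "D \<in> diff_ops C E k U d \<Longrightarrow> (\<And>I l. I \<in> indices k \<Longrightarrow> l < r \<Longrightarrow> cc I d D (d\<theta> l) (\<Phi> l) = 0) \<Longrightarrow> D = 0"
proof (induction k arbitrary: d D)
  case 0
  have "(\<lambda>_. 0) \<in> indices 0" by (simp add: multi_indices_def)
  from 0(2)[OF this] have "D (d\<theta> l) (\<Phi> l) = 0" if "l < r" for l
    using that by (simp add: coord_commutator_def multi_list_zero)
  moreover have "br d (dz A) D (z A) = 0" if "A < n" for A
    using 0(1) z_in[OF that] unfolding diff_op_zero_iff by blast
  ultimately show ?case by (intro zero_if_commutes_frame[OF diff_op_gmap[OF 0(1)]])
next
  case (Suc k)
  note g = diff_op_gmap[OF Suc.prems(1)]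
  have "(\<lambda>_. 0) \<in> indices (Suc k)" by (auto simp: multi_indices_def)
  from Suc.prems(2)[OF this] have "D (d\<theta> l) (\<Phi> l) = 0" if "l < r" for l
    using that by (simp add: coord_commutator_def multi_list_zero)
  moreover have "br d (dz A) D (z A) = 0" if A: "A < n" for A
  proof (rule Suc.IH)
    show "br d (dz A) D (z A) \<in> diff_ops C E k U (d + dz A)"
      using Suc.prems(1) z_in[OF A] by (simp only: diff_op_Suc_iff)
    fix I l assume I: "I \<in> indices k" and l: "l < r"
    let ?z = "map (\<lambda>A. (dz A, z A))"
    obtain xs ys where s: "multi_list n I = xs @ replicate (I A) A @ ys"
      "\<And>i. multi_list n (I(A := i)) = xs @ replicate i A @ ys" using multi_list_split[OF A] by metis
    have h: "homogeneous (?z xs)" "homogeneous (?z (replicate (I A) A))" "homogeneous (?z ys)"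
      using zl_multi_list[of I] s(1) by simp_all
    have c: "cc I (d + dz A) (br d (dz A) D (z A)) = iter ((dz A, z A) # ?z xs @ ?z (replicate (I A) A @ ys)) d D"
      by (simp add: coord_commutator_def s(1))
    show "cc I (d + dz A) (br d (dz A) D (z A)) (d\<theta> l) (\<Phi> l) = 0"
    \<comment> \<open>Exactly in this case raising \<open>I\<close> at \<open>A\<close> leaves the
      set of multi-indices. The commutator then contains an odd coordinate twice and vanishes by
      itself.\<close>
    proof (cases "odd (dz A) \<and> I A \<noteq> 0")
      case True
      then obtain i where i: "I A = Suc i" by (cases "I A") auto
      then have "iter ((dz A, z A) # ?z xs @ (dz A, z A) # ?z (replicate i A @ ys)) d D = 0"
        using True h by (intro iter_repeat_odd[OF g z_in[OF A]]) auto
      then show ?thesis unfolding c using i by simp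
    next
      case False
      have "(\<Sum>B<n. (I(A := Suc (I A))) B) = Suc (\<Sum>B<n. I B)"
        using A by (simp add: sum.remove[of "{..<n}" A])
      then have "I(A := Suc (I A)) \<in> indices (Suc k)"
        using I A False by (auto simp: multi_indices_def)
      then have "cc (I(A := Suc (I A))) d D (d\<theta> l) (\<Phi> l) = 0" using Suc.prems(2) l by blast
      then have "iter (?z (xs @ replicate (Suc (I A)) A @ ys)) d D (d\<theta> l) (\<Phi> l) = 0"
        unfolding coord_commutator_def s(2) .
      moreover have "\<exists>s. s \<noteq> 0 \<and> iter (?z xs @ (dz A, z A) # ?z (replicate (I A) A @ ys)) d D =
          s *\<^sub>R iter ((dz A, z A) # ?z xs @ ?z (replicate (I A) A @ ys)) d D"
        by (rule iter_move[OF g z_in[OF A]]) (use h in auto)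
      ultimately show ?thesis unfolding c by auto
    qed
  qed
  ultimately show ?case by (intro zero_if_commutes_frame[OF g])
qed

section \<open>The decomposition and the uniqueness of its coefficients\<close>

abbreviation decomp :: "nat \<Rightarrow> ((nat \<Rightarrow> nat) \<Rightarrow> nat \<Rightarrow> nat \<Rightarrow> 'c) \<Rightarrow> 'e gmap" where
  "decomp k c \<equiv> (\<Sum>q=0..k. \<Sum>I\<in>multi_indices n dz q. \<Sum>m<r. \<Sum>l<r.
     (1 / multi_fact n I) *\<^sub>R fmul (c I m l) (P I l m))"

definition coeffs_in :: "nat \<Rightarrow> int \<Rightarrow> ((nat \<Rightarrow> nat) \<Rightarrow> nat \<Rightarrow> nat \<Rightarrow> 'c) \<Rightarrow> bool" where
  "coeffs_in k d c \<longleftrightarrow> (\<forall>I\<in>indices k. \<forall>m<r. \<forall>l<r. c I m l \<in> gsec C U (d - P_deg I l m))"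

lemma decomp_diff_op:
  assumes "coeffs_in k d c" shows "decomp k c \<in> diff_ops C E k U d"
  unfolding sum_multi_indices
proof (intro subspace_sum[OF diff_ops_subspace] subspace_scale[OF diff_ops_subspace])
  fix I m l assume *: "I \<in> indices k" "m \<in> {..<r}" "l \<in> {..<r}"
  show "fmul (c I m l) (P I l m) \<in> diff_ops C E k U d"
    by (rule fmul_diff_op[OF frame_op_diff_op[OF *(1)]])
      (use * assms in \<open>auto simp: coeffs_in_def\<close>)
qed

text \<open>Coefficients pass through commutators by \<open>iter_fmul\<close>, the factorials cancel
  against those of \<open>cc_frame_op\<close>, and a single multi-index and frame index survive.
  Hence the coefficients can be recovered from the operator.\<close>

lemma cc_decomp:
  assumes c: "coeffs_in k d c" and J: "J \<in> indices k" and l': "l' < r"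
  shows "cc J d (decomp k c) (d\<theta> l') (\<Phi> l') = (\<Sum>m<r. gact E (c J m l') (\<Phi> m))"
proof -
  let ?zs = "map (\<lambda>A. (dz A, z A)) (multi_list n J)"
  note h = zl_multi_list[of J]
  have ci: "c I m l \<in> gsec C U (d - P_deg I l m)" if "I \<in> indices k" "m < r" "l < r" for I m l
    using c that unfolding coeffs_in_def by blast
  note Pg = diff_op_gmap[OF frame_op_diff_op]
  have f: "fmul (c I m l) (P I l m) \<in> graded_maps E U d" if "I \<in> indices k" "m < r" "l < r" for I m l
    by (rule fmul_gmap[OF Pg[OF that(1,3,2)] ci[OF that]]) simp
  note S = subspace_sum[OF gmaps_subspace] and S' = subspace_scale[OF gmaps_subspace]
  have "cc J d (decomp k c) = (\<Sum>I\<in>indices k. cc J d (\<Sum>m<r. \<Sum>l<r. (1 / multi_fact n I) *\<^sub>R fmul (c I m l) (P I l m)))"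
    unfolding sum_multi_indices coord_commutator_def
    by (intro iter_sum[OF _ h] S S' f) auto
  also have "\<dots> = (\<Sum>I\<in>indices k. \<Sum>m<r. cc J d (\<Sum>l<r. (1 / multi_fact n I) *\<^sub>R fmul (c I m l) (P I l m)))"
    unfolding coord_commutator_def
    by (intro sum.cong refl iter_sum[OF _ h] S S' f) auto
  also have "\<dots> = (\<Sum>I\<in>indices k. \<Sum>m<r. \<Sum>l<r. cc J d ((1 / multi_fact n I) *\<^sub>R fmul (c I m l) (P I l m)))"
    unfolding coord_commutator_def
    by (intro sum.cong refl iter_sum[OF _ h] S S' f) auto
  also have "\<dots> = (\<Sum>I\<in>indices k. \<Sum>m<r. \<Sum>l<r. (1 / multi_fact n I) *\<^sub>R fmul (c I m l) (cc J (P_deg I l m) (P I l m)))"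
  proof (intro sum.cong refl)
    fix I m l assume *: "I \<in> indices k" "m \<in> {..<r}" "l \<in> {..<r}"
    then have *: "I \<in> indices k" "m < r" "l < r" by auto
    show "cc J d ((1 / multi_fact n I) *\<^sub>R fmul (c I m l) (P I l m)) =
        (1 / multi_fact n I) *\<^sub>R fmul (c I m l) (cc J (P_deg I l m) (P I l m))"
      unfolding coord_commutator_def iter_scale[OF f[OF *] h]
      by (subst iter_fmul[OF Pg[OF *(1,3,2)] ci[OF *] h]) simp_all
  qed
  finally have "cc J d (decomp k c) (d\<theta> l') (\<Phi> l') = (\<Sum>I\<in>indices k. \<Sum>m<r. \<Sum>l<r.
      (1 / multi_fact n I) *\<^sub>R gact E (c I m l) (cc J (P_deg I l m) (P I l m) (d\<theta> l') (\<Phi> l')))"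
    by (simp add: sum_fun_apply)
  also have "\<dots> = (\<Sum>I\<in>indices k. \<Sum>m<r. \<Sum>l<r. if I = J \<and> l = l' then gact E (c J m l') (\<Phi> m) else 0)"
  proof (intro sum.cong refl)
    fix I m l assume *: "I \<in> indices k" "m \<in> {..<r}" "l \<in> {..<r}"
    then have *: "I \<in> indices k" "m < r" "l < r" by auto
    have "multi_fact n I \<noteq> 0" by (simp add: multi_fact_def)
    then show "(1 / multi_fact n I) *\<^sub>R gact E (c I m l) (cc J (P_deg I l m) (P I l m) (d\<theta> l') (\<Phi> l')) =
      (if I = J \<and> l = l' then gact E (c J m l') (\<Phi> m) else 0)"
      using cc_frame_op[OF *(1) J *(3,2) l'] act_scale_right[OF ci[OF *] frame_in[OF *(2)]]
        act_zero_right[OF ci[OF *]] by auto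
  qed
  also have "\<dots> = (\<Sum>I\<in>indices k. if I = J then (\<Sum>m<r. gact E (c J m l') (\<Phi> m)) else 0)"
    by (intro sum.cong refl) (use l' in auto)
  also have "\<dots> = (\<Sum>m<r. gact E (c J m l') (\<Phi> m))"
    using J finite_multi_indices by (subst sum.delta) auto
  finally show ?thesis .
qed

text \<open>One formula covers the zero multi-index too, for which the commutator is
  \<open>D\<close> itself.\<close>

definition coeff :: "int \<Rightarrow> 'e gmap \<Rightarrow> (nat \<Rightarrow> nat) \<Rightarrow> nat \<Rightarrow> nat \<Rightarrow> 'c" where
  "coeff d D I m l = comp (d + deg I + d\<theta> l) (cc I d D (d\<theta> l) (\<Phi> l)) m"

lemma
  assumes D: "D \<in> diff_ops C E k U d"
  shows coeff_in: "coeffs_in k d (coeff d D)"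
    and cc_frame: "l < r \<Longrightarrow> cc I d D (d\<theta> l) (\<Phi> l) = (\<Sum>m<r. gact E (coeff d D I m l) (\<Phi> m))"
    and decomposition: "D = decomp k (coeff d D)"
proof -
  have i: "cc I d D (d\<theta> l) (\<Phi> l) \<in> gsec E U (d + deg I + d\<theta> l)" if "l < r" for I l
    by (rule gmap_in[OF cc_gmap[OF diff_op_gmap[OF D] refl] frame_in[OF that]]) simp
  show c: "coeffs_in k d (coeff d D)"
    unfolding coeffs_in_def coeff_def by (auto intro!: comp_in[OF i])
  show *: "cc I d D (d\<theta> l) (\<Phi> l) = (\<Sum>m<r. gact E (coeff d D I m l) (\<Phi> m))" if "l < r" for I l
    unfolding coeff_def using expand[OF i[OF that]] by simp
  let ?D = "decomp k (coeff d D)"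
  have "D - ?D = 0"
  proof (rule diff_op_zero_if_cc_frame_zero)
    show "D - ?D \<in> diff_ops C E k U d"
      using subspace_diff[OF diff_ops_subspace D decomp_diff_op[OF c]] .
    fix I l assume I: "I \<in> indices k" and l: "l < r"
    note g = diff_op_gmap[OF D] diff_op_gmap[OF decomp_diff_op[OF c]]
    have "cc I d (D + (-1) *\<^sub>R ?D) = cc I d D + (-1) *\<^sub>R cc I d ?D"
      unfolding coord_commutator_def
      using iter_add[OF g(1) subspace_scale[OF gmaps_subspace g(2)] zl_multi_list]
        iter_scale[OF g(2) zl_multi_list] by metis
    moreover have "D + (-1) *\<^sub>R ?D = D - ?D" by (simp add: fun_eq_iff)
    ultimately have "cc I d (D - ?D) (d\<theta> l) (\<Phi> l) = cc I d D (d\<theta> l) (\<Phi> l) - cc I d ?D (d\<theta> l) (\<Phi> l)"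
      by simp
    then show "cc I d (D - ?D) (d\<theta> l) (\<Phi> l) = 0" using cc_decomp[OF c I l] *[OF l] by simp
  qed
  then show "D = ?D" by simp
qed

lemma coeff_unique:
  assumes c: "coeffs_in k d c" and I: "I \<in> indices k" and "m < r" "l < r"
  shows "coeff d (decomp k c) I m l = c I m l"
  unfolding coeff_def cc_decomp[OF c I assms(4)]
  by (rule comp_unique) (use c I assms in \<open>auto simp: coeffs_in_def algebra_simps\<close>)

end

section \<open>Smooth functions on open subsets of the body space\<close>

definition body :: "nat \<Rightarrow> (nat \<Rightarrow> int) \<Rightarrow> (nat \<Rightarrow> real) set" where
  "body n dz = {x. \<forall>A. \<not> (A < n \<and> dz A = 0) \<longrightarrow> x A = 0}"

definition bd :: "nat \<Rightarrow> (nat \<Rightarrow> int) \<Rightarrow> nat set" where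
  "bd n dz = {A. A < n \<and> dz A = 0}"

lemma finite_bd [simp]: "finite (bd n dz)"
  by (simp add: bd_def)

text \<open>Passes from the abstract topology to the topology of the function type, so that
  \<open>continuous_on\<close> and \<open>compact\<close> can be used.\<close>

lemma body_space_eq: "body_space n dz = top_of_set (body n dz)"
  by (simp add: body_space_def body_def euclidean_product_topology)

lemma body_upd: "x \<in> body n dz \<Longrightarrow> A \<in> bd n dz \<Longrightarrow> x(A := t) \<in> body n dz"
  by (auto simp: body_def bd_def)

lemma continuous_on_upd:
  assumes "continuous_on S f" "continuous_on S g"
  shows "continuous_on S (\<lambda>x. (f x)(A := g x :: real))"
proof (rule continuous_on_coordinatewise_then_product)
  fix i show "continuous_on S (\<lambda>x. ((f x)(A := g x)) i)"
    by (cases "i = A") (auto intro: assms continuous_on_product_then_coordinatewise)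
qed

lemma continuous_on_coord: "continuous_on S (\<lambda>x::nat \<Rightarrow> real. x A)"
  by (rule continuous_on_product_then_coordinatewise[OF continuous_on_id])

text \<open>Short moves along a coordinate of degree 0 stay inside \<open>W\<close>. Hence partial
  derivatives at points of \<open>W\<close> depend only on the values on \<open>W\<close>.\<close>

lemma eventually_upd:
  assumes W: "openin (body_space n dz) W" and x: "x \<in> W" and A: "A \<in> bd n dz"
  shows "eventually (\<lambda>t. x(A := t) \<in> W) (nhds (x A))"
proof -
  obtain T where T: "open T" "W = body n dz \<inter> T"
    using W by (auto simp: body_space_eq openin_open)
  have "continuous_on UNIV (\<lambda>t. x(A := t))" by (intro continuous_on_upd continuous_intros)
  then have "open {t. x(A := t) \<in> T}" using T(1) open_vimage[of T "\<lambda>t. x(A := t)"] by (simp add: vimage_def)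
  moreover have "x A \<in> {t. x(A := t) \<in> T}" using x T by simp
  ultimately have "eventually (\<lambda>t. t \<in> {t. x(A := t) \<in> T}) (nhds (x A))" by (rule eventually_nhds_in_open)
  then show ?thesis
    by (rule eventually_mono) (use T x body_upd[OF _ A] in auto)
qed

lemma openin_body_subset: "openin (body_space n dz) W \<Longrightarrow> W \<subseteq> body n dz"
  using openin_subset by (fastforce simp: body_space_eq)

lemma openin_body: "openin (body_space n dz) (body n dz)"
  by (simp add: body_space_eq)

lemma continuous_map_body:
  "W \<subseteq> body n dz \<Longrightarrow> continuous_map (subtopology (body_space n dz) W) euclideanreal f \<longleftrightarrow> continuous_on W f"
  by (simp add: body_space_eq subtopology_subtopology Int_absorb1 inf.absorb2)

abbreviation partial_on where
  "partial_on W A f g \<equiv> (\<forall>x\<in>W. ((\<lambda>t. f (x(A := t))) has_real_derivative g x) (at (x A)))"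

lemma partial_on_cong:
  assumes W: "openin (body_space n dz) W" and A: "A \<in> bd n dz"
    and fg: "\<And>x. x \<in> W \<Longrightarrow> f x = f' x" "\<And>x. x \<in> W \<Longrightarrow> g x = g' x"
  shows "partial_on W A f g \<longleftrightarrow> partial_on W A f' g'"
proof (intro ball_cong refl)
  fix x assume x: "x \<in> W"
  show "((\<lambda>t. f (x(A := t))) has_real_derivative g x) (at (x A)) \<longleftrightarrow>
     ((\<lambda>t. f' (x(A := t))) has_real_derivative g' x) (at (x A))"
    by (rule DERIV_cong_ev)
      (use fg x eventually_mono[OF eventually_upd[OF W x A]] in auto)
qed

lemma Ck_on_0: "W \<subseteq> body n dz \<Longrightarrow> Ck_on 0 n dz W f \<longleftrightarrow> continuous_on W f"
  by (simp add: continuous_map_body)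

text \<open>The definition chooses all first partial derivatives at once; in this form each
  direction can be treated separately.\<close>

lemma Ck_on_Suc:
  assumes "W \<subseteq> body n dz"
  shows "Ck_on (Suc k) n dz W f \<longleftrightarrow> continuous_on W f \<and>
    (\<forall>A\<in>bd n dz. \<exists>g. partial_on W A f g \<and> Ck_on k n dz W g)"
proof -
  have "(\<exists>g. \<forall>A. A < n \<and> dz A = 0 \<longrightarrow> partial_on W A f (g A) \<and> Ck_on k n dz W (g A)) \<longleftrightarrow>
    (\<forall>A\<in>bd n dz. \<exists>g. partial_on W A f g \<and> Ck_on k n dz W g)"
    unfolding bd_def by (subst bchoice_iff) auto
  then show ?thesis by (simp add: continuous_map_body[OF assms] ball_conj_distrib)
qed

lemma Ck_on_SucE:
  assumes "Ck_on (Suc k) n dz W f" "W \<subseteq> body n dz" "A \<in> bd n dz"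
  obtains g where "partial_on W A f g" "Ck_on k n dz W g"
  using assms unfolding Ck_on_Suc[OF assms(2)] by blast

lemma Ck_on_cong:
  "openin (body_space n dz) W \<Longrightarrow> (\<And>x. x \<in> W \<Longrightarrow> f x = f' x) \<Longrightarrow> Ck_on k n dz W f \<Longrightarrow> Ck_on k n dz W f'"
proof (induction k)
  case 0
  then show ?case using continuous_on_cong[of W W f f'] by (simp add: Ck_on_0[OF openin_body_subset] del: Ck_on.simps)
next
  case (Suc k)
  note W = openin_body_subset[OF Suc.prems(1)]
  have "continuous_on W f" using Suc.prems(3) unfolding Ck_on_Suc[OF W] by blast
  then have "continuous_on W f'" using Suc.prems(2) continuous_on_cong[of W W f f'] by blast
  moreover have "\<exists>g. partial_on W A f' g \<and> Ck_on k n dz W g" if A: "A \<in> bd n dz" for A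
  proof -
    have "partial_on W A f g \<longleftrightarrow> partial_on W A f' g" for g
      by (rule partial_on_cong[OF Suc.prems(1) A]) (use Suc.prems(2) in auto)
    then show ?thesis using Suc.prems(3) A unfolding Ck_on_Suc[OF W] by blast
  qed
  ultimately show ?case unfolding Ck_on_Suc[OF W] by blast
qed

lemma Ck_on_Suc_imp: "W \<subseteq> body n dz \<Longrightarrow> Ck_on (Suc k) n dz W f \<Longrightarrow> Ck_on k n dz W f"
proof (induction k arbitrary: f)
  case 0 then show ?case by (simp only: Ck_on_0 Ck_on_Suc)
next
  case (Suc k) then show ?case by (simp only: Ck_on_Suc) blast
qed

lemma smooth_on_cong:
  "openin (body_space n dz) W \<Longrightarrow> smooth_on n dz W f \<Longrightarrow> (\<And>x. x \<in> W \<Longrightarrow> f x = f' x) \<Longrightarrow> smooth_on n dz W f'"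
  unfolding smooth_on_def using Ck_on_cong by blast

text \<open>Smoothness is the largest property that implies continuity and is stable under partial
  derivatives. Exhibiting a set \<open>S\<close> with these closure properties replaces an induction
  on the order in most proofs below.\<close>

lemma smooth_on_coinduct:
  assumes W: "W \<subseteq> body n dz" and f: "f \<in> S"
    and S: "\<And>f. f \<in> S \<Longrightarrow> continuous_on W f"
      "\<And>f A. f \<in> S \<Longrightarrow> A \<in> bd n dz \<Longrightarrow> \<exists>g\<in>S. partial_on W A f g"
  shows "smooth_on n dz W f"
proof -
  have "\<forall>f\<in>S. Ck_on k n dz W f" for k
  proof (induction k)
    case 0 show ?case using S(1) by (simp only: Ck_on_0[OF W]) blast
  next
    case (Suc k)
    show ?case
      unfolding Ck_on_Suc[OF W]
    proof (intro ballI conjI S(1))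
      fix f A assume "f \<in> S" "A \<in> bd n dz"
      then obtain g where g: "g \<in> S" "partial_on W A f g" using S(2) by blast
      show "\<exists>g. partial_on W A f g \<and> Ck_on k n dz W g"
        using g(2) bspec[OF Suc g(1)] by (intro exI conjI)
    qed
  qed
  then show ?thesis using f by (simp add: smooth_on_def)
qed

definition partial :: "nat \<Rightarrow> ((nat \<Rightarrow> real) \<Rightarrow> real) \<Rightarrow> (nat \<Rightarrow> real) \<Rightarrow> real" where
  "partial A f x = deriv (\<lambda>t. f (x(A := t))) (x A)"

lemma partial_eq: "((\<lambda>t. f (x(A := t))) has_real_derivative y) (at (x A)) \<Longrightarrow> partial A f x = y"
  unfolding partial_def by (rule DERIV_imp_deriv)

lemma
  assumes W: "openin (body_space n dz) W" and f: "smooth_on n dz W f"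
  shows smooth_on_continuous: "continuous_on W f"
    and smooth_on_DERIV: "A \<in> bd n dz \<Longrightarrow> x \<in> W \<Longrightarrow>
      ((\<lambda>t. f (x(A := t))) has_real_derivative partial A f x) (at (x A))"
    and smooth_on_partial: "A \<in> bd n dz \<Longrightarrow> smooth_on n dz W (partial A f)"
proof -
  note W' = openin_body_subset[OF W]
  show "continuous_on W f" using f unfolding smooth_on_def Ck_on_0[OF W', symmetric] by blast
  have *: "\<exists>g. partial_on W A f g \<and> Ck_on k n dz W g" if "A \<in> bd n dz" for A k
    using f that unfolding smooth_on_def using Ck_on_Suc[OF W'] by blast
  show "((\<lambda>t. f (x(A := t))) has_real_derivative partial A f x) (at (x A))" if A: "A \<in> bd n dz" and x: "x \<in> W"
  proof -
    obtain g where g: "partial_on W A f g" using *[OF A] by blast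
    have "((\<lambda>t. f (x(A := t))) has_real_derivative g x) (at (x A))" by (rule bspec[OF g x])
    then show ?thesis using partial_eq[of f x A "g x"] by simp
  qed
  show "smooth_on n dz W (partial A f)" if A: "A \<in> bd n dz"
    unfolding smooth_on_def
  proof
    fix k
    obtain g where g: "partial_on W A f g" "Ck_on k n dz W g" using *[OF A] by blast
    show "Ck_on k n dz W (partial A f)"
      by (rule Ck_on_cong[OF W _ g(2)]) (rule partial_eq[symmetric], rule bspec[OF g(1)])
  qed
qed

lemma smooth_on_const: "W \<subseteq> body n dz \<Longrightarrow> smooth_on n dz W (\<lambda>_. c)"
  by (rule smooth_on_coinduct[where S = "range (\<lambda>c _. c)"]) (auto intro!: exI[of _ 0])

lemma smooth_on_subset:
  assumes f: "smooth_on n dz W f" and W: "openin (body_space n dz) W" and W': "W' \<subseteq> W"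
  shows "smooth_on n dz W' f"
proof (rule smooth_on_coinduct[where S = "{f. smooth_on n dz W f}"])
  show "W' \<subseteq> body n dz" using openin_body_subset[OF W] W' by blast
  show "continuous_on W' f" if "f \<in> {f. smooth_on n dz W f}" for f
    using smooth_on_continuous[OF W, of f] that W' continuous_on_subset by auto
  show "\<exists>g\<in>{f. smooth_on n dz W f}. partial_on W' A f g"
    if "f \<in> {f. smooth_on n dz W f}" "A \<in> bd n dz" for f A
    using smooth_on_DERIV[OF W, of f A] smooth_on_partial[OF W, of f A] that W'
    by (intro bexI[of _ "partial A f"]) auto
qed (use f in simp)

text \<open>The set for the coinduction consists of the functions that are smooth near each point of
  \<open>W\<close>; continuity and \<open>partial A\<close> are both determined locally.\<close>

lemma smooth_on_local:
  assumes W: "openin (body_space n dz) W"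
    and loc: "\<And>x. x \<in> W \<Longrightarrow> \<exists>V. x \<in> V \<and> openin (body_space n dz) V \<and> smooth_on n dz V f"
  shows "smooth_on n dz W f"
proof (rule smooth_on_coinduct[where S =
    "{f. \<forall>x\<in>W. \<exists>V. x \<in> V \<and> openin (body_space n dz) V \<and> smooth_on n dz V f}"])
  note W' = openin_body_subset[OF W]
  show "W \<subseteq> body n dz" by (rule W')
  show "f \<in> {f. \<forall>x\<in>W. \<exists>V. x \<in> V \<and> openin (body_space n dz) V \<and> smooth_on n dz V f}" using loc by blast
next
  fix f assume "f \<in> {f. \<forall>x\<in>W. \<exists>V. x \<in> V \<and> openin (body_space n dz) V \<and> smooth_on n dz V f}"
  then have "\<forall>x\<in>W. \<exists>V. x \<in> V \<and> openin (body_space n dz) V \<and> smooth_on n dz V f" by blast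
  then obtain V where V: "\<And>x. x \<in> W \<Longrightarrow> x \<in> V x \<and> openin (body_space n dz) (V x) \<and> smooth_on n dz (V x) f"
    by metis
  show "continuous_on W f"
  proof (rule continuous_on_eq_continuous_within[THEN iffD2], rule ballI)
    fix x assume x: "x \<in> W"
    obtain T where T: "open T" "V x = body n dz \<inter> T" using V[OF x] by (auto simp: body_space_eq openin_open)
    have "continuous_on (W \<inter> T) f"
      by (rule continuous_on_subset[OF smooth_on_continuous[of n dz "V x" f]])
        (use V[OF x] T openin_body_subset[OF W] in auto)
    then have "continuous (at x within W \<inter> T) f"
      using x V[OF x] T by (auto simp: continuous_on_eq_continuous_within)
    then show "continuous (at x within W) f"
      using x V[OF x] T at_within_nhd[of x T W "W \<inter> T"] by auto
  qed
  fix A assume A: "A \<in> bd n dz"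
  show "\<exists>g\<in>{f. \<forall>x\<in>W. \<exists>V. x \<in> V \<and> openin (body_space n dz) V \<and> smooth_on n dz V f}. partial_on W A f g"
  proof (intro bexI[of _ "partial A f"] ballI CollectI)
    fix x assume x: "x \<in> W"
    show "((\<lambda>t. f (x(A := t))) has_real_derivative partial A f x) (at (x A))"
      using smooth_on_DERIV[of n dz "V x" f A x] V[OF x] A by blast
    show "\<exists>V. x \<in> V \<and> openin (body_space n dz) V \<and> smooth_on n dz V (partial A f)"
      using smooth_on_partial[of n dz "V x" f A] V[OF x] A by blast
  qed
qed

section \<open>Closure properties of smooth functions\<close>

lemma smooth_on_add:
  assumes W: "openin (body_space n dz) W" and "smooth_on n dz W f" "smooth_on n dz W g"
  shows "smooth_on n dz W (\<lambda>x. f x + g x)"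
proof (rule smooth_on_coinduct[OF openin_body_subset[OF W],
      where S = "{\<lambda>x. f x + g x |f g. smooth_on n dz W f \<and> smooth_on n dz W g}"])
  fix h assume "h \<in> {\<lambda>x. f x + g x |f g. smooth_on n dz W f \<and> smooth_on n dz W g}"
  then obtain f g where h: "h = (\<lambda>x. f x + g x)" and s: "smooth_on n dz W f" "smooth_on n dz W g" by blast
  show "continuous_on W h" unfolding h by (intro continuous_on_add smooth_on_continuous[OF W] s)
  fix A assume A: "A \<in> bd n dz"
  show "\<exists>g\<in>{\<lambda>x. f x + g x |f g. smooth_on n dz W f \<and> smooth_on n dz W g}. partial_on W A h g"
    using smooth_on_partial[OF W s(1) A] smooth_on_partial[OF W s(2) A]
    by (intro bexI[of _ "\<lambda>x. partial A f x + partial A g x"])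
      (auto simp: h intro!: DERIV_add smooth_on_DERIV[OF W s(1) A] smooth_on_DERIV[OF W s(2) A])
qed (use assms in blast)

text \<open>The derivative of a product is a sum of products, so products alone are not stable under
  derivatives. The proof therefore runs by induction on the order of differentiability, for sums
  first.\<close>

lemma smooth_on_mult:
  assumes W: "openin (body_space n dz) W" and "smooth_on n dz W f" "smooth_on n dz W g"
  shows "smooth_on n dz W (\<lambda>x. f x * g x)"
proof -
  note W' = openin_body_subset[OF W]
  have "Ck_on k n dz W (\<lambda>x. f x + g x)" if "Ck_on k n dz W f" "Ck_on k n dz W g" for k f g
    using that
  proof (induction k arbitrary: f g)
    case 0 then show ?case by (simp add: Ck_on_0[OF W'] continuous_on_add del: Ck_on.simps)
  next
    case (Suc k)
    have "\<exists>h. partial_on W A (\<lambda>x. f x + g x) h \<and> Ck_on k n dz W h" if A: "A \<in> bd n dz" for A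
    proof -
      obtain f' where f': "partial_on W A f f'" "Ck_on k n dz W f'" by (rule Ck_on_SucE[OF Suc.prems(1) W' A])
      obtain g' where g': "partial_on W A g g'" "Ck_on k n dz W g'" by (rule Ck_on_SucE[OF Suc.prems(2) W' A])
      have "partial_on W A (\<lambda>x. f x + g x) (\<lambda>x. f' x + g' x)"
        using f'(1) g'(1) by (intro ballI DERIV_add) simp_all
      then show ?thesis using Suc.IH[OF f'(2) g'(2)] by (intro exI conjI)
    qed
    then show ?case using Suc.prems unfolding Ck_on_Suc[OF W'] by (blast intro: continuous_on_add)
  qed
  note add = this
  have "Ck_on k n dz W (\<lambda>x. f x * g x)" if "Ck_on k n dz W f" "Ck_on k n dz W g" for k f g
    using that
  proof (induction k arbitrary: f g)
    case 0 then show ?case by (simp add: Ck_on_0[OF W'] continuous_on_mult del: Ck_on.simps)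
  next
    case (Suc k)
    note p = Suc.prems[THEN Ck_on_Suc_imp[OF W']]
    have "\<exists>h. partial_on W A (\<lambda>x. f x * g x) h \<and> Ck_on k n dz W h" if A: "A \<in> bd n dz" for A
    proof -
      obtain f' where f': "partial_on W A f f'" "Ck_on k n dz W f'" by (rule Ck_on_SucE[OF Suc.prems(1) W' A])
      obtain g' where g': "partial_on W A g g'" "Ck_on k n dz W g'" by (rule Ck_on_SucE[OF Suc.prems(2) W' A])
      have "partial_on W A (\<lambda>x. f x * g x) (\<lambda>x. f' x * g x + g' x * f x)"
      proof
        fix x assume x: "x \<in> W"
        have d: "((\<lambda>t. f (x(A := t))) has_real_derivative f' x) (at (x A))"
          "((\<lambda>t. g (x(A := t))) has_real_derivative g' x) (at (x A))"
          by (rule bspec[OF f'(1) x], rule bspec[OF g'(1) x])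
        show "((\<lambda>t. f (x(A := t)) * g (x(A := t))) has_real_derivative f' x * g x + g' x * f x) (at (x A))"
          using DERIV_mult[OF d] by simp
      qed
      moreover have "Ck_on k n dz W (\<lambda>x. f' x * g x + g' x * f x)"
        by (intro add Suc.IH f' g' p)
      ultimately show ?thesis by (intro exI conjI)
    qed
    then show ?case using Suc.prems unfolding Ck_on_Suc[OF W'] by (blast intro: continuous_on_mult)
  qed
  then show ?thesis using assms by (simp add: smooth_on_def)
qed

lemma smooth_on_cmult:
  "openin (body_space n dz) W \<Longrightarrow> smooth_on n dz W f \<Longrightarrow> smooth_on n dz W (\<lambda>x. c * f x)"
  using smooth_on_mult[of n dz W "\<lambda>_. c" f] smooth_on_const[OF openin_body_subset] by blast

lemma smooth_on_diff:
  "openin (body_space n dz) W \<Longrightarrow> smooth_on n dz W f \<Longrightarrow> smooth_on n dz W g \<Longrightarrow>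
    smooth_on n dz W (\<lambda>x. f x - g x)"
  using smooth_on_add[of n dz W f "\<lambda>x. -1 * g x"] smooth_on_cmult[of n dz W g "-1"] by simp

lemma smooth_on_sum:
  "openin (body_space n dz) W \<Longrightarrow> (\<And>i. i \<in> S \<Longrightarrow> smooth_on n dz W (f i)) \<Longrightarrow>
    smooth_on n dz W (\<lambda>x. \<Sum>i\<in>S. f i x)"
  by (induction S rule: infinite_finite_induct)
    (auto intro: smooth_on_add smooth_on_const[OF openin_body_subset])

lemma smooth_on_prod:
  "openin (body_space n dz) W \<Longrightarrow> (\<And>i. i \<in> S \<Longrightarrow> smooth_on n dz W (f i)) \<Longrightarrow>
    smooth_on n dz W (\<lambda>x. \<Prod>i\<in>S. f i x)"
  by (induction S rule: infinite_finite_induct)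
    (auto intro: smooth_on_mult smooth_on_const[OF openin_body_subset])

text \<open>The witness lists all derivatives at once, which makes them available for products and
  affine substitutions.\<close>

definition smooth1 :: "(real \<Rightarrow> real) \<Rightarrow> bool" where
  "smooth1 h \<longleftrightarrow> (\<exists>D. D 0 = h \<and> (\<forall>i t. (D i has_real_derivative D (Suc i) t) (at t)))"

lemma smooth_on_coord_fun:
  assumes "smooth1 h" and W: "W \<subseteq> body n dz"
  shows "smooth_on n dz W (\<lambda>x. h (x A))"
proof -
  obtain D where D: "D 0 = h" "\<And>i t. (D i has_real_derivative D (Suc i) t) (at t)"
    using assms by (auto simp: smooth1_def)
  show ?thesis
  \<comment> \<open>The zero function is added because the derivatives in directions other than
    \<open>A\<close> vanish.\<close>
  proof (rule smooth_on_coinduct[OF W, where S = "insert (\<lambda>_. 0) (range (\<lambda>i x. D i (x A)))"])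
    show "(\<lambda>x. h (x A)) \<in> insert (\<lambda>_. 0) (range (\<lambda>i x. D i (x A)))" using D(1) by blast
    fix f assume "f \<in> insert (\<lambda>_. 0) (range (\<lambda>i x. D i (x A)))"
    then consider "f = (\<lambda>_. 0)" | i where "f = (\<lambda>x. D i (x A))" by blast
    note f = this
    have c: "continuous_on UNIV (D i)" for i
      using D(2) by (meson DERIV_continuous_on has_field_derivative_at_within)
    show "continuous_on W f"
      using f by cases (auto intro!: continuous_on_compose2[OF c] continuous_on_coord)
    fix B
    show "\<exists>g\<in>insert (\<lambda>_. 0) (range (\<lambda>i x. D i (x A))). partial_on W B f g"
      using f
    proof cases
      case (2 i)
      show ?thesis
      proof (cases "B = A")
        case True
        then show ?thesis using D(2) 2 by (intro bexI[of _ "\<lambda>x. D (Suc i) (x A)"]) auto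
      next
        case False
        then show ?thesis using 2 by (intro bexI[of _ "\<lambda>_. 0"]) auto
      qed
    qed auto
  qed
qed

lemma smooth1_affine: "smooth1 h \<Longrightarrow> smooth1 (\<lambda>t. h (c * t + d))"
proof -
  assume "smooth1 h"
  then obtain D where D: "D 0 = h" "\<And>i t. (D i has_real_derivative D (Suc i) t) (at t)"
    by (auto simp: smooth1_def)
  have "((\<lambda>t. c ^ i * D i (c * t + d)) has_real_derivative c ^ Suc i * D (Suc i) (c * t + d)) (at t)" for i t
    by (rule derivative_eq_intros DERIV_chain2[OF D(2)] refl)+ simp
  then show ?thesis unfolding smooth1_def
    by (intro exI[of _ "\<lambda>i t. c ^ i * D i (c * t + d)"]) (simp add: D(1))
qed

text \<open>The derivatives of the product are given by the binomial formula; the step from order k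
  to k + 1 is Pascal's rule.\<close>

lemma smooth1_mult:
  assumes "smooth1 f" "smooth1 g" shows "smooth1 (\<lambda>t. f t * g t)"
proof -
  obtain D where D: "D 0 = f" "\<And>i t. (D i has_real_derivative D (Suc i) t) (at t)"
    using assms by (auto simp: smooth1_def)
  obtain E where E: "E 0 = g" "\<And>i t. (E i has_real_derivative E (Suc i) t) (at t)"
    using assms by (auto simp: smooth1_def)
  let ?F = "\<lambda>k t. \<Sum>i\<le>k. real (k choose i) * (D i t * E (k - i) t)"
  have "(?F k has_real_derivative ?F (Suc k) t) (at t)" for k t
  proof -
    have 1: "(?F k has_real_derivative
      (\<Sum>i\<le>k. real (k choose i) * (D (Suc i) t * E (k - i) t + E (Suc (k - i)) t * D i t))) (at t)"
      by (intro DERIV_sum DERIV_cmult DERIV_mult D E)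
    have "(\<Sum>i\<le>k. real (k choose i) * (D (Suc i) t * E (k - i) t + E (Suc (k - i)) t * D i t)) =
      (\<Sum>i\<le>k. real (k choose i) * (D (Suc i) t * E (k - i) t)) +
      (\<Sum>i\<le>k. real (k choose i) * (D i t * E (Suc k - i) t))"
      unfolding sum.distrib[symmetric]
      by (rule sum.cong) (auto simp: algebra_simps Suc_diff_le)
    also have "(\<Sum>i\<le>k. real (k choose i) * (D i t * E (Suc k - i) t)) =
      D 0 t * E (Suc k) t + (\<Sum>i\<le>k. real (k choose Suc i) * (D (Suc i) t * E (k - i) t))"
    proof -
      \<comment> \<open>The added term at \<open>Suc k\<close> is 0, because
        \<open>k choose Suc k\<close> is; then the term at 0 is split off.\<close>
      have "(\<Sum>i\<le>k. real (k choose i) * (D i t * E (Suc k - i) t)) =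
        (\<Sum>i\<le>Suc k. real (k choose i) * (D i t * E (Suc k - i) t))" by simp
      then show ?thesis by (simp only: sum.atMost_Suc_shift) simp
    qed
    also have "(\<Sum>i\<le>k. real (k choose i) * (D (Suc i) t * E (k - i) t)) +
      (D 0 t * E (Suc k) t + (\<Sum>i\<le>k. real (k choose Suc i) * (D (Suc i) t * E (k - i) t))) = ?F (Suc k) t"
      by (simp only: sum.atMost_Suc_shift)
        (simp add: sum.distrib[symmetric] algebra_simps)
    finally show ?thesis using 1 by simp
  qed
  then show ?thesis unfolding smooth1_def
    by (intro exI[of _ ?F]) (simp add: D(1) E(1))
qed

subsection \<open>Bump functions\<close>

text \<open>For p = 1 this is the classical function exp (-1/t), extended by 0. Polynomials in 1/t
  are included to make the family stable under differentiation.\<close>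

definition flat :: "real poly \<Rightarrow> real \<Rightarrow> real" where
  "flat p t = (if t > 0 then poly p (1 / t) * exp (- (1 / t)) else 0)"

text \<open>The power of \<open>x\<close> is carried along so that the induction over the
  coefficients of \<open>p\<close> goes through.\<close>

lemma poly_exp_tendsto_0: "((\<lambda>x::real. x ^ k * poly p x * exp (- x)) \<longlongrightarrow> 0) at_top"
proof (induction p arbitrary: k)
  case 0 show ?case by simp
next
  case (pCons a p)
  have "((\<lambda>x. a * (x ^ k / exp x) + x ^ Suc k * poly p x * exp (- x)) \<longlongrightarrow> a * 0 + 0) at_top"
    by (intro tendsto_add tendsto_mult tendsto_const tendsto_power_div_exp_0 pCons.IH)
  then show ?case by (simp add: algebra_simps exp_minus divide_inverse)
qed

text \<open>In the variable s = 1/t the chain rule gives the factor s^2, which is the polynomial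
  \<open>[:0, 0, 1:]\<close>, and the product rule gives p - p'. At 0 the right difference quotient
  is s p(s) exp (-s), which tends to 0.\<close>

lemma flat_DERIV: "(flat p has_real_derivative flat ([:0, 0, 1:] * (p - pderiv p)) t) (at t)"
proof -
  consider "t < 0" | "t > 0" | "t = 0" by linarith
  then show ?thesis
  proof cases
    case 1
    have "((\<lambda>_. 0) has_real_derivative 0) (at t)" by simp
    moreover have "eventually (\<lambda>s. s < 0) (nhds t)" using 1 eventually_nhds_in_open[of "{..<0}" t] by simp
    then have "eventually (\<lambda>s. 0 = flat p s) (nhds t)" by eventually_elim (simp add: flat_def)
    ultimately show ?thesis using 1 DERIV_cong_ev[of t t "\<lambda>_. 0" "flat p" 0] by (simp add: flat_def)
  next
    case 2
    have "((\<lambda>s. poly p (1 / s) * exp (- (1 / s))) has_real_derivative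
        poly ([:0, 0, 1:] * (p - pderiv p)) (1 / t) * exp (- (1 / t))) (at t)"
      using 2 by (auto intro!: derivative_eq_intros DERIV_chain2[OF poly_DERIV] simp: field_simps power2_eq_square)
    moreover have "eventually (\<lambda>s. s > 0) (nhds t)" using 2 eventually_nhds_in_open[of "{0<..}" t] by simp
    then have "eventually (\<lambda>s. poly p (1 / s) * exp (- (1 / s)) = flat p s) (nhds t)"
      by eventually_elim (simp add: flat_def)
    ultimately show ?thesis using 2 DERIV_cong_ev[of t t "\<lambda>s. poly p (1 / s) * exp (- (1 / s))" "flat p"]
      by (simp add: flat_def)
  next
    case 3
    have "((\<lambda>h. (flat p (0 + h) - flat p 0) / h) \<longlongrightarrow> 0) (at_right 0)"
    proof -
      have "((\<lambda>h. inverse h ^ 1 * poly p (inverse h) * exp (- inverse h)) \<longlongrightarrow> 0) (at_right (0::real))"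
        by (rule filterlim_compose[OF poly_exp_tendsto_0 filterlim_inverse_at_top_right])
      moreover have "eventually (\<lambda>h::real. h > 0) (at_right 0)" by (simp add: eventually_at_filter)
      then have "eventually (\<lambda>h. inverse h ^ 1 * poly p (inverse h) * exp (- inverse h) =
          (flat p (0 + h) - flat p 0) / h) (at_right 0)"
        by eventually_elim (simp add: flat_def field_simps)
      ultimately show ?thesis by (rule Lim_transform_eventually)
    qed
    moreover have "((\<lambda>h. (flat p (0 + h) - flat p 0) / h) \<longlongrightarrow> 0) (at_left 0)"
    proof (rule Lim_transform_eventually[OF tendsto_const])
      have "eventually (\<lambda>h::real. h < 0) (at_left 0)" by (simp add: eventually_at_filter)
      then show "eventually (\<lambda>h. 0 = (flat p (0 + h) - flat p 0) / h) (at_left 0)"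
        by eventually_elim (simp add: flat_def)
    qed
    ultimately have "(flat p has_real_derivative 0) (at 0)"
      unfolding DERIV_def by (rule filterlim_split_at[rotated])
    then show ?thesis by (simp add: 3 flat_def)
  qed
qed

lemma smooth1_flat: "smooth1 (flat p)"
  unfolding smooth1_def
  by (intro exI[of _ "\<lambda>i. flat (((\<lambda>p. [:0, 0, 1:] * (p - pderiv p)) ^^ i) p)"])
    (simp add: flat_DERIV del: mult_pCons_left)

text \<open>A primitive of a smooth function that is positive inside the unit interval and 0 outside
  is constant on either side of it, with different values; normalised it is the step.\<close>

lemma smooth_step: "\<exists>s. smooth1 s \<and> (\<forall>t\<le>0. s t = 0) \<and> (\<forall>t\<ge>1. s t = 1)"
proof -
  define w where "w = (\<lambda>t. flat 1 t * flat 1 (1 - t))"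
  have "smooth1 (\<lambda>t. flat 1 (-1 * t + 1))" by (rule smooth1_affine[OF smooth1_flat])
  then have "smooth1 w" unfolding w_def by (intro smooth1_mult smooth1_flat) simp
  then obtain D where D: "D 0 = w" "\<And>i t. (D i has_real_derivative D (Suc i) t) (at t)"
    by (auto simp: smooth1_def)
  have "isCont w t" for t using D DERIV_isCont by metis
  then obtain F where F: "\<And>t. (F has_real_derivative w t) (at t)"
    using einterval_antiderivative[of "-\<infinity>" "\<infinity>" w]
    by (auto simp: has_real_derivative_iff_has_vector_derivative)
  have w0: "w t = 0" if "t \<le> 0 \<or> t \<ge> 1" for t using that by (auto simp: w_def flat_def)
  have pos: "F 0 < F 1"
    by (rule DERIV_pos_imp_increasing_open)
      (use F DERIV_isCont in \<open>auto simp: w_def flat_def intro!: exI continuous_at_imp_continuous_on\<close>)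
  have cF: "continuous_on S F" for S
    using F DERIV_isCont by (blast intro: continuous_at_imp_continuous_on)
  have F': "(F has_real_derivative 0) (at t)" if "t \<le> 0 \<or> t \<ge> 1" for t
    using F[of t] w0[OF that] by simp
  have F0: "F t = F 0" if "t \<le> 0" for t
  proof (cases "t = 0")
    case False
    then show ?thesis
      by (intro DERIV_isconst_end[symmetric] cF) (use that F' in auto)
  qed simp
  have F1: "F t = F 1" if "t \<ge> 1" for t
  proof (cases "t = 1")
    case False
    then show ?thesis
      by (intro DERIV_isconst_end cF) (use that F' in auto)
  qed simp
  \<comment> \<open>The derivatives of the step: its own values first, then those of
    \<open>w\<close>, shifted by one.\<close>
  let ?G = "\<lambda>i t. (case i of 0 \<Rightarrow> F t - F 0 | Suc j \<Rightarrow> D j t) / (F 1 - F 0)"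
  have "(?G i has_real_derivative ?G (Suc i) t) (at t)" for i t
    using DERIV_cdivide[OF DERIV_diff[OF F[of t] DERIV_const[of "F 0"]], of "F 1 - F 0"]
      DERIV_cdivide[OF D(2), of _ "F 1 - F 0" t] D(1) by (cases i) simp_all
  then have "smooth1 (?G 0)" unfolding smooth1_def by (intro exI[of _ ?G]) simp
  moreover have "?G 0 t = 0" if "t \<le> 0" for t using F0[OF that] by simp
  moreover have "?G 0 t = 1" if "t \<ge> 1" for t using F1[OF that] pos by simp
  ultimately show ?thesis by (intro exI[of _ "?G 0"] conjI allI impI)
qed

text \<open>A product of one-dimensional plateaus over the coordinates of degree 0. The compact set
  \<open>K\<close> containing the support is part of the result, since it is what allows extension
  by 0 later.\<close>

lemma bump_function:
  assumes W: "openin (body_space n dz) W" and a: "a \<in> W"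
  shows "\<exists>\<beta> K V. smooth_on n dz (body n dz) \<beta> \<and> compact K \<and> K \<subseteq> W \<and> openin (body_space n dz) V \<and>
    a \<in> V \<and> V \<subseteq> K \<and> (\<forall>x\<in>V. \<beta> x = 1) \<and> (\<forall>x\<in>body n dz - K. \<beta> x = 0)"
proof -
  obtain T where T: "open T" "W = body n dz \<inter> T" using W by (auto simp: body_space_eq openin_open)
  have "openin (product_topology (\<lambda>i. euclidean) UNIV) T"
    using T(1) by (simp add: euclidean_product_topology)
  from product_topology_open_contains_basis[OF this, of a] a T
  obtain X where X: "a \<in> (\<Pi>\<^sub>E i\<in>UNIV. X i)" "\<And>i. open (X i)" "(\<Pi>\<^sub>E i\<in>UNIV. X i) \<subseteq> T" by auto
  have "\<exists>e>0. cball (a A) e \<subseteq> X A" for A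
    using X(1,2) open_contains_cball[of "X A"] by (auto simp: PiE_iff)
  then obtain e where e: "\<And>A. e A > 0" "\<And>A. cball (a A) (e A) \<subseteq> X A" by metis
  \<comment> \<open>The 1 keeps the minimum meaningful if there is no coordinate of degree 0;
    halving leaves room for the transition between the distances \<epsilon> and 2
    \<epsilon>.\<close>
  define \<epsilon> where "\<epsilon> = Min (insert 1 (e ` bd n dz)) / 2"
  have \<epsilon>: "\<epsilon> > 0" "\<And>A. A \<in> bd n dz \<Longrightarrow> 2 * \<epsilon> \<le> e A"
    using e(1) by (auto simp: \<epsilon>_def)
  obtain s where s: "smooth1 s" "\<And>t. t \<le> 0 \<Longrightarrow> s t = 0" "\<And>t. t \<ge> 1 \<Longrightarrow> s t = 1"
    using smooth_step by blast
  \<comment> \<open>The two arguments equal 2 + (a A - t) / \<epsilon> and 2 + (t - a A) /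
    \<epsilon>: both are at least 1 within distance \<epsilon> of \<open>a A\<close>, and one of
    them is at most 0 from distance 2 \<epsilon> on.\<close>
  define h where "h A t = s ((-1 / \<epsilon>) * t + (2 + a A / \<epsilon>)) * s ((1 / \<epsilon>) * t + (2 - a A / \<epsilon>))" for A t
  have h: "smooth1 (h A)" for A unfolding h_def by (intro smooth1_mult smooth1_affine s)
  have h1: "h A t = 1" if "\<bar>t - a A\<bar> \<le> \<epsilon>" for A t
  proof -
    have e: "(-1 / \<epsilon>) * t + (2 + a A / \<epsilon>) = 2 + (a A - t) / \<epsilon>" "(1 / \<epsilon>) * t + (2 - a A / \<epsilon>) = 2 + (t - a A) / \<epsilon>"
      by (simp_all add: diff_divide_distrib)
    have "2 + (a A - t) / \<epsilon> \<ge> 1" "2 + (t - a A) / \<epsilon> \<ge> 1"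
      using that \<epsilon>(1) by (simp_all add: field_simps abs_le_iff)
    from this[THEN s(3)] show ?thesis unfolding h_def e by (simp only: mult_1)
  qed
  have h0: "h A t = 0" if "\<bar>t - a A\<bar> \<ge> 2 * \<epsilon>" for A t
  proof -
    have e: "(-1 / \<epsilon>) * t + (2 + a A / \<epsilon>) = 2 + (a A - t) / \<epsilon>" "(1 / \<epsilon>) * t + (2 - a A / \<epsilon>) = 2 + (t - a A) / \<epsilon>"
      by (simp_all add: diff_divide_distrib)
    have "2 + (a A - t) / \<epsilon> \<le> 0 \<or> 2 + (t - a A) / \<epsilon> \<le> 0"
      using that \<epsilon>(1) by (auto simp: field_simps)
    then show ?thesis unfolding h_def e using s(2) by (metis mult_zero_left mult_zero_right)
  qed
  define \<beta> where "\<beta> = (\<lambda>x. \<Prod>A\<in>bd n dz. h A (x A))"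
  define K where "K = {x \<in> body n dz. \<forall>A\<in>bd n dz. \<bar>x A - a A\<bar> \<le> 2 * \<epsilon>}"
  define V where "V = {x \<in> body n dz. \<forall>A\<in>bd n dz. \<bar>x A - a A\<bar> < \<epsilon>}"
  have "smooth_on n dz (body n dz) \<beta>" unfolding \<beta>_def
    by (intro smooth_on_prod openin_body smooth_on_coord_fun h) simp
  moreover have "compact K"
  proof -
    \<comment> \<open>A product of intervals and, at the positions that are not coordinates of
      degree 0, single points; it is compact by Tychonoff's theorem.\<close>
    have K: "K = (\<Pi>\<^sub>E A\<in>UNIV. if A \<in> bd n dz then {a A - 2 * \<epsilon>..a A + 2 * \<epsilon>} else {0})"
      by (auto simp: K_def body_def bd_def PiE_iff abs_le_iff algebra_simps split: if_splits)
    have "compactin (product_topology (\<lambda>i. euclidean) UNIV) K"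
      unfolding K compactin_PiE by auto
    then show ?thesis by (simp add: euclidean_product_topology)
  qed
  moreover have "K \<subseteq> W"
  proof
    fix x assume x: "x \<in> K"
    have "x A \<in> X A" for A
    proof (cases "A \<in> bd n dz")
      case True
      then have "\<bar>x A - a A\<bar> \<le> e A" using x \<epsilon>(2)[OF True] by (force simp: K_def)
      then show ?thesis using e(2)[of A] by (auto simp: dist_real_def abs_minus_commute)
    next
      case False
      then have "x A = a A" using x a T by (auto simp: K_def body_def bd_def)
      then show ?thesis using X(1) by (auto simp: PiE_iff)
    qed
    then show "x \<in> W" using x X(3) T(2) by (auto simp: K_def PiE_iff)
  qed
  moreover have "openin (body_space n dz) V"
  proof -
    have "open {x::nat \<Rightarrow> real. \<bar>x A - a A\<bar> < \<epsilon>}" for A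
      by (intro open_Collect_less continuous_on_rabs continuous_on_diff continuous_on_coord continuous_on_const)
    then have "open (\<Inter>A\<in>bd n dz. {x::nat \<Rightarrow> real. \<bar>x A - a A\<bar> < \<epsilon>})" by (intro open_INT) auto
    moreover have "V = body n dz \<inter> (\<Inter>A\<in>bd n dz. {x::nat \<Rightarrow> real. \<bar>x A - a A\<bar> < \<epsilon>})" by (auto simp: V_def)
    ultimately show ?thesis by (auto simp: body_space_eq openin_open)
  qed
  moreover have "a \<in> V" using a T \<epsilon> by (auto simp: V_def)
  moreover have "V \<subseteq> K" using \<epsilon> by (auto simp: V_def K_def)
  moreover have "\<forall>x\<in>V. \<beta> x = 1" by (auto simp: \<beta>_def V_def intro!: prod.neutral h1 less_imp_le)
  moreover have "\<forall>x\<in>body n dz - K. \<beta> x = 0"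
  proof
    fix x assume "x \<in> body n dz - K"
    then obtain A where A: "A \<in> bd n dz" "2 * \<epsilon> < \<bar>x A - a A\<bar>" by (auto simp: K_def not_le)
    then have "h A (x A) = 0" using h0[OF less_imp_le] by blast
    then show "\<beta> x = 0" unfolding \<beta>_def using A(1) by (intro prod_zero[OF finite_bd]) blast
  qed
  ultimately show ?thesis by (intro exI[of _ \<beta>] exI[of _ K] exI[of _ V] conjI)
qed

subsection \<open>Hadamard's lemma\<close>

lemma smooth_on_fixed_coord:
  assumes f: "smooth_on n dz (body n dz) f" and A: "A \<in> bd n dz"
  shows "smooth_on n dz (body n dz) (\<lambda>x. f (x(A := c)))"
proof (rule smooth_on_coinduct[OF order_refl, where S = "{\<lambda>x. f (x(A := c)) |f. smooth_on n dz (body n dz) f}"])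
  note B = openin_body[of n dz]
  fix h assume "h \<in> {\<lambda>x. f (x(A := c)) |f. smooth_on n dz (body n dz) f}"
  then obtain f where h: "h = (\<lambda>x. f (x(A := c)))" and f: "smooth_on n dz (body n dz) f" by blast
  show "continuous_on (body n dz) h" unfolding h
  proof (rule continuous_on_compose2[OF smooth_on_continuous[OF B f]])
    show "continuous_on (body n dz) (\<lambda>x. x(A := c))"
      by (intro continuous_on_upd continuous_on_id continuous_on_const)
  qed (use body_upd[OF _ A] in auto)
  fix A' assume A': "A' \<in> bd n dz"
  show "\<exists>g\<in>{\<lambda>x. f (x(A := c)) |f. smooth_on n dz (body n dz) f}. partial_on (body n dz) A' h g"
  proof (cases "A' = A")
    case True
    have "partial_on (body n dz) A' h (\<lambda>x. 0)" by (simp add: h True)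
    then show ?thesis using smooth_on_const[of "body n dz" n dz 0] by fastforce
  next
    case False
    have p: "partial_on (body n dz) A' h (\<lambda>x. partial A' f (x(A := c)))"
    proof
      fix x assume "x \<in> body n dz"
      then show "((\<lambda>t. h (x(A' := t))) has_real_derivative partial A' f (x(A := c))) (at (x A'))"
        using smooth_on_DERIV[OF B f A' body_upd[OF _ A], of x c] False
        by (simp add: h fun_upd_twist)
    qed
    show ?thesis
    proof (rule bexI[where x = "\<lambda>x. partial A' f (x(A := c))"])
      show "(\<lambda>x. partial A' f (x(A := c))) \<in> {\<lambda>x. f (x(A := c)) |f. smooth_on n dz (body n dz) f}"
        by (intro CollectI exI[of _ "partial A' f"] conjI refl smooth_on_partial[OF B f A'])
    qed (rule p)
  qed
qed (use f in blast)

text \<open>Differentiating under the integral, a derivative along \<open>A\<close> brings out a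
  factor \<open>t\<close> and any other derivative does not. Hence the family with all powers of
  \<open>t\<close> is stable under partial derivatives.\<close>

lemma smooth_on_segment_integral:
  assumes h: "smooth_on n dz (body n dz) h" and A: "A \<in> bd n dz"
  shows "smooth_on n dz (body n dz) (\<lambda>x. integral {0..1} (\<lambda>t. t ^ e * h (x(A := c + t * (x A - c)))))"
proof (rule smooth_on_coinduct[OF order_refl, where S = "{\<lambda>x. integral {0..1} (\<lambda>t. t ^ e * h (x(A := c + t * (x A - c)))) |h e.
    smooth_on n dz (body n dz) h}"])
  note B = openin_body[of n dz]
  fix F assume "F \<in> {\<lambda>x. integral {0..1} (\<lambda>t. t ^ e * h (x(A := c + t * (x A - c)))) |h e. smooth_on n dz (body n dz) h}"
  then obtain h e where F: "F = (\<lambda>x. integral {0..1} (\<lambda>t. t ^ e * h (x(A := c + t * (x A - c)))))"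
    and h: "smooth_on n dz (body n dz) h" by blast
  \<comment> \<open>Stated over an arbitrary space of parameters, because it is used both with the
    points of the body and with a single real parameter.\<close>
  have cont: "continuous_on S (\<lambda>p. snd p ^ i * k ((\<xi> p)(A := c + snd p * (\<xi> p A - c))))"
    if "smooth_on n dz (body n dz) k" "continuous_on S \<xi>" "\<xi> ` S \<subseteq> body n dz"
    for k and S :: "('z::topological_space \<times> real) set" and \<xi> i
    by (intro continuous_intros continuous_on_compose2[OF smooth_on_continuous[OF B that(1)]]
        continuous_on_upd that(2) continuous_on_product_then_coordinatewise[OF that(2)])
      (use that(3) body_upd[OF _ A] in auto)
  show "continuous_on (body n dz) F"
    using integral_continuous_on_param[of "body n dz" "0::real" 1 "\<lambda>x t. t ^ e * h (x(A := c + t * (x A - c)))"]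
      cont[OF h continuous_on_fst[OF continuous_on_id], of "body n dz \<times> {0..1}" e]
    by (simp add: F case_prod_unfold)
  fix A' assume A': "A' \<in> bd n dz"
  let ?e = "if A' = A then Suc e else e"
  have "partial_on (body n dz) A' F (\<lambda>x. integral {0..1} (\<lambda>t. t ^ ?e * partial A' h (x(A := c + t * (x A - c)))))"
  proof
    fix x assume x: "x \<in> body n dz"
    define y where "y s = x(A' := s)" for s
    have y: "y s \<in> body n dz" for s using body_upd[OF x A'] by (simp add: y_def)
    have cy: "continuous_on S y" for S unfolding y_def by (intro continuous_on_upd continuous_intros)
    have cyf: "continuous_on S (\<lambda>p. y (fst p))" for S :: "(real \<times> real) set"
      by (rule continuous_on_compose2[OF cy[of UNIV] continuous_on_fst[OF continuous_on_id]]) simp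
    note p = smooth_on_partial[OF B h A']
    have d: "((\<lambda>s. t ^ e * h ((y s)(A := c + t * (y s A - c)))) has_real_derivative
        t ^ ?e * partial A' h ((y s)(A := c + t * (y s A - c)))) (at s)" for s t
    proof (cases "A' = A")
      case True
      let ?w = "(y s)(A := c + t * (s - c))"
      have "((\<lambda>u. h (?w(A := u))) has_real_derivative partial A h ?w) (at (?w A))"
        by (rule smooth_on_DERIV[OF B h A body_upd[OF y A]])
      then have 1: "((\<lambda>u. h (x(A := u))) has_real_derivative partial A h ?w) (at (c + t * (s - c)))"
        using True by (simp add: y_def)
      have 2: "((\<lambda>s. c + t * (s - c)) has_real_derivative t) (at s)"
        by (auto intro!: derivative_eq_intros)
      have "((\<lambda>s. t ^ e * h (x(A := c + t * (s - c)))) has_real_derivative t ^ e * (partial A h ?w * t)) (at s)"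
        by (intro DERIV_cmult DERIV_chain2[OF 1 2])
      then show ?thesis using True by (simp add: y_def algebra_simps)
    next
      case False
      let ?w = "(y s)(A := c + t * (x A - c))"
      have "((\<lambda>u. h (?w(A' := u))) has_real_derivative partial A' h ?w) (at (?w A'))"
        by (rule smooth_on_DERIV[OF B h A' body_upd[OF y A]])
      moreover have "?w(A' := u) = (y u)(A := c + t * (x A - c))" for u
        using False by (auto simp: y_def)
      ultimately have "((\<lambda>u. h ((y u)(A := c + t * (x A - c)))) has_real_derivative partial A' h ?w) (at s)"
        using False by (simp add: y_def)
      then have "((\<lambda>u. t ^ e * h ((y u)(A := c + t * (x A - c)))) has_real_derivative t ^ e * partial A' h ?w) (at s)"
        by (rule DERIV_cmult)
      then show ?thesis using False by (simp add: y_def)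
    qed
    have "((\<lambda>s. integral (cbox 0 1) (\<lambda>t. t ^ e * h ((y s)(A := c + t * (y s A - c))))) has_real_derivative
        integral (cbox 0 1) (\<lambda>t. t ^ ?e * partial A' h ((y (x A'))(A := c + t * (y (x A') A - c))))) (at (x A') within UNIV)"
    proof (rule leibniz_rule_field_derivative)
      show "((\<lambda>s. t ^ e * h ((y s)(A := c + t * (y s A - c)))) has_real_derivative
        t ^ ?e * partial A' h ((y s)(A := c + t * (y s A - c)))) (at s within UNIV)" for s t
        using d by simp
      show "(\<lambda>t. t ^ e * h ((y s)(A := c + t * (y s A - c)))) integrable_on cbox 0 1" for s
      proof (rule integrable_continuous)
        have "continuous_on ({s} \<times> {0..1}) (\<lambda>p. snd p ^ e * h ((y (fst p))(A := c + snd p * (y (fst p) A - c))))"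
          by (rule cont[OF h]) (use y cyf in auto)
        then have "continuous_on {0..1} (\<lambda>t. (\<lambda>p. snd p ^ e * h ((y (fst p))(A := c + snd p * (y (fst p) A - c)))) (s, t))"
          by (rule continuous_on_compose2) (auto intro!: continuous_intros)
        then show "continuous_on (cbox 0 1) (\<lambda>t. t ^ e * h ((y s)(A := c + t * (y s A - c))))" by simp
      qed
      have "continuous_on (UNIV \<times> {0..1}) (\<lambda>q. snd q ^ ?e * partial A' h ((y (fst q))(A := c + snd q * (y (fst q) A - c))))"
        by (rule cont[OF p]) (use y cyf in auto)
      then show "continuous_on (UNIV \<times> cbox 0 1) (\<lambda>(s, t). t ^ ?e * partial A' h ((y s)(A := c + t * (y s A - c))))"
        by (simp add: case_prod_unfold)
    qed auto
    then show "((\<lambda>s. F (x(A' := s))) has_real_derivative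
        integral {0..1} (\<lambda>t. t ^ ?e * partial A' h (x(A := c + t * (x A - c))))) (at (x A'))"
      by (simp add: F y_def)
  qed
  note d = this
  show "\<exists>g\<in>{\<lambda>x. integral {0..1} (\<lambda>t. t ^ e * h (x(A := c + t * (x A - c)))) |h e. smooth_on n dz (body n dz) h}.
      partial_on (body n dz) A' F g"
  proof (rule bexI[where x = "\<lambda>x. integral {0..1} (\<lambda>t. t ^ ?e * partial A' h (x(A := c + t * (x A - c))))"])
    show "(\<lambda>x. integral {0..1} (\<lambda>t. t ^ ?e * partial A' h (x(A := c + t * (x A - c))))) \<in>
      {\<lambda>x. integral {0..1} (\<lambda>t. t ^ e * h (x(A := c + t * (x A - c)))) |h e. smooth_on n dz (body n dz) h}"
      by (intro CollectI exI[of _ "partial A' h"] exI[of _ ?e] conjI refl smooth_on_partial[OF B h A'])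
  qed (rule d)
qed (use h in blast)

text \<open>By the fundamental theorem of calculus the quotient is the mean of the partial
  derivative over the segment from \<open>c\<close> to \<open>x A\<close>; in this form it is smooth
  across \<open>x A = c\<close> as well.\<close>

lemma smooth_on_divided_difference:
  assumes f: "smooth_on n dz (body n dz) f" and A: "A \<in> bd n dz"
  shows "\<exists>g. smooth_on n dz (body n dz) g \<and> (\<forall>x\<in>body n dz. f x - f (x(A := c)) = (x A - c) * g x)"
proof -
  note B = openin_body[of n dz]
  let ?h = "partial A f"
  let ?g = "\<lambda>x. integral {0..1} (\<lambda>t. t ^ 0 * ?h (x(A := c + t * (x A - c))))"
  have "f x - f (x(A := c)) = (x A - c) * ?g x" if x: "x \<in> body n dz" for x
  proof -
    have d: "((\<lambda>t. f (x(A := c + t * (x A - c)))) has_real_derivative ?h (x(A := c + t * (x A - c))) * (x A - c)) (at t)" for t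
    proof -
      have 1: "((\<lambda>u. f ((x(A := c + t * (x A - c)))(A := u))) has_real_derivative ?h (x(A := c + t * (x A - c)))) (at (c + t * (x A - c)))"
        using smooth_on_DERIV[OF B f A body_upd[OF x A], of "c + t * (x A - c)"] by simp
      have 2: "((\<lambda>t. c + t * (x A - c)) has_real_derivative (x A - c)) (at t)"
        by (auto intro!: derivative_eq_intros)
      show ?thesis using DERIV_chain2[OF 1 2] by simp
    qed
    have "((\<lambda>t. ?h (x(A := c + t * (x A - c))) * (x A - c)) has_integral
        f (x(A := c + 1 * (x A - c))) - f (x(A := c + 0 * (x A - c)))) {0..1}"
    proof (rule fundamental_theorem_of_calculus)
      show "((\<lambda>t. f (x(A := c + t * (x A - c)))) has_vector_derivative ?h (x(A := c + t * (x A - c))) * (x A - c))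
          (at t within {0..1})" for t
        using has_field_derivative_at_within[OF d, of t "{0..1}"]
        by (simp only: has_real_derivative_iff_has_vector_derivative)
    qed simp
    then have "integral {0..1} (\<lambda>t. ?h (x(A := c + t * (x A - c))) * (x A - c)) = f x - f (x(A := c))"
      by (auto dest: integral_unique)
    then show ?thesis by (simp add: mult.commute)
  qed
  then show ?thesis using smooth_on_segment_integral[OF smooth_on_partial[OF B f A] A, of 0 c] by blast
qed

text \<open>The coordinates are replaced by those of \<open>a\<close> one after the other, each
  replacement costing one divided difference. Smoothness of the function with the coordinates in
  \<open>S\<close> frozen is carried along for the next replacement.\<close>

lemma Hadamard_body:
  assumes f: "smooth_on n dz (body n dz) f" and a: "a \<in> body n dz"
  shows "\<exists>g. (\<forall>A. smooth_on n dz (body n dz) (g A)) \<and>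
    (\<forall>x\<in>body n dz. f x = f a + (\<Sum>A\<in>bd n dz. (x A - a A) * g A x))"
proof -
  note B = openin_body[of n dz]
  have "\<exists>g. (\<forall>A. smooth_on n dz (body n dz) (g A)) \<and>
      (\<forall>x\<in>body n dz. f x = f (\<lambda>A. if A \<in> S then a A else x A) + (\<Sum>A\<in>S. (x A - a A) * g A x)) \<and>
      smooth_on n dz (body n dz) (\<lambda>x. f (\<lambda>A. if A \<in> S then a A else x A))"
    if "finite S" "S \<subseteq> bd n dz" for S
    using that
  proof (induction S)
    case empty
    then show ?case using f smooth_on_const[of "body n dz" n dz 0] by (auto intro!: exI[of _ "\<lambda>_ _. 0"])
  next
    case (insert A S)
    let ?f = "\<lambda>x. f (\<lambda>A. if A \<in> S then a A else x A)"
    from insert obtain g where g: "\<And>A. smooth_on n dz (body n dz) (g A)"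
      "\<And>x. x \<in> body n dz \<Longrightarrow> f x = ?f x + (\<Sum>A\<in>S. (x A - a A) * g A x)" "smooth_on n dz (body n dz) ?f"
      by auto
    have A: "A \<in> bd n dz" using insert by simp
    obtain k where k: "smooth_on n dz (body n dz) k" "\<And>x. x \<in> body n dz \<Longrightarrow> ?f x - ?f (x(A := a A)) = (x A - a A) * k x"
      using smooth_on_divided_difference[OF g(3) A, of "a A"] by blast
    have u: "(\<lambda>B. if B \<in> S then a B else (x(A := a A)) B) = (\<lambda>B. if B \<in> insert A S then a B else x B)" for x
      using insert(2) by auto
    show ?case
    proof (intro exI[of _ "g(A := k)"] conjI allI ballI)
      show "smooth_on n dz (body n dz) ((g(A := k)) B)" for B using g(1) k(1) by simp
      show "smooth_on n dz (body n dz) (\<lambda>x. f (\<lambda>B. if B \<in> insert A S then a B else x B))"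
        using smooth_on_fixed_coord[OF g(3) A, of "a A"] unfolding u .
      fix x assume x: "x \<in> body n dz"
      have "(\<Sum>B\<in>S. (x B - a B) * (g(A := k)) B x) = (\<Sum>B\<in>S. (x B - a B) * g B x)"
        using insert(2) by (intro sum.cong) auto
      then show "f x = f (\<lambda>B. if B \<in> insert A S then a B else x B) + (\<Sum>B\<in>insert A S. (x B - a B) * (g(A := k)) B x)"
        using g(2)[OF x] k(2)[OF x, unfolded u] insert(1,2) by simp
    qed
  qed
  from this[of "bd n dz"] obtain g where g: "\<And>A. smooth_on n dz (body n dz) (g A)"
      "\<And>x. x \<in> body n dz \<Longrightarrow> f x = f (\<lambda>A. if A \<in> bd n dz then a A else x A) + (\<Sum>A\<in>bd n dz. (x A - a A) * g A x)"
    by auto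
  \<comment> \<open>At all other positions both points are 0.\<close>
  have "(\<lambda>A. if A \<in> bd n dz then a A else x A) = a" if "x \<in> body n dz" for x
    using that a by (auto simp: body_def bd_def)
  then show ?thesis using g by metis
qed

text \<open>\<open>W\<close> need not contain the segments used before. For a bump function \<beta>
  with value 1 at \<open>a\<close>, the product of \<beta> and f - f a extends by 0 to the whole
  body. The rest is 1 - \<beta> times f - f a, and 1 - \<beta> vanishes at \<open>a\<close>, so it
  can be expanded on the body too.\<close>

lemma Hadamard:
  assumes W: "openin (body_space n dz) W" and f: "smooth_on n dz W f" and a: "a \<in> W"
  shows "\<exists>g. (\<forall>A. smooth_on n dz W (g A)) \<and>
    (\<forall>x\<in>W. f x = f a + (\<Sum>A\<in>bd n dz. (x A - a A) * g A x))"
proof -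
  note B = openin_body[of n dz] and W' = openin_body_subset[OF W]
  obtain \<beta> K V where \<beta>: "smooth_on n dz (body n dz) \<beta>" "compact K" "K \<subseteq> W" "a \<in> V"
    "\<And>x. x \<in> V \<Longrightarrow> \<beta> x = 1" "\<And>x. x \<in> body n dz - K \<Longrightarrow> \<beta> x = 0"
    using bump_function[OF W a] by blast
  define u where "u x = (if x \<in> W then \<beta> x * (f x - f a) else 0)" for x
  have u: "smooth_on n dz (body n dz) u"
  proof (rule smooth_on_local[OF B])
    fix x assume x: "x \<in> body n dz"
    show "\<exists>V. x \<in> V \<and> openin (body_space n dz) V \<and> smooth_on n dz V u"
    proof (cases "x \<in> W")
      case True
      have "smooth_on n dz W (\<lambda>x. \<beta> x * (f x - f a))"
        by (intro smooth_on_mult smooth_on_diff smooth_on_const W W' f smooth_on_subset[OF \<beta>(1) B W'])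
      then have "smooth_on n dz W u" by (rule smooth_on_cong[OF W]) (simp add: u_def)
      then show ?thesis using True W by blast
    next
      case False
      have K: "openin (body_space n dz) (body n dz - K)"
        using compact_imp_closed[OF \<beta>(2)] by (auto simp: body_space_eq openin_open intro!: exI[of _ "- K"])
      have "smooth_on n dz (body n dz - K) u"
        by (rule smooth_on_cong[OF K smooth_on_const]) (auto simp: u_def \<beta>(6))
      then show ?thesis using False x K \<beta>(3) by blast
    qed
  qed
  have a': "a \<in> body n dz" using a W' by blast
  obtain p where p: "\<And>A. smooth_on n dz (body n dz) (p A)"
    "\<And>x. x \<in> body n dz \<Longrightarrow> u x = u a + (\<Sum>A\<in>bd n dz. (x A - a A) * p A x)"
    using Hadamard_body[OF u a'] by blast
  obtain q where q: "\<And>A. smooth_on n dz (body n dz) (q A)"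
    "\<And>x. x \<in> body n dz \<Longrightarrow> \<beta> x = \<beta> a + (\<Sum>A\<in>bd n dz. (x A - a A) * q A x)"
    using Hadamard_body[OF \<beta>(1) a'] by blast
  let ?g = "\<lambda>A x. p A x - q A x * (f x - f a)"
  have "f x = f a + (\<Sum>A\<in>bd n dz. (x A - a A) * ?g A x)" if x: "x \<in> W" for x
  proof -
    have "(\<Sum>A\<in>bd n dz. (x A - a A) * ?g A x) =
      (\<Sum>A\<in>bd n dz. (x A - a A) * p A x) - (\<Sum>A\<in>bd n dz. (x A - a A) * q A x) * (f x - f a)"
      unfolding sum_distrib_right sum_subtractf[symmetric]
      by (intro sum.cong refl) (simp add: algebra_simps)
    also have "(\<Sum>A\<in>bd n dz. (x A - a A) * p A x) = \<beta> x * (f x - f a)"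
      using p(2)[of x] x a W' by (auto simp: u_def)
    also have "(\<Sum>A\<in>bd n dz. (x A - a A) * q A x) = \<beta> x - 1"
      using q(2)[of x] x W' \<beta>(4,5) by auto
    finally show ?thesis by (simp add: algebra_simps)
  qed
  moreover have "smooth_on n dz W (?g A)" for A
    by (intro smooth_on_mult smooth_on_diff smooth_on_const W W' f smooth_on_subset[OF p(1) B W']
        smooth_on_subset[OF q(1) B W'])
  ultimately show ?thesis by (intro exI[of _ ?g]) blast
qed

section \<open>The calculus of the graded model\<close>

definition unit_exp :: "nat \<Rightarrow> nat \<Rightarrow> nat" where
  "unit_exp A = (\<lambda>B. if B = A then 1 else 0)"

lemma unit_exp_simps [simp]: "unit_exp A A = 1" "B \<noteq> A \<Longrightarrow> unit_exp A B = 0"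
  by (simp_all add: unit_exp_def)

lemma model_sec_iff: "F \<in> gsec (graded_model n dz) W j \<longleftrightarrow>
   (\<forall>p. smooth_on n dz W (F p) \<and> (\<forall>x. x \<notin> W \<longrightarrow> F p x = 0) \<and>
     (F p \<noteq> 0 \<longrightarrow> p \<in> formal_exponents n dz \<and> exponent_degree n dz p = j))"
  by (simp add: graded_model_def)

lemma model_mul: "gmul (graded_model n dz) F G s x = (if s \<in> formal_exponents n dz
    then \<Sum>p | p \<le> s. reorder_sign n dz p (s - p) * F p x * G (s - p) x else 0)"
  by (simp add: graded_model_def)

lemma model_one: "gone (graded_model n dz) W p x = (if p = 0 \<and> x \<in> W then 1 else 0)"
  by (simp add: graded_model_def)

lemma model_res: "gres (graded_model n dz) W W' F p x = (if x \<in> W' then F p x else 0)"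
  by (simp add: graded_model_def)

lemma model_sec_outside: "F \<in> gsec (graded_model n dz) W j \<Longrightarrow> x \<notin> W \<Longrightarrow> F p x = 0"
  by (simp add: model_sec_iff)

lemma model_sec_exponent: "F \<in> gsec (graded_model n dz) W j \<Longrightarrow> F p x \<noteq> 0 \<Longrightarrow>
    p \<in> formal_exponents n dz \<and> exponent_degree n dz p = j"
  unfolding model_sec_iff by (metis zero_fun_apply)

lemma finite_exponents_le: "s \<in> formal_exponents n dz \<Longrightarrow> finite {p. p \<le> s}"
proof (rule finite_subset[OF _ finite_set_of_finite_funs[of "{..<n}" "{..Max (s ` {..<n})}" 0]])
  assume s: "s \<in> formal_exponents n dz"
  show "{p. p \<le> s} \<subseteq> {f. \<forall>x. (x \<in> {..<n} \<longrightarrow> f x \<in> {..Max (s ` {..<n})}) \<and> (x \<notin> {..<n} \<longrightarrow> f x = 0)}"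
  proof clarify
    fix p x assume "p \<le> s"
    then have "p x \<le> s x" for x by (simp add: le_fun_def)
    then show "(x \<in> {..<n} \<longrightarrow> p x \<in> {..Max (s ` {..<n})}) \<and> (x \<notin> {..<n} \<longrightarrow> p x = 0)"
      using s by (auto simp: formal_exponents_def intro: order_trans[OF _ Max_ge]) (metis le_zero_eq)
  qed
qed simp_all

lemma exponent_degree_add: "exponent_degree n dz (p + q) = exponent_degree n dz p + exponent_degree n dz q"
  by (simp add: exponent_degree_def sum.distrib[symmetric] algebra_simps)

lemma exponent_degree_unit: "A < n \<Longrightarrow> exponent_degree n dz (unit_exp A) = dz A"
  by (simp add: exponent_degree_def unit_exp_def if_distrib[of int] if_distrib[of "\<lambda>x. x * _"] cong: if_cong)

lemma exponent_degree_zero [simp]: "exponent_degree n dz 0 = 0"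
  by (simp add: exponent_degree_def)

lemma zero_formal_exponent [simp]: "0 \<in> formal_exponents n dz"
  by (simp add: formal_exponents_def)

lemma exponent_le_add: "p \<le> s \<Longrightarrow> s = p + (s - p)" for p s :: "nat \<Rightarrow> nat"
  by (auto simp: le_fun_def fun_eq_iff)

section \<open>Closure of the model sections under the algebra operations\<close>

lemma model_sec_subspace:
  assumes W: "openin (body_space n dz) W" shows "subspace (gsec (graded_model n dz) W j)"
  unfolding subspace_def
proof (intro conjI ballI allI)
  note W' = openin_body_subset[OF W]
  show "0 \<in> gsec (graded_model n dz) W j"
    using smooth_on_const[OF W', of 0] by (simp add: model_sec_iff zero_fun_def)
  fix F G and c :: real
  assume F: "F \<in> gsec (graded_model n dz) W j"
  show "c *\<^sub>R F \<in> gsec (graded_model n dz) W j"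
    unfolding model_sec_iff
  proof (intro allI conjI impI)
    fix p
    show "smooth_on n dz W ((c *\<^sub>R F) p)"
      using smooth_on_cmult[OF W, of "F p" c] F by (simp add: model_sec_iff scaleR_fun_def)
    show "(c *\<^sub>R F) p x = 0" if "x \<notin> W" for x using model_sec_outside[OF F that] by simp
    assume "(c *\<^sub>R F) p \<noteq> 0"
    then have "F p \<noteq> 0" by auto
    then show "p \<in> formal_exponents n dz" "exponent_degree n dz p = j" using F by (auto simp: model_sec_iff)
  qed
  assume G: "G \<in> gsec (graded_model n dz) W j"
  show "F + G \<in> gsec (graded_model n dz) W j"
    unfolding model_sec_iff
  proof (intro allI conjI impI)
    fix p
    show "smooth_on n dz W ((F + G) p)"
      using smooth_on_add[OF W, of "F p" "G p"] F G by (simp add: model_sec_iff plus_fun_def)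
    show "(F + G) p x = 0" if "x \<notin> W" for x using model_sec_outside[OF F that] model_sec_outside[OF G that] by simp
    assume "(F + G) p \<noteq> 0"
    then have "F p \<noteq> 0 \<or> G p \<noteq> 0" by (simp only: plus_fun_apply) auto
    then show "p \<in> formal_exponents n dz" "exponent_degree n dz p = j" using F G by (auto simp: model_sec_iff)
  qed
qed

lemma model_one_in: "openin (body_space n dz) W \<Longrightarrow> gone (graded_model n dz) W \<in> gsec (graded_model n dz) W 0"
proof -
  assume W: "openin (body_space n dz) W"
  have "smooth_on n dz W (gone (graded_model n dz) W p)" for p
    by (rule smooth_on_cong[OF W smooth_on_const[OF openin_body_subset[OF W], of "if p = 0 then 1 else 0"]])
      (simp add: model_one)
  moreover have "p \<in> formal_exponents n dz \<and> exponent_degree n dz p = 0"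
    if "gone (graded_model n dz) W p \<noteq> 0" for p
  proof -
    have "p = 0" using that by (auto simp: model_one fun_eq_iff split: if_splits)
    then show ?thesis by simp
  qed
  moreover have "gone (graded_model n dz) W p x = 0" if "x \<notin> W" for p x using that by (simp add: model_one)
  ultimately show ?thesis unfolding model_sec_iff by blast
qed

lemma model_mul_in:
  assumes W: "openin (body_space n dz) W" and F: "F \<in> gsec (graded_model n dz) W i"
    and G: "G \<in> gsec (graded_model n dz) W j"
  shows "gmul (graded_model n dz) F G \<in> gsec (graded_model n dz) W (i + j)"
  unfolding model_sec_iff
proof (intro allI conjI impI)
  fix s
  have FG: "smooth_on n dz W (F p)" "smooth_on n dz W (G p)" for p using F G by (simp_all add: model_sec_iff)
  have "smooth_on n dz W (\<lambda>x. c * F p x * G q x)" for c p q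
    by (rule smooth_on_mult[OF W smooth_on_cmult[OF W FG(1)] FG(2)])
  then have "smooth_on n dz W (\<lambda>x. \<Sum>p | p \<le> s. reorder_sign n dz p (s - p) * F p x * G (s - p) x)"
    by (rule smooth_on_sum[OF W])
  then have "smooth_on n dz W (\<lambda>x. if s \<in> formal_exponents n dz
    then \<Sum>p | p \<le> s. reorder_sign n dz p (s - p) * F p x * G (s - p) x else 0)"
    using smooth_on_const[OF openin_body_subset[OF W], of 0] by (cases "s \<in> formal_exponents n dz") simp_all
  then show "smooth_on n dz W (gmul (graded_model n dz) F G s)" by (simp add: model_mul[abs_def])
  show "gmul (graded_model n dz) F G s x = 0" if "x \<notin> W" for x
    using model_sec_outside[OF F that] by (simp add: model_mul)
  assume "gmul (graded_model n dz) F G s \<noteq> 0"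
  then obtain x where x: "gmul (graded_model n dz) F G s x \<noteq> 0" by (auto simp: fun_eq_iff)
  then show s: "s \<in> formal_exponents n dz" by (auto simp: model_mul split: if_splits)
  have "\<exists>p. p \<le> s \<and> F p x \<noteq> 0 \<and> G (s - p) x \<noteq> 0"
  proof (rule ccontr)
    assume "\<not> ?thesis"
    then have "(\<Sum>p | p \<le> s. reorder_sign n dz p (s - p) * F p x * G (s - p) x) = 0"
      by (intro sum.neutral) auto
    then show False using x s by (simp add: model_mul)
  qed
  then obtain p where p: "p \<le> s" "F p x \<noteq> 0" "G (s - p) x \<noteq> 0" by blast
  have "exponent_degree n dz s = exponent_degree n dz p + exponent_degree n dz (s - p)"
    using exponent_degree_add exponent_le_add[OF p(1)] by metis
  then show "exponent_degree n dz s = i + j"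
    using model_sec_exponent[OF F, of p x] model_sec_exponent[OF G, of "s - p" x] p by simp
qed

subsection \<open>Reordering signs\<close>

text \<open>The exponent of \<open>reorder_sign\<close>, kept as an integer: it is additive in both
  arguments, so identities between signs become linear identities modulo 2.\<close>

definition reorder_exp :: "nat \<Rightarrow> (nat \<Rightarrow> int) \<Rightarrow> (nat \<Rightarrow> nat) \<Rightarrow> (nat \<Rightarrow> nat) \<Rightarrow> int" where
  "reorder_exp n dz p q = (\<Sum>A<n. \<Sum>B<A. int (p A) * dz A * (int (q B) * dz B))"

text \<open>The exponent of the sign for moving a variable or derivative of index \<open>A\<close>
  past all factors of smaller index.\<close>

definition pass_exp :: "(nat \<Rightarrow> int) \<Rightarrow> nat \<Rightarrow> (nat \<Rightarrow> nat) \<Rightarrow> int" where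
  "pass_exp dz A q = dz A * (\<Sum>B<A. int (q B) * dz B)"

lemma reorder_sign_eq: "reorder_sign n dz p q = (-1) powi reorder_exp n dz p q"
  by (simp add: reorder_sign_def reorder_exp_def)

lemma reorder_exp_add_left: "reorder_exp n dz (p + p') q = reorder_exp n dz p q + reorder_exp n dz p' q"
  by (simp add: reorder_exp_def sum.distrib[symmetric] algebra_simps)

lemma reorder_exp_add_right: "reorder_exp n dz p (q + q') = reorder_exp n dz p q + reorder_exp n dz p q'"
  by (simp add: reorder_exp_def sum.distrib[symmetric] algebra_simps)

lemma reorder_exp_unit_left: "A < n \<Longrightarrow> reorder_exp n dz (unit_exp A) q = pass_exp dz A q"
proof -
  assume A: "A < n"
  have "reorder_exp n dz (unit_exp A) q = (\<Sum>A'<n. if A' = A then pass_exp dz A q else 0)"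
    unfolding reorder_exp_def pass_exp_def by (intro sum.cong refl) (auto simp: sum_distrib_left)
  then show ?thesis using A by simp
qed

text \<open>The variable of index \<open>A\<close> moves past the factors of larger index. Their
  degree is the total degree less the contribution of the indices up to \<open>A\<close>.\<close>

lemma reorder_exp_unit_right:
  assumes A: "A < n"
  shows "reorder_exp n dz p (unit_exp A) =
    dz A * exponent_degree n dz p - pass_exp dz A p - dz A * dz A * int (p A)"
proof -
  have "(\<Sum>B<A'. int (p A') * dz A' * (int (unit_exp A B) * dz B)) =
      (if A < A' then int (p A') * dz A' * dz A else 0)" for A'
  proof -
    have "(\<Sum>B<A'. int (p A') * dz A' * (int (unit_exp A B) * dz B)) =
        (\<Sum>B<A'. if B = A then int (p A') * dz A' * dz A else 0)"
      by (intro sum.cong refl) auto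
    then show ?thesis by simp
  qed
  then have "reorder_exp n dz p (unit_exp A) = (\<Sum>A'<n. if A < A' then int (p A') * dz A' * dz A else 0)"
    by (simp add: reorder_exp_def)
  also have "\<dots> = (\<Sum>A'\<in>{A<..<n}. int (p A') * dz A' * dz A)"
    by (rule sum.mono_neutral_cong_right) auto
  finally have 1: "reorder_exp n dz p (unit_exp A) = dz A * (\<Sum>A'\<in>{A<..<n}. int (p A') * dz A')"
    by (simp add: sum_distrib_left algebra_simps)
  have "{..<n} = {..<A} \<union> ({A} \<union> {A<..<n})" using A by auto
  then have "exponent_degree n dz p = (\<Sum>B\<in>{..<A} \<union> ({A} \<union> {A<..<n}). int (p B) * dz B)"
    by (simp add: exponent_degree_def)
  also have "\<dots> = (\<Sum>B<A. int (p B) * dz B) + (int (p A) * dz A + (\<Sum>A'\<in>{A<..<n}. int (p A') * dz A'))"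
    by (subst sum.union_disjoint, auto)+
  finally show ?thesis unfolding 1 pass_exp_def by (simp add: algebra_simps)
qed

lemma pass_exp_add: "pass_exp dz A (p + q) = pass_exp dz A p + pass_exp dz A q"
  by (simp add: pass_exp_def ring_distribs sum.distrib)

lemma pass_exp_unit [simp]: "pass_exp dz A (unit_exp A) = 0"
  by (auto simp: pass_exp_def intro!: sum.neutral)

lemma pass_exp_zero [simp]: "pass_exp dz A 0 = 0"
  by (simp add: pass_exp_def)

lemma reorder_exp_zero_left [simp]: "reorder_exp n dz 0 q = 0"
  by (simp add: reorder_exp_def)

subsection \<open>Multiplication with the coordinates\<close>

lemma model_coord_body: "A \<in> bd n dz \<Longrightarrow> model_coord n dz W A p x = (if x \<in> W \<and> p = 0 then x A else 0)"
  by (simp add: model_coord_def bd_def)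

lemma model_coord_formal:
  "dz A \<noteq> 0 \<Longrightarrow> model_coord n dz W A p x = (if x \<in> W \<and> p = unit_exp A then 1 else 0)"
  by (simp add: model_coord_def unit_exp_def)

lemma unit_formal_exponent: "A < n \<Longrightarrow> dz A \<noteq> 0 \<Longrightarrow> unit_exp A \<in> formal_exponents n dz"
  by (auto simp: formal_exponents_def unit_exp_def)

lemma smooth1_id: "smooth1 (\<lambda>t. t)"
  unfolding smooth1_def
  by (intro exI[of _ "\<lambda>i t. if i = 0 then t else if i = 1 then 1 else 0"]) auto

lemma model_coord_in:
  assumes W: "openin (body_space n dz) W" and A: "A < n"
  shows "model_coord n dz W A \<in> gsec (graded_model n dz) W (dz A)"
proof (cases "dz A = 0")
  case True
  then have A': "A \<in> bd n dz" using A by (simp add: bd_def)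
  note W' = openin_body_subset[OF W]
  have "smooth_on n dz W (model_coord n dz W A p)" for p
  proof (cases "p = 0")
    case True
    then show ?thesis
      by (intro smooth_on_cong[OF W smooth_on_coord_fun[OF smooth1_id W', of A]]) (simp add: model_coord_body[OF A'])
  next
    case False
    then show ?thesis
      by (intro smooth_on_cong[OF W smooth_on_const[OF W', of 0]]) (simp add: model_coord_body[OF A'])
  qed
  moreover have "p \<in> formal_exponents n dz \<and> exponent_degree n dz p = dz A"
    if "model_coord n dz W A p \<noteq> 0" for p
  proof -
    have "p = 0" using that by (auto simp: model_coord_body[OF A'] fun_eq_iff split: if_splits)
    then show ?thesis using True by simp
  qed
  moreover have "model_coord n dz W A p x = 0" if "x \<notin> W" for p x using that by (simp add: model_coord_def)
  ultimately show ?thesis unfolding model_sec_iff by blast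
next
  case False
  have "smooth_on n dz W (model_coord n dz W A p)" for p
    by (rule smooth_on_cong[OF W smooth_on_const[OF openin_body_subset[OF W], of "if p = unit_exp A then 1 else 0"]])
      (simp add: model_coord_formal[where dz = dz and A = A, OF False])
  moreover have "p \<in> formal_exponents n dz \<and> exponent_degree n dz p = dz A"
    if "model_coord n dz W A p \<noteq> 0" for p
  proof -
    have "p = unit_exp A" using that by (auto simp: model_coord_formal[where dz = dz and A = A, OF False] fun_eq_iff split: if_splits)
    then show ?thesis using unit_formal_exponent[where dz = dz and A = A, OF A False] exponent_degree_unit[OF A] by simp
  qed
  moreover have "model_coord n dz W A p x = 0" if "x \<notin> W" for p x using that by (simp add: model_coord_def)
  ultimately show ?thesis unfolding model_sec_iff by blast
qed

text \<open>A coordinate function has a single nonzero coefficient, so its products reduce to one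
  term of the convolution.\<close>

lemma model_mul_single:
  assumes G: "G \<in> gsec (graded_model n dz) W j"
    and F: "\<And>p. p \<noteq> q \<Longrightarrow> F p x = 0" and s: "s \<in> formal_exponents n dz"
  shows "gmul (graded_model n dz) F G s x =
    (if q \<le> s then reorder_sign n dz q (s - q) * F q x * G (s - q) x else 0)"
proof -
  have "(\<Sum>p | p \<le> s. reorder_sign n dz p (s - p) * F p x * G (s - p) x) =
    (\<Sum>p | p \<le> s. if p = q then reorder_sign n dz q (s - q) * F q x * G (s - q) x else 0)"
    using F by (intro sum.cong) auto
  then show ?thesis using s finite_exponents_le[OF s] by (simp add: model_mul)
qed

lemma model_coord_mul_body:
  assumes G: "G \<in> gsec (graded_model n dz) W j" and A: "A \<in> bd n dz"
  shows "gmul (graded_model n dz) (model_coord n dz W A) G s x = x A * G s x"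
proof (cases "s \<in> formal_exponents n dz")
  case True
  have "gmul (graded_model n dz) (model_coord n dz W A) G s x =
    (if 0 \<le> s then reorder_sign n dz 0 (s - 0) * model_coord n dz W A 0 x * G (s - 0) x else 0)"
    by (rule model_mul_single[OF G _ True]) (simp add: model_coord_body[OF A])
  moreover have "0 \<le> s" "s - 0 = s" by (simp_all add: le_fun_def)
  ultimately show ?thesis using model_sec_outside[OF G]
    by (simp add: model_coord_body[OF A] reorder_sign_eq)
next
  case False
  then have "G s x = 0" using model_sec_exponent[OF G, of s x] by blast
  then show ?thesis using False by (simp add: model_mul)
qed

text \<open>Lowering the exponent at \<open>A\<close> does not change \<open>pass_exp dz A\<close>,
  which looks only at smaller indices; so the sign can be stated in terms of
  \<open>s\<close>.\<close>

lemma model_coord_mul_formal: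
  assumes G: "G \<in> gsec (graded_model n dz) W j" and A: "A < n" "dz A \<noteq> 0"
  shows "gmul (graded_model n dz) (model_coord n dz W A) G s x =
    (if s \<in> formal_exponents n dz \<and> 1 \<le> s A then (-1) powi (pass_exp dz A s) * G (s - unit_exp A) x else 0)"
proof (cases "s \<in> formal_exponents n dz")
  case True
  have "gmul (graded_model n dz) (model_coord n dz W A) G s x =
    (if unit_exp A \<le> s then reorder_sign n dz (unit_exp A) (s - unit_exp A) *
       model_coord n dz W A (unit_exp A) x * G (s - unit_exp A) x else 0)"
    by (rule model_mul_single[OF G _ True]) (simp add: model_coord_formal[where dz = dz and A = A, OF A(2)])
  moreover have "unit_exp A \<le> s \<longleftrightarrow> 1 \<le> s A" by (auto simp: le_fun_def unit_exp_def)
  moreover have "pass_exp dz A (s - unit_exp A) = pass_exp dz A s" if "1 \<le> s A"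
    unfolding pass_exp_def by (intro arg_cong2[of _ _ _ _ "(*)"] sum.cong refl) (simp add: unit_exp_def)
  ultimately show ?thesis using True model_sec_outside[OF G]
    by (auto simp: model_coord_formal[where dz = dz and A = A, OF A(2)] reorder_sign_eq reorder_exp_unit_left[OF A(1)])
qed (simp add: model_mul)

subsection \<open>Coordinate derivatives\<close>

text \<open>For a formal variable the coefficient at \<open>p\<close> comes from the monomial with
  one more factor of index \<open>A\<close>; the derivative first passes the variables of smaller
  index and then acts on the power \<open>p A + 1\<close>. For odd \<open>dz A\<close> the raised
  exponent is admissible only if \<open>p A = 0\<close>, and the factor is 1.\<close>

definition model_deriv :: "(nat \<Rightarrow> int) \<Rightarrow> (nat \<Rightarrow> real) set \<Rightarrow> nat \<Rightarrow> power_series \<Rightarrow> power_series" where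
  "model_deriv dz W A F = (\<lambda>p x. if dz A = 0 then (if x \<in> W then partial A (F p) x else 0)
     else real (p A + 1) * (-1) powi (pass_exp dz A p) * F (p + unit_exp A) x)"

lemma formal_exponent_add_unit:
  "A < n \<Longrightarrow> dz A \<noteq> 0 \<Longrightarrow> p + unit_exp A \<in> formal_exponents n dz \<longleftrightarrow>
    p \<in> formal_exponents n dz \<and> (odd (dz A) \<longrightarrow> p A = 0)"
  by (auto simp: formal_exponents_def unit_exp_def split: if_splits)

lemma model_deriv_in:
  assumes W: "openin (body_space n dz) W" and F: "F \<in> gsec (graded_model n dz) W j" and A: "A < n"
  shows "model_deriv dz W A F \<in> gsec (graded_model n dz) W (j - dz A)"
proof (cases "dz A = 0")
  case True
  then have A': "A \<in> bd n dz" using A by (simp add: bd_def)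
  have "smooth_on n dz W (partial A (F p))" for p
    using smooth_on_partial[OF W _ A'] F by (simp add: model_sec_iff)
  then have "smooth_on n dz W (model_deriv dz W A F p)" for p
    by (rule smooth_on_cong[OF W]) (simp add: model_deriv_def True)
  moreover have "F p \<noteq> 0" if "model_deriv dz W A F p \<noteq> 0" for p
  proof
    assume "F p = 0"
    then have "model_deriv dz W A F p = 0" by (simp add: model_deriv_def True partial_def fun_eq_iff)
    then show False using that by simp
  qed
  ultimately show ?thesis using F True by (auto simp: model_sec_iff) (auto simp: model_deriv_def)
next
  case False
  have *: "F (p + unit_exp A) \<noteq> 0" if "model_deriv dz W A F p \<noteq> 0" for p
    using that by (auto simp: model_deriv_def False fun_eq_iff)
  have "smooth_on n dz W (model_deriv dz W A F p)" for p
    using smooth_on_cmult[OF W, of "F (p + unit_exp A)"] F False by (simp add: model_deriv_def model_sec_iff)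
  moreover have "model_deriv dz W A F p x = 0" if "x \<notin> W" for p x
    using model_sec_outside[OF F that] False by (simp add: model_deriv_def)
  moreover have "p \<in> formal_exponents n dz \<and> exponent_degree n dz p = j - dz A"
    if "model_deriv dz W A F p \<noteq> 0" for p
  proof -
    have "p + unit_exp A \<in> formal_exponents n dz" "exponent_degree n dz (p + unit_exp A) = j"
      using *[OF that] F by (auto simp: model_sec_iff)
    then show ?thesis using formal_exponent_add_unit[where dz = dz and A = A, OF A False] exponent_degree_add exponent_degree_unit[OF A]
      by (auto simp: algebra_simps)
  qed
  ultimately show ?thesis unfolding model_sec_iff by blast
qed

lemma partial_cong_ev:
  assumes W: "openin (body_space n dz) W" and x: "x \<in> W" and A: "A \<in> bd n dz" and "\<And>x. x \<in> W \<Longrightarrow> f x = g x"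
  shows "partial A f x = partial A g x"
  unfolding partial_def
  by (rule deriv_cong_ev[OF eventually_mono[OF eventually_upd[OF W x A]]]) (simp_all add: assms(4))

lemma model_sec_DERIV:
  "openin (body_space n dz) W \<Longrightarrow> F \<in> gsec (graded_model n dz) W j \<Longrightarrow> A \<in> bd n dz \<Longrightarrow> x \<in> W \<Longrightarrow>
    ((\<lambda>t. F p (x(A := t))) has_real_derivative partial A (F p) x) (at (x A))"
  by (rule smooth_on_DERIV) (simp_all add: model_sec_iff)

lemma model_deriv_add:
  assumes W: "openin (body_space n dz) W" and F: "F \<in> gsec (graded_model n dz) W j"
    and G: "G \<in> gsec (graded_model n dz) W j" and A: "A < n"
  shows "model_deriv dz W A (F + G) = model_deriv dz W A F + model_deriv dz W A G"
proof (intro ext)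
  fix p x
  have "partial A ((F + G) p) x = partial A (F p) x + partial A (G p) x" if "dz A = 0" "x \<in> W"
    by (rule partial_eq, simp, rule DERIV_add)
      (use model_sec_DERIV[OF W F _ that(2)] model_sec_DERIV[OF W G _ that(2)] that A in \<open>auto simp: bd_def\<close>)
  then show "model_deriv dz W A (F + G) p x = (model_deriv dz W A F + model_deriv dz W A G) p x"
    by (simp add: model_deriv_def algebra_simps)
qed

lemma model_deriv_scale:
  assumes W: "openin (body_space n dz) W" and F: "F \<in> gsec (graded_model n dz) W j" and A: "A < n"
  shows "model_deriv dz W A (c *\<^sub>R F) = c *\<^sub>R model_deriv dz W A F"
proof (intro ext)
  fix p x
  have "partial A ((c *\<^sub>R F) p) x = c * partial A (F p) x" if "dz A = 0" "x \<in> W"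
    by (rule partial_eq, simp, rule DERIV_cmult)
      (use model_sec_DERIV[OF W F _ that(2)] that A in \<open>auto simp: bd_def\<close>)
  then show "model_deriv dz W A (c *\<^sub>R F) p x = (c *\<^sub>R model_deriv dz W A F) p x"
    by (simp add: model_deriv_def)
qed

lemma model_deriv_res:
  assumes W: "openin (body_space n dz) W" and W': "openin (body_space n dz) W'" "W' \<subseteq> W" and A: "A < n"
  shows "gres (graded_model n dz) W W' (model_deriv dz W A F) =
    model_deriv dz W' A (gres (graded_model n dz) W W' F)"
proof (intro ext)
  fix p x
  have "partial A (F p) x = partial A (gres (graded_model n dz) W W' F p) x" if "dz A = 0" "x \<in> W'"
    by (rule partial_cong_ev[OF W'(1) that(2)]) (use that A in \<open>auto simp: bd_def model_res\<close>)
  then show "gres (graded_model n dz) W W' (model_deriv dz W A F) p x =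
    model_deriv dz W' A (gres (graded_model n dz) W W' F) p x"
    using W'(2) by (auto simp: model_res model_deriv_def)
qed

lemma model_deriv_coord:
  assumes W: "openin (body_space n dz) W" and A: "A < n" and B: "B < n"
  shows "model_deriv dz W A (model_coord n dz W B) = (if B = A then gone (graded_model n dz) W else 0)"
proof (intro ext)
  fix p x
  show "model_deriv dz W A (model_coord n dz W B) p x = (if B = A then gone (graded_model n dz) W else 0) p x"
  proof (cases "dz A = 0")
    case True
    then have A': "A \<in> bd n dz" using A by (simp add: bd_def)
    have "partial A (model_coord n dz W B p) x = (if B = A \<and> p = 0 then 1 else 0)" if x: "x \<in> W"
    proof -
      have "partial A (model_coord n dz W B p) x = partial A (\<lambda>x. if dz B = 0 then if p = 0 then x B else 0
          else if p = unit_exp B then 1 else 0) x"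
        by (rule partial_cong_ev[OF W x A']) (simp add: model_coord_def unit_exp_def)
      also have "\<dots> = (if B = A \<and> p = 0 then 1 else 0)"
        using True by (intro partial_eq) (cases "dz B = 0"; cases "B = A"; cases "p = 0"; auto)
      finally show ?thesis .
    qed
    then show ?thesis using True by (auto simp: model_deriv_def model_one)
  next
    case False
    show ?thesis
    proof (cases "dz B = 0")
      case True
      moreover have "p + unit_exp A \<noteq> 0" by (auto simp: fun_eq_iff unit_exp_def)
      ultimately show ?thesis using False B by (auto simp: model_deriv_def model_coord_body bd_def)
    next
      case B': False
      have "p + unit_exp A = unit_exp B \<longleftrightarrow> p = 0 \<and> A = B"
        by (auto simp: fun_eq_iff unit_exp_def split: if_splits)
      then show ?thesis using False by (auto simp: model_deriv_def model_coord_formal[where dz = dz and A = B, OF B'] model_one)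
    qed
  qed
qed

text \<open>Isolates the delicate sign of the product rule as a statement on parities:
  \<open>a\<close> stands for the degree of the variable, \<open>i\<close> for that of the first
  factor, \<open>p\<close> for the exponent of the variable in it, and \<open>k\<close>,
  \<open>b\<close>, \<open>l\<close> for the exponents of the remaining signs.\<close>

lemma Leibniz_sign: "(-1 :: real) powi (a * i) * (-1) powi (k + b + (a * i - l - a * a * p)) =
    (-1) powi (l + k + b) * (-1) powi (a * p)"
  by (cases "even a"; cases "even i"; cases "even p"; cases "even k"; cases "even b"; cases "even l";
      simp add: powi_minus_one_if)

text \<open>All coefficients are written as sums over the splittings of
  \<open>s + unit_exp A\<close> into \<open>p\<close> and \<open>q\<close> and compared term by
  term. The derivative hits \<open>F\<close> or \<open>G\<close>, which accounts for
  \<open>p A\<close> and \<open>q A\<close> of the \<open>s A + 1\<close> factors of index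
  \<open>A\<close>.\<close>

lemma model_deriv_mul_formal:
  assumes F: "F \<in> gsec (graded_model n dz) W i" and G: "G \<in> gsec (graded_model n dz) W j"
    and A: "A < n" "dz A \<noteq> 0"
  shows "model_deriv dz W A (gmul (graded_model n dz) F G) s x =
    gmul (graded_model n dz) (model_deriv dz W A F) G s x +
    (-1) powi (dz A * i) * gmul (graded_model n dz) F (model_deriv dz W A G) s x"
proof (cases "s \<in> formal_exponents n dz")
  case False
  then have "s + unit_exp A \<notin> formal_exponents n dz" using formal_exponent_add_unit[where dz = dz and A = A, OF A] by blast
  then show ?thesis using False A by (simp add: model_deriv_def model_mul)
next
  case s: True
  let ?e = "unit_exp A" and ?b = "reorder_exp n dz" and ?k = "pass_exp dz A"
  let ?s = "s + ?e"
  \<comment> \<open>For odd \<open>dz A\<close> the raised exponent need not be admissible, so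
    \<open>finite_exponents_le\<close> is applied to \<open>s\<close> instead.\<close>
  have fin: "finite {p. p \<le> ?s}"
  proof -
    have "{p. p \<le> ?s} \<subseteq> (\<lambda>p. p) ` {p. p \<le> s} \<union> (\<lambda>p. p + ?e) ` {p. p \<le> s}"
    proof
      fix p assume "p \<in> {p. p \<le> ?s}"
      then have p: "p B \<le> s B + ?e B" for B by (simp add: le_fun_def)
      show "p \<in> (\<lambda>p. p) ` {p. p \<le> s} \<union> (\<lambda>p. p + ?e) ` {p. p \<le> s}"
      proof (cases "p A = 0")
        case True
        then have "p B \<le> s B" for B using p[of B] by (cases "B = A") auto
        then show ?thesis by (simp add: le_fun_def)
      next
        case False
        then have "p = (p - ?e) + ?e" by (auto simp: fun_eq_iff unit_exp_def)
        moreover have "(p - ?e) B \<le> s B" for B using p[of B] by (cases "B = A") auto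
        ultimately show ?thesis by (auto simp: le_fun_def intro!: image_eqI[of _ _ "p - ?e"])
      qed
    qed
    then show ?thesis using finite_exponents_le[OF s] finite_subset by blast
  qed
  define h where "h p = reorder_sign n dz p (s - p) * model_deriv dz W A F p x * G (s - p) x" for p
  define k where "k p = reorder_sign n dz p (s - p) * F p x * model_deriv dz W A G (s - p) x" for p
  \<comment> \<open>The derivative takes its factor from \<open>F\<close>, so the summation index is
    shifted by the unit exponent.\<close>
  have S1: "(\<Sum>p | p \<le> s. h p) = (\<Sum>p | p \<le> ?s. if 1 \<le> p A then h (p - ?e) else 0)"
  proof -
    have "(\<Sum>p | p \<le> s. h p) = (\<Sum>p\<in>{p \<in> {p. p \<le> ?s}. 1 \<le> p A}. h (p - ?e))"
    proof (rule sum.reindex_bij_witness[where i = "\<lambda>p. p - ?e" and j = "\<lambda>p. p + ?e"])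
      fix p assume p: "p \<in> {p \<in> {p. p \<le> ?s}. 1 \<le> p A}"
      then have p': "p B \<le> s B + ?e B" for B by (simp add: le_fun_def)
      have "(p - ?e) B \<le> s B" for B using p'[of B] by (cases "B = A") auto
      then show "p - ?e \<in> {p. p \<le> s}" by (simp add: le_fun_def)
      show "p - ?e + ?e = p" using p by (auto simp: fun_eq_iff unit_exp_def)
    qed (auto simp: le_fun_def fun_eq_iff unit_exp_def)
    also have "\<dots> = (\<Sum>p | p \<le> ?s. if 1 \<le> p A then h (p - ?e) else 0)"
      by (rule sum.inter_filter[OF fin])
    finally show ?thesis .
  qed
  \<comment> \<open>Here the factor is taken from \<open>G\<close>, so \<open>p\<close> stays below
    \<open>s\<close>.\<close>
  have S2: "(\<Sum>p | p \<le> s. k p) = (\<Sum>p | p \<le> ?s. if p \<le> s then k p else 0)"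
  proof -
    have "{p. p \<le> s} = {p \<in> {p. p \<le> ?s}. p \<le> s}" by (auto simp: le_fun_def intro: le_add1[THEN order_trans[rotated]])
    then show ?thesis using sum.inter_filter[OF fin, of k "\<lambda>p. p \<le> s"] by simp
  qed
  have T: "(if ?s \<in> formal_exponents n dz then real (s A + 1) * (-1) powi (?k s) *
        (reorder_sign n dz p (?s - p) * F p x * G (?s - p) x) else 0) =
      (if 1 \<le> p A then h (p - ?e) else 0) + (-1) powi (dz A * i) * (if p \<le> s then k p else 0)"
    if p: "p \<le> ?s" for p
  proof -
    define q where "q = ?s - p"
    have pq: "p + q = s + ?e" using p by (auto simp: q_def le_fun_def fun_eq_iff)
    then have pqB: "p B + q B = s B + ?e B" for B by (metis plus_fun_apply)
    have pqA: "p A + q A = s A + 1" using pqB[of A] by simp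
    have ps: "p \<le> s \<longleftrightarrow> 1 \<le> q A"
    proof
      assume "p \<le> s"
      then have "p A \<le> s A" by (simp add: le_fun_def)
      then show "1 \<le> q A" using pqA by simp
    next
      assume q: "1 \<le> q A"
      have "p B \<le> s B" for B using pqB[of B] q by (cases "B = A") auto
      then show "p \<le> s" by (simp add: le_fun_def)
    qed
    have h: "h (p - ?e) = real (p A) * (-1) powi (?k p + ?k q + ?b p q) * F p x * G q x" if "1 \<le> p A"
    proof -
      have e: "p - ?e + ?e = p" using that by (auto simp: fun_eq_iff unit_exp_def)
      have sq: "s - (p - ?e) = q"
      proof
        fix B show "(s - (p - ?e)) B = q B" using pqB[of B] that by (cases "B = A") auto
      qed
      have "?k (p - ?e) = ?k p" using pass_exp_add[of dz A "p - ?e" ?e] e by simp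
      moreover have "?b (p - ?e) q = ?b p q - ?k q"
        using reorder_exp_add_left[of n dz "p - ?e" ?e q] e reorder_exp_unit_left[OF A(1)] by simp
      moreover have "(-1 :: real) powi (?b p q - ?k q) * (-1) powi ?k p = (-1) powi (?k p + ?k q + ?b p q)"
        by (auto simp: powi_minus_one_if)
      moreover have "real ((p - ?e) A + 1) = real (p A)" using that by simp
      ultimately show ?thesis using A(2) e
        by (simp add: h_def sq model_deriv_def reorder_sign_eq mult.assoc[symmetric] del: of_nat_add)
    qed
    have k: "k p = real (q A) * (-1) powi (?k q + ?b p q + ?b p ?e) * F p x * G q x" if "1 \<le> q A"
    proof -
      have e: "s - p + ?e = q"
      proof
        fix B
        have "p B \<le> s B" using ps that by (simp add: le_fun_def)
        then show "(s - p + ?e) B = q B" using pqB[of B] by simp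
      qed
      have "?k (s - p) = ?k q" using pass_exp_add[of dz A "s - p" ?e] e by simp
      moreover have "?b p (s - p) = ?b p q - ?b p ?e"
        using reorder_exp_add_right[of n dz p "s - p" ?e] e by simp
      moreover have "(-1 :: real) powi (?b p q - ?b p ?e) * (-1) powi ?k q = (-1) powi (?k q + ?b p q + ?b p ?e)"
        by (auto simp: powi_minus_one_if)
      moreover have "real ((s - p) A + 1) = real (q A)" using e that by (metis plus_fun_apply unit_exp_simps(1))
      ultimately show ?thesis using A(2) e
        by (simp add: k_def model_deriv_def reorder_sign_eq ac_simps del: of_nat_add)
    qed
    show ?thesis
    proof (cases "F p x = 0 \<or> G q x = 0")
      case True
      then show ?thesis using h k ps unfolding q_def[symmetric] by auto
    next
      case False
      then have pf: "p \<in> formal_exponents n dz" "exponent_degree n dz p = i" and qf: "q \<in> formal_exponents n dz"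
        using model_sec_exponent[OF F, of p x] model_sec_exponent[OF G, of q x] by simp_all
      have ks: "?k s = ?k p + ?k q"
        using pass_exp_add[of dz A p q] pass_exp_add[of dz A s ?e] pq by simp
      have be: "?b p ?e = dz A * i - ?k p - dz A * dz A * int (p A)"
        using reorder_exp_unit_right[OF A(1)] pf by simp
      have sgn: "(-1 :: real) powi (dz A * i) * (-1) powi (?k q + ?b p q + ?b p ?e) =
          (-1) powi (?k p + ?k q + ?b p q) * (-1) powi (dz A * int (p A))"
        unfolding be by (rule Leibniz_sign)
      have R: "(if 1 \<le> p A then h (p - ?e) else 0) + (-1) powi (dz A * i) * (if p \<le> s then k p else 0) =
          (real (p A) + real (q A) * (-1) powi (dz A * int (p A))) * ((-1) powi (?k p + ?k q + ?b p q) * F p x * G q x)"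
      proof -
        have "(if 1 \<le> p A then h (p - ?e) else 0) = real (p A) * ((-1) powi (?k p + ?k q + ?b p q) * F p x * G q x)"
          using h by (cases "p A") auto
        moreover have "(-1) powi (dz A * i) * (if p \<le> s then k p else 0) =
            real (q A) * ((-1) powi (dz A * i) * (-1) powi (?k q + ?b p q + ?b p ?e)) * F p x * G q x"
          unfolding ps using k by (cases "q A") (auto simp: algebra_simps)
        ultimately show ?thesis unfolding sgn by (simp add: algebra_simps)
      qed
      have "(-1 :: real) powi (?k s) * (-1) powi (?b p q) = (-1) powi (?k p + ?k q + ?b p q)"
        unfolding ks by (auto simp: powi_minus_one_if)
      then have L: "real (s A + 1) * (-1) powi (?k s) * (reorder_sign n dz p (?s - p) * F p x * G (?s - p) x) =
          real (s A + 1) * ((-1) powi (?k p + ?k q + ?b p q) * F p x * G q x)"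
        unfolding q_def[symmetric] reorder_sign_eq by (simp add: mult.assoc[symmetric])
      \<comment> \<open>For even \<open>dz A\<close> this is \<open>s A + 1 = p A + q A\<close>. For
        odd \<open>dz A\<close> the two contributions cancel precisely if both \<open>p\<close> and
        \<open>q\<close> contain the variable, which is when the raised exponent is not
        admissible.\<close>
      have "(if ?s \<in> formal_exponents n dz then real (s A + 1) else 0) =
          real (p A) + real (q A) * (-1) powi (dz A * int (p A))"
      proof (cases "even (dz A)")
        case True
        then show ?thesis using s pqA formal_exponent_add_unit[where dz = dz and A = A, OF A, of s]
          by (simp add: powi_minus_one_if flip: of_nat_add)
      next
        case False
        then have "p A \<le> 1" "q A \<le> 1" "s A \<le> 1" using pf qf s by (auto simp: formal_exponents_def)
        then consider "p A = 0" "q A = 1" "s A = 0" | "p A = 1" "q A = 0" "s A = 0" | "p A = 1" "q A = 1" "s A = 1"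
          using pqA by linarith
        then show ?thesis using s False formal_exponent_add_unit[where dz = dz and A = A, OF A, of s]
          by cases (simp_all add: powi_minus_one_if)
      qed
      then show ?thesis unfolding R L by (auto split: if_splits)
    qed
  qed
  have "model_deriv dz W A (gmul (graded_model n dz) F G) s x =
    (\<Sum>p | p \<le> ?s. if ?s \<in> formal_exponents n dz then real (s A + 1) * (-1) powi (?k s) *
        (reorder_sign n dz p (?s - p) * F p x * G (?s - p) x) else 0)"
    using A(2) by (simp add: model_deriv_def model_mul sum_distrib_left)
  also have "\<dots> = (\<Sum>p | p \<le> ?s. (if 1 \<le> p A then h (p - ?e) else 0) +
      (-1) powi (dz A * i) * (if p \<le> s then k p else 0))"
    by (rule sum.cong[OF refl T]) simp
  also have "\<dots> = (\<Sum>p | p \<le> s. h p) + (-1) powi (dz A * i) * (\<Sum>p | p \<le> s. k p)"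
    unfolding S1 S2 by (simp add: sum.distrib sum_distrib_left)
  finally show ?thesis using s by (simp add: model_mul h_def k_def)
qed

lemma model_deriv_mul_body:
  assumes W: "openin (body_space n dz) W" and F: "F \<in> gsec (graded_model n dz) W i"
    and G: "G \<in> gsec (graded_model n dz) W j" and A: "A < n" "dz A = 0"
  shows "model_deriv dz W A (gmul (graded_model n dz) F G) s x =
    gmul (graded_model n dz) (model_deriv dz W A F) G s x +
    gmul (graded_model n dz) F (model_deriv dz W A G) s x"
proof (cases "s \<in> formal_exponents n dz \<and> x \<in> W")
  case True
  have A': "A \<in> bd n dz" using A by (simp add: bd_def)
  have x: "x \<in> W" using True by simp
  have "((\<lambda>t. \<Sum>p | p \<le> s. reorder_sign n dz p (s - p) * (F p (x(A := t)) * G (s - p) (x(A := t))))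
      has_real_derivative (\<Sum>p | p \<le> s. reorder_sign n dz p (s - p) *
        (partial A (F p) x * G (s - p) (x(A := x A)) + partial A (G (s - p)) x * F p (x(A := x A))))) (at (x A))"
    by (intro DERIV_sum DERIV_cmult DERIV_mult model_sec_DERIV[OF W F A' x] model_sec_DERIV[OF W G A' x])
  then have "partial A (gmul (graded_model n dz) F G s) x = (\<Sum>p | p \<le> s. reorder_sign n dz p (s - p) *
        (partial A (F p) x * G (s - p) x + partial A (G (s - p)) x * F p x))"
    using True by (intro partial_eq) (simp add: model_mul mult.assoc)
  then show ?thesis using True A by (simp add: model_deriv_def model_mul sum.distrib[symmetric] algebra_simps)
next
  case False
  show ?thesis
  proof (cases "x \<in> W")
    case True
    with False have "gmul (graded_model n dz) F G s = (\<lambda>x. 0)" by (simp add: model_mul[abs_def])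
    then have "partial A (gmul (graded_model n dz) F G s) x = 0" by (simp add: partial_def)
    then show ?thesis using True False A by (simp add: model_deriv_def model_mul)
  next
    case False
    then show ?thesis using A model_sec_outside[OF F False] model_sec_outside[OF G False]
      by (simp add: model_deriv_def model_mul)
  qed
qed

lemma model_deriv_mul:
  assumes "openin (body_space n dz) W" "F \<in> gsec (graded_model n dz) W i"
    "G \<in> gsec (graded_model n dz) W j" "A < n"
  shows "model_deriv dz W A (gmul (graded_model n dz) F G) =
    gmul (graded_model n dz) (model_deriv dz W A F) G +
    ((-1) powi (- dz A * i)) *\<^sub>R gmul (graded_model n dz) F (model_deriv dz W A G)"
proof (intro ext)
  fix s x
  have "(-1 :: real) powi (- dz A * i) = (-1) powi (dz A * i)" by (simp add: powi_minus_one_if)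
  then show "model_deriv dz W A (gmul (graded_model n dz) F G) s x =
    (gmul (graded_model n dz) (model_deriv dz W A F) G +
    ((-1) powi (- dz A * i)) *\<^sub>R gmul (graded_model n dz) F (model_deriv dz W A G)) s x"
    using model_deriv_mul_body[OF assms] model_deriv_mul_formal[OF assms(2-4)] by (cases "dz A = 0") simp_all
qed

subsection \<open>Hadamard's lemma for power series\<close>

text \<open>The constant coefficient is expanded at \<open>a\<close> as a smooth function. Every
  other monomial is divided by its variable of smallest index, so that no sign arises. As
  \<open>a\<close> is 0 at formal positions, the subtracted terms can be written uniformly for all
  coordinates.\<close>

lemma model_Hadamard:
  assumes W: "openin (body_space n dz) W" and F: "F \<in> gsec (graded_model n dz) W j" and a: "a \<in> W"
  shows "\<exists>c G. (c \<noteq> 0 \<longrightarrow> j = 0) \<and> (\<forall>A<n. G A \<in> gsec (graded_model n dz) W (j - dz A)) \<and>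
    F = c *\<^sub>R gone (graded_model n dz) W +
      (\<Sum>A<n. gmul (graded_model n dz) (model_coord n dz W A) (G A) - a A *\<^sub>R G A)"
proof -
  note W' = openin_body_subset[OF W]
  have a0: "a A = 0" if "A \<notin> bd n dz" for A using a W' that by (auto simp: body_def bd_def)
  have F0: "smooth_on n dz W (F 0)" using F by (simp add: model_sec_iff)
  obtain g where g: "\<And>A. smooth_on n dz W (g A)"
    "\<And>x. x \<in> W \<Longrightarrow> F 0 x = F 0 a + (\<Sum>A\<in>bd n dz. (x A - a A) * g A x)"
    using Hadamard[OF W F0 a] by blast
  \<comment> \<open>If the constant coefficient is 0, the degree \<open>j\<close> may be nonzero,
    and then the quotients have to be 0 for \<open>G A\<close> to be homogeneous of the right
    degree.\<close>
  define g' where "g' A x = (if F 0 = 0 then 0 else g A x)" for A x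
  have g': "smooth_on n dz W (g' A)" for A
    using g(1)[of A] smooth_on_const[OF W', of 0] by (cases "F 0 = 0") (simp_all add: g'_def[abs_def])
  have g'0: "F 0 x = F 0 a + (\<Sum>A\<in>bd n dz. (x A - a A) * g' A x)" if "x \<in> W" for x
    using g(2)[OF that] by (cases "F 0 = 0") (simp_all add: g'_def)
  have j: "j = 0" if "F 0 \<noteq> 0" using F that by (force simp: model_sec_iff)
  \<comment> \<open>For a formal variable this is the part of \<open>F\<close> whose monomials start
    with \<open>A\<close>, with that factor removed.\<close>
  define G where "G A = (if dz A = 0 then (\<lambda>p x. if p = 0 \<and> x \<in> W then g' A x else 0)
    else (\<lambda>p x. if \<forall>B<A. p B = 0 then F (p + unit_exp A) x else 0))" for A
  have G_in: "G A \<in> gsec (graded_model n dz) W (j - dz A)" if A: "A < n" for A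
  proof (cases "dz A = 0")
    case True
    have "smooth_on n dz W (\<lambda>x. if p = 0 \<and> x \<in> W then g' A x else 0)" for p :: "nat \<Rightarrow> nat"
    proof (cases "p = 0")
      case True then show ?thesis by (intro smooth_on_cong[OF W g'[of A]]) simp
    next
      case False then show ?thesis using smooth_on_const[OF W', of 0] by simp
    qed
    moreover have "p \<in> formal_exponents n dz \<and> exponent_degree n dz p = j - dz A"
      if "(\<lambda>x. if p = 0 \<and> x \<in> W then g' A x else 0) \<noteq> 0" for p :: "nat \<Rightarrow> nat"
    proof -
      have "p = 0 \<and> j = 0" using that j by (auto simp: g'_def fun_eq_iff split: if_splits)
      then show ?thesis using True by simp
    qed
    ultimately show ?thesis using True unfolding model_sec_iff G_def by auto
  next
    case False
    have "smooth_on n dz W (\<lambda>x. if \<forall>B<A. p B = 0 then F (p + unit_exp A) x else 0)" for p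
    proof -
      have "smooth_on n dz W (F (p + unit_exp A))" using F by (simp add: model_sec_iff)
      then have "smooth_on n dz W (\<lambda>x. (if \<forall>B<A. p B = 0 then 1 else 0) * F (p + unit_exp A) x)"
        by (rule smooth_on_cmult[OF W])
      then show ?thesis by (rule smooth_on_cong[OF W]) auto
    qed
    moreover have "p \<in> formal_exponents n dz \<and> exponent_degree n dz p = j - dz A"
      if "(\<lambda>x. if \<forall>B<A. p B = 0 then F (p + unit_exp A) x else 0) \<noteq> 0" for p
    proof -
      have "F (p + unit_exp A) \<noteq> 0" using that by (auto simp: fun_eq_iff split: if_splits)
      then have "p + unit_exp A \<in> formal_exponents n dz" "exponent_degree n dz (p + unit_exp A) = j"
        using F by (auto simp: model_sec_iff)
      then show ?thesis using formal_exponent_add_unit[where dz = dz and A = A, OF A False] exponent_degree_add exponent_degree_unit[OF A]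
        by (auto simp: algebra_simps)
    qed
    ultimately show ?thesis using False model_sec_outside[OF F] unfolding model_sec_iff G_def by auto
  qed
  have term_body: "(gmul (graded_model n dz) (model_coord n dz W A) (G A) - a A *\<^sub>R G A) s x =
      (if s = 0 \<and> x \<in> W then (x A - a A) * g' A x else 0)" if A: "A \<in> bd n dz" for A s x
  proof -
    have "A < n" using A by (simp add: bd_def)
    then have "gmul (graded_model n dz) (model_coord n dz W A) (G A) s x = x A * G A s x"
      by (intro model_coord_mul_body[OF G_in A])
    moreover have "G A s x = (if s = 0 \<and> x \<in> W then g' A x else 0)" using A by (simp add: bd_def G_def)
    ultimately show ?thesis by (simp add: algebra_simps)
  qed
  have term_formal: "(gmul (graded_model n dz) (model_coord n dz W A) (G A) - a A *\<^sub>R G A) s x =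
      (if s \<in> formal_exponents n dz \<and> 1 \<le> s A \<and> (\<forall>B<A. s B = 0) then F s x else 0)"
    if A: "A < n" "dz A \<noteq> 0" for A s x
  proof -
    have u: "s - unit_exp A + unit_exp A = s" if "1 \<le> s A" using that by (auto simp: fun_eq_iff unit_exp_def)
    have k: "pass_exp dz A s = 0" if "\<forall>B<A. s B = 0" using that by (simp add: pass_exp_def)
    have z: "(\<forall>B<A. (s - unit_exp A) B = 0) \<longleftrightarrow> (\<forall>B<A. s B = 0)" by (auto simp: unit_exp_def)
    have G: "G A (s - unit_exp A) x = (if \<forall>B<A. s B = 0 then F (s - unit_exp A + unit_exp A) x else 0)"
      using A(2) z by (simp add: G_def)
    have "a A = 0" using A(2) by (intro a0) (simp add: bd_def)
    moreover have "gmul (graded_model n dz) (model_coord n dz W A) (G A) s x =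
      (if s \<in> formal_exponents n dz \<and> 1 \<le> s A then (-1) powi (pass_exp dz A s) * G A (s - unit_exp A) x else 0)"
      by (rule model_coord_mul_formal[where dz = dz and A = A, OF G_in[OF A(1)] A])
    moreover have "\<dots> = (if s \<in> formal_exponents n dz \<and> 1 \<le> s A \<and> (\<forall>B<A. s B = 0) then F s x else 0)"
      unfolding G using u k by auto
    ultimately show ?thesis by simp
  qed
  have "F s x = (F 0 a *\<^sub>R gone (graded_model n dz) W +
      (\<Sum>A<n. gmul (graded_model n dz) (model_coord n dz W A) (G A) - a A *\<^sub>R G A)) s x" for s x
  proof -
    have sum: "(\<Sum>A<n. gmul (graded_model n dz) (model_coord n dz W A) (G A) - a A *\<^sub>R G A) s x =
      (\<Sum>A\<in>bd n dz. if s = 0 \<and> x \<in> W then (x A - a A) * g' A x else 0) +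
      (\<Sum>A\<in>{..<n} - bd n dz. if s \<in> formal_exponents n dz \<and> 1 \<le> s A \<and> (\<forall>B<A. s B = 0) then F s x else 0)"
    proof -
      let ?t = "\<lambda>A. (gmul (graded_model n dz) (model_coord n dz W A) (G A) - a A *\<^sub>R G A) s x"
      have "(\<Sum>A<n. ?t A) = (\<Sum>A\<in>{..<n} - bd n dz. ?t A) + (\<Sum>A\<in>bd n dz. ?t A)"
        by (rule sum.subset_diff) (auto simp: bd_def)
      moreover have "(\<Sum>A\<in>bd n dz. ?t A) =
          (\<Sum>A\<in>bd n dz. if s = 0 \<and> x \<in> W then (x A - a A) * g' A x else 0)"
        by (rule sum.cong[OF refl term_body])
      moreover have "(\<Sum>A\<in>{..<n} - bd n dz. ?t A) =
          (\<Sum>A\<in>{..<n} - bd n dz. if s \<in> formal_exponents n dz \<and> 1 \<le> s A \<and> (\<forall>B<A. s B = 0) then F s x else 0)"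
        by (rule sum.cong[OF refl term_formal]) (auto simp: bd_def)
      ultimately show ?thesis unfolding sum_fun_apply by simp
    qed
    show ?thesis
    proof (cases "s = 0")
      case True
      have "(\<Sum>A\<in>{..<n} - bd n dz. if s \<in> formal_exponents n dz \<and> 1 \<le> s A \<and> (\<forall>B<A. s B = 0) then F s x else 0) = 0"
        using True by (intro sum.neutral) auto
      then show ?thesis using g'0[of x] model_sec_outside[OF F, of x 0] True
        unfolding plus_fun_apply sum by (cases "x \<in> W") (simp_all add: model_one)
    next
      case False
      have "(\<Sum>A\<in>{..<n} - bd n dz. if s \<in> formal_exponents n dz \<and> 1 \<le> s A \<and> (\<forall>B<A. s B = 0) then F s x else 0) = F s x"
      proof (cases "s \<in> formal_exponents n dz")
        case s: True
        have ex: "\<exists>A. s A \<noteq> 0" using False by (auto simp: fun_eq_iff)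
        \<comment> \<open>The first variable of the monomial: its term is the only one that
          contributes to the coefficient at \<open>s\<close>.\<close>
        define L where "L = (LEAST A. s A \<noteq> 0)"
        have L: "s L \<noteq> 0" "\<And>B. B < L \<Longrightarrow> s B = 0"
          unfolding L_def using LeastI_ex[OF ex] not_less_Least by blast+
        have Ln: "L \<in> {..<n} - bd n dz" using L(1) s by (auto simp: formal_exponents_def bd_def)
        have u: "1 \<le> s A \<and> (\<forall>B<A. s B = 0) \<longleftrightarrow> A = L" for A
          using L by (metis One_nat_def Suc_leI linorder_neqE_nat neq0_conv not_one_le_zero)
        have "(\<Sum>A\<in>{..<n} - bd n dz. if s \<in> formal_exponents n dz \<and> 1 \<le> s A \<and> (\<forall>B<A. s B = 0) then F s x else 0) =
            (\<Sum>A\<in>{..<n} - bd n dz. if A = L then F s x else 0)"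
          by (intro sum.cong refl) (simp only: s u simp_thms)
        then show ?thesis using Ln by (simp only: sum.delta finite_Diff finite_lessThan if_True)
      next
        case s: False
        then have "F s x = 0" using model_sec_exponent[OF F, of s x] by blast
        moreover have "(\<Sum>A\<in>{..<n} - bd n dz. if s \<in> formal_exponents n dz \<and> 1 \<le> s A \<and> (\<forall>B<A. s B = 0) then F s x else 0) = 0"
          by (intro sum.neutral ballI) (simp only: s simp_thms if_False)
        ultimately show ?thesis by simp
      qed
      then show ?thesis using False unfolding plus_fun_apply sum by (simp add: model_one)
    qed
  qed
  then have "F = F 0 a *\<^sub>R gone (graded_model n dz) W +
      (\<Sum>A<n. gmul (graded_model n dz) (model_coord n dz W A) (G A) - a A *\<^sub>R G A)" by (intro ext)
  moreover have "F 0 a \<noteq> 0 \<longrightarrow> j = 0" using j by (auto simp: fun_eq_iff)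
  ultimately show ?thesis using G_in by blast
qed

section \<open>Charts\<close>

lemma graded_algebraI:
  assumes "graded_algebra_sheaf X C" "openin X U" shows "graded_algebra C U"
proof -
  have p: "\<forall>j. subspace (gsec C U j)" "\<forall>i j. i \<noteq> j \<longrightarrow> gsec C U i \<inter> gsec C U j = {0}"
    using assms by (simp_all add: graded_algebra_sheaf_def graded_sheaf_def graded_presheaf_def)
  have a: "gone C U \<in> gsec C U 0" "\<forall>i. \<forall>f\<in>gsec C U i. gmul C (gone C U) f = f \<and>
      (\<forall>j. lin_on (gsec C U j) (gmul C f) \<and> lin_on (gsec C U j) (\<lambda>g. gmul C g f)) \<and>
      (\<forall>j. \<forall>g\<in>gsec C U j. gmul C f g \<in> gsec C U (i + j) \<and>
         gmul C f g = ((-1) powi (i * j)) *\<^sub>R gmul C g f \<and>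
         (\<forall>l. \<forall>h\<in>gsec C U l. gmul C (gmul C f g) h = gmul C f (gmul C g h)))"
    using assms(1)[unfolded graded_algebra_sheaf_def, THEN conjunct2, THEN conjunct1, THEN spec, THEN mp, OF assms(2)] by (rule conjunct1, rule conjunct2)
  note c = bspec[OF spec[OF a(2)]]
  note d = c[THEN conjunct2, THEN conjunct2, THEN spec, THEN bspec]
  show ?thesis
    by unfold_locales (rule p(1)[THEN spec], erule p(2)[THEN spec, THEN spec, THEN mp], rule a(1),
      erule c[THEN conjunct1], erule c[THEN conjunct2, THEN conjunct1, THEN spec, THEN conjunct1],
      erule c[THEN conjunct2, THEN conjunct1, THEN spec, THEN conjunct2], erule (1) d[THEN conjunct1],
      erule (1) d[THEN conjunct2, THEN conjunct1],
      erule (2) d[THEN conjunct2, THEN conjunct2, THEN spec, THEN bspec])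
qed

lemma graded_moduleI:
  assumes "graded_algebra_sheaf X C" "graded_module_sheaf X C E" "openin X U" shows "graded_module C U E"
proof -
  have p: "\<forall>j. subspace (gsec E U j)" "\<forall>i j. i \<noteq> j \<longrightarrow> gsec E U i \<inter> gsec E U j = {0}"
    using assms(2,3) by (simp_all add: graded_module_sheaf_def graded_sheaf_def graded_presheaf_def)
  have a: "\<forall>j. \<forall>\<psi>\<in>gsec E U j. gact E (gone C U) \<psi> = \<psi> \<and> (\<forall>i. lin_on (gsec C U i) (\<lambda>f. gact E f \<psi>))"
    "\<forall>i. \<forall>f\<in>gsec C U i. \<forall>j. lin_on (gsec E U j) (gact E f) \<and>
      (\<forall>\<psi>\<in>gsec E U j. gact E f \<psi> \<in> gsec E U (i + j) \<and>
         (\<forall>l. \<forall>g\<in>gsec C U l. gact E (gmul C g f) \<psi> = gact E g (gact E f \<psi>)))"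
    using assms(2)[unfolded graded_module_sheaf_def, THEN conjunct2, THEN conjunct1, THEN spec, THEN mp, OF assms(3)] by (rule conjunct1, rule conjunct2)
  interpret graded_algebra C U by (rule graded_algebraI[OF assms(1,3)])
  note c = bspec[OF spec[OF a(1)]] and d = bspec[OF spec[OF a(2)], THEN spec]
  note e = d[THEN conjunct2, THEN bspec]
  show ?thesis
    by unfold_locales (rule p(1)[THEN spec], erule p(2)[THEN spec, THEN spec, THEN mp], erule c[THEN conjunct1],
      erule c[THEN conjunct2, THEN spec], erule d[THEN conjunct1], erule (1) e[THEN conjunct1],
      erule (2) e[THEN conjunct2, THEN spec, THEN bspec, rotated 2])
qed

text \<open>A chart seen over a single open set, without its behaviour under restriction.\<close>

locale chart_on_algebra = graded_algebra C U
  for C :: "('p, 'c::real_vector) galgebra" and U :: "'p set" +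
  fixes n :: nat and dz :: "nat \<Rightarrow> int" and W :: "(nat \<Rightarrow> real) set" and pb :: "power_series \<Rightarrow> 'c"
  assumes W_open: "openin (body_space n dz) W"
    and pb_bij: "bij_betw pb (gsec (graded_model n dz) W j) (gsec C U j)"
    and pb_lin: "lin_on (gsec (graded_model n dz) W j) pb"
    and pb_one: "pb (gone (graded_model n dz) W) = gone C U"
    and pb_mul: "F \<in> gsec (graded_model n dz) W i \<Longrightarrow> G \<in> gsec (graded_model n dz) W j \<Longrightarrow>
      pb (gmul (graded_model n dz) F G) = gmul C (pb F) (pb G)"
begin

interpretation self: graded_module C U "self_module C" by (rule self_module)

abbreviation "M \<equiv> graded_model n dz"

lemma M_subspace: "subspace (gsec M W j)"
  by (rule model_sec_subspace[OF W_open])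

lemma pb_in: "F \<in> gsec M W j \<Longrightarrow> pb F \<in> gsec C U j"
  using pb_bij bij_betwE by blast

text \<open>\<open>pb\<close> is known to be bijective on each homogeneous component only, so its
  inverse depends on the degree.\<close>

definition qb :: "int \<Rightarrow> 'c \<Rightarrow> power_series" where "qb j = inv_into (gsec M W j) pb"

lemma qb_in: "f \<in> gsec C U j \<Longrightarrow> qb j f \<in> gsec M W j"
  unfolding qb_def using pb_bij by (metis bij_betw_imp_surj_on inv_into_into)

lemma pb_qb: "f \<in> gsec C U j \<Longrightarrow> pb (qb j f) = f"
  unfolding qb_def using pb_bij by (metis bij_betw_inv_into_right)

lemma qb_pb: "F \<in> gsec M W j \<Longrightarrow> qb j (pb F) = F"
  unfolding qb_def using pb_bij by (metis bij_betw_inv_into_left)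

lemma qbI: "F \<in> gsec M W j \<Longrightarrow> pb F = f \<Longrightarrow> qb j f = F"
  using qb_pb by blast

definition zc :: "nat \<Rightarrow> 'c" where "zc A = pb (model_coord n dz W A)"

definition dc :: "nat \<Rightarrow> 'c gmap" where
  "dc A = (\<lambda>j f. if f \<in> gsec C U j then pb (model_deriv dz W A (qb j f)) else 0)"

lemma zc_in: "A < n \<Longrightarrow> zc A \<in> gsec C U (dz A)"
  unfolding zc_def by (rule pb_in[OF model_coord_in[OF W_open]])

lemma dc_derivation:
  assumes A: "A < n" shows "dc A \<in> graded_derivations C U (- dz A)"
  unfolding graded_derivations_def
proof (intro CollectI conjI allI ballI)
  note D = model_deriv_in[OF W_open qb_in A]
  show "dc A \<in> graded_maps C U (- dz A)"
  proof (rule self.gmapI[simplified])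
    fix i f g assume f: "f \<in> gsec C U i" and g: "g \<in> gsec C U i"
    have fg: "f + g \<in> gsec C U i" using self.M_add f g by simp
    have "qb i (f + g) = qb i f + qb i g"
      by (rule qbI) (use lin_on_add[OF pb_lin qb_in[OF f] qb_in[OF g]] pb_qb f g
          subspace_add[OF M_subspace qb_in[OF f] qb_in[OF g]] in auto)
    then show "dc A i (f + g) = dc A i f + dc A i g"
      using f g fg lin_on_add[OF pb_lin D[OF f] D[OF g]]
      by (simp add: dc_def model_deriv_add[OF W_open qb_in[OF f] qb_in[OF g] A] del: plus_fun_apply)
  next
    fix i f and c :: real assume f: "f \<in> gsec C U i"
    have cf: "c *\<^sub>R f \<in> gsec C U i" using self.A_scale f by simp
    have "qb i (c *\<^sub>R f) = c *\<^sub>R qb i f"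
      by (rule qbI) (use lin_on_scaleR[OF pb_lin qb_in[OF f]] pb_qb f
          subspace_scale[OF M_subspace qb_in[OF f]] in auto)
    then show "dc A i (c *\<^sub>R f) = c *\<^sub>R dc A i f"
      using f cf lin_on_scaleR[OF pb_lin D[OF f]]
      by (simp add: dc_def model_deriv_scale[OF W_open qb_in[OF f] A] del: scaleR_fun_apply)
  next
    fix i f assume f: "f \<in> gsec C U i"
    then show "dc A i f \<in> gsec C U (i + - dz A)" using pb_in[OF D[OF f]] by (simp add: dc_def)
  qed (simp add: dc_def)
  fix i j f g assume f: "f \<in> gsec C U i" and g: "g \<in> gsec C U j"
  let ?s = "(-1 :: real) powi (- dz A * i)"
  have "qb (i + j) (gmul C f g) = gmul M (qb i f) (qb j g)"
    by (rule qbI[OF model_mul_in[OF W_open qb_in[OF f] qb_in[OF g]]])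
      (simp add: pb_mul[OF qb_in[OF f] qb_in[OF g]] pb_qb[OF f] pb_qb[OF g])
  then have "dc A (i + j) (gmul C f g) = pb (gmul M (model_deriv dz W A (qb i f)) (qb j g) +
      ?s *\<^sub>R gmul M (qb i f) (model_deriv dz W A (qb j g)))"
    using mul_in_deg[OF f g] model_deriv_mul[OF W_open qb_in[OF f] qb_in[OF g] A]
    by (simp add: dc_def del: plus_fun_apply scaleR_fun_apply)
  also have "\<dots> = pb (gmul M (model_deriv dz W A (qb i f)) (qb j g)) +
      ?s *\<^sub>R pb (gmul M (qb i f) (model_deriv dz W A (qb j g)))"
  proof -
    have 1: "gmul M (model_deriv dz W A (qb i f)) (qb j g) \<in> gsec M W (i - dz A + j)"
      by (rule model_mul_in[OF W_open D[OF f] qb_in[OF g]])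
    have 2: "gmul M (qb i f) (model_deriv dz W A (qb j g)) \<in> gsec M W (i - dz A + j)"
      using model_mul_in[OF W_open qb_in[OF f] D[OF g]] by (simp add: algebra_simps)
    show ?thesis
      by (simp only: lin_on_add[OF pb_lin 1 subspace_scale[OF M_subspace 2]] lin_on_scaleR[OF pb_lin 2])
  qed
  also have "\<dots> = gmul C (dc A i f) g + ?s *\<^sub>R gmul C f (dc A j g)"
    using f g by (simp add: dc_def pb_mul[OF D[OF f] qb_in[OF g]] pb_mul[OF qb_in[OF f] D[OF g]] pb_qb)
  finally show "dc A (i + j) (gmul C f g) = gmul C (dc A i f) g + ?s *\<^sub>R gmul C f (dc A j g)" .
qed

lemma dc_zc:
  assumes "A < n" "B < n" shows "dc A (dz B) (zc B) = (if B = A then gone C U else 0)"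
proof -
  have "qb (dz B) (zc B) = model_coord n dz W B"
    by (rule qbI[OF model_coord_in[OF W_open assms(2)]]) (simp add: zc_def)
  then show ?thesis
    using zc_in[OF assms(2)] pb_one lin_on_zero[OF pb_lin subspace_0[OF M_subspace]]
    by (simp add: dc_def model_deriv_coord[OF W_open assms] del: zero_fun_apply)
qed

text \<open>By Hadamard's lemma, the coefficients of \<open>T f\<close> at a point are determined by coefficients of lower order
  of the images under \<open>T\<close> of other functions.\<close>

lemma zero_if_commutes_chart:
  assumes T: "T \<in> graded_maps C U d" and T1: "T 0 (gone C U) = 0"
    and comm: "\<And>A i f. A < n \<Longrightarrow> f \<in> gsec C U i \<Longrightarrow> \<exists>s::real. (dz A = 0 \<longrightarrow> s = 1) \<and>
      T (i + dz A) (gmul C (zc A) f) = s *\<^sub>R gmul C (zc A) (T i f)"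
  shows "T = 0"
proof -
  have Tg: "T \<in> graded_maps (self_module C) U d" using T by simp
  have Tin: "T i f \<in> gsec C U (i + d)" if "f \<in> gsec C U i" for i f
    using self.gmap_in[OF Tg, of f i] that by simp
  \<comment> \<open>\<open>T\<close> read in the chart, where coefficients make sense.\<close>
  define H where "H j F = qb (j + d) (T j (pb F))" for j F
  have H: "H j F \<in> gsec M W (j + d)" "pb (H j F) = T j (pb F)" if "F \<in> gsec M W j" for j F
    using Tin[OF pb_in[OF that]] qb_in pb_qb by (simp_all add: H_def)
  \<comment> \<open>Strong induction on the weight of the exponent, for all functions and degrees at
    once, because the quotients from Hadamard's lemma take the place of \<open>F\<close>.\<close>
  have zero: "H j F p a = 0" if "F \<in> gsec M W j" "a \<in> W" "(\<Sum>A<n. p A) = m" for j F p a m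
    using that
  proof (induction m arbitrary: j F p rule: less_induct)
    case (less m)
    obtain c G where c: "c \<noteq> 0 \<longrightarrow> j = 0" and G: "\<And>A. A < n \<Longrightarrow> G A \<in> gsec M W (j - dz A)"
      and F: "F = c *\<^sub>R gone M W + (\<Sum>A<n. gmul M (model_coord n dz W A) (G A) - a A *\<^sub>R G A)"
      using model_Hadamard[OF W_open less.prems(1,2)] by blast
    have a0: "a A = 0" if "dz A \<noteq> 0" for A
      using less.prems(2) openin_body_subset[OF W_open] that by (auto simp: body_def)
    \<comment> \<open>\<open>a A\<close> is nonzero only if \<open>dz A = 0\<close>, so
      multiplication by it may be regarded as raising the degree by \<open>dz A\<close>.\<close>
    have aG: "a A *\<^sub>R K \<in> gsec M W i" if "K \<in> gsec M W (i - dz A)" for A K i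
      using that a0[of A] subspace_0[OF M_subspace] subspace_scale[OF M_subspace that, of "a A"]
      by (cases "dz A = 0") (simp_all del: scaleR_fun_apply zero_fun_apply)
    have zG: "gmul M (model_coord n dz W A) K \<in> gsec M W i" if "K \<in> gsec M W (i - dz A)" "A < n" for A K i
      using model_mul_in[OF W_open model_coord_in[OF W_open that(2)] that(1)] by simp
    have tm: "gmul M (model_coord n dz W A) (G A) - a A *\<^sub>R G A \<in> gsec M W j" if "A < n" for A
      by (rule subspace_diff[OF M_subspace zG[OF G[OF that] that] aG[OF G[OF that]]])
    have c1: "c *\<^sub>R gone M W \<in> gsec M W j"
      using c subspace_0[OF M_subspace] subspace_scale[OF M_subspace model_one_in[OF W_open], of c]
      by (cases "c = 0") (simp_all del: scaleR_fun_apply zero_fun_apply)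
    have tmC: "pb (gmul M (model_coord n dz W A) (G A) - a A *\<^sub>R G A) \<in> gsec C U j" if "A < n" for A
      by (rule pb_in[OF tm[OF that]])
    have sumM: "(\<Sum>A<n. gmul M (model_coord n dz W A) (G A) - a A *\<^sub>R G A) \<in> gsec M W j"
      by (rule subspace_sum[OF M_subspace tm]) simp
    have sumC: "(\<Sum>A<n. pb (gmul M (model_coord n dz W A) (G A) - a A *\<^sub>R G A)) \<in> gsec C U j"
      by (rule subspace_sum[OF A_subspace tmC]) simp
    have "pb F = pb (c *\<^sub>R gone M W) + (\<Sum>A<n. pb (gmul M (model_coord n dz W A) (G A) - a A *\<^sub>R G A))"
      unfolding F lin_on_add[OF pb_lin c1 sumM] using lin_on_sum[OF M_subspace pb_lin tm, of "{..<n}" "\<lambda>A. A"] by simp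
    then have "T j (pb F) = T j (pb (c *\<^sub>R gone M W)) +
        (\<Sum>A<n. T j (pb (gmul M (model_coord n dz W A) (G A) - a A *\<^sub>R G A)))"
      using self.gmap_add[OF Tg, of "pb (c *\<^sub>R gone M W)" j "\<Sum>A<n. pb (gmul M (model_coord n dz W A) (G A) - a A *\<^sub>R G A)"]
        sumC pb_in[OF c1] self.gmap_sum[OF Tg, of "{..<n}" "\<lambda>A. pb (gmul M (model_coord n dz W A) (G A) - a A *\<^sub>R G A)" j] tmC
      by simp
    moreover have "T j (pb (c *\<^sub>R gone M W)) = 0"
    proof (cases "c = 0")
      case True
      then show ?thesis using lin_on_zero[OF pb_lin subspace_0[OF M_subspace]] self.gmap_zero[OF Tg]
        by (simp del: zero_fun_apply)
    next
      case False
      then show ?thesis using c lin_on_scaleR[OF pb_lin model_one_in[OF W_open], of c] pb_one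
          self.gmap_scale[OF Tg, of "gone C U" 0 c] one_in T1
        by (simp del: scaleR_fun_apply)
    qed
    moreover have "\<exists>s. (dz A = 0 \<longrightarrow> s = 1) \<and> T j (pb (gmul M (model_coord n dz W A) (G A) - a A *\<^sub>R G A)) =
        pb (s *\<^sub>R gmul M (model_coord n dz W A) (H (j - dz A) (G A)) - a A *\<^sub>R H (j - dz A) (G A))" if A: "A < n" for A
    proof -
      note g = G[OF A]
      obtain s where s: "dz A = 0 \<longrightarrow> s = 1"
        "T (j - dz A + dz A) (gmul C (zc A) (pb (G A))) = s *\<^sub>R gmul C (zc A) (T (j - dz A) (pb (G A)))"
        using comm[OF A pb_in[OF g]] by blast
      have "pb (gmul M (model_coord n dz W A) (G A) - a A *\<^sub>R G A) = gmul C (zc A) (pb (G A)) - pb (a A *\<^sub>R G A)"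
        using lin_on_diff[OF M_subspace pb_lin zG[OF g A] aG[OF g]] pb_mul[OF model_coord_in[OF W_open A] g]
        by (simp add: zc_def)
      then have "T j (pb (gmul M (model_coord n dz W A) (G A) - a A *\<^sub>R G A)) =
          T j (gmul C (zc A) (pb (G A))) - T j (pb (a A *\<^sub>R G A))"
        using self.gmap_diff[OF Tg, of "gmul C (zc A) (pb (G A))" j "pb (a A *\<^sub>R G A)"]
          mul_in[OF zc_in[OF A] pb_in[OF g]] pb_in[OF aG[OF g]] by simp
      also have "T j (gmul C (zc A) (pb (G A))) = s *\<^sub>R gmul C (zc A) (pb (H (j - dz A) (G A)))"
        using s(2) H(2)[OF g] by simp
      also have "\<dots> = pb (s *\<^sub>R gmul M (model_coord n dz W A) (H (j - dz A) (G A)))"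
        using lin_on_scaleR[OF pb_lin model_mul_in[OF W_open model_coord_in[OF W_open A] H(1)[OF g]]]
          pb_mul[OF model_coord_in[OF W_open A] H(1)[OF g]] by (simp add: zc_def)
      also have "T j (pb (a A *\<^sub>R G A)) = pb (a A *\<^sub>R H (j - dz A) (G A))"
      proof (cases "dz A = 0")
        case True
        then show ?thesis
          using lin_on_scaleR[OF pb_lin g] lin_on_scaleR[OF pb_lin H(1)[OF g]] H(2)[OF g]
            self.gmap_scale[OF Tg, of "pb (G A)" j "a A"] pb_in[OF g] by simp
      next
        case False
        then show ?thesis using a0 lin_on_zero[OF pb_lin subspace_0[OF M_subspace]] self.gmap_zero[OF Tg]
          by (simp del: zero_fun_apply)
      qed
      finally have "T j (pb (gmul M (model_coord n dz W A) (G A) - a A *\<^sub>R G A)) =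
        pb (s *\<^sub>R gmul M (model_coord n dz W A) (H (j - dz A) (G A))) - pb (a A *\<^sub>R H (j - dz A) (G A))" .
      moreover have "H (j - dz A) (G A) \<in> gsec M W (j + d - dz A)" using H(1)[OF g] by (simp add: algebra_simps)
      from lin_on_diff[OF M_subspace pb_lin subspace_scale[OF M_subspace zG[OF this A]] aG[OF this]]
      have "pb (s *\<^sub>R gmul M (model_coord n dz W A) (H (j - dz A) (G A)) - a A *\<^sub>R H (j - dz A) (G A)) =
        pb (s *\<^sub>R gmul M (model_coord n dz W A) (H (j - dz A) (G A))) - pb (a A *\<^sub>R H (j - dz A) (G A))" .
      ultimately show ?thesis using s(1) by (intro exI[of _ s] conjI) simp_all
    qed
    then obtain s where s: "\<And>A. A < n \<Longrightarrow> dz A = 0 \<Longrightarrow> s A = 1"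
      "\<And>A. A < n \<Longrightarrow> T j (pb (gmul M (model_coord n dz W A) (G A) - a A *\<^sub>R G A)) =
        pb (s A *\<^sub>R gmul M (model_coord n dz W A) (H (j - dz A) (G A)) - a A *\<^sub>R H (j - dz A) (G A))" by metis
    define R where "R A = s A *\<^sub>R gmul M (model_coord n dz W A) (H (j - dz A) (G A)) - a A *\<^sub>R H (j - dz A) (G A)" for A
    have HG: "H (j - dz A) (G A) \<in> gsec M W (j + d - dz A)" if "A < n" for A
      using H(1)[OF G[OF that]] by (simp add: algebra_simps)
    have R: "R A \<in> gsec M W (j + d)" if "A < n" for A
      unfolding R_def
      by (rule subspace_diff[OF M_subspace subspace_scale[OF M_subspace zG[OF HG[OF that] that]] aG[OF HG[OF that]]])
    have sumR: "(\<Sum>A<n. R A) \<in> gsec M W (j + d)" by (rule subspace_sum[OF M_subspace R]) simp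
    ultimately have "T j (pb F) = (\<Sum>A<n. pb (R A))" using s(2) by (simp add: R_def)
    also have "\<dots> = pb (\<Sum>A<n. R A)" using lin_on_sum[OF M_subspace pb_lin R, of "{..<n}" "\<lambda>A. A"] by simp
    finally have "H j F = (\<Sum>A<n. R A)" unfolding H_def using qb_pb[OF sumR] by simp
    \<comment> \<open>In degree 0 the scalar is 1 and the factor \<open>x A - a A\<close> vanishes
      at \<open>a\<close>. For a formal coordinate the coefficient at \<open>p\<close> involves only
      the one at \<open>p - unit_exp A\<close>, of smaller weight.\<close>
    moreover have "R A p a = 0" if A: "A < n" for A
    proof (cases "dz A = 0")
      case True
      then have "A \<in> bd n dz" using A by (simp add: bd_def)
      then show ?thesis using model_coord_mul_body[OF HG[OF A]] s(1)[OF A True] by (simp add: R_def)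
    next
      case False
      have "gmul M (model_coord n dz W A) (H (j - dz A) (G A)) p a = 0"
      proof (cases "1 \<le> p A")
        case True
        have "(\<Sum>B<n. (p - unit_exp A) B) + 1 = (\<Sum>B<n. p B)"
          using A True by (simp add: sum.remove[of "{..<n}" A])
        then have "H (j - dz A) (G A) (p - unit_exp A) a = 0"
          using less.IH[OF _ G[OF A] less.prems(2) refl] less.prems(3) by simp
        then show ?thesis using model_coord_mul_formal[where dz = dz and A = A, OF HG[OF A] A False] by simp
      next
        case False': False
        then show ?thesis using model_coord_mul_formal[where dz = dz and A = A, OF HG[OF A] A False] by simp
      qed
      then show ?thesis using a0[OF False] by (simp add: R_def)
    qed
    ultimately show ?case by (simp add: sum_fun_apply)
  qed
  show ?thesis
  proof (rule self.gmap_eqI[OF Tg subspace_0[OF self.gmaps_subspace]])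
    fix i f assume "f \<in> gsec (self_module C) U i"
    then have f: "f \<in> gsec C U i" by simp
    have "H i (qb i f) p a = 0" for p a
      using zero[OF qb_in[OF f], of a p] model_sec_outside[OF H(1)[OF qb_in[OF f]], of a p] by (cases "a \<in> W") auto
    then have "H i (qb i f) = 0" by (intro ext) simp
    then have "pb 0 = T i f" using H(2)[OF qb_in[OF f]] pb_qb[OF f] by (simp del: zero_fun_apply)
    then show "T i f = 0 i f" using lin_on_zero[OF pb_lin subspace_0[OF M_subspace]] by simp
  qed
qed

end

text \<open>A homeomorphism onto an open set carries open subsets to open sets, so the chart
  restricts to \<open>V\<close>.\<close>

lemma chart_on_algebraI:
  assumes C: "graded_algebra_sheaf X C" and ch: "graded_chart X C nd U n dz \<phi> pb"
    and V: "openin X V" "V \<subseteq> U"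
  shows "chart_on_algebra C V n dz (\<phi> ` V) (pb V)"
proof -
  interpret graded_algebra C V by (rule graded_algebraI[OF C V(1)])
  have U: "openin X U" "openin (body_space n dz) (\<phi> ` U)"
    "homeomorphic_map (subtopology X U) (subtopology (body_space n dz) (\<phi> ` U)) \<phi>"
    using ch by (simp_all add: graded_chart_def)
  have "openin (subtopology X U) V" using V U(1) openin_open_subtopology by blast
  then have "openin (subtopology (body_space n dz) (\<phi> ` U)) (\<phi> ` V)"
    using homeomorphic_map_openness[OF U(3)] V(2) openin_subset[OF U(1)] openin_subset by blast
  then have W: "openin (body_space n dz) (\<phi> ` V)" using U(2) openin_trans_full by blast
  show ?thesis
    by unfold_locales (use W ch V in \<open>simp_all add: graded_chart_def\<close>)
qed

section \<open>Locality and restriction of differential operators\<close>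

locale gsheaf =
  fixes X :: "'p topology" and S :: "('p, 'v::real_vector, 'm) gpresheaf_scheme"
  assumes sheaf: "graded_sheaf X S"
begin

lemma presheaf: "graded_presheaf X S"
  using sheaf by (simp add: graded_sheaf_def)

lemma sec_subspace: "openin X U \<Longrightarrow> subspace (gsec S U j)"
  using presheaf[unfolded graded_presheaf_def, THEN conjunct1] by blast

lemma sec_zero: "openin X U \<Longrightarrow> 0 \<in> gsec S U j"
  using sec_subspace subspace_0 by blast

lemma res_in: "openin X U \<Longrightarrow> openin X V \<Longrightarrow> V \<subseteq> U \<Longrightarrow> s \<in> gsec S U j \<Longrightarrow> gres S U V s \<in> gsec S V j"
  using presheaf[unfolded graded_presheaf_def, THEN conjunct2, THEN conjunct2, THEN conjunct1] by blast

lemma res_lin: "openin X U \<Longrightarrow> openin X V \<Longrightarrow> V \<subseteq> U \<Longrightarrow> lin_on (gsec S U j) (gres S U V)"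
  using presheaf[unfolded graded_presheaf_def, THEN conjunct2, THEN conjunct2, THEN conjunct1] by blast

lemma res_id: "openin X U \<Longrightarrow> s \<in> gsec S U j \<Longrightarrow> gres S U U s = s"
  using presheaf[unfolded graded_presheaf_def, THEN conjunct2, THEN conjunct2, THEN conjunct2, THEN conjunct1] by blast

lemma res_res: "openin X U \<Longrightarrow> openin X V \<Longrightarrow> openin X W \<Longrightarrow> W \<subseteq> V \<Longrightarrow> V \<subseteq> U \<Longrightarrow> s \<in> gsec S U j \<Longrightarrow>
    gres S V W (gres S U V s) = gres S U W s"
  using presheaf[unfolded graded_presheaf_def, THEN conjunct2, THEN conjunct2, THEN conjunct2, THEN conjunct2] by blast

lemma res_zero: "openin X U \<Longrightarrow> openin X V \<Longrightarrow> V \<subseteq> U \<Longrightarrow> gres S U V 0 = 0"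
  using lin_on_zero[OF res_lin[of U V 0]] sec_zero by blast

lemma res_add: "openin X U \<Longrightarrow> openin X V \<Longrightarrow> V \<subseteq> U \<Longrightarrow> s \<in> gsec S U j \<Longrightarrow> t \<in> gsec S U j \<Longrightarrow>
    gres S U V (s + t) = gres S U V s + gres S U V t"
  using lin_on_add[OF res_lin] by blast

lemma res_diff: "openin X U \<Longrightarrow> openin X V \<Longrightarrow> V \<subseteq> U \<Longrightarrow> s \<in> gsec S U j \<Longrightarrow> t \<in> gsec S U j \<Longrightarrow>
    gres S U V (s - t) = gres S U V s - gres S U V t"
  using lin_on_diff[OF sec_subspace res_lin] by blast

lemma res_scale: "openin X U \<Longrightarrow> openin X V \<Longrightarrow> V \<subseteq> U \<Longrightarrow> s \<in> gsec S U j \<Longrightarrow>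
    gres S U V (a *\<^sub>R s) = a *\<^sub>R gres S U V s"
  using lin_on_scaleR[OF res_lin] by blast

lemma res_eq_subset:
  assumes "openin X O1" "openin X O2" "openin X N" "openin X N'" "N' \<subseteq> N" "N \<subseteq> O1" "N \<subseteq> O2"
    "s \<in> gsec S O1 j" "t \<in> gsec S O2 j" "gres S O1 N s = gres S O2 N t"
  shows "gres S O1 N' s = gres S O2 N' t"
  using res_res[of O1 N N' s j] res_res[of O2 N N' t j] assms by simp

lemma glue:
  assumes "\<And>V. V \<in> \<U> \<Longrightarrow> openin X V" "\<And>V. V \<in> \<U> \<Longrightarrow> s V \<in> gsec S V j"
    "\<And>V W. V \<in> \<U> \<Longrightarrow> W \<in> \<U> \<Longrightarrow> gres S V (V \<inter> W) (s V) = gres S W (V \<inter> W) (s W)"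
  shows "\<exists>!t. t \<in> gsec S (\<Union>\<U>) j \<and> (\<forall>V\<in>\<U>. gres S (\<Union>\<U>) V t = s V)"
proof -
  have "(\<forall>V\<in>\<U>. openin X V \<and> s V \<in> gsec S V j) \<and>
      (\<forall>V\<in>\<U>. \<forall>W\<in>\<U>. gres S V (V \<inter> W) (s V) = gres S W (V \<inter> W) (s W))"
    by (intro conjI ballI assms)
  then show ?thesis by (rule sheaf[unfolded graded_sheaf_def, THEN conjunct2, rule_format])
qed

text \<open>Separation is extracted from the uniqueness of gluing; the cover consists of all open
  sets on which the two sections coincide.\<close>

lemma sec_eqI:
  assumes U: "openin X U" and s: "s \<in> gsec S U j" and t: "t \<in> gsec S U j"
    and loc: "\<And>x. x \<in> U \<Longrightarrow> \<exists>N. openin X N \<and> x \<in> N \<and> N \<subseteq> U \<and> gres S U N s = gres S U N t"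
  shows "s = t"
proof -
  define \<U> where "\<U> = {N. openin X N \<and> N \<subseteq> U \<and> gres S U N s = gres S U N t}"
  have UU: "\<Union>\<U> = U" using loc by (auto simp: \<U>_def)
  have "\<exists>!u. u \<in> gsec S (\<Union>\<U>) j \<and> (\<forall>V\<in>\<U>. gres S (\<Union>\<U>) V u = gres S U V s)"
  proof (rule glue)
    fix V W assume "V \<in> \<U>" "W \<in> \<U>"
    then have "openin X V" "openin X W" "V \<subseteq> U" "W \<subseteq> U" by (auto simp: \<U>_def)
    then show "gres S V (V \<inter> W) (gres S U V s) = gres S W (V \<inter> W) (gres S U W s)"
      using res_res[OF U _ openin_Int _ _ s, of V V W] res_res[OF U _ openin_Int _ _ s, of W V W] by simp
  next
    fix V assume "V \<in> \<U>"
    then have V: "openin X V" "V \<subseteq> U" by (auto simp: \<U>_def)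
    show "openin X V" "gres S U V s \<in> gsec S V j" using V res_in[OF U V s] by auto
  qed
  moreover have "\<forall>V\<in>\<U>. gres S U V t = gres S U V s" by (auto simp: \<U>_def)
  ultimately show ?thesis using s t unfolding UU by blast
qed

lemma glue2:
  assumes U: "openin X U1" "openin X U2" and s: "s1 \<in> gsec S U1 j" "s2 \<in> gsec S U2 j"
    and eq: "gres S U1 (U1 \<inter> U2) s1 = gres S U2 (U1 \<inter> U2) s2"
  shows "\<exists>t\<in>gsec S (U1 \<union> U2) j. gres S (U1 \<union> U2) U1 t = s1 \<and> gres S (U1 \<union> U2) U2 t = s2"
\<comment> \<open>\<open>glue\<close> takes a family indexed by open sets, which cannot assign two
  sections to one set.\<close>
proof (cases "U1 = U2")
  case True
  then have "s1 = s2" using eq res_id[OF U(1)] s by simp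
  then show ?thesis using True res_id[OF U(1) s(1)] s by auto
next
  case False
  let ?s = "\<lambda>V. if V = U1 then s1 else s2"
  have "\<exists>!t. t \<in> gsec S (\<Union>{U1, U2}) j \<and> (\<forall>V\<in>{U1, U2}. gres S (\<Union>{U1, U2}) V t = ?s V)"
    by (rule glue) (use U s eq False in \<open>auto simp: Int_commute\<close>)
  then show ?thesis using False by auto
qed

end

locale module_sheaf =
  fixes X :: "'p topology" and C :: "('p, 'c::real_vector) galgebra" and E :: "('p, 'e::real_vector, 'c) gmodule"
  assumes C: "graded_algebra_sheaf X C" and E: "graded_module_sheaf X C E"
begin

sublocale Es: gsheaf X E
  by unfold_locales (use E in \<open>simp add: graded_module_sheaf_def\<close>)

sublocale Cs: gsheaf X C
  by unfold_locales (use C in \<open>simp add: graded_algebra_sheaf_def\<close>)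

lemma module_at: "openin X U \<Longrightarrow> graded_module C U E"
  by (rule graded_moduleI[OF C E])

lemma res_act: "openin X U \<Longrightarrow> openin X V \<Longrightarrow> V \<subseteq> U \<Longrightarrow> f \<in> gsec C U i \<Longrightarrow> \<psi> \<in> gsec E U j \<Longrightarrow>
    gres E U V (gact E f \<psi>) = gact E (gres C U V f) (gres E U V \<psi>)"
  using E[unfolded graded_module_sheaf_def, THEN conjunct2, THEN conjunct2] by blast

lemma res_one: "openin X U \<Longrightarrow> openin X V \<Longrightarrow> V \<subseteq> U \<Longrightarrow> gres C U V (gone C U) = gone C V"
  using C[unfolded graded_algebra_sheaf_def, THEN conjunct2, THEN conjunct2] by blast

text \<open>\<open>b\<close> is 1 near \<open>x\<close> and vanishes on \<open>N'\<close>, which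
  together with \<open>V\<close> covers \<open>U\<close>. This expresses in terms of sections alone
  that the support of \<open>b\<close> lies in \<open>V\<close>.\<close>

definition bump_at :: "'p set \<Rightarrow> 'p set \<Rightarrow> 'p \<Rightarrow> 'c \<Rightarrow> 'p set \<Rightarrow> 'p set \<Rightarrow> bool" where
  "bump_at U V x b N N' \<longleftrightarrow> b \<in> gsec C U 0 \<and> openin X N \<and> x \<in> N \<and> N \<subseteq> V \<and> openin X N' \<and> V \<union> N' = U \<and>
    gres C U N b = gone C N \<and> gres C U N' b = 0"

text \<open>The product with \<open>b\<close> vanishes on the overlap of \<open>V\<close> and
  \<open>N'\<close>, so it glues with 0 to a section over \<open>U\<close>; it is unchanged where
  \<open>b\<close> is 1.\<close>

lemma bump_extension:
  assumes U: "openin X U" and V: "openin X V" and b: "bump_at U V x b N N'" and p: "\<psi> \<in> gsec E V j"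
  shows "\<exists>\<psi>'\<in>gsec E U j. gres E U N \<psi>' = gres E V N \<psi>"
proof -
  have N: "openin X N" "N \<subseteq> V" "openin X N'" "V \<union> N' = U" "b \<in> gsec C U 0" "gres C U N b = gone C N" "gres C U N' b = 0"
    using b by (auto simp: bump_at_def)
  then have sub: "V \<subseteq> U" "N' \<subseteq> U" "N \<subseteq> U" by auto
  have VN: "openin X (V \<inter> N')" using V N by auto
  interpret MV: graded_module C V E by (rule module_at[OF V])
  interpret MN: graded_module C N E by (rule module_at[OF N(1)])
  interpret MVN: graded_module C "V \<inter> N'" E by (rule module_at[OF VN])
  let ?bp = "gact E (gres C U V b) \<psi>"
  have bV: "gres C U V b \<in> gsec C V 0" by (rule Cs.res_in[OF U V sub(1) N(5)])
  have bp: "?bp \<in> gsec E V j" by (rule MV.act_in[OF bV p]) simp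
  have "gres E V (V \<inter> N') ?bp = gact E (gres C V (V \<inter> N') (gres C U V b)) (gres E V (V \<inter> N') \<psi>)"
    by (rule res_act[OF V VN _ bV p]) simp
  also have "gres C V (V \<inter> N') (gres C U V b) = gres C N' (V \<inter> N') (gres C U N' b)"
    using Cs.res_res[OF U V VN _ sub(1) N(5)] Cs.res_res[OF U N(3) VN _ sub(2) N(5)] by simp
  also have "\<dots> = 0" unfolding N(7) by (rule Cs.res_zero[OF N(3) VN]) simp
  also have "gact E 0 (gres E V (V \<inter> N') \<psi>) = 0"
    by (rule MVN.act_zero_left[OF Es.res_in[OF V VN _ p]]) simp
  finally have "gres E V (V \<inter> N') ?bp = gres E N' (V \<inter> N') 0"
    using Es.res_zero[OF N(3) VN] by simp
  then obtain t where t: "t \<in> gsec E U j" "gres E U V t = ?bp"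
    using Es.glue2[OF V N(3) bp Es.sec_zero[OF N(3)]] unfolding N(4) by auto
  have "gres E U N t = gres E V N ?bp" using Es.res_res[OF U V N(1,2) sub(1) t(1)] t(2) by simp
  also have "\<dots> = gact E (gres C V N (gres C U V b)) (gres E V N \<psi>)" by (rule res_act[OF V N(1,2) bV p])
  also have "\<dots> = gres E V N \<psi>"
    using Cs.res_res[OF U V N(1,2) sub(1) N(5)] N(6) MN.one_act[OF Es.res_in[OF V N(1,2) p]] by simp
  finally show ?thesis using t(1) by blast
qed

text \<open>Allows \<open>bump_extension\<close> to be used for functions as well.\<close>

lemma self_module_sheaf: "graded_module_sheaf X C (self_module C)"
proof -
  have "graded_sheaf X (self_module C) \<longleftrightarrow> graded_sheaf X C"
    by (simp only: graded_sheaf_def graded_presheaf_def self_module_simps)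
  then have S: "graded_sheaf X (self_module C)"
    using C[unfolded graded_algebra_sheaf_def, THEN conjunct1] by simp
  have M: "(\<forall>j. \<forall>\<psi>\<in>gsec C U j. gmul C (gone C U) \<psi> = \<psi> \<and> (\<forall>i. lin_on (gsec C U i) (\<lambda>f. gmul C f \<psi>))) \<and>
      (\<forall>i. \<forall>f\<in>gsec C U i. \<forall>j. lin_on (gsec C U j) (gmul C f) \<and>
         (\<forall>\<psi>\<in>gsec C U j. gmul C f \<psi> \<in> gsec C U (i + j) \<and>
           (\<forall>l. \<forall>g\<in>gsec C U l. gmul C (gmul C g f) \<psi> = gmul C g (gmul C f \<psi>))))"
    if "openin X U" for U
  proof -
    interpret graded_algebra C U by (rule graded_algebraI[OF C that])
    show ?thesis by (intro conjI allI ballI one_mul mul_lin_left mul_lin_right mul_in_deg mul_assoc)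
  qed
  have R: "\<forall>i j. \<forall>f\<in>gsec C U i. \<forall>\<psi>\<in>gsec C U j. gres C U V (gmul C f \<psi>) = gmul C (gres C U V f) (gres C U V \<psi>)"
    if "openin X U \<and> openin X V \<and> V \<subseteq> U" for U V
    using C[unfolded graded_algebra_sheaf_def, THEN conjunct2, THEN conjunct2, THEN spec, THEN spec, THEN mp, OF that]
    by (rule conjunct2)
  show ?thesis
    unfolding graded_module_sheaf_def self_module_simps
    by (rule conjI[OF S], rule conjI, (rule allI, rule impI, erule M),
        (rule allI, rule allI, rule impI, erule R))
qed

end

locale module_sheaf_with_bumps = module_sheaf +
  assumes bumps: "openin X U \<Longrightarrow> openin X V \<Longrightarrow> V \<subseteq> U \<Longrightarrow> x \<in> V \<Longrightarrow> \<exists>b N N'. bump_at U V x b N N'"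
begin

text \<open>Sections over \<open>V\<close> need not extend to \<open>U\<close>, but near a point
  they do. One neighbourhood serves all sections and functions, since it depends only on the bump
  function.\<close>

lemma extension:
  assumes U: "openin X U" and V: "openin X V" "V \<subseteq> U" and x: "x \<in> V"
  shows "\<exists>N. openin X N \<and> x \<in> N \<and> N \<subseteq> V \<and>
    (\<forall>j. \<forall>\<psi>\<in>gsec E V j. \<exists>\<psi>'\<in>gsec E U j. gres E U N \<psi>' = gres E V N \<psi>) \<and>
    (\<forall>j. \<forall>f\<in>gsec C V j. \<exists>f'\<in>gsec C U j. gres C U N f' = gres C V N f)"
proof -
  obtain b N N' where b: "bump_at U V x b N N'" using bumps[OF U V x] by blast
  interpret self: module_sheaf X C "self_module C" by unfold_locales (rule C, rule self_module_sheaf)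
  have b': "self.bump_at U V x b N N'" using b by (simp add: bump_at_def self.bump_at_def)
  show ?thesis
  proof (intro exI[of _ N] conjI allI ballI)
    show "openin X N" "x \<in> N" "N \<subseteq> V" using b by (simp_all add: bump_at_def)
    show "\<exists>\<psi>'\<in>gsec E U j. gres E U N \<psi>' = gres E V N \<psi>" if "\<psi> \<in> gsec E V j" for j \<psi>
      by (rule bump_extension[OF U V(1) b that])
    show "\<exists>f'\<in>gsec C U j. gres C U N f' = gres C V N f" if "f \<in> gsec C V j" for j f
      using self.bump_extension[OF U V(1) b', of f j] that by simp
  qed
qed

text \<open>Let \<psi> vanish on \<open>V\<close> and let \<open>b\<close> be supported in
  \<open>V\<close>. Then b \<psi> = 0, so [D, b] \<psi> = - b D \<psi>. The left side vanishes on
  \<open>V\<close> by induction on the order, and \<open>b\<close> can be chosen to be 1 near any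
  given point of \<open>V\<close>.\<close>

lemma diff_op_local:
  "D \<in> diff_ops C E k U d \<Longrightarrow> openin X U \<Longrightarrow> openin X V \<Longrightarrow> V \<subseteq> U \<Longrightarrow> \<psi> \<in> gsec E U i \<Longrightarrow>
    gres E U V \<psi> = 0 \<Longrightarrow> gres E U V (D i \<psi>) = 0"
proof (induction k arbitrary: d D)
  \<comment> \<open>Both cases of the induction use this argument and differ only in the reason why
    the commutators vanish on \<open>V\<close>.\<close>
  have step: "gres E U V (D i \<psi>) = 0"
    if D: "D \<in> graded_maps E U d" and U: "openin X U" and V: "openin X V" "V \<subseteq> U" and p: "\<psi> \<in> gsec E U i"
      and p0: "gres E U V \<psi> = 0"
      and br: "\<And>b. b \<in> gsec C U 0 \<Longrightarrow> gres E U V (gcommutator d 0 D (left_mult E U b) i \<psi>) = 0" for d D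
  proof -
    interpret M: graded_module C U E by (rule module_at[OF U])
    interpret MV: graded_module C V E by (rule module_at[OF V(1)])
    have Dp: "D i \<psi> \<in> gsec E U (i + d)" by (rule M.gmap_in[OF D p refl])
    show ?thesis
    proof (rule Es.sec_eqI[OF V(1) Es.res_in[OF U V Dp] Es.sec_zero[OF V(1)]])
      fix x assume "x \<in> V"
      then obtain b N N' where b: "bump_at U V x b N N'" using bumps[OF U V] by blast
      then have N: "openin X N" "N \<subseteq> V" "openin X N'" "V \<union> N' = U" "b \<in> gsec C U 0" "gres C U N b = gone C N"
        "gres C U N' b = 0" "x \<in> N" by (auto simp: bump_at_def)
      then have sub: "N' \<subseteq> U" "N \<subseteq> U" by auto
      interpret MN: graded_module C N E by (rule module_at[OF N(1)])
      interpret MN': graded_module C N' E by (rule module_at[OF N(3)])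
      have bp: "gact E b \<psi> \<in> gsec E U i" by (rule M.act_in[OF N(5) p]) simp
      have "gact E b \<psi> = 0"
      proof (rule Es.sec_eqI[OF U bp Es.sec_zero[OF U]])
        fix y assume "y \<in> U"
        then consider "y \<in> V" | "y \<in> N'" using N(4) by blast
        then show "\<exists>N. openin X N \<and> y \<in> N \<and> N \<subseteq> U \<and> gres E U N (gact E b \<psi>) = gres E U N 0"
        proof cases
          case 1
          have "gres E U V (gact E b \<psi>) = 0"
            unfolding res_act[OF U V N(5) p] p0 by (rule MV.act_zero_right[OF Cs.res_in[OF U V N(5)]])
          then show ?thesis using 1 V Es.res_zero[OF U V] by auto
        next
          case 2
          have "gres E U N' (gact E b \<psi>) = 0"
            unfolding res_act[OF U N(3) sub(1) N(5) p] N(7)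
            by (rule MN'.act_zero_left[OF Es.res_in[OF U N(3) sub(1) p]])
          then show ?thesis using 2 N(3) sub(1) Es.res_zero[OF U N(3) sub(1)] by auto
        qed
      qed
      then have "gcommutator d 0 D (left_mult E U b) i \<psi> = - gact E b (D i \<psi>)"
        using M.br_apply[OF D p, of 0 b] M.gmap_zero[OF D] by simp
      then have bD: "gact E b (D i \<psi>) = (-1) *\<^sub>R gcommutator d 0 D (left_mult E U b) i \<psi>" by simp
      have "gcommutator d 0 D (left_mult E U b) i \<psi> \<in> gsec E U (i + d)"
        by (rule M.gmap_in[OF M.br_gmap[OF D N(5) refl] p]) simp
      then have "gres E U V (gact E b (D i \<psi>)) = 0"
        unfolding bD using Es.res_scale[OF U V, of _ "i + d" "-1"] br[OF N(5)] by simp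
      then have "gres E U N (gact E b (D i \<psi>)) = 0"
        using Es.res_res[OF U V(1) N(1,2) V(2) M.act_in[OF N(5) Dp refl]] Es.res_zero[OF V(1) N(1,2)] by simp
      moreover have "gres E U N (gact E b (D i \<psi>)) = gres E U N (D i \<psi>)"
        using res_act[OF U N(1) sub(2) N(5) Dp] N(6) MN.one_act[OF Es.res_in[OF U N(1) sub(2) Dp]] by simp
      ultimately have "gres E V N (gres E U V (D i \<psi>)) = gres E V N 0"
        using Es.res_res[OF U V(1) N(1,2) V(2) Dp] Es.res_zero[OF V(1) N(1,2)] by simp
      then show "\<exists>N. openin X N \<and> x \<in> N \<and> N \<subseteq> V \<and> gres E V N (gres E U V (D i \<psi>)) = gres E V N 0"
        using N by blast
    qed
  qed
  {
    case 0
    interpret M: graded_module C U E by (rule module_at[OF 0(2)])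
    show ?case
      by (rule step[OF M.diff_op_gmap[OF 0(1)] 0(2-6)])
        (use 0 Es.res_zero[OF 0(2-4)] in \<open>auto simp: M.diff_op_zero_iff simp del: diff_ops.simps\<close>)
  next
    case (Suc k)
    interpret M: graded_module C U E by (rule module_at[OF Suc.prems(2)])
    show ?case
    proof (rule step[OF M.diff_op_gmap[OF Suc.prems(1)] Suc.prems(2-6)])
      fix b assume "b \<in> gsec C U 0"
      then have "gcommutator d 0 D (left_mult E U b) \<in> diff_ops C E k U (d + 0)"
        using Suc.prems(1) M.diff_op_Suc_iff by blast
      then show "gres E U V (gcommutator d 0 D (left_mult E U b) i \<psi>) = 0"
        using Suc.IH Suc.prems by blast
    qed
  }
qed

text \<open>\<open>D\<close> over \<open>O1\<close> and \<open>D'\<close> over \<open>O2\<close> induce the same map of sheaves over \<open>N\<close>.\<close>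

definition agree :: "'a set \<Rightarrow> 'a set \<Rightarrow> 'c gmap \<Rightarrow> 'a set \<Rightarrow> 'c gmap \<Rightarrow> bool" where
  "agree N O1 D O2 D' \<longleftrightarrow> (\<forall>N' i. openin X N' \<and> N' \<subseteq> N \<longrightarrow> (\<forall>\<psi>\<in>gsec E O1 i. \<forall>\<psi>'\<in>gsec E O2 i.
     gres E O1 N' \<psi> = gres E O2 N' \<psi>' \<longrightarrow> gres E O1 N' (D i \<psi>) = gres E O2 N' (D' i \<psi>')))"

lemma agreeD: "agree N O1 D O2 D' \<Longrightarrow> openin X N' \<Longrightarrow> N' \<subseteq> N \<Longrightarrow> \<psi> \<in> gsec E O1 i \<Longrightarrow> \<psi>' \<in> gsec E O2 i \<Longrightarrow>
    gres E O1 N' \<psi> = gres E O2 N' \<psi>' \<Longrightarrow> gres E O1 N' (D i \<psi>) = gres E O2 N' (D' i \<psi>')"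
  unfolding agree_def by blast

lemma agree_sym: "agree N O1 D O2 D' \<Longrightarrow> agree N O2 D' O1 D"
  unfolding agree_def by (intro allI impI ballI) (rule sym, simp)

lemma agree_br:
  assumes O1: "openin X O1" and O2: "openin X O2" and N: "openin X N" "N \<subseteq> O1" "N \<subseteq> O2"
    and D: "D \<in> graded_maps E O1 d" and D': "D' \<in> graded_maps E O2 d" and a: "agree N O1 D O2 D'"
    and f: "f \<in> gsec C O1 i" and f': "f' \<in> gsec C O2 i" and ff: "gres C O1 N f = gres C O2 N f'"
  shows "agree N O1 (gcommutator d i D (left_mult E O1 f)) O2 (gcommutator d i D' (left_mult E O2 f'))"
  unfolding agree_def
proof (intro allI impI ballI, elim conjE)
  interpret M1: graded_module C O1 E by (rule module_at[OF O1])
  interpret M2: graded_module C O2 E by (rule module_at[OF O2])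
  fix N' j \<psi> \<psi>' assume N': "openin X N'" "N' \<subseteq> N" and p: "\<psi> \<in> gsec E O1 j" and p': "\<psi>' \<in> gsec E O2 j"
    and pp: "gres E O1 N' \<psi> = gres E O2 N' \<psi>'"
  have s: "N' \<subseteq> O1" "N' \<subseteq> O2" using N' N by auto
  have ff': "gres C O1 N' f = gres C O2 N' f'"
    by (rule Cs.res_eq_subset[OF O1 O2 N(1) N'(1,2) N(2,3) f f' ff])
  have fp: "gact E f \<psi> \<in> gsec E O1 (j + i)" by (rule M1.act_in[OF f p]) simp
  have fp': "gact E f' \<psi>' \<in> gsec E O2 (j + i)" by (rule M2.act_in[OF f' p']) simp
  have e1: "gres E O1 N' (gact E f \<psi>) = gres E O2 N' (gact E f' \<psi>')"
    by (simp add: res_act[OF O1 N'(1) s(1) f p] res_act[OF O2 N'(1) s(2) f' p'] ff' pp)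
  have e2: "gres E O1 N' (D (j + i) (gact E f \<psi>)) = gres E O2 N' (D' (j + i) (gact E f' \<psi>'))"
    by (rule agreeD[OF a N' fp fp' e1])
  have e3: "gres E O1 N' (D j \<psi>) = gres E O2 N' (D' j \<psi>')" by (rule agreeD[OF a N' p p' pp])
  have e4: "gres E O1 N' (gact E f (D j \<psi>)) = gres E O2 N' (gact E f' (D' j \<psi>'))"
    by (simp add: res_act[OF O1 N'(1) s(1) f M1.gmap_in[OF D p refl]]
        res_act[OF O2 N'(1) s(2) f' M2.gmap_in[OF D' p' refl]] ff' e3)
  have m1: "gact E f (D j \<psi>) \<in> gsec E O1 (j + i + d)" by (rule M1.act_in[OF f M1.gmap_in[OF D p refl]]) simp
  have m2: "gact E f' (D' j \<psi>') \<in> gsec E O2 (j + i + d)" by (rule M2.act_in[OF f' M2.gmap_in[OF D' p' refl]]) simp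
  show "gres E O1 N' (gcommutator d i D (left_mult E O1 f) j \<psi>) =
      gres E O2 N' (gcommutator d i D' (left_mult E O2 f') j \<psi>')"
    unfolding M1.br_apply[OF D p] M2.br_apply[OF D' p']
      Es.res_diff[OF O1 N'(1) s(1) M1.gmap_in[OF D fp refl] M1.M_scale[OF m1]]
      Es.res_diff[OF O2 N'(1) s(2) M2.gmap_in[OF D' fp' refl] M2.M_scale[OF m2]]
      Es.res_scale[OF O1 N'(1) s(1) m1] Es.res_scale[OF O2 N'(1) s(2) m2] e2 e4 ..
qed

lemma agree_iter:
  assumes O1: "openin X O1" and O2: "openin X O2" and N: "openin X N" "N \<subseteq> O1" "N \<subseteq> O2"
  shows "list_all2 (\<lambda>(i, f) (i', f'). i' = i \<and> f \<in> gsec C O1 i \<and> f' \<in> gsec C O2 i \<and> gres C O1 N f = gres C O2 N f') fs fs' \<Longrightarrow>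
    D \<in> graded_maps E O1 d \<Longrightarrow> D' \<in> graded_maps E O2 d \<Longrightarrow> agree N O1 D O2 D' \<Longrightarrow>
    agree N O1 (iter_commutator E O1 fs d D) O2 (iter_commutator E O2 fs' d D')"
proof (induction fs fs' arbitrary: d D D' rule: list_all2_induct)
  interpret M1: graded_module C O1 E by (rule module_at[OF O1])
  interpret M2: graded_module C O2 E by (rule module_at[OF O2])
  case (Cons a fs a' fs')
  obtain i f f' where a: "a = (i, f)" "a' = (i, f')" and f: "f \<in> gsec C O1 i" "f' \<in> gsec C O2 i" "gres C O1 N f = gres C O2 N f'"
    using Cons.hyps(1) by (cases a; cases a') auto
  show ?case
    unfolding a iter_commutator.simps fst_conv snd_conv
    by (rule Cons.IH[OF M1.br_gmap[OF Cons.prems(1) f(1) refl] M2.br_gmap[OF Cons.prems(2) f(2) refl]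
          agree_br[OF O1 O2 N Cons.prems f]])
qed simp

text \<open>Each (k + 1)-fold commutator of \<open>D\<close> is compared near a point with one of
  \<open>D'\<close>. The set \<open>V\<close> may be larger than \<open>U\<close>, as in the
  construction of restrictions, or smaller, as in gluing.\<close>

lemma diff_op_locally:
  assumes U: "openin X U" and D: "D \<in> graded_maps E U d"
    and loc: "\<And>x. x \<in> U \<Longrightarrow> \<exists>N V D'. openin X N \<and> x \<in> N \<and> N \<subseteq> U \<and> openin X V \<and> N \<subseteq> V \<and>
      D' \<in> diff_ops C E k V d \<and> agree N U D V D' \<and>
      (\<forall>j. \<forall>\<psi>\<in>gsec E U j. \<exists>\<psi>'\<in>gsec E V j. gres E V N \<psi>' = gres E U N \<psi>) \<and>
      (\<forall>j. \<forall>f\<in>gsec C U j. \<exists>f'\<in>gsec C V j. gres C V N f' = gres C U N f)"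
  shows "D \<in> diff_ops C E k U d"
proof -
  interpret MU: graded_module C U E by (rule module_at[OF U])
  have "iter_commutator E U fs d D i \<psi> = 0"
    if fs: "length fs = Suc k" "MU.homogeneous fs" and p: "\<psi> \<in> gsec E U i" for fs i \<psi>
  proof -
    have it: "iter_commutator E U fs d D i \<psi> \<in> gsec E U (i + (d + sum_list (map fst fs)))"
      by (rule MU.gmap_in[OF MU.iter_gmap[OF D fs(2)] p refl])
    show ?thesis
    proof (rule Es.sec_eqI[OF U it Es.sec_zero[OF U]])
      fix x assume "x \<in> U"
      then obtain N V D' where N: "openin X N" "x \<in> N" "N \<subseteq> U" "openin X V" "N \<subseteq> V"
        and D': "D' \<in> diff_ops C E k V d" "agree N U D V D'"
        and ext: "\<forall>j. \<forall>\<psi>\<in>gsec E U j. \<exists>\<psi>'\<in>gsec E V j. gres E V N \<psi>' = gres E U N \<psi>"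
          "\<forall>j. \<forall>f\<in>gsec C U j. \<exists>f'\<in>gsec C V j. gres C V N f' = gres C U N f"
        using loc[of x] by blast
      interpret MV: graded_module C V E by (rule module_at[OF N(4)])
      \<comment> \<open>The functions in the commutator are replaced by functions over
        \<open>V\<close> that coincide with them over \<open>N\<close>.\<close>
      have "\<exists>fs'. list_all2 (\<lambda>(i, f) (i', f'). i' = i \<and> f \<in> gsec C U i \<and> f' \<in> gsec C V i \<and> gres C U N f = gres C V N f') fs fs'"
        using fs(2)
      proof (induction fs)
        case (Cons a fs)
        obtain i f where a: "a = (i, f)" by (cases a)
        then have f: "f \<in> gsec C U i" and "MU.homogeneous fs" using Cons.prems by auto
        then obtain fs' where "list_all2 (\<lambda>(i, f) (i', f'). i' = i \<and> f \<in> gsec C U i \<and> f' \<in> gsec C V i \<and> gres C U N f = gres C V N f') fs fs'"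
          using Cons.IH by blast
        moreover obtain f' where "f' \<in> gsec C V i" "gres C V N f' = gres C U N f" using ext(2)[rule_format, OF f] by blast
        ultimately show ?case using a f by (intro exI[of _ "(i, f') # fs'"]) simp
      qed auto
      then obtain fs' where fs': "list_all2 (\<lambda>(i, f) (i', f'). i' = i \<and> f \<in> gsec C U i \<and> f' \<in> gsec C V i \<and> gres C U N f = gres C V N f') fs fs'" ..
      have ag: "agree N U (iter_commutator E U fs d D) V (iter_commutator E V fs' d D')"
        by (rule agree_iter[OF U N(4,1,3,5) fs' D MV.diff_op_gmap[OF D'(1)] D'(2)])
      have "length fs' = Suc k" using list_all2_lengthD[OF fs'] fs(1) by simp
      moreover have "MV.homogeneous fs'"
        unfolding MV.homogeneous_def using fs' by (induction rule: list_all2_induct) auto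
      ultimately have "iter_commutator E V fs' d D' = 0" using D'(1) unfolding MV.diff_op_iff_iter by blast
      moreover obtain \<psi>' where "\<psi>' \<in> gsec E V i" "gres E V N \<psi>' = gres E U N \<psi>" using ext(1)[rule_format, OF p] by blast
      ultimately have "gres E U N (iter_commutator E U fs d D i \<psi>) = gres E V N 0"
        using agreeD[OF ag N(1) order_refl p, of \<psi>'] by simp
      then show "\<exists>N. openin X N \<and> x \<in> N \<and> N \<subseteq> U \<and> gres E U N (iter_commutator E U fs d D i \<psi>) = gres E U N 0"
        using N Es.res_zero[OF U N(1,3)] Es.res_zero[OF N(4,1,5)] by auto
    qed
  qed
  then have "iter_commutator E U fs d D = 0" if "length fs = Suc k" "MU.homogeneous fs" for fs
    using that by (intro MU.gmap_eqI[OF MU.iter_gmap[OF D that(2)] subspace_0[OF MU.gmaps_subspace]]) simp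
  then show ?thesis using D unfolding MU.diff_op_iff_iter by blast
qed

text \<open>The operators match on restrictions of sections over \<open>U\<close>; locality of
  \<open>D'\<close> extends this to all sections over \<open>V\<close> that coincide with such a
  restriction on a smaller set.\<close>

lemma agreeI_restricted:
  assumes U: "openin X U" and V: "openin X V" "V \<subseteq> U" and D': "D' \<in> diff_ops C E k V d'"
    and D: "D \<in> graded_maps E U d'"
    and eq: "\<And>i \<psi>. \<psi> \<in> gsec E U i \<Longrightarrow> D' i (gres E U V \<psi>) = gres E U V (D i \<psi>)"
  shows "agree V U D V D'"
  unfolding agree_def
proof (intro allI impI ballI, elim conjE)
  fix N i \<psi> \<psi>' assume N: "openin X N" "N \<subseteq> V" and p: "\<psi> \<in> gsec E U i" and p': "\<psi>' \<in> gsec E V i"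
    and pp: "gres E U N \<psi> = gres E V N \<psi>'"
  interpret MU: graded_module C U E by (rule module_at[OF U])
  interpret MV: graded_module C V E by (rule module_at[OF V(1)])
  note g = MV.diff_op_gmap[OF D']
  have r: "gres E U V \<psi> \<in> gsec E V i" by (rule Es.res_in[OF U V p])
  have "gres E V N (gres E U V \<psi> - \<psi>') = 0"
    using Es.res_diff[OF V(1) N r p'] Es.res_res[OF U V(1) N V(2) p] pp by simp
  then have "gres E V N (D' i (gres E U V \<psi> - \<psi>')) = 0"
    by (rule diff_op_local[OF D' V(1) N MV.M_diff[OF r p']])
  then have "gres E V N (D' i (gres E U V \<psi>)) = gres E V N (D' i \<psi>')"
    using MV.gmap_diff[OF g r p'] Es.res_diff[OF V(1) N MV.gmap_in[OF g r refl] MV.gmap_in[OF g p' refl]] by simp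
  then show "gres E U N (D i \<psi>) = gres E V N (D' i \<psi>')"
    unfolding eq[OF p] using Es.res_res[OF U V(1) N V(2) MU.gmap_in[OF D p refl]] by simp
qed

text \<open>D' \<psi> is glued from the sections D \<psi>', where \<psi>' over \<open>U\<close>
  coincides with \<psi> on a small open set. Locality of \<open>D\<close> makes the pieces
  independent of this choice, and \<open>diff_op_locally\<close> transfers the order.\<close>

lemma restriction_exists:
  assumes D: "D \<in> diff_ops C E k U d" and U: "openin X U" and V: "openin X V" "V \<subseteq> U"
  shows "\<exists>D'\<in>diff_ops C E k V d. agree V U D V D'"
proof -
  interpret MU: graded_module C U E by (rule module_at[OF U])
  interpret MV: graded_module C V E by (rule module_at[OF V(1)])
  note g = MU.diff_op_gmap[OF D]
  have eqN: "gres E U N (D i \<psi>) = gres E U N (D i \<eta>)"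
    if N: "openin X N" "N \<subseteq> U" and p: "\<psi> \<in> gsec E U i" "\<eta> \<in> gsec E U i" "gres E U N \<psi> = gres E U N \<eta>" for N i \<psi> \<eta>
  proof -
    have "gres E U N (\<psi> - \<eta>) = 0" using Es.res_diff[OF U N p(1,2)] p(3) by simp
    then have "gres E U N (D i (\<psi> - \<eta>)) = 0" by (rule diff_op_local[OF D U N MU.M_diff[OF p(1,2)]])
    then show ?thesis
      using MU.gmap_diff[OF g p(1,2)] Es.res_diff[OF U N MU.gmap_in[OF g p(1) refl] MU.gmap_in[OF g p(2) refl]] by simp
  qed
  have ex: "\<exists>t. t \<in> gsec E V (i + d) \<and> (\<forall>N \<psi>'. openin X N \<and> N \<subseteq> V \<and> \<psi>' \<in> gsec E U i \<and> gres E U N \<psi>' = gres E V N \<psi> \<longrightarrow>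
      gres E V N t = gres E U N (D i \<psi>'))" if p: "\<psi> \<in> gsec E V i" for i \<psi>
  proof -
    \<comment> \<open>The open sets on which \<psi> coincides with some section over
      \<open>U\<close>; by \<open>extension\<close> they cover \<open>V\<close>.\<close>
    define \<U> where "\<U> = {N. openin X N \<and> N \<subseteq> V \<and> (\<exists>\<psi>'\<in>gsec E U i. gres E U N \<psi>' = gres E V N \<psi>)}"
    have "x \<in> \<Union>\<U>" if x: "x \<in> V" for x
    proof -
      obtain N where N: "openin X N" "x \<in> N" "N \<subseteq> V"
        "\<forall>j. \<forall>\<psi>\<in>gsec E V j. \<exists>\<psi>'\<in>gsec E U j. gres E U N \<psi>' = gres E V N \<psi>"
        "\<forall>j. \<forall>f\<in>gsec C V j. \<exists>f'\<in>gsec C U j. gres C U N f' = gres C V N f"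
        using extension[OF U V x] by blast
      then show ?thesis using N(4)[rule_format, OF p] unfolding \<U>_def by blast
    qed
    then have UU: "\<Union>\<U> = V" by (auto simp: \<U>_def)
    define \<psi>N where "\<psi>N N = (SOME \<psi>'. \<psi>' \<in> gsec E U i \<and> gres E U N \<psi>' = gres E V N \<psi>)" for N
    have \<psi>N: "\<psi>N N \<in> gsec E U i" "gres E U N (\<psi>N N) = gres E V N \<psi>" "openin X N" "N \<subseteq> V" "N \<subseteq> U" if "N \<in> \<U>" for N
    proof -
      have "\<exists>\<psi>'. \<psi>' \<in> gsec E U i \<and> gres E U N \<psi>' = gres E V N \<psi>" using that by (auto simp: \<U>_def)
      then have "\<psi>N N \<in> gsec E U i \<and> gres E U N (\<psi>N N) = gres E V N \<psi>" unfolding \<psi>N_def by (rule someI_ex)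
      then show "\<psi>N N \<in> gsec E U i" "gres E U N (\<psi>N N) = gres E V N \<psi>" by auto
      show "openin X N" "N \<subseteq> V" "N \<subseteq> U" using that V by (auto simp: \<U>_def)
    qed
    have "\<exists>!t. t \<in> gsec E (\<Union>\<U>) (i + d) \<and> (\<forall>N\<in>\<U>. gres E (\<Union>\<U>) N t = gres E U N (D i (\<psi>N N)))"
    proof (rule Es.glue)
      show "openin X N" if "N \<in> \<U>" for N using \<psi>N[OF that] by blast
      show "gres E U N (D i (\<psi>N N)) \<in> gsec E N (i + d)" if "N \<in> \<U>" for N
        using Es.res_in[OF U _ _ MU.gmap_in[OF g \<psi>N(1)[OF that] refl]] \<psi>N[OF that] by blast
      fix N N' assume N: "N \<in> \<U>" and N': "N' \<in> \<U>"
      note a = \<psi>N[OF N] and b = \<psi>N[OF N']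
      have o: "openin X (N \<inter> N')" using a b by auto
      have "gres E U (N \<inter> N') (\<psi>N N) = gres E V (N \<inter> N') \<psi>"
        by (rule Es.res_eq_subset[OF U V(1) a(3) o _ a(5,4,1) p a(2)]) simp
      moreover have "gres E U (N \<inter> N') (\<psi>N N') = gres E V (N \<inter> N') \<psi>"
        by (rule Es.res_eq_subset[OF U V(1) b(3) o _ b(5,4,1) p b(2)]) simp
      ultimately have "gres E U (N \<inter> N') (D i (\<psi>N N)) = gres E U (N \<inter> N') (D i (\<psi>N N'))"
        using a b by (intro eqN[OF o]) auto
      then show "gres E N (N \<inter> N') (gres E U N (D i (\<psi>N N))) = gres E N' (N \<inter> N') (gres E U N' (D i (\<psi>N N')))"
        using Es.res_res[OF U a(3) o _ a(5) MU.gmap_in[OF g a(1) refl]]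
          Es.res_res[OF U b(3) o _ b(5) MU.gmap_in[OF g b(1) refl]] by simp
    qed
    then obtain t where t: "t \<in> gsec E V (i + d)" "\<And>N. N \<in> \<U> \<Longrightarrow> gres E V N t = gres E U N (D i (\<psi>N N))"
      unfolding UU by blast
    have "gres E V N t = gres E U N (D i \<psi>')"
      if "openin X N" "N \<subseteq> V" "\<psi>' \<in> gsec E U i" "gres E U N \<psi>' = gres E V N \<psi>" for N \<psi>'
    proof -
      have N: "N \<in> \<U>" using that by (auto simp: \<U>_def)
      show ?thesis unfolding t(2)[OF N]
        by (rule eqN) (use \<psi>N[OF N] that in auto)
    qed
    then show ?thesis using t(1) by blast
  qed
  \<comment> \<open>The property refers to every \<psi>' and not only to the chosen ones, so that
    linearity can be checked with sums and multiples of extensions.\<close>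
  define R where "R i \<psi> t \<longleftrightarrow> t \<in> gsec E V (i + d) \<and> (\<forall>N \<psi>'. openin X N \<and> N \<subseteq> V \<and> \<psi>' \<in> gsec E U i \<and>
      gres E U N \<psi>' = gres E V N \<psi> \<longrightarrow> gres E V N t = gres E U N (D i \<psi>'))" for i \<psi> t
  define D' where "D' i \<psi> = (if \<psi> \<in> gsec E V i then SOME t. R i \<psi> t else 0)" for i \<psi>
  have R: "R i \<psi> (D' i \<psi>)" if "\<psi> \<in> gsec E V i" for i \<psi>
  proof -
    have "\<exists>t. R i \<psi> t" using ex[OF that] by (simp add: R_def)
    then have "R i \<psi> (SOME t. R i \<psi> t)" by (rule someI_ex)
    then show ?thesis using that by (simp add: D'_def)
  qed
  have D'_in: "D' i \<psi> \<in> gsec E V (i + d)" if "\<psi> \<in> gsec E V i" for i \<psi> using R[OF that] by (simp add: R_def)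
  have D'_res: "gres E V N (D' i \<psi>) = gres E U N (D i \<psi>')"
    if "\<psi> \<in> gsec E V i" "openin X N" "N \<subseteq> V" "\<psi>' \<in> gsec E U i" "gres E U N \<psi>' = gres E V N \<psi>" for i \<psi> N \<psi>'
    using R[OF that(1)] that by (simp add: R_def)
  have D'g: "D' \<in> graded_maps E V d"
  proof (rule MV.gmapI)
    fix i \<psi> \<eta> assume p: "\<psi> \<in> gsec E V i" and q: "\<eta> \<in> gsec E V i"
    note pq = MV.M_add[OF p q]
    show "D' i (\<psi> + \<eta>) = D' i \<psi> + D' i \<eta>"
    proof (rule Es.sec_eqI[OF V(1) D'_in[OF pq] MV.M_add[OF D'_in[OF p] D'_in[OF q]]])
      fix x assume x: "x \<in> V"
      obtain N where N: "openin X N" "x \<in> N" "N \<subseteq> V"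
        "\<forall>j. \<forall>\<psi>\<in>gsec E V j. \<exists>\<psi>'\<in>gsec E U j. gres E U N \<psi>' = gres E V N \<psi>"
        "\<forall>j. \<forall>f\<in>gsec C V j. \<exists>f'\<in>gsec C U j. gres C U N f' = gres C V N f"
        using extension[OF U V x] by blast
      obtain \<psi>' \<eta>' where e: "\<psi>' \<in> gsec E U i" "gres E U N \<psi>' = gres E V N \<psi>" "\<eta>' \<in> gsec E U i" "gres E U N \<eta>' = gres E V N \<eta>"
        using N(4)[rule_format, OF p] N(4)[rule_format, OF q] by blast
      have NU: "N \<subseteq> U" using N V by auto
      have "gres E V N (D' i (\<psi> + \<eta>)) = gres E U N (D i (\<psi>' + \<eta>'))"
        by (rule D'_res[OF pq N(1,3) MU.M_add[OF e(1,3)]])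
          (simp add: Es.res_add[OF U N(1) NU e(1,3)] Es.res_add[OF V(1) N(1,3) p q] e)
      also have "\<dots> = gres E V N (D' i \<psi> + D' i \<eta>)"
        using Es.res_add[OF U N(1) NU MU.gmap_in[OF g e(1) refl] MU.gmap_in[OF g e(3) refl]]
          Es.res_add[OF V(1) N(1,3) D'_in[OF p] D'_in[OF q]] D'_res[OF p N(1,3) e(1,2)] D'_res[OF q N(1,3) e(3,4)]
          MU.gmap_add[OF g e(1,3)] by simp
      finally show "\<exists>N. openin X N \<and> x \<in> N \<and> N \<subseteq> V \<and> gres E V N (D' i (\<psi> + \<eta>)) = gres E V N (D' i \<psi> + D' i \<eta>)"
        using N by blast
    qed
  next
    fix i \<psi> and c :: real assume p: "\<psi> \<in> gsec E V i"
    show "D' i \<psi> \<in> gsec E V (i + d)" by (rule D'_in[OF p])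
    note cp = MV.M_scale[OF p, of c]
    show "D' i (c *\<^sub>R \<psi>) = c *\<^sub>R D' i \<psi>"
    proof (rule Es.sec_eqI[OF V(1) D'_in[OF cp] MV.M_scale[OF D'_in[OF p]]])
      fix x assume x: "x \<in> V"
      obtain N where N: "openin X N" "x \<in> N" "N \<subseteq> V"
        "\<forall>j. \<forall>\<psi>\<in>gsec E V j. \<exists>\<psi>'\<in>gsec E U j. gres E U N \<psi>' = gres E V N \<psi>"
        "\<forall>j. \<forall>f\<in>gsec C V j. \<exists>f'\<in>gsec C U j. gres C U N f' = gres C V N f"
        using extension[OF U V x] by blast
      obtain \<psi>' where e: "\<psi>' \<in> gsec E U i" "gres E U N \<psi>' = gres E V N \<psi>" using N(4)[rule_format, OF p] by blast
      have NU: "N \<subseteq> U" using N V by auto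
      have "gres E V N (D' i (c *\<^sub>R \<psi>)) = gres E U N (D i (c *\<^sub>R \<psi>'))"
        by (rule D'_res[OF cp N(1,3) MU.M_scale[OF e(1)]])
          (simp add: Es.res_scale[OF U N(1) NU e(1)] Es.res_scale[OF V(1) N(1,3) p] e)
      also have "\<dots> = gres E V N (c *\<^sub>R D' i \<psi>)"
        using Es.res_scale[OF U N(1) NU MU.gmap_in[OF g e(1) refl]]
          Es.res_scale[OF V(1) N(1,3) D'_in[OF p]] D'_res[OF p N(1,3) e(1,2)] MU.gmap_scale[OF g e(1)] by simp
      finally show "\<exists>N. openin X N \<and> x \<in> N \<and> N \<subseteq> V \<and> gres E V N (D' i (c *\<^sub>R \<psi>)) = gres E V N (c *\<^sub>R D' i \<psi>)"
        using N by blast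
    qed
  qed (simp add: D'_def)
  have ag: "agree V U D V D'" unfolding agree_def using D'_res by (metis (no_types, lifting))
  have "D' \<in> diff_ops C E k V d"
  proof (rule diff_op_locally[OF V(1) D'g])
    fix x assume x: "x \<in> V"
    obtain N where N: "openin X N" "x \<in> N" "N \<subseteq> V"
      and ext: "\<forall>j. \<forall>\<psi>\<in>gsec E V j. \<exists>\<psi>'\<in>gsec E U j. gres E U N \<psi>' = gres E V N \<psi>"
        "\<forall>j. \<forall>f\<in>gsec C V j. \<exists>f'\<in>gsec C U j. gres C U N f' = gres C V N f"
      using extension[OF U V x] by blast
    have "agree N V D' U D" using agree_sym[OF ag] N(3) unfolding agree_def by blast
    then show "\<exists>N W D''. openin X N \<and> x \<in> N \<and> N \<subseteq> V \<and> openin X W \<and> N \<subseteq> W \<and>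
      D'' \<in> diff_ops C E k W d \<and> agree N V D' W D'' \<and>
      (\<forall>j. \<forall>\<psi>\<in>gsec E V j. \<exists>\<psi>'\<in>gsec E W j. gres E W N \<psi>' = gres E V N \<psi>) \<and>
      (\<forall>j. \<forall>f\<in>gsec C V j. \<exists>f'\<in>gsec C W j. gres C W N f' = gres C V N f)"
      using N ext U V(2) D by (intro exI[of _ N] exI[of _ U] exI[of _ D] conjI allI ballI) auto
  qed
  then show ?thesis using ag by blast
qed

end

section \<open>The sheaf of differential operators\<close>

lemma diff_op_sheaf_simps [simp]:
  "gsec (diff_op_sheaf C E k) = diff_ops C E k"
  "gact (diff_op_sheaf C E k) f D = (\<lambda>i \<psi>. gact E f (D i \<psi>))"
  by (simp_all add: diff_op_sheaf_def)

context module_sheaf_with_bumps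
begin

abbreviation resD :: "nat \<Rightarrow> 'a set \<Rightarrow> 'a set \<Rightarrow> 'c gmap \<Rightarrow> 'c gmap" where
  "resD k \<equiv> gres (diff_op_sheaf C E k)"

text \<open>Near each point a section over \<open>V\<close> coincides with one coming from
  \<open>U\<close>, and on such sections both maps are determined by \<open>D\<close>.\<close>

lemma gmap_eq_if_agree:
  assumes U: "openin X U" and V: "openin X V" "V \<subseteq> U"
    and D: "D \<in> graded_maps E U d"
    and D1: "D1 \<in> graded_maps E V d" "agree V U D V D1" and D2: "D2 \<in> graded_maps E V d" "agree V U D V D2"
  shows "D1 = D2"
proof -
  interpret MV: graded_module C V E by (rule module_at[OF V(1)])
  show ?thesis
  proof (rule MV.gmap_eqI[OF D1(1) D2(1)])
    fix i \<psi> assume p: "\<psi> \<in> gsec E V i"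
    show "D1 i \<psi> = D2 i \<psi>"
    proof (rule Es.sec_eqI[OF V(1) MV.gmap_in[OF D1(1) p refl] MV.gmap_in[OF D2(1) p refl]])
      fix x assume x: "x \<in> V"
      obtain N where N: "openin X N" "x \<in> N" "N \<subseteq> V"
        "\<forall>j. \<forall>\<psi>\<in>gsec E V j. \<exists>\<psi>'\<in>gsec E U j. gres E U N \<psi>' = gres E V N \<psi>"
        using extension[OF U V x] by blast
      obtain \<psi>' where e: "\<psi>' \<in> gsec E U i" "gres E U N \<psi>' = gres E V N \<psi>" using N(4)[rule_format, OF p] by blast
      have "gres E V N (D1 i \<psi>) = gres E V N (D2 i \<psi>)"
        using agreeD[OF D1(2) N(1,3) e(1) p e(2)] agreeD[OF D2(2) N(1,3) e(1) p e(2)] by simp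
      then show "\<exists>N. openin X N \<and> x \<in> N \<and> N \<subseteq> V \<and> gres E V N (D1 i \<psi>) = gres E V N (D2 i \<psi>)"
        using N by blast
    qed
  qed
qed

text \<open>The definition of the restriction leaves the degree open, as operators do not record it.
  If \<open>D\<close> has two degrees it is 0, and then every candidate is 0.\<close>

lemma resD_unique:
  assumes U: "openin X U" and V: "openin X V" "V \<subseteq> U" and D: "D \<in> diff_ops C E k U d"
    and D': "D' \<in> diff_ops C E k V d"
    and eq: "\<And>i \<psi>. \<psi> \<in> gsec E U i \<Longrightarrow> D' i (gres E U V \<psi>) = gres E U V (D i \<psi>)"
  shows "resD k U V D = D'"
proof -
  interpret MU: graded_module C U E by (rule module_at[OF U])
  interpret MV: graded_module C V E by (rule module_at[OF V(1)])
  note g = MU.diff_op_gmap[OF D] and g' = MV.diff_op_gmap[OF D']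
  have ag: "agree V U D V D'" by (rule agreeI_restricted[OF U V D' g eq])
  show ?thesis
    unfolding diff_op_sheaf_def gpresheaf.simps
  proof (rule the_equality)
    show "\<exists>d. D \<in> diff_ops C E k U d \<and> D' \<in> diff_ops C E k V d \<and>
        (\<forall>i. \<forall>\<psi>\<in>gsec E U i. D' i (gres E U V \<psi>) = gres E U V (D i \<psi>))"
      using D D' eq by blast
    fix D'' assume "\<exists>d. D \<in> diff_ops C E k U d \<and> D'' \<in> diff_ops C E k V d \<and>
        (\<forall>i. \<forall>\<psi>\<in>gsec E U i. D'' i (gres E U V \<psi>) = gres E U V (D i \<psi>))"
    then obtain d'' where d'': "D \<in> diff_ops C E k U d''" "D'' \<in> diff_ops C E k V d''"
      "\<And>i \<psi>. \<psi> \<in> gsec E U i \<Longrightarrow> D'' i (gres E U V \<psi>) = gres E U V (D i \<psi>)" by blast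
    note h = MU.diff_op_gmap[OF d''(1)] and h'' = MV.diff_op_gmap[OF d''(2)]
    have ag'': "agree V U D V D''" by (rule agreeI_restricted[OF U V d''(2) h d''(3)])
    show "D'' = D'"
    proof (cases "d'' = d")
      case True
      then show ?thesis using gmap_eq_if_agree[OF U V g _ ag'' g' ag] h'' by simp
    next
      case False
      then have D0: "D = 0" using MU.gmap_degree_unique[OF h g] by blast
      have z: "(0 :: 'c gmap) \<in> graded_maps E V e" for e by (rule subspace_0[OF MV.gmaps_subspace])
      have agz: "agree V U D V 0"
        using D0 Es.res_zero[OF U] Es.res_zero[OF V(1)] V(2) by (auto simp: agree_def)
      have "D'' = 0" by (rule gmap_eq_if_agree[OF U V h h'' ag'' z agz])
      moreover have "D' = 0" by (rule gmap_eq_if_agree[OF U V g g' ag z agz])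
      ultimately show ?thesis by simp
    qed
  qed
qed

lemma resD:
  assumes U: "openin X U" and V: "openin X V" "V \<subseteq> U" and D: "D \<in> diff_ops C E k U d"
  shows resD_in: "resD k U V D \<in> diff_ops C E k V d"
    and resD_apply: "\<psi> \<in> gsec E U i \<Longrightarrow> resD k U V D i (gres E U V \<psi>) = gres E U V (D i \<psi>)"
proof -
  interpret MU: graded_module C U E by (rule module_at[OF U])
  interpret MV: graded_module C V E by (rule module_at[OF V(1)])
  obtain D' where D': "D' \<in> diff_ops C E k V d" "agree V U D V D'" using restriction_exists[OF D U V] by blast
  have eq: "D' i (gres E U V \<psi>) = gres E U V (D i \<psi>)" if p: "\<psi> \<in> gsec E U i" for i \<psi>
  proof -
    note r = Es.res_in[OF U V p]
    have "gres E V V (D' i (gres E U V \<psi>)) = gres E U V (D i \<psi>)"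
      using agreeD[OF D'(2) V(1) order_refl p r] Es.res_id[OF V(1) r] by simp
    then show ?thesis using Es.res_id[OF V(1) MV.gmap_in[OF MV.diff_op_gmap[OF D'(1)] r refl]] by simp
  qed
  have "resD k U V D = D'" by (rule resD_unique[OF U V D D'(1) eq])
  then show "resD k U V D \<in> diff_ops C E k V d"
    "\<psi> \<in> gsec E U i \<Longrightarrow> resD k U V D i (gres E U V \<psi>) = gres E U V (D i \<psi>)"
    using D' eq by auto
qed

lemma diff_op_presheaf: "graded_presheaf X (diff_op_sheaf C E k)"
proof -
  have P1: "subspace (diff_ops C E k U j)" if "openin X U" for U j
    by (rule graded_module.diff_ops_subspace[OF module_at[OF that]])
  have P4: "resD k U U D = D" if U: "openin X U" and D: "D \<in> diff_ops C E k U j" for U j D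
  proof -
    interpret MU: graded_module C U E by (rule module_at[OF U])
    show ?thesis
    proof (rule resD_unique[OF U U order_refl D D])
      fix i \<psi> assume p: "\<psi> \<in> gsec E U i"
      show "D i (gres E U U \<psi>) = gres E U U (D i \<psi>)"
        unfolding Es.res_id[OF U p] Es.res_id[OF U MU.gmap_in[OF MU.diff_op_gmap[OF D] p refl]] ..
    qed
  qed
  have P2: "diff_ops C E k U i \<inter> diff_ops C E k U j = {0}" if U: "openin X U" and ij: "i \<noteq> j" for U and i j :: int
  proof -
    interpret MU: graded_module C U E by (rule module_at[OF U])
    show ?thesis
      using MU.gmap_degree_unique[OF MU.diff_op_gmap MU.diff_op_gmap ij] subspace_0[OF MU.diff_ops_subspace] by blast
  qed
  have P3: "resD k U V ` diff_ops C E k U j \<subseteq> diff_ops C E k V j"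
    if U: "openin X U" and V: "openin X V" "V \<subseteq> U" for U V j using resD_in[OF U V] by blast
  have P3': "lin_on (diff_ops C E k U j) (resD k U V)"
    if U: "openin X U" and V: "openin X V" "V \<subseteq> U" for U V j
    unfolding lin_on_def
  proof (intro conjI ballI allI)
    interpret MU: graded_module C U E by (rule module_at[OF U])
    interpret MV: graded_module C V E by (rule module_at[OF V(1)])
    fix D D' assume D: "D \<in> diff_ops C E k U j" and D': "D' \<in> diff_ops C E k U j"
    note g = MU.diff_op_gmap[OF D] and g' = MU.diff_op_gmap[OF D']
    show "resD k U V (D + D') = resD k U V D + resD k U V D'"
      by (rule resD_unique[OF U V subspace_add[OF MU.diff_ops_subspace D D']
            subspace_add[OF MV.diff_ops_subspace resD_in[OF U V D] resD_in[OF U V D']]])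
        (simp add: resD_apply[OF U V D] resD_apply[OF U V D']
          Es.res_add[OF U V MU.gmap_in[OF g _ refl] MU.gmap_in[OF g' _ refl]])
  next
    interpret MU: graded_module C U E by (rule module_at[OF U])
    interpret MV: graded_module C V E by (rule module_at[OF V(1)])
    fix c D assume D: "D \<in> diff_ops C E k U j"
    note g = MU.diff_op_gmap[OF D]
    show "resD k U V (c *\<^sub>R D) = c *\<^sub>R resD k U V D"
      by (rule resD_unique[OF U V subspace_scale[OF MU.diff_ops_subspace D]
            subspace_scale[OF MV.diff_ops_subspace resD_in[OF U V D]]])
        (simp add: resD_apply[OF U V D] Es.res_scale[OF U V MU.gmap_in[OF g _ refl]])
  qed
  have P5: "resD k V W (resD k U V D) = resD k U W D"
    if D: "D \<in> diff_ops C E k U j" and U: "openin X U" and V: "openin X V" and W: "openin X W"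
      and WV: "W \<subseteq> V" and VU: "V \<subseteq> U" for U V W j D
  proof (rule sym, rule resD_unique[OF U W _ D])
    interpret MU: graded_module C U E by (rule module_at[OF U])
    note g = MU.diff_op_gmap[OF D] and r = resD_in[OF U V VU D]
    show "W \<subseteq> U" using WV VU by auto
    show "resD k V W (resD k U V D) \<in> diff_ops C E k W j" by (rule resD_in[OF V W WV r])
    fix i \<psi> assume p: "\<psi> \<in> gsec E U i"
    show "resD k V W (resD k U V D) i (gres E U W \<psi>) = gres E U W (D i \<psi>)"
      using resD_apply[OF V W WV r Es.res_in[OF U V VU p]] resD_apply[OF U V VU D p]
        Es.res_res[OF U V W WV VU p] Es.res_res[OF U V W WV VU MU.gmap_in[OF g p refl]] by simp
  qed
  show ?thesis
    unfolding graded_presheaf_def diff_op_sheaf_simps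
    by (rule conjI, (intro allI impI, erule P1), rule conjI, (intro allI impI, elim conjE, erule (1) P2),
        rule conjI, (intro allI impI, elim conjE, rule conjI, erule (2) P3, erule (2) P3'), rule conjI,
        (intro allI ballI impI, erule (1) P4), (intro allI ballI impI, elim conjE, erule (5) P5))
qed

text \<open>The value on a section over the union is glued from the values of the local operators on
  its restrictions; the order follows from \<open>diff_op_locally\<close>, with the members of the
  cover as neighbourhoods.\<close>

lemma diff_op_glue:
  assumes open_U: "\<And>V. V \<in> \<U> \<Longrightarrow> openin X V" and s: "\<And>V. V \<in> \<U> \<Longrightarrow> s V \<in> diff_ops C E k V d"
    and compat: "\<And>V W. V \<in> \<U> \<Longrightarrow> W \<in> \<U> \<Longrightarrow> resD k V (V \<inter> W) (s V) = resD k W (V \<inter> W) (s W)"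
  shows "\<exists>!t. t \<in> diff_ops C E k (\<Union>\<U>) d \<and> (\<forall>V\<in>\<U>. resD k (\<Union>\<U>) V t = s V)"
proof -
  let ?U = "\<Union>\<U>"
  have U: "openin X ?U" using open_U by blast
  have sub: "V \<subseteq> ?U" if "V \<in> \<U>" for V using that by blast
  interpret MU: graded_module C ?U E by (rule module_at[OF U])
  have sg: "s V \<in> graded_maps E V d" if "V \<in> \<U>" for V
    using graded_module.diff_op_gmap[OF module_at[OF open_U[OF that]] s[OF that]] .
  have s_in: "s V i (gres E ?U V \<psi>) \<in> gsec E V (i + d)" if "V \<in> \<U>" "\<psi> \<in> gsec E ?U i" for V i \<psi>
    using graded_module.gmap_in[OF module_at[OF open_U[OF that(1)]] sg[OF that(1)]
        Es.res_in[OF U open_U[OF that(1)] sub[OF that(1)] that(2)] refl] .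
  have ex: "\<exists>!t. t \<in> gsec E ?U (i + d) \<and> (\<forall>V\<in>\<U>. gres E ?U V t = s V i (gres E ?U V \<psi>))"
    if p: "\<psi> \<in> gsec E ?U i" for i \<psi>
  proof (rule Es.glue[OF open_U s_in[OF _ p]])
    fix V W assume VW: "V \<in> \<U>" "W \<in> \<U>"
    note V = open_U[OF VW(1)] and W = open_U[OF VW(2)]
    have I: "openin X (V \<inter> W)" using V W by auto
    have "gres E V (V \<inter> W) (s V i (gres E ?U V \<psi>)) = resD k V (V \<inter> W) (s V) i (gres E ?U (V \<inter> W) \<psi>)"
      using resD_apply[OF V I _ s[OF VW(1)] Es.res_in[OF U V sub[OF VW(1)] p]]
        Es.res_res[OF U V I _ sub[OF VW(1)] p] by simp
    also have "\<dots> = gres E W (V \<inter> W) (s W i (gres E ?U W \<psi>))"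
      unfolding compat[OF VW]
      using resD_apply[OF W I _ s[OF VW(2)] Es.res_in[OF U W sub[OF VW(2)] p]]
        Es.res_res[OF U W I _ sub[OF VW(2)] p] by simp
    finally show "gres E V (V \<inter> W) (s V i (gres E ?U V \<psi>)) = gres E W (V \<inter> W) (s W i (gres E ?U W \<psi>))" .
  qed
  define t where "t i \<psi> = (if \<psi> \<in> gsec E ?U i then THE t. t \<in> gsec E ?U (i + d) \<and>
      (\<forall>V\<in>\<U>. gres E ?U V t = s V i (gres E ?U V \<psi>)) else 0)" for i \<psi>
  have t: "t i \<psi> \<in> gsec E ?U (i + d) \<and> (\<forall>V\<in>\<U>. gres E ?U V (t i \<psi>) = s V i (gres E ?U V \<psi>))"
    if "\<psi> \<in> gsec E ?U i" for i \<psi>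
    using theI'[OF ex[OF that]] that by (simp add: t_def)
  have t_in: "t i \<psi> \<in> gsec E ?U (i + d)" if "\<psi> \<in> gsec E ?U i" for i \<psi> using t[OF that] by blast
  have t_res: "gres E ?U V (t i \<psi>) = s V i (gres E ?U V \<psi>)" if "\<psi> \<in> gsec E ?U i" "V \<in> \<U>" for i \<psi> V
    using t[OF that(1)] that(2) by blast
  have eqI: "a = b" if "a \<in> gsec E ?U j" "b \<in> gsec E ?U j" "\<And>V. V \<in> \<U> \<Longrightarrow> gres E ?U V a = gres E ?U V b" for a b j
  proof (rule Es.sec_eqI[OF U that(1,2)])
    fix x assume "x \<in> ?U"
    then obtain V where "V \<in> \<U>" "x \<in> V" by blast
    then show "\<exists>N. openin X N \<and> x \<in> N \<and> N \<subseteq> ?U \<and> gres E ?U N a = gres E ?U N b"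
      using open_U sub that(3) by blast
  qed
  have tg: "t \<in> graded_maps E ?U d"
  proof (rule MU.gmapI)
    fix i \<psi> \<eta> assume p: "\<psi> \<in> gsec E ?U i" and q: "\<eta> \<in> gsec E ?U i"
    note pq = MU.M_add[OF p q]
    show "t i (\<psi> + \<eta>) = t i \<psi> + t i \<eta>"
    proof (rule eqI[OF t_in[OF pq] MU.M_add[OF t_in[OF p] t_in[OF q]]])
      fix V assume V: "V \<in> \<U>"
      interpret MV: graded_module C V E by (rule module_at[OF open_U[OF V]])
      note R = Es.res_add[OF U open_U[OF V] sub[OF V]] and I = Es.res_in[OF U open_U[OF V] sub[OF V]]
      show "gres E ?U V (t i (\<psi> + \<eta>)) = gres E ?U V (t i \<psi> + t i \<eta>)"
        unfolding t_res[OF pq V] R[OF p q] R[OF t_in[OF p] t_in[OF q]] t_res[OF p V] t_res[OF q V]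
        by (rule MV.gmap_add[OF sg[OF V] I[OF p] I[OF q]])
    qed
  next
    fix i \<psi> and c :: real assume p: "\<psi> \<in> gsec E ?U i"
    show "t i \<psi> \<in> gsec E ?U (i + d)" by (rule t_in[OF p])
    note cp = MU.M_scale[OF p, of c]
    show "t i (c *\<^sub>R \<psi>) = c *\<^sub>R t i \<psi>"
    proof (rule eqI[OF t_in[OF cp] MU.M_scale[OF t_in[OF p]]])
      fix V assume V: "V \<in> \<U>"
      interpret MV: graded_module C V E by (rule module_at[OF open_U[OF V]])
      note R = Es.res_scale[OF U open_U[OF V] sub[OF V]] and I = Es.res_in[OF U open_U[OF V] sub[OF V]]
      show "gres E ?U V (t i (c *\<^sub>R \<psi>)) = gres E ?U V (c *\<^sub>R t i \<psi>)"
        unfolding t_res[OF cp V] R[OF p] R[OF t_in[OF p]] t_res[OF p V]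
        by (rule MV.gmap_scale[OF sg[OF V] I[OF p]])
    qed
  qed (simp add: t_def)
  have ag: "agree V ?U t V (s V)" if V: "V \<in> \<U>" for V
    by (rule agreeI_restricted[OF U open_U[OF V] sub[OF V] s[OF V] tg]) (simp add: t_res[OF _ V])
  have tD: "t \<in> diff_ops C E k ?U d"
  proof (rule diff_op_locally[OF U tg])
    fix x assume "x \<in> ?U"
    then obtain V where V: "V \<in> \<U>" "x \<in> V" by blast
    note o = open_U[OF V(1)] and sb = sub[OF V(1)]
    have "\<forall>j. \<forall>\<psi>\<in>gsec E ?U j. \<exists>\<psi>'\<in>gsec E V j. gres E V V \<psi>' = gres E ?U V \<psi>"
      using Es.res_in[OF U o sb] Es.res_id[OF o] by blast
    moreover have "\<forall>j. \<forall>f\<in>gsec C ?U j. \<exists>f'\<in>gsec C V j. gres C V V f' = gres C ?U V f"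
      using Cs.res_in[OF U o sb] Cs.res_id[OF o] by blast
    ultimately show "\<exists>N W D'. openin X N \<and> x \<in> N \<and> N \<subseteq> ?U \<and> openin X W \<and> N \<subseteq> W \<and>
      D' \<in> diff_ops C E k W d \<and> agree N ?U t W D' \<and>
      (\<forall>j. \<forall>\<psi>\<in>gsec E ?U j. \<exists>\<psi>'\<in>gsec E W j. gres E W N \<psi>' = gres E ?U N \<psi>) \<and>
      (\<forall>j. \<forall>f\<in>gsec C ?U j. \<exists>f'\<in>gsec C W j. gres C W N f' = gres C ?U N f)"
      using o sb V s[OF V(1)] ag[OF V(1)]
      by (intro exI[of _ V] exI[of _ "s V"] conjI order_refl) assumption+
  qed
  show ?thesis
  proof (rule ex1I[of _ t], intro conjI ballI tD)
    fix V assume V: "V \<in> \<U>"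
    show "resD k ?U V t = s V"
      by (rule resD_unique[OF U open_U[OF V] sub[OF V] tD s[OF V]]) (simp add: t_res[OF _ V])
  next
    fix t' assume t': "t' \<in> diff_ops C E k ?U d \<and> (\<forall>V\<in>\<U>. resD k ?U V t' = s V)"
    then have t'D: "t' \<in> diff_ops C E k ?U d" by blast
    note g' = MU.diff_op_gmap[OF t'D]
    show "t' = t"
    proof (rule MU.gmap_eqI[OF g' tg])
      fix i \<psi> assume p: "\<psi> \<in> gsec E ?U i"
      show "t' i \<psi> = t i \<psi>"
      proof (rule eqI[OF MU.gmap_in[OF g' p refl] t_in[OF p]])
        fix V assume V: "V \<in> \<U>"
        show "gres E ?U V (t' i \<psi>) = gres E ?U V (t i \<psi>)"
          using resD_apply[OF U open_U[OF V] sub[OF V] t'D p] t' V t_res[OF p V] by simp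
      qed
    qed
  qed
qed

lemma diff_op_sheaf: "graded_sheaf X (diff_op_sheaf C E k)"
  unfolding graded_sheaf_def
proof (intro conjI diff_op_presheaf allI impI; elim conjE)
  fix \<U> :: "'a set set" and d and s :: "'a set \<Rightarrow> 'c gmap"
  assume a: "\<forall>V\<in>\<U>. openin X V \<and> s V \<in> gsec (diff_op_sheaf C E k) V d"
    and c: "\<forall>V\<in>\<U>. \<forall>W\<in>\<U>. resD k V (V \<inter> W) (s V) = resD k W (V \<inter> W) (s W)"
  show "\<exists>!t. t \<in> gsec (diff_op_sheaf C E k) (\<Union>\<U>) d \<and> (\<forall>V\<in>\<U>. resD k (\<Union>\<U>) V t = s V)"
    unfolding diff_op_sheaf_simps
  proof (rule diff_op_glue)
    show "openin X V" "s V \<in> diff_ops C E k V d" if "V \<in> \<U>" for V using a that by simp_all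
    show "resD k V (V \<inter> W) (s V) = resD k W (V \<inter> W) (s W)" if "V \<in> \<U>" "W \<in> \<U>" for V W
      by (rule bspec[OF bspec[OF c that(1)] that(2)])
  qed
qed

lemma diff_op_module_sheaf: "graded_module_sheaf X C (diff_op_sheaf C E k)"
proof -
  have M: "(\<forall>j. \<forall>D\<in>diff_ops C E k U j. (\<lambda>i \<psi>. gact E (gone C U) (D i \<psi>)) = D \<and>
      (\<forall>i. lin_on (gsec C U i) (\<lambda>f i \<psi>. gact E f (D i \<psi>)))) \<and>
    (\<forall>i. \<forall>f\<in>gsec C U i. \<forall>j. lin_on (diff_ops C E k U j) (\<lambda>D i \<psi>. gact E f (D i \<psi>)) \<and>
      (\<forall>D\<in>diff_ops C E k U j. (\<lambda>i \<psi>. gact E f (D i \<psi>)) \<in> diff_ops C E k U (i + j) \<and>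
        (\<forall>l. \<forall>h\<in>gsec C U l. (\<lambda>i \<psi>. gact E (gmul C h f) (D i \<psi>)) = (\<lambda>i \<psi>. gact E h (gact E f (D i \<psi>))))))"
    if U: "openin X U" for U
  proof (intro conjI allI ballI)
    interpret MU: graded_module C U E by (rule module_at[OF U])
    fix j D assume D: "D \<in> diff_ops C E k U j"
    note g = MU.diff_op_gmap[OF D]
    show "(\<lambda>i \<psi>. gact E (gone C U) (D i \<psi>)) = D"
      by (rule MU.gmap_eqI[OF MU.fmul_gmap[OF g MU.one_in refl] g])
        (rule MU.one_act[OF MU.gmap_in[OF g _ refl]])
    fix i
    show "lin_on (gsec C U i) (\<lambda>f i \<psi>. gact E f (D i \<psi>))"
      unfolding lin_on_def
    proof (intro conjI ballI allI)
      fix f h assume f: "f \<in> gsec C U i" and h: "h \<in> gsec C U i"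
      have fh: "f + h \<in> gsec C U i" using subspace_add[OF MU.A_subspace f h] .
      show "(\<lambda>i \<psi>. gact E (f + h) (D i \<psi>)) = (\<lambda>i \<psi>. gact E f (D i \<psi>)) + (\<lambda>i \<psi>. gact E h (D i \<psi>))"
        by (rule MU.gmap_eqI[OF MU.fmul_gmap[OF g fh refl] subspace_add[OF MU.gmaps_subspace MU.fmul_gmap[OF g f refl] MU.fmul_gmap[OF g h refl]]])
          (simp add: MU.act_add_left[OF f h MU.gmap_in[OF g _ refl]])
    next
      fix c f assume f: "f \<in> gsec C U i"
      show "(\<lambda>i \<psi>. gact E (c *\<^sub>R f) (D i \<psi>)) = c *\<^sub>R (\<lambda>i \<psi>. gact E f (D i \<psi>))"
        by (rule MU.gmap_eqI[OF MU.fmul_gmap[OF g MU.A_scale[OF f] refl] subspace_scale[OF MU.gmaps_subspace MU.fmul_gmap[OF g f refl]]])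
          (simp add: MU.act_scale_left[OF f MU.gmap_in[OF g _ refl]])
    qed
  next
    interpret MU: graded_module C U E by (rule module_at[OF U])
    fix i f j assume f: "f \<in> gsec C U i"
    show "lin_on (diff_ops C E k U j) (\<lambda>D i \<psi>. gact E f (D i \<psi>))"
      unfolding lin_on_def diff_op_sheaf_simps
    proof (intro conjI ballI allI)
      fix D D' assume D: "D \<in> diff_ops C E k U j" and D': "D' \<in> diff_ops C E k U j"
      note g = MU.diff_op_gmap[OF D] and g' = MU.diff_op_gmap[OF D']
      show "(\<lambda>i \<psi>. gact E f ((D + D') i \<psi>)) = (\<lambda>i \<psi>. gact E f (D i \<psi>)) + (\<lambda>i \<psi>. gact E f (D' i \<psi>))"
        by (rule MU.gmap_eqI[OF MU.fmul_gmap[OF subspace_add[OF MU.gmaps_subspace g g'] f refl] subspace_add[OF MU.gmaps_subspace MU.fmul_gmap[OF g f refl] MU.fmul_gmap[OF g' f refl]]])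
          (simp add: MU.act_add_right[OF f MU.gmap_in[OF g _ refl] MU.gmap_in[OF g' _ refl]])
    next
      fix c D assume D: "D \<in> diff_ops C E k U j"
      note g = MU.diff_op_gmap[OF D]
      show "(\<lambda>i \<psi>. gact E f ((c *\<^sub>R D) i \<psi>)) = c *\<^sub>R (\<lambda>i \<psi>. gact E f (D i \<psi>))"
        by (rule MU.gmap_eqI[OF MU.fmul_gmap[OF subspace_scale[OF MU.gmaps_subspace g] f refl] subspace_scale[OF MU.gmaps_subspace MU.fmul_gmap[OF g f refl]]])
          (simp add: MU.act_scale_right[OF f MU.gmap_in[OF g _ refl]])
    qed
    fix D assume D: "D \<in> diff_ops C E k U j"
    note g = MU.diff_op_gmap[OF D]
    show "(\<lambda>i \<psi>. gact E f (D i \<psi>)) \<in> diff_ops C E k U (i + j)" by (rule MU.fmul_diff_op[OF D f refl])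
    fix l h assume h: "h \<in> gsec C U l"
    show "(\<lambda>i \<psi>. gact E (gmul C h f) (D i \<psi>)) = (\<lambda>i \<psi>. gact E h (gact E f (D i \<psi>)))"
      by (rule MU.gmap_eqI[OF MU.fmul_gmap[OF g MU.mul_in_deg[OF h f] refl] MU.fmul_gmap[OF MU.fmul_gmap[OF g f refl] h refl]])
        (rule MU.mul_act[OF h f MU.gmap_in[OF g _ refl]])
  qed
  have R: "resD k U V (\<lambda>i \<psi>. gact E f (D i \<psi>)) = (\<lambda>i \<psi>. gact E (gres C U V f) (resD k U V D i \<psi>))"
    if U: "openin X U" and V: "openin X V" "V \<subseteq> U" and f: "f \<in> gsec C U i" and D: "D \<in> diff_ops C E k U j"
    for U V i j f D
  proof -
    interpret MU: graded_module C U E by (rule module_at[OF U])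
    interpret MV: graded_module C V E by (rule module_at[OF V(1)])
    note g = MU.diff_op_gmap[OF D]
    show ?thesis
      by (rule resD_unique[OF U V MU.fmul_diff_op[OF D f refl] MV.fmul_diff_op[OF resD_in[OF U V D] Cs.res_in[OF U V f] refl]])
        (simp add: resD_apply[OF U V D] res_act[OF U V f MU.gmap_in[OF g _ refl]])
  qed
  show ?thesis
    unfolding graded_module_sheaf_def diff_op_sheaf_simps
    by (rule conjI[OF diff_op_sheaf], rule conjI, (rule allI, rule impI, erule M),
        (intro allI impI ballI, elim conjE, erule (4) R))
qed

end

section \<open>Charts, bump functions and frames\<close>

lemma (in chart_on_algebra) graded_coordinates: "graded_coordinates C U n dz zc dc"
proof unfold_locales
  show "T = 0" if "T \<in> graded_maps C U d" "T 0 (gone C U) = 0"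
    "\<And>A i f. A < n \<Longrightarrow> f \<in> gsec C U i \<Longrightarrow> \<exists>s::real. (dz A = 0 \<longrightarrow> s = 1) \<and>
      T (i + dz A) (gmul C (zc A) f) = s *\<^sub>R gmul C (zc A) (T i f)" for T d
    by (rule zero_if_commutes_chart[OF that])
qed (fact zc_in dc_derivation dc_zc)+

lemma chart_res:
  assumes "graded_chart X C nd U n dz \<phi> pb" "openin X V" "V \<subseteq> U" "openin X V'" "V' \<subseteq> V"
    "F \<in> gsec (graded_model n dz) (\<phi> ` V) j"
  shows "gres C V V' (pb V F) = pb V' (gres (graded_model n dz) (\<phi> ` V) (\<phi> ` V') F)"
proof -
  have "\<forall>V' j. \<forall>F\<in>gsec (graded_model n dz) (\<phi> ` V) j. openin X V' \<and> V' \<subseteq> V \<longrightarrow>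
      pb V' (gres (graded_model n dz) (\<phi> ` V) (\<phi> ` V') F) = gres C V V' (pb V F)"
    using assms(1)[unfolded graded_chart_def, THEN conjunct2, THEN conjunct2, THEN conjunct2, THEN conjunct2,
        THEN spec, THEN mp, OF conjI[OF assms(2,3)], THEN conjunct2, THEN conjunct2, THEN conjunct2] .
  then show ?thesis using assms(4-6) by simp
qed

lemma model_res_in:
  assumes "openin (body_space n dz) W" "openin (body_space n dz) W'" "W' \<subseteq> W" "F \<in> gsec (graded_model n dz) W j"
  shows "gres (graded_model n dz) W W' F \<in> gsec (graded_model n dz) W' j"
  unfolding model_sec_iff
proof (intro allI conjI impI)
  fix p
  have "smooth_on n dz W' (F p)" using smooth_on_subset[OF _ assms(1,3)] assms(4) by (simp add: model_sec_iff)
  then show "smooth_on n dz W' (gres (graded_model n dz) W W' F p)"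
    by (rule smooth_on_cong[OF assms(2)]) (simp add: model_res)
  show "gres (graded_model n dz) W W' F p x = 0" if "x \<notin> W'" for x using that by (simp add: model_res)
  assume "gres (graded_model n dz) W W' F p \<noteq> 0"
  then have "F p \<noteq> 0" by (auto simp: fun_eq_iff model_res split: if_splits)
  then show "p \<in> formal_exponents n dz" "exponent_degree n dz p = j" using assms(4) by (auto simp: model_sec_iff)
qed

text \<open>A bump function in a chart is extended by 0 to \<open>U\<close>. For this the set
  \<open>K'\<close> containing its support has to be closed in \<open>X\<close> and not only in the
  chart: it is compact, and \<open>X\<close> is Hausdorff.\<close>

lemma manifold_bump:
  assumes M: "graded_manifold X C nd" and U: "openin X U" and V: "openin X V" "V \<subseteq> U" and x: "x \<in> V"
  shows "\<exists>b N N'. b \<in> gsec C U 0 \<and> openin X N \<and> x \<in> N \<and> N \<subseteq> V \<and> openin X N' \<and> V \<union> N' = U \<and>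
    gres C U N b = gone C N \<and> gres C U N' b = 0"
proof -
  have C: "graded_algebra_sheaf X C" and H: "Hausdorff_space X" using M by (simp_all add: graded_manifold_def)
  have "x \<in> topspace X" using x openin_subset[OF V(1)] by blast
  then obtain n dz U0 \<phi> pb where U0: "x \<in> U0" and ch: "graded_chart X C nd U0 n dz \<phi> pb"
    using M unfolding graded_manifold_def by blast
  interpret Cs: gsheaf X C by unfold_locales (use C in \<open>simp add: graded_algebra_sheaf_def\<close>)
  have oU0: "openin X U0" and hom: "homeomorphic_map (subtopology X U0) (subtopology (body_space n dz) (\<phi> ` U0)) \<phi>"
    and oW0: "openin (body_space n dz) (\<phi> ` U0)"
    using ch by (simp_all add: graded_chart_def)
  define V0 where "V0 = V \<inter> U0"
  have V0: "openin X V0" "V0 \<subseteq> U0" "V0 \<subseteq> V" "V0 \<subseteq> U" "x \<in> V0" using V oU0 x U0 by (auto simp: V0_def)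
  interpret ch: chart_on_algebra C V0 n dz "\<phi> ` V0" "pb V0" by (rule chart_on_algebraI[OF C ch V0(1,2)])
  note W = ch.W_open
  obtain \<beta> K Vb where \<beta>: "smooth_on n dz (body n dz) \<beta>" "compact K" "K \<subseteq> \<phi> ` V0" "openin (body_space n dz) Vb"
    "\<phi> x \<in> Vb" "Vb \<subseteq> K" "\<And>y. y \<in> Vb \<Longrightarrow> \<beta> y = 1" "\<And>y. y \<in> body n dz - K \<Longrightarrow> \<beta> y = 0"
    using bump_function[OF W, of "\<phi> x"] V0(5) by blast
  have t0: "topspace (subtopology X U0) = U0" using openin_subset[OF oU0] by auto
  have tW0: "topspace (subtopology (body_space n dz) (\<phi> ` U0)) = \<phi> ` U0" using openin_subset[OF oW0] by auto
  obtain g where g: "homeomorphic_maps (subtopology X U0) (subtopology (body_space n dz) (\<phi> ` U0)) \<phi> g"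
    using hom homeomorphic_map_maps by blast
  then have g': "continuous_map (subtopology X U0) (subtopology (body_space n dz) (\<phi> ` U0)) \<phi>"
    "continuous_map (subtopology (body_space n dz) (\<phi> ` U0)) (subtopology X U0) g"
    "\<And>y. y \<in> U0 \<Longrightarrow> g (\<phi> y) = y"
    unfolding homeomorphic_maps_def t0 by blast+
  define K' where "K' = {y \<in> V0. \<phi> y \<in> K}"
  have K'g: "K' = g ` K"
  proof (intro equalityI subsetI)
    fix y assume y: "y \<in> K'"
    then have "y = g (\<phi> y)" using g'(3)[of y] V0(2) by (auto simp: K'_def)
    then show "y \<in> g ` K" using y by (auto simp: K'_def)
  next
    fix y assume "y \<in> g ` K"
    then obtain w where w: "w \<in> K" "y = g w" by blast
    then obtain v where "v \<in> V0" "w = \<phi> v" using \<beta>(3) by blast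
    then show "y \<in> K'" using w g'(3)[of v] V0(2) by (auto simp: K'_def)
  qed
  have "compactin (subtopology (body_space n dz) (\<phi> ` U0)) K"
    using \<beta>(2,3) V0(2) openin_body_subset[OF W]
    by (auto simp: compactin_subtopology body_space_eq)
  then have "compactin (subtopology X U0) K'" unfolding K'g by (rule image_compactin[OF _ g'(2)])
  then have "closedin X K'" using compactin_imp_closedin[OF H] by (simp add: compactin_subtopology)
  then have N': "openin X (U - K')" by (rule openin_diff[OF U])
  define N where "N = {y \<in> U0. \<phi> y \<in> Vb \<inter> \<phi> ` U0}"
  have NV0: "N \<subseteq> K'"
  proof
    fix y assume y: "y \<in> N"
    then have "\<phi> y \<in> K" using \<beta>(6) by (auto simp: N_def)
    then obtain v where v: "v \<in> V0" "\<phi> y = \<phi> v" using \<beta>(3) by blast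
    then have "y = v" using g'(3)[of y] g'(3)[of v] y V0(2) by (auto simp: N_def)
    then show "y \<in> K'" using v \<open>\<phi> y \<in> K\<close> by (simp add: K'_def)
  qed
  have "openin (subtopology (body_space n dz) (\<phi> ` U0)) (Vb \<inter> \<phi> ` U0)"
    using \<beta>(4) by (auto simp: openin_subtopology)
  from openin_continuous_map_preimage[OF g'(1) this]
  have "openin (subtopology X U0) N" unfolding N_def t0 .
  then have oN: "openin X N" using oU0 openin_trans_full by blast
  have K'V0: "K' \<subseteq> V0" by (auto simp: K'_def)
  have NV: "N \<subseteq> V0" using NV0 K'V0 by blast
  have xN: "x \<in> N" using \<beta>(5) V0 by (auto simp: N_def)
  \<comment> \<open>The bump function as a power series that has only a constant
    coefficient.\<close>
  define \<beta>' where "\<beta>' = (\<lambda>p y. if p = (0 :: nat \<Rightarrow> nat) \<and> y \<in> \<phi> ` V0 then \<beta> y else 0)"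
  have \<beta>': "\<beta>' \<in> gsec (graded_model n dz) (\<phi> ` V0) 0"
    unfolding model_sec_iff
  proof (intro allI conjI impI)
    fix p
    have s: "smooth_on n dz (\<phi> ` V0) \<beta>"
      by (rule smooth_on_subset[OF \<beta>(1) openin_body openin_body_subset[OF W]])
    show "smooth_on n dz (\<phi> ` V0) (\<beta>' p)"
    proof (cases "p = 0")
      case True then show ?thesis by (intro smooth_on_cong[OF W s]) (simp add: \<beta>'_def)
    next
      case False then show ?thesis
        using smooth_on_const[OF openin_body_subset[OF W], of 0] by (simp add: \<beta>'_def)
    qed
    show "\<beta>' p y = 0" if "y \<notin> \<phi> ` V0" for y using that by (simp add: \<beta>'_def)
    assume "\<beta>' p \<noteq> 0"
    then have "p = 0" by (auto simp: \<beta>'_def fun_eq_iff split: if_splits)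
    then show "p \<in> formal_exponents n dz" "exponent_degree n dz p = 0" by simp_all
  qed
  let ?b0 = "pb V0 \<beta>'"
  have b0: "?b0 \<in> gsec C V0 0" by (rule ch.pb_in[OF \<beta>'])
  have I: "openin X (V0 \<inter> (U - K'))" using V0(1) N' by (rule openin_Int)
  interpret chI: chart_on_algebra C "V0 \<inter> (U - K')" n dz "\<phi> ` (V0 \<inter> (U - K'))" "pb (V0 \<inter> (U - K'))"
    by (rule chart_on_algebraI[OF C ch I]) (use V0 in auto)
  interpret chN: chart_on_algebra C N n dz "\<phi> ` N" "pb N"
    by (rule chart_on_algebraI[OF C ch oN]) (use NV V0 in auto)
  have "gres (graded_model n dz) (\<phi> ` V0) (\<phi> ` (V0 \<inter> (U - K'))) \<beta>' = 0"
  proof (intro ext)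
    fix p y
    have "\<beta> y = 0" if "y \<in> \<phi> ` (V0 \<inter> (U - K'))"
      using that \<beta>(8)[of y] openin_body_subset[OF W] by (auto simp: K'_def)
    then show "gres (graded_model n dz) (\<phi> ` V0) (\<phi> ` (V0 \<inter> (U - K'))) \<beta>' p y = 0 p y"
      by (auto simp: model_res \<beta>'_def)
  qed
  then have "gres C V0 (V0 \<inter> (U - K')) ?b0 = 0"
    using chart_res[OF ch V0(1,2) I _ \<beta>'] lin_on_zero[OF chI.pb_lin subspace_0[OF chI.M_subspace]]
    by (simp del: zero_fun_apply)
  then have eq: "gres C V0 (V0 \<inter> (U - K')) ?b0 = gres C (U - K') (V0 \<inter> (U - K')) 0"
    using Cs.res_zero[OF N' I] by simp
  have UU: "V0 \<union> (U - K') = U" using V0 K'V0 by blast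
  obtain b where b: "b \<in> gsec C U 0" "gres C U V0 b = ?b0" "gres C U (U - K') b = 0"
    using Cs.glue2[OF V0(1) N' b0 Cs.sec_zero[OF N'] eq] unfolding UU by blast
  have "gres (graded_model n dz) (\<phi> ` V0) (\<phi> ` N) \<beta>' = gone (graded_model n dz) (\<phi> ` N)"
  proof (intro ext)
    fix p y
    have "\<beta> y = 1 \<and> y \<in> \<phi> ` V0" if "y \<in> \<phi> ` N"
      using that NV \<beta>(7) by (auto simp: N_def)
    then show "gres (graded_model n dz) (\<phi> ` V0) (\<phi> ` N) \<beta>' p y = gone (graded_model n dz) (\<phi> ` N) p y"
      by (auto simp: model_res model_one \<beta>'_def)
  qed
  then have "gres C V0 N ?b0 = gone C N"
    using chart_res[OF ch V0(1,2) oN NV \<beta>'] chN.pb_one by simp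
  then have "gres C U N b = gone C N"
    using Cs.res_res[OF U V0(1) oN NV V0(4) b(1)] b(2) by simp
  moreover have "V \<union> (U - K') = U" using V K'V0 V0 by blast
  moreover have "N \<subseteq> V" using NV V0 by blast
  ultimately show ?thesis using b(1,3) oN xN N' by blast
qed

lemma module_sheaf_with_bumpsI:
  assumes "graded_manifold X C nd" "graded_module_sheaf X C E"
  shows "module_sheaf_with_bumps X C E"
proof -
  interpret module_sheaf X C E
    by unfold_locales (use assms in \<open>simp_all add: graded_manifold_def\<close>)
  show ?thesis
    by unfold_locales (use manifold_bump[OF assms(1)] in \<open>simp add: bump_at_def\<close>)
qed

lemma has_degrees_reindex:
  fixes N :: nat
  assumes L: "has_degrees L degs d" and h: "bij_betw h {..<N} L"
  shows "has_degrees {..<N} (\<lambda>i. degs (h i)) d"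
proof -
  have "card {i \<in> {..<N}. degs (h i) = j} = card {l \<in> L. degs l = j}" for j
  proof (rule bij_betw_same_card[of h])
    have "h ` {i \<in> {..<N}. degs (h i) = j} = {l \<in> L. degs l = j}"
      using h unfolding bij_betw_def by auto
    then show "bij_betw h {i \<in> {..<N}. degs (h i) = j} {l \<in> L. degs l = j}"
      using h by (auto simp: bij_betw_def intro: inj_on_subset)
  qed
  then show ?thesis using L by (auto simp: has_degrees_def)
qed

lemma local_frameD:
  assumes "local_frame X C E rk L degs U \<Phi>"
  shows "has_degrees L degs rk" "openin X U" "l \<in> L \<Longrightarrow> \<Phi> l \<in> gsec E U (degs l)"
    "openin X V \<Longrightarrow> V \<subseteq> U \<Longrightarrow> \<psi> \<in> gsec E V j \<Longrightarrow>
      \<exists>!c. frame_expansion C E L degs V (\<lambda>l. gres E U V (\<Phi> l)) j \<psi> c"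
proof -
  note d = assms[unfolded local_frame_def]
  show "has_degrees L degs rk" "openin X U" "l \<in> L \<Longrightarrow> \<Phi> l \<in> gsec E U (degs l)" using d by simp_all
  show "openin X V \<Longrightarrow> V \<subseteq> U \<Longrightarrow> \<psi> \<in> gsec E V j \<Longrightarrow>
      \<exists>!c. frame_expansion C E L degs V (\<lambda>l. gres E U V (\<Phi> l)) j \<psi> c"
    by (rule d[THEN conjunct2, THEN conjunct2, THEN conjunct2, THEN spec, THEN spec, THEN bspec, THEN mp]) simp_all
qed

context module_sheaf
begin

section \<open>Local frames and trivialisations\<close>

lemma framed_module_at:
  fixes r :: nat
  assumes lf: "local_frame X C E rk {..<r} d\<theta> U \<Phi>" and V: "openin X V" "V \<subseteq> U"
  shows "framed_module C V E r d\<theta> (\<lambda>l. gres E U V (\<Phi> l))"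
proof -
  interpret MV: graded_module C V E by (rule module_at[OF V(1)])
  show ?thesis
    by unfold_locales
      (use Es.res_in[OF local_frameD(2)[OF lf] V local_frameD(3)[OF lf]] local_frameD(4)[OF lf V] in simp_all)
qed

text \<open>The restriction of an expansion is an expansion of the restricted section, and
  components are unique.\<close>

lemma comp_res:
  fixes r :: nat
  assumes lf: "local_frame X C E rk {..<r} d\<theta> U \<Phi>" and V: "openin X V" "V \<subseteq> U" and V': "openin X V'" "V' \<subseteq> V"
    and p: "\<psi> \<in> gsec E V j" and l: "l < r"
  shows "frame_components C E {..<r} d\<theta> V' (\<lambda>l. gres E U V' (\<Phi> l)) j (gres E V V' \<psi>) l =
    gres C V V' (frame_components C E {..<r} d\<theta> V (\<lambda>l. gres E U V (\<Phi> l)) j \<psi> l)"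
proof -
  note U = local_frameD(2)[OF lf]
  have V'U: "V' \<subseteq> U" using V V' by auto
  interpret F: framed_module C V E r d\<theta> "\<lambda>l. gres E U V (\<Phi> l)" by (rule framed_module_at[OF lf V])
  interpret F': framed_module C V' E r d\<theta> "\<lambda>l. gres E U V' (\<Phi> l)" by (rule framed_module_at[OF lf V'(1) V'U])
  let ?c = "F.comp j \<psi>"
  have ci: "?c l \<in> gsec C V (j - d\<theta> l)" if "l < r" for l by (rule F.comp_in[OF p that refl])
  have fi: "gres E U V (\<Phi> l) \<in> gsec E V (d\<theta> l)" if "l < r" for l by (rule F.frame_in[OF that])
  have ti: "gact E (?c l) (gres E U V (\<Phi> l)) \<in> gsec E V j" if "l < r" for l
    by (rule F.act_in[OF ci[OF that] fi[OF that]]) simp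
  have "gres E V V' (\<Sum>l<r. gact E (?c l) (gres E U V (\<Phi> l))) = (\<Sum>l<r. gres E V V' (gact E (?c l) (gres E U V (\<Phi> l))))"
    by (rule lin_on_sum[OF F.M_subspace Es.res_lin[OF V(1) V']]) (use ti in simp)
  also have "\<dots> = (\<Sum>l<r. gact E (gres C V V' (?c l)) (gres E U V' (\<Phi> l)))"
  proof (rule sum.cong[OF refl])
    fix l assume "l \<in> {..<r}"
    then have l: "l < r" by simp
    show "gres E V V' (gact E (?c l) (gres E U V (\<Phi> l))) = gact E (gres C V V' (?c l)) (gres E U V' (\<Phi> l))"
      unfolding res_act[OF V(1) V' ci[OF l] fi[OF l]]
      using Es.res_res[OF U V(1) V'(1) V'(2) V(2) local_frameD(3)[OF lf, of l]] l by simp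
  qed
  finally have "gres E V V' \<psi> = (\<Sum>l<r. gact E (gres C V V' (?c l)) (gres E U V' (\<Phi> l)))"
    using F.expand[OF p] by simp
  then show ?thesis
    by (intro F'.comp_unique[OF _ _ l] Cs.res_in[OF V(1) V' ci])
qed

text \<open>A section determines its degree unless it is \<open>0\<close>, so its components do not depend on the degree.\<close>

lemma local_frame_iso:
  fixes r :: nat
  assumes lf: "local_frame X C E rk {..<r} d\<theta> U \<Phi>"
  shows "\<exists>T. module_iso_on X C E (tensor_module C {..<r} d\<theta>) U T"
proof -
  define c where "c V j \<psi> l = (if l < r then frame_components C E {..<r} d\<theta> V (\<lambda>l. gres E U V (\<Phi> l)) j \<psi> l else 0)" for V j \<psi> l
  define T where "T V \<psi> = c V (SOME j. \<psi> \<in> gsec E V j) \<psi>" for V \<psi>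
  have c0: "c V j 0 = 0" if V: "openin X V" "V \<subseteq> U" for V j
  proof -
    interpret F: framed_module C V E r d\<theta> "\<lambda>l. gres E U V (\<Phi> l)" by (rule framed_module_at[OF lf V])
    show ?thesis using F.comp_scale[OF F.M_zero, of _ j 0] by (auto simp: c_def fun_eq_iff)
  qed
  have T: "T V \<psi> = c V j \<psi>" if V: "openin X V" "V \<subseteq> U" and p: "\<psi> \<in> gsec E V j" for V j \<psi>
  proof -
    interpret M: graded_module C V E by (rule module_at[OF V(1)])
    let ?j = "SOME j. \<psi> \<in> gsec E V j"
    have "\<psi> \<in> gsec E V ?j" using p by (rule someI[of "\<lambda>j. \<psi> \<in> gsec E V j"])
    then have "?j \<noteq> j \<Longrightarrow> \<psi> = 0" using M.M_disjoint[of ?j j] p by blast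
    then show ?thesis using c0[OF V] unfolding T_def by (cases "?j = j") auto
  qed
  have "module_iso_on X C E (tensor_module C {..<r} d\<theta>) U T"
    unfolding module_iso_on_def
  proof (intro allI impI conjI ballI; (elim conjE)?)
    fix V j assume V: "openin X V" "V \<subseteq> U"
    interpret F: framed_module C V E r d\<theta> "\<lambda>l. gres E U V (\<Phi> l)" by (rule framed_module_at[OF lf V])
    have inv: "(\<Sum>l<r. gact E (T V \<psi> l) (gres E U V (\<Phi> l))) = \<psi>" if "\<psi> \<in> gsec E V j" for \<psi>
      unfolding T[OF V that] using F.expand[OF that] by (simp add: c_def)
    show "bij_betw (T V) (gsec E V j) (gsec (tensor_module C {..<r} d\<theta>) V j)"
      unfolding bij_betw_def
    proof
      show "inj_on (T V) (gsec E V j)" by (rule inj_onI) (metis inv)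
      show "T V ` gsec E V j = gsec (tensor_module C {..<r} d\<theta>) V j"
      proof (intro equalityI subsetI)
        fix s assume "s \<in> T V ` gsec E V j"
        then show "s \<in> gsec (tensor_module C {..<r} d\<theta>) V j"
          using F.comp_in[OF _ _ refl] by (auto simp: tensor_module_def T[OF V] c_def)
      next
        fix s assume "s \<in> gsec (tensor_module C {..<r} d\<theta>) V j"
        then have s: "\<And>l. l < r \<Longrightarrow> s l \<in> gsec C V (j - d\<theta> l)" "\<And>l. \<not> l < r \<Longrightarrow> s l = 0"
          by (simp_all add: tensor_module_def)
        let ?\<psi> = "\<Sum>l<r. gact E (s l) (gres E U V (\<Phi> l))"
        have p: "?\<psi> \<in> gsec E V j" by (rule F.M_sum) (auto intro!: F.act_in[OF s(1) F.frame_in])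
        have Ts: "T V ?\<psi> = s"
        proof
          fix l show "T V ?\<psi> l = s l"
            unfolding T[OF V p] c_def using F.comp_unique[OF s(1) refl, of l] s(2)[of l] by simp
        qed
        show "s \<in> T V ` gsec E V j" by (rule image_eqI) (rule Ts[symmetric], rule p)
      qed
    qed
    show "lin_on (gsec E V j) (T V)"
      unfolding lin_on_def
    proof (intro conjI ballI allI ext)
      fix x y l assume x: "x \<in> gsec E V j" and y: "y \<in> gsec E V j"
      show "T V (x + y) l = (T V x + T V y) l"
        unfolding T[OF V F.M_add[OF x y]] T[OF V x] T[OF V y] using F.comp_add[OF x y] by (simp add: c_def)
    next
      fix a x l assume x: "x \<in> gsec E V j"
      show "T V (a *\<^sub>R x) l = (a *\<^sub>R T V x) l"
        unfolding T[OF V F.M_scale[OF x]] T[OF V x] using F.comp_scale[OF x] by (simp add: c_def)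
    qed
  next
    fix V i j f \<psi> assume V: "openin X V" "V \<subseteq> U" and f: "f \<in> gsec C V i" and p: "\<psi> \<in> gsec E V j"
    interpret F: framed_module C V E r d\<theta> "\<lambda>l. gres E U V (\<Phi> l)" by (rule framed_module_at[OF lf V])
    show "T V (gact E f \<psi>) = gact (tensor_module C {..<r} d\<theta>) f (T V \<psi>)"
      unfolding T[OF V p] T[OF V F.act_in[OF f p refl]]
      using F.comp_act[OF f p refl] by (auto simp: c_def tensor_module_def fun_eq_iff)
  next
    fix V V' j \<psi> assume V: "openin X V" "V \<subseteq> U" and V': "openin X V'" "V' \<subseteq> V" and p: "\<psi> \<in> gsec E V j"
    have V'U: "V' \<subseteq> U" using V V' by auto
    show "T V' (gres E V V' \<psi>) = gres (tensor_module C {..<r} d\<theta>) V V' (T V \<psi>)"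
      unfolding T[OF V p] T[OF V'(1) V'U Es.res_in[OF V(1) V' p]]
      using comp_res[OF lf V V' p] by (auto simp: c_def tensor_module_def fun_eq_iff)
  qed
  then show ?thesis by blast
qed

text \<open>The frame consists of the preimages of the standard sections, which are 1 at one index
  and 0 elsewhere; the components of a section are then the entries of its image under the
  isomorphism.\<close>

lemma iso_local_frame:
  fixes r :: nat
  assumes iso: "module_iso_on X C E (tensor_module C {..<r} d\<theta>) U T" and U: "openin X U"
    and deg: "has_degrees {..<r} d\<theta> rk"
  shows "\<exists>\<Phi>. local_frame X C E rk {..<r} d\<theta> U \<Phi>"
proof -
  let ?K = "tensor_module C {..<r} d\<theta>"
  have bij: "bij_betw (T V) (gsec E V j) (gsec ?K V j)" and lin: "lin_on (gsec E V j) (T V)"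
    if "openin X V" "V \<subseteq> U" for V j
    using iso[unfolded module_iso_on_def, THEN spec, THEN mp, OF conjI[OF that], THEN conjunct1] by blast+
  have Tact: "T V (gact E f \<psi>) = gact ?K f (T V \<psi>)"
    if "openin X V" "V \<subseteq> U" "f \<in> gsec C V i" "\<psi> \<in> gsec E V j" for V f \<psi> i j
    using iso[unfolded module_iso_on_def, THEN spec, THEN mp, OF conjI[OF that(1,2)], THEN conjunct2, THEN conjunct1] that(3,4)
    by blast
  have Tres: "T V (gres E U V \<psi>) = gres ?K U V (T U \<psi>)" if "openin X V" "V \<subseteq> U" "\<psi> \<in> gsec E U j" for V \<psi> j
    using iso[unfolded module_iso_on_def, THEN spec, THEN mp, OF conjI[OF U order_refl], THEN conjunct2, THEN conjunct2] that
    by blast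
  define e where "e V l = (\<lambda>l'. if l' = l then gone C V else 0)" for V and l :: nat
  have e: "e V l \<in> gsec ?K V (d\<theta> l)" if "openin X V" "l < r" for V l
  proof -
    interpret M: graded_module C V E by (rule module_at[OF that(1)])
    show ?thesis using M.one_in that(2) by (auto simp: tensor_module_def e_def)
  qed
  define \<Phi> where "\<Phi> l = inv_into (gsec E U (d\<theta> l)) (T U) (e U l)" for l
  have \<Phi>: "\<Phi> l \<in> gsec E U (d\<theta> l)" "T U (\<Phi> l) = e U l" if "l < r" for l
    using bij[OF U order_refl, of "d\<theta> l"] e[OF U that] unfolding \<Phi>_def bij_betw_def
    by (metis inv_into_into, metis f_inv_into_f)
  have "\<exists>!c. frame_expansion C E {..<r} d\<theta> V (\<lambda>l. gres E U V (\<Phi> l)) j \<psi> c"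
    if V: "openin X V" "V \<subseteq> U" and p: "\<psi> \<in> gsec E V j" for V j \<psi>
  proof -
    interpret M: graded_module C V E by (rule module_at[OF V(1)])
    have \<Phi>V: "gres E U V (\<Phi> l) \<in> gsec E V (d\<theta> l)" if "l < r" for l by (rule Es.res_in[OF U V \<Phi>(1)[OF that]])
    have TV: "T V (gres E U V (\<Phi> l)) = e V l" if "l < r" for l
      unfolding Tres[OF V \<Phi>(1)[OF that]] \<Phi>(2)[OF that]
      using res_one[OF U V] Cs.res_zero[OF U V] that by (auto simp: tensor_module_def e_def fun_eq_iff)
    have main: "T V (\<Sum>l<r. gact E (c l) (gres E U V (\<Phi> l))) = c"
      if c: "\<And>l. l < r \<Longrightarrow> c l \<in> gsec C V (j - d\<theta> l)" "\<And>l. \<not> l < r \<Longrightarrow> c l = 0" for c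
    proof -
      have ti: "gact E (c l) (gres E U V (\<Phi> l)) \<in> gsec E V j" if "l < r" for l
        by (rule M.act_in[OF c(1)[OF that] \<Phi>V[OF that]]) simp
      have "T V (\<Sum>l<r. gact E (c l) (gres E U V (\<Phi> l))) = (\<Sum>l<r. T V (gact E (c l) (gres E U V (\<Phi> l))))"
        by (rule lin_on_sum[OF M.M_subspace lin[OF V]]) (use ti in simp)
      also have "\<dots> = (\<Sum>l<r. gact ?K (c l) (e V l))"
        by (rule sum.cong[OF refl]) (use Tact[OF V c(1) \<Phi>V] TV in simp)
      also have "\<dots> = c"
      proof
        fix l'
        have "gact ?K (c l) (e V l) l' = (if l = l' then c l else 0)" if "l < r" for l
        proof -
          have "gmul C (c l) 0 = 0" by (rule lin_on_zero[OF M.mul_lin_right[OF c(1)[OF that]] M.A_zero])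
          then show ?thesis using M.mul_one[OF c(1)[OF that]] that by (auto simp: tensor_module_def e_def)
        qed
        then have "(\<Sum>l<r. gact ?K (c l) (e V l)) l' = (\<Sum>l<r. if l = l' then c l else 0)"
          unfolding sum_fun_apply by (intro sum.cong) auto
        then show "(\<Sum>l<r. gact ?K (c l) (e V l)) l' = c l'" using c(2)[of l'] by simp
      qed
      finally show ?thesis .
    qed
    have Tp: "T V \<psi> \<in> gsec ?K V j" using bij[OF V, of j] p bij_betwE by blast
    then have c: "\<And>l. l < r \<Longrightarrow> T V \<psi> l \<in> gsec C V (j - d\<theta> l)" "\<And>l. \<not> l < r \<Longrightarrow> T V \<psi> l = 0"
      by (simp_all add: tensor_module_def)
    have S: "(\<Sum>l<r. gact E (T V \<psi> l) (gres E U V (\<Phi> l))) \<in> gsec E V j"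
      by (rule M.M_sum) (auto intro!: M.act_in[OF c(1) \<Phi>V])
    have "\<psi> = (\<Sum>l<r. gact E (T V \<psi> l) (gres E U V (\<Phi> l)))"
      using inj_onD[OF bij_betw_imp_inj_on[OF bij[OF V]] _ p S] main[OF c] by simp
    then have "frame_expansion C E {..<r} d\<theta> V (\<lambda>l. gres E U V (\<Phi> l)) j \<psi> (T V \<psi>)"
      using c by (simp add: frame_expansion_def)
    moreover have "c' = T V \<psi>" if "frame_expansion C E {..<r} d\<theta> V (\<lambda>l. gres E U V (\<Phi> l)) j \<psi> c'" for c'
      using main[of c'] that by (simp add: frame_expansion_def)
    ultimately show ?thesis by blast
  qed
  then show ?thesis using deg U \<Phi>(1) unfolding local_frame_def by (intro exI[of _ \<Phi>]) simp
qed

text \<open>Bundles are trivialised with index sets of the form \<open>{..<N}\<close>, whereas the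
  operators are indexed by triples.\<close>

lemma local_frame_reindex:
  fixes N :: nat
  assumes lf: "local_frame X C E rk L degs U \<Phi>" and h: "bij_betw h {..<N} L"
  shows "local_frame X C E rk {..<N} (\<lambda>i. degs (h i)) U (\<lambda>i. \<Phi> (h i))"
proof -
  define g where "g = inv_into {..<N} h"
  have hL: "h i \<in> L" if "i < N" for i using h that by (auto simp: bij_betw_def)
  have gL: "g l < N" "h (g l) = l" if "l \<in> L" for l
    using h that unfolding g_def bij_betw_def by (metis inv_into_into lessThan_iff, metis f_inv_into_f)
  have gh: "g (h i) = i" if "i < N" for i
    using h that unfolding g_def bij_betw_def by (simp add: inv_into_f_f)
  note deg = has_degrees_reindex[OF local_frameD(1)[OF lf] h]
  have "\<exists>!c. frame_expansion C E {..<N} (\<lambda>i. degs (h i)) V (\<lambda>i. gres E U V (\<Phi> (h i))) j \<psi> c"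
    if V: "openin X V" "V \<subseteq> U" and p: "\<psi> \<in> gsec E V j" for V j \<psi>
  proof -
    have sum: "(\<Sum>i<N. gact E (c i) (gres E U V (\<Phi> (h i)))) = (\<Sum>l\<in>L. gact E (c (g l)) (gres E U V (\<Phi> l)))" for c
      by (rule sum.reindex_bij_witness[where i = g and j = h]) (use hL gL gh in auto)
    have F: "frame_expansion C E {..<N} (\<lambda>i. degs (h i)) V (\<lambda>i. gres E U V (\<Phi> (h i))) j \<psi> c \<longleftrightarrow>
      (\<forall>i. \<not> i < N \<longrightarrow> c i = 0) \<and> frame_expansion C E L degs V (\<lambda>l. gres E U V (\<Phi> l)) j \<psi> (\<lambda>l. if l \<in> L then c (g l) else 0)" for c
    proof -
      have "(\<forall>i\<in>{..<N}. c i \<in> gsec C V (j - degs (h i))) \<longleftrightarrow> (\<forall>l\<in>L. c (g l) \<in> gsec C V (j - degs l))"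
        using hL gL gh by (metis lessThan_iff)
      then show ?thesis unfolding frame_expansion_def sum by auto
    qed
    obtain c where c: "frame_expansion C E L degs V (\<lambda>l. gres E U V (\<Phi> l)) j \<psi> c"
      and u: "\<And>c'. frame_expansion C E L degs V (\<lambda>l. gres E U V (\<Phi> l)) j \<psi> c' \<Longrightarrow> c' = c"
      using local_frameD(4)[OF lf V p] by blast
    have c0: "c l = 0" if "l \<notin> L" for l using c that by (simp add: frame_expansion_def)
    show ?thesis
    proof (rule ex1I[of _ "\<lambda>i. if i < N then c (h i) else 0"])
      have "(\<lambda>l. if l \<in> L then (if g l < N then c (h (g l)) else 0) else 0) = c" using gL c0 by (auto simp: fun_eq_iff)
      then show "frame_expansion C E {..<N} (\<lambda>i. degs (h i)) V (\<lambda>i. gres E U V (\<Phi> (h i))) j \<psi> (\<lambda>i. if i < N then c (h i) else 0)"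
        unfolding F using c by simp
      fix c' assume "frame_expansion C E {..<N} (\<lambda>i. degs (h i)) V (\<lambda>i. gres E U V (\<Phi> (h i))) j \<psi> c'"
      then have 1: "\<And>i. \<not> i < N \<Longrightarrow> c' i = 0" and 2: "(\<lambda>l. if l \<in> L then c' (g l) else 0) = c"
        using u unfolding F by blast+
      show "c' = (\<lambda>i. if i < N then c (h i) else 0)"
      proof
        fix i show "c' i = (if i < N then c (h i) else 0)"
          using 1[of i] fun_cong[OF 2, of "h i"] hL[of i] gh[of i] by auto
      qed
    qed
  qed
  then show ?thesis using deg local_frameD(2,3)[OF lf] hL unfolding local_frame_def by simp
qed

end

section \<open>The frame of the sheaf of differential operators\<close>

definition op_indices :: "nat \<Rightarrow> nat \<Rightarrow> (nat \<Rightarrow> int) \<Rightarrow> nat \<Rightarrow> ((nat \<Rightarrow> nat) \<times> nat \<times> nat) set" where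
  "op_indices k n dz r = (\<Union>q\<in>{0..k}. multi_indices n dz q) \<times> {..<r} \<times> {..<r}"

definition op_degree :: "nat \<Rightarrow> (nat \<Rightarrow> int) \<Rightarrow> (nat \<Rightarrow> int) \<Rightarrow> (nat \<Rightarrow> nat) \<times> nat \<times> nat \<Rightarrow> int" where
  "op_degree n dz d\<theta> = (\<lambda>(I, m, l). d\<theta> m - d\<theta> l - exponent_degree n dz I)"

definition op_rank :: "nat \<Rightarrow> nat \<Rightarrow> (nat \<Rightarrow> int) \<Rightarrow> nat \<Rightarrow> (nat \<Rightarrow> int) \<Rightarrow> int \<Rightarrow> nat" where
  "op_rank k n dz r d\<theta> j = card {x \<in> op_indices k n dz r. op_degree n dz d\<theta> x = j}"

lemma finite_op_indices: "finite (op_indices k n dz r)"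
  by (simp add: op_indices_def finite_multi_indices)

lemma has_degrees_op: "has_degrees (op_indices k n dz r) (op_degree n dz d\<theta>) (op_rank k n dz r d\<theta>)"
  by (simp add: has_degrees_def finite_op_indices op_rank_def)

lemma has_degrees_bij:
  assumes L: "has_degrees L degs d" and L': "has_degrees L' degs' d"
  shows "\<exists>\<sigma>. bij_betw \<sigma> L' L \<and> (\<forall>l\<in>L'. degs (\<sigma> l) = degs' l)"
proof -
  have "\<exists>g. bij_betw g {l \<in> L'. degs' l = j} {l \<in> L. degs l = j}" for j
    using L L' unfolding has_degrees_def by (intro finite_same_card_bij) simp_all
  then obtain g where g: "\<And>j. bij_betw (g j) {l \<in> L'. degs' l = j} {l \<in> L. degs l = j}" by metis
  define \<sigma> where "\<sigma> l = g (degs' l) l" for l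
  have in_L: "\<sigma> l \<in> L \<and> degs (\<sigma> l) = degs' l" if "l \<in> L'" for l
    using bij_betwE[OF g[of "degs' l"]] that by (simp add: \<sigma>_def)
  have "inj_on \<sigma> L'"
  proof (rule inj_onI)
    fix l l' assume l: "l \<in> L'" "l' \<in> L'" "\<sigma> l = \<sigma> l'"
    then have e: "degs' l = degs' l'" using in_L by metis
    then show "l = l'" using inj_onD[OF bij_betw_imp_inj_on[OF g[of "degs' l"]], of l l'] l by (simp add: \<sigma>_def)
  qed
  moreover have "\<sigma> ` L' = L"
  proof (intro equalityI subsetI)
    fix l assume l: "l \<in> L"
    then have "l \<in> g (degs l) ` {l' \<in> L'. degs' l' = degs l}" using bij_betw_imp_surj_on[OF g] by simp
    then obtain l' where l': "l' \<in> L'" "degs' l' = degs l" "l = g (degs l) l'" by blast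
    then have "l = \<sigma> l'" by (simp add: \<sigma>_def)
    then show "l \<in> \<sigma> ` L'" using l'(1) by (rule image_eqI)
  qed (use in_L in auto)
  ultimately show ?thesis using in_L by (auto simp: bij_betw_def)
qed

text \<open>Charts of the same graded dimension may list their variables in different orders, and
  frames likewise. Permuting the indices accordingly gives an injection between the index sets;
  equality of the ranks follows by exchanging the roles.\<close>

lemma op_rank_le:
  assumes n: "has_degrees {..<n} dz nd" and n': "has_degrees {..<n'} dz' nd"
    and r: "has_degrees {..<r} d\<theta> rk" and r': "has_degrees {..<r'} d\<theta>' rk"
  shows "op_rank k n dz r d\<theta> j \<le> op_rank k n' dz' r' d\<theta>' j"
proof -
  obtain \<sigma> where \<sigma>: "bij_betw \<sigma> {..<n'} {..<n}" "\<And>A. A < n' \<Longrightarrow> dz (\<sigma> A) = dz' A"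
    using has_degrees_bij[OF n n'] by auto
  obtain \<tau> where \<tau>: "bij_betw \<tau> {..<r} {..<r'}" "\<And>l. l < r \<Longrightarrow> d\<theta>' (\<tau> l) = d\<theta> l"
    using has_degrees_bij[OF r' r] by auto
  have \<sigma>n: "\<sigma> A < n" if "A < n'" for A using \<sigma>(1) that by (auto simp: bij_betw_def)
  have \<tau>r: "\<tau> l < r'" if "l < r" for l using \<tau>(1) that by (auto simp: bij_betw_def)
  define s :: "(nat \<Rightarrow> nat) \<Rightarrow> nat \<Rightarrow> nat" where "s I = (\<lambda>A. if A < n' then I (\<sigma> A) else 0)" for I
  have s_in: "s I \<in> multi_indices n' dz' q" if I: "I \<in> multi_indices n dz q" for I q
  proof -
    have "(\<Sum>A<n'. s I A) = (\<Sum>A<n'. I (\<sigma> A))" by (simp add: s_def)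
    also have "\<dots> = (\<Sum>A<n. I A)" by (rule sum.reindex_bij_betw[OF \<sigma>(1)])
    finally show ?thesis using I \<sigma>n \<sigma>(2) by (force simp: multi_indices_def s_def)
  qed
  have s_deg: "exponent_degree n' dz' (s I) = exponent_degree n dz I" for I
  proof -
    have "exponent_degree n' dz' (s I) = (\<Sum>A<n'. int (I (\<sigma> A)) * dz (\<sigma> A))"
      using \<sigma>(2) by (simp add: exponent_degree_def s_def)
    also have "\<dots> = (\<Sum>A<n. int (I A) * dz A)" by (rule sum.reindex_bij_betw[OF \<sigma>(1)])
    finally show ?thesis by (simp add: exponent_degree_def)
  qed
  have s_inj: "I = J" if "I \<in> multi_indices n dz q" "J \<in> multi_indices n dz q'" "s I = s J" for I J q q'
  proof
    fix A
    show "I A = J A"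
    proof (cases "A < n")
      case True
      then obtain B where B: "B < n'" "A = \<sigma> B" using \<sigma>(1) by (auto simp: bij_betw_def)
      then show ?thesis using fun_cong[OF that(3), of B] by (simp add: s_def)
    next
      case False then show ?thesis using that(1,2) by (simp add: multi_indices_def)
    qed
  qed
  let ?f = "\<lambda>(I, m, l). (s I, \<tau> m, \<tau> l)"
  show ?thesis
    unfolding op_rank_def
  proof (rule card_inj_on_le[where f = ?f])
    show "inj_on ?f {x \<in> op_indices k n dz r. op_degree n dz d\<theta> x = j}"
      using s_inj inj_onD[OF bij_betw_imp_inj_on[OF \<tau>(1)]] by (fastforce simp: inj_on_def op_indices_def)
    show "?f ` {x \<in> op_indices k n dz r. op_degree n dz d\<theta> x = j} \<subseteq>
        {x \<in> op_indices k n' dz' r'. op_degree n' dz' d\<theta>' x = j}"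
      using s_in \<tau>r \<tau>(2) s_deg by (fastforce simp: op_indices_def op_degree_def)
  qed (simp add: finite_op_indices)
qed

lemma deriv_list_cong: "(\<And>A. A \<in> set As \<Longrightarrow> p A = q A) \<Longrightarrow> deriv_list p dz As = deriv_list q dz As"
  by (induction As) simp_all

lemma (in graded_coordinates) deriv_op_eq: "deriv_op C U n dz z I = deriv_list pd dz (multi_list n I)"
  unfolding deriv_op_def by (rule deriv_list_cong) (simp add: coord_vector_field_eq set_multi_list)

lemma frame_components_cong:
  assumes "\<And>l. l \<in> L \<Longrightarrow> \<Phi> l = \<Phi>' l"
  shows "frame_expansion C E L degs U \<Phi> j \<psi> c = frame_expansion C E L degs U \<Phi>' j \<psi> c"
    and "frame_components C E L degs U \<Phi> j \<psi> = frame_components C E L degs U \<Phi>' j \<psi>"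
proof -
  show *: "frame_expansion C E L degs U \<Phi> j \<psi> c = frame_expansion C E L degs U \<Phi>' j \<psi> c" for c
    using assms by (simp add: frame_expansion_def)
  show "frame_components C E L degs U \<Phi> j \<psi> = frame_components C E L degs U \<Phi>' j \<psi>"
    by (simp add: frame_components_def *)
qed

lemma (in graded_module) fmul_rescale:
  assumes D: "D \<in> graded_maps E U d" and f: "f \<in> gsec C U i" and a: "a \<noteq> 0"
  shows "(1 / a) *\<^sub>R fmul (a *\<^sub>R f) D = fmul f D"
proof (intro ext)
  fix j \<psi>
  have "D j \<psi> \<in> gsec E U (j + d)"
    using gmap_in[OF D, of \<psi> j] gmap_out[OF D, of \<psi> j] M_zero by (cases "\<psi> \<in> gsec E U j") auto
  then show "((1 / a) *\<^sub>R fmul (a *\<^sub>R f) D) j \<psi> = fmul f D j \<psi>" using act_scale_left[OF f] a by simp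
qed

text \<open>The frame may live on a smaller set than the chart domain \<open>U0\<close>, as happens
  when a chart is intersected with a trivialising set.\<close>

locale framed_chart = module_sheaf_with_bumps X C E
  for X :: "'p topology" and C :: "('p, 'c::real_vector) galgebra" and E :: "('p, 'e::real_vector, 'c) gmodule" +
  fixes nd rk :: "int \<Rightarrow> nat" and n r :: nat and dz d\<theta> :: "nat \<Rightarrow> int" and U0 U :: "'p set"
    and \<phi> :: "'p \<Rightarrow> nat \<Rightarrow> real" and pb :: "'p set \<Rightarrow> power_series \<Rightarrow> 'c" and \<Phi> :: "nat \<Rightarrow> 'e"
  assumes chart: "graded_chart X C nd U0 n dz \<phi> pb" and U_sub: "U \<subseteq> U0"
    and frame: "local_frame X C E rk {..<r} d\<theta> U \<Phi>"
begin

abbreviation "zV V \<equiv> chart_coord V n dz \<phi> pb"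
abbreviation "dV V \<equiv> chart_on_algebra.dc C V n dz (\<phi> ` V) (pb V)"
abbreviation "\<Phi>V V \<equiv> \<lambda>l. gres E U V (\<Phi> l)"
abbreviation "PV V \<equiv> frame_op C E V n dz (zV V) r d\<theta> (\<Phi>V V)"

lemma U_open: "openin X U"
  by (rule local_frameD(2)[OF frame])

lemma chart_at: "openin X V \<Longrightarrow> V \<subseteq> U \<Longrightarrow> chart_on_algebra C V n dz (\<phi> ` V) (pb V)"
  using chart_on_algebraI[OF C chart] U_sub by blast

lemma coordinates_at:
  assumes V: "openin X V" "V \<subseteq> U" shows "graded_coordinates C V n dz (zV V) (dV V)"
proof -
  interpret ch: chart_on_algebra C V n dz "\<phi> ` V" "pb V" by (rule chart_at[OF V])
  have "ch.zc = zV V" by (auto simp: fun_eq_iff ch.zc_def chart_coord_def)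
  then show ?thesis using ch.graded_coordinates by simp
qed

lemma graded_frame_at:
  assumes V: "openin X V" "V \<subseteq> U" shows "graded_frame C V n dz (zV V) (dV V) E r d\<theta> (\<Phi>V V)"
  by (intro graded_frame.intro coordinates_at[OF V] framed_module_at[OF frame V])

text \<open>At indices outside of the frame \<Phi> is arbitrary, and restricting it from
  \<open>U\<close> to \<open>U\<close> may change it; so the two families are exchanged by
  congruence on the indices below \<open>r\<close>.\<close>

lemma \<Phi>V_self: "l \<in> {..<r} \<Longrightarrow> \<Phi>V U l = \<Phi> l"
  using Es.res_id[OF U_open local_frameD(3)[OF frame]] by simp

lemma \<Phi>V_self_cong:
  "frame_expansion C E {..<r} d\<theta> U (\<Phi>V U) j \<psi> c = frame_expansion C E {..<r} d\<theta> U \<Phi> j \<psi> c"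
  "frame_components C E {..<r} d\<theta> U (\<Phi>V U) j \<psi> = frame_components C E {..<r} d\<theta> U \<Phi> j \<psi>"
  by (rule frame_components_cong[OF \<Phi>V_self], assumption)+

lemma graded_frame_self: "graded_frame C U n dz (zV U) (dV U) E r d\<theta> \<Phi>"
proof (rule graded_frame.intro[OF coordinates_at[OF U_open order_refl]])
  interpret F: framed_module C U E r d\<theta> "\<Phi>V U" by (rule framed_module_at[OF frame U_open order_refl])
  show "framed_module C U E r d\<theta> \<Phi>"
    by unfold_locales
      (use local_frameD(3)[OF frame] F.frame_ex1[unfolded \<Phi>V_self_cong] in simp_all)
qed

lemma frame_op_self: "m < r \<Longrightarrow> frame_op C E U n dz (zV U) r d\<theta> \<Phi> I l m = PV U I l m"
  using \<Phi>V_self[of m] unfolding frame_op_def \<Phi>V_self_cong by (simp cong: if_cong)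

text \<open>Derivatives in the model commute with restriction because they depend on nearby values
  only; the chart transports this to \<open>C\<close>.\<close>

lemma deriv_res:
  assumes V: "openin X V" "V \<subseteq> U" and V': "openin X V'" "V' \<subseteq> V" and A: "A < n" and f: "f \<in> gsec C V j"
  shows "dV V' A j (gres C V V' f) = gres C V V' (dV V A j f)"
proof -
  have V'U: "V' \<subseteq> U" and VU0: "V \<subseteq> U0" using V V' U_sub by auto
  interpret ch: chart_on_algebra C V n dz "\<phi> ` V" "pb V" by (rule chart_at[OF V])
  interpret ch': chart_on_algebra C V' n dz "\<phi> ` V'" "pb V'" by (rule chart_at[OF V'(1) V'U])
  let ?F = "ch.qb j f" and ?r = "gres (graded_model n dz) (\<phi> ` V) (\<phi> ` V')"
  note F = ch.qb_in[OF f]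
  note r = chart_res[OF chart V(1) VU0 V']
  have im: "\<phi> ` V' \<subseteq> \<phi> ` V" using V' by auto
  have "pb V' (?r ?F) = gres C V V' f" using r[OF F] ch.pb_qb[OF f] by simp
  then have q: "ch'.qb j (gres C V V' f) = ?r ?F"
    by (rule ch'.qbI[OF model_res_in[OF ch.W_open ch'.W_open im F]])
  have "gres C V V' (dV V A j f) = pb V' (?r (model_deriv dz (\<phi> ` V) A ?F))"
    using r[OF model_deriv_in[OF ch.W_open F A]] f by (simp add: ch.dc_def)
  also have "\<dots> = dV V' A j (gres C V V' f)"
    using Cs.res_in[OF V(1) V' f] model_deriv_res[OF ch.W_open ch'.W_open im A] by (simp add: ch'.dc_def q)
  finally show ?thesis by simp
qed

lemma deriv_list_res:
  assumes V: "openin X V" "V \<subseteq> U" and V': "openin X V'" "V' \<subseteq> V"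
  shows "\<forall>A\<in>set As. A < n \<Longrightarrow> f \<in> gsec C V j \<Longrightarrow>
    deriv_list (dV V) dz As j f \<in> gsec C V (j - sum_list (map dz As)) \<and>
    deriv_list (dV V') dz As j (gres C V V' f) = gres C V V' (deriv_list (dV V) dz As j f)"
proof (induction As arbitrary: f j)
  case (Cons A As)
  interpret co: graded_coordinates C V n dz "zV V" "dV V" by (rule coordinates_at[OF V])
  have A: "A < n" using Cons.prems by simp
  have "dV V A \<in> graded_maps C V (- dz A)" using co.pd_derivation[OF A] by (simp add: graded_derivations_def)
  then have d: "dV V A j f \<in> gsec C V (j - dz A)" using Cons.prems(2) by (auto simp: graded_maps_def)
  show ?case
    using Cons.IH[OF _ d] Cons.prems deriv_res[OF V V' A Cons.prems(2)] by (simp add: algebra_simps)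
qed simp

text \<open>Components, derivatives and frame elements all commute with restriction, and
  \<open>resD_unique\<close> says that this determines the restricted operator. Hence one family of
  operators over \<open>U\<close> can serve as a frame over every smaller open set.\<close>

lemma frame_op_res:
  assumes V: "openin X V" "V \<subseteq> U" and I: "I \<in> (\<Union>q\<in>{0..k}. multi_indices n dz q)" and l: "l < r" and m: "m < r"
  shows "resD k U V (frame_op C E U n dz (zV U) r d\<theta> \<Phi> I l m) = PV V I l m"
  unfolding frame_op_self[OF m]
proof (rule resD_unique[OF U_open V])
  interpret FU: graded_frame C U n dz "zV U" "dV U" E r d\<theta> "\<Phi>V U" by (rule graded_frame_at[OF U_open order_refl])
  interpret FV: graded_frame C V n dz "zV V" "dV V" E r d\<theta> "\<Phi>V V" by (rule graded_frame_at[OF V])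
  show "PV U I l m \<in> diff_ops C E k U (FU.P_deg I l m)" by (rule FU.frame_op_diff_op[OF I l m])
  show "PV V I l m \<in> diff_ops C E k V (FU.P_deg I l m)" by (rule FV.frame_op_diff_op[OF I l m])
  fix i \<psi> assume p: "\<psi> \<in> gsec E U i"
  let ?g = "deriv_list (dV U) dz (multi_list n I) (i - d\<theta> l) (FU.comp i \<psi> l)"
  let ?s = "(- 1) powi ((d\<theta> m - d\<theta> l) * (i - d\<theta> l - exponent_degree n dz I)) :: real"
  have "\<forall>A\<in>set (multi_list n I). A < n" using set_multi_list by blast
  note g = deriv_list_res[OF U_open order_refl V this FU.comp_in[OF p l refl]]
  have g1: "?g \<in> gsec C U (i - d\<theta> l - exponent_degree n dz I)" using g by (simp add: degree_multi_list)
  have \<Phi>m: "\<Phi> m \<in> gsec E U (d\<theta> m)" by (rule local_frameD(3)[OF frame]) (simp add: m)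
  have "gres E U V (PV U I l m i \<psi>) = gres E U V (?s *\<^sub>R gact E ?g (\<Phi> m))"
    using p \<Phi>V_self[of m] m by (simp add: frame_op_def FU.deriv_op_eq)
  also have "\<dots> = ?s *\<^sub>R gact E (gres C U V ?g) (\<Phi>V V m)"
    using Es.res_scale[OF U_open V FU.act_in[OF g1 \<Phi>m refl]] res_act[OF U_open V g1 \<Phi>m] by simp
  also have "\<dots> = PV V I l m i (gres E U V \<psi>)"
    using Es.res_in[OF U_open V p] g comp_res[OF frame U_open order_refl V p l]
    by (simp add: frame_op_def FV.deriv_op_eq)
  finally show "PV V I l m i (gres E U V \<psi>) = gres E U V (PV U I l m i \<psi>)" by simp
qed

text \<open>Over each smaller \<open>V\<close> the frame expansion is the decomposition of the
  operators over \<open>V\<close> up to factorials, so that existence and uniqueness are those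
  proved for \<open>coeff\<close>.\<close>

lemma diff_op_frame:
  "local_frame X C (diff_op_sheaf C E k) (op_rank k n dz r d\<theta>) (op_indices k n dz r) (op_degree n dz d\<theta>) U
    (\<lambda>(I, m, l). frame_op C E U n dz (zV U) r d\<theta> \<Phi> I l m)"
proof -
  let ?L = "op_indices k n dz r" and ?deg = "op_degree n dz d\<theta>"
    and ?fr = "\<lambda>(I, m, l). frame_op C E U n dz (zV U) r d\<theta> \<Phi> I l m"
  interpret FU: graded_frame C U n dz "zV U" "dV U" E r d\<theta> \<Phi> by (rule graded_frame_self)
  have fr_in: "?fr x \<in> diff_ops C E k U (?deg x)" if "x \<in> ?L" for x
  proof -
    obtain I m l where x: "x = (I, m, l)" by (cases x)
    show ?thesis using FU.frame_op_diff_op[of I k l m] that unfolding x op_indices_def op_degree_def by simp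
  qed
  have "\<exists>!c. frame_expansion C (diff_op_sheaf C E k) ?L ?deg V (\<lambda>x. resD k U V (?fr x)) d D c"
    if D: "D \<in> diff_ops C E k V d" and V: "openin X V" "V \<subseteq> U" for V d D
  proof -
    interpret FV: graded_frame C V n dz "zV V" "dV V" E r d\<theta> "\<Phi>V V" by (rule graded_frame_at[OF V])
    have fact: "multi_fact n I \<noteq> 0" for I by (simp add: multi_fact_def)
    \<comment> \<open>The factor compensates the denominator in \<open>decomp\<close>.\<close>
    let ?c = "\<lambda>c I m l. multi_fact n I *\<^sub>R c (I, m, l)"
    have sum: "(\<Sum>x\<in>?L. gact (diff_op_sheaf C E k) (c x) (resD k U V (?fr x))) = FV.decomp k (?c c)"
      if c: "\<And>x. x \<in> ?L \<Longrightarrow> c x \<in> gsec C V (d - ?deg x)" for c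
    proof -
      have "(\<Sum>x\<in>?L. gact (diff_op_sheaf C E k) (c x) (resD k U V (?fr x))) =
        (\<Sum>I\<in>FV.indices k. \<Sum>m<r. \<Sum>l<r. gact (diff_op_sheaf C E k) (c (I, m, l)) (resD k U V (?fr (I, m, l))))"
        by (simp only: op_indices_def sum.cartesian_product split_def fst_conv snd_conv prod.collapse)
      also have "\<dots> = (\<Sum>I\<in>FV.indices k. \<Sum>m<r. \<Sum>l<r. (1 / multi_fact n I) *\<^sub>R FV.fmul (?c c I m l) (PV V I l m))"
      proof (intro sum.cong refl)
        fix I m l assume I: "I \<in> FV.indices k" and "m \<in> {..<r}" "l \<in> {..<r}"
        then have ml: "m < r" "l < r" and x: "(I, m, l) \<in> ?L" by (auto simp: op_indices_def)
        have "resD k U V (?fr (I, m, l)) = PV V I l m" using frame_op_res[OF V I ml(2,1)] by simp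
        then show "gact (diff_op_sheaf C E k) (c (I, m, l)) (resD k U V (?fr (I, m, l))) =
            (1 / multi_fact n I) *\<^sub>R FV.fmul (?c c I m l) (PV V I l m)"
          using FV.fmul_rescale[OF FV.diff_op_gmap[OF FV.frame_op_diff_op[OF I ml(2,1)]] c[OF x] fact]
          by (simp only: diff_op_sheaf_simps)
      qed
      finally show ?thesis unfolding sum_multi_indices .
    qed
    have cin: "FV.coeffs_in k d (?c c)" if "\<And>x. x \<in> ?L \<Longrightarrow> c x \<in> gsec C V (d - ?deg x)" for c
      unfolding FV.coeffs_in_def
    proof (intro ballI allI impI)
      fix I m l assume "I \<in> FV.indices k" "m < r" "l < r"
      then have "(I, m, l) \<in> ?L" by (simp add: op_indices_def)
      from FV.A_scale[OF that[OF this]] show "?c c I m l \<in> gsec C V (d - FV.P_deg I l m)"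
        by (simp add: op_degree_def)
    qed
    define c0 where "c0 = (\<lambda>(I, m, l). if (I, m, l) \<in> ?L then (1 / multi_fact n I) *\<^sub>R FV.coeff d D I m l else 0)"
    have c0_in: "c0 x \<in> gsec C V (d - ?deg x)" if "x \<in> ?L" for x
    proof -
      obtain I m l where x: "x = (I, m, l)" by (cases x)
      have "FV.coeff d D I m l \<in> gsec C V (d - ?deg x)"
        using FV.coeff_in[OF D] that by (auto simp: x FV.coeffs_in_def op_indices_def op_degree_def)
      then show ?thesis using that FV.A_scale by (simp add: x c0_def)
    qed
    have "FV.decomp k (?c c0) = FV.decomp k (FV.coeff d D)"
      unfolding sum_multi_indices
      by (intro sum.cong refl) (use fact in \<open>simp add: c0_def op_indices_def del: scaleR_fun_apply\<close>)
    then have D0: "D = FV.decomp k (?c c0)" using FV.decomposition[OF D] by (rule trans[OF _ sym, rotated])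
    have "frame_expansion C (diff_op_sheaf C E k) ?L ?deg V (\<lambda>x. resD k U V (?fr x)) d D c0"
      unfolding frame_expansion_def
    proof (intro conjI ballI allI impI)
      show "c0 x = 0" if "x \<notin> ?L" for x using that by (cases x) (simp add: c0_def)
      show "D = (\<Sum>x\<in>?L. gact (diff_op_sheaf C E k) (c0 x) (resD k U V (?fr x)))"
        by (rule trans[OF D0 sum[symmetric]]) (rule c0_in)
    qed (rule c0_in)
    moreover have "c = c0"
      if ex: "frame_expansion C (diff_op_sheaf C E k) ?L ?deg V (\<lambda>x. resD k U V (?fr x)) d D c" for c
    proof -
      have c: "\<And>x. x \<in> ?L \<Longrightarrow> c x \<in> gsec C V (d - ?deg x)" and off: "\<And>x. x \<notin> ?L \<Longrightarrow> c x = 0"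
        using ex unfolding frame_expansion_def by blast+
      have "D = (\<Sum>x\<in>?L. gact (diff_op_sheaf C E k) (c x) (resD k U V (?fr x)))"
        using ex unfolding frame_expansion_def by (elim conjE)
      then have D1: "D = FV.decomp k (?c c)" by (rule trans[OF _ sum]) (rule c)
      have u: "FV.coeff d D I m l = multi_fact n I *\<^sub>R c (I, m, l)" if L: "(I, m, l) \<in> ?L" for I m l
      proof -
        have I: "I \<in> FV.indices k" and ml: "m < r" "l < r" using L unfolding op_indices_def by auto
        have "FV.coeff d (FV.decomp k (?c c)) I m l = ?c c I m l"
          by (rule FV.coeff_unique[OF cin I ml]) (rule c)
        then show ?thesis unfolding D1[symmetric] .
      qed
      show ?thesis
      proof
        fix x show "c x = c0 x" using u off[of x] fact by (cases x) (simp add: c0_def)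
      qed
    qed
    ultimately show ?thesis by blast
  qed
  note ex1 = this
  show ?thesis
    unfolding local_frame_def
  proof (intro conjI allI ballI impI)
    fix V d D assume "D \<in> gsec (diff_op_sheaf C E k) V d" "openin X V \<and> V \<subseteq> U"
    then show "\<exists>!c. frame_expansion C (diff_op_sheaf C E k) ?L ?deg V (\<lambda>x. resD k U V (?fr x)) d D c"
      using ex1 unfolding diff_op_sheaf_simps(1) by blast
  next
    fix x assume "x \<in> ?L"
    then show "?fr x \<in> gsec (diff_op_sheaf C E k) U (?deg x)" unfolding diff_op_sheaf_simps(1) by (rule fr_in)
  qed (rule has_degrees_op U_open)+
qed

end

text \<open>A chart and a trivialisation of \<open>E\<close> around a point give a frame of
  operators over their intersection. The numbers and degrees of the given chart and frame may differ
  from those in the definitions of the manifold and the bundle by their order;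
  \<open>op_rank_le\<close> identifies the ranks.\<close>

lemma diff_op_bundle:
  assumes M: "graded_manifold X C nd" and B: "graded_vector_bundle X C E rk"
    and n: "has_degrees {..<n} dz nd" and r: "has_degrees {..<r} d\<theta> rk"
  shows "graded_vector_bundle X C (diff_op_sheaf C E k) (op_rank k n dz r d\<theta>)"
proof -
  interpret module_sheaf_with_bumps X C E
    by (rule module_sheaf_with_bumpsI[OF M]) (use B in \<open>simp add: graded_vector_bundle_def\<close>)
  interpret DS: module_sheaf X C "diff_op_sheaf C E k" by unfold_locales (rule C, rule diff_op_module_sheaf)
  obtain n' dz' where n': "has_degrees {..<n'} dz' nd"
    and charts: "\<And>x. x \<in> topspace X \<Longrightarrow> \<exists>U \<phi> pb. x \<in> U \<and> graded_chart X C nd U n' dz' \<phi> pb"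
    using M unfolding graded_manifold_def by blast
  obtain r' :: nat and d\<theta>' where r': "has_degrees {..<r'} d\<theta>' rk"
    and triv: "\<And>x. x \<in> topspace X \<Longrightarrow> \<exists>U T. openin X U \<and> x \<in> U \<and> module_iso_on X C E (tensor_module C {..<r'} d\<theta>') U T"
    using B unfolding graded_vector_bundle_def by blast
  let ?L = "op_indices k n' dz' r'" and ?deg = "op_degree n' dz' d\<theta>'"
  have rank: "op_rank k n dz r d\<theta> = op_rank k n' dz' r' d\<theta>'"
    using op_rank_le[OF n n' r r'] op_rank_le[OF n' n r' r] by (intro ext antisym) auto
  obtain h where h: "bij_betw h {..<card ?L} ?L"
    using ex_bij_betw_nat_finite[OF finite_op_indices[of k n' dz' r']] by (auto simp: atLeast0LessThan)
  have "\<exists>U T. openin X U \<and> x \<in> U \<and>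
      module_iso_on X C (diff_op_sheaf C E k) (tensor_module C {..<card ?L} (\<lambda>i. ?deg (h i))) U T"
    if x: "x \<in> topspace X" for x
  proof -
    obtain U1 \<phi> pb where U1: "x \<in> U1" "graded_chart X C nd U1 n' dz' \<phi> pb" using charts[OF x] by blast
    obtain U2 T where U2: "openin X U2" "x \<in> U2" "module_iso_on X C E (tensor_module C {..<r'} d\<theta>') U2 T"
      using triv[OF x] by blast
    let ?U = "U1 \<inter> U2"
    have U: "openin X ?U" using U1(2) U2(1) by (simp add: graded_chart_def openin_Int)
    have "module_iso_on X C E (tensor_module C {..<r'} d\<theta>') ?U T" using U2(3) by (simp add: module_iso_on_def)
    then obtain \<Phi> where \<Phi>: "local_frame X C E rk {..<r'} d\<theta>' ?U \<Phi>" using iso_local_frame[OF _ U r'] by blast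
    interpret F: framed_chart X C E nd rk n' r' dz' d\<theta>' U1 ?U \<phi> pb \<Phi>
      by unfold_locales (use U1(2) \<Phi> in auto)
    obtain T' where "module_iso_on X C (diff_op_sheaf C E k) (tensor_module C {..<card ?L} (\<lambda>i. ?deg (h i))) ?U T'"
      using DS.local_frame_iso[OF DS.local_frame_reindex[OF F.diff_op_frame h]] by blast
    then show ?thesis using U U1(1) U2(2) by blast
  qed
  moreover have "has_degrees {..<card ?L} (\<lambda>i. ?deg (h i)) (op_rank k n' dz' r' d\<theta>')"
    by (rule has_degrees_reindex[OF has_degrees_op h])
  ultimately show ?thesis
    unfolding graded_vector_bundle_def rank using diff_op_module_sheaf by blast
qed

theorem theorem3p4:
  fixes X :: "'p topology"
    and C :: "('p, 'c::real_vector) galgebra"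
    and E :: "('p, 'e::real_vector, 'c) gmodule"
    and nd rk :: "int \<Rightarrow> nat"
    and k n r :: nat
    and dz d\<theta> :: "nat \<Rightarrow> int"
    and U :: "'p set"
    and \<phi> :: "'p \<Rightarrow> nat \<Rightarrow> real"
    and pb :: "'p set \<Rightarrow> power_series \<Rightarrow> 'c"
    and \<Phi> :: "nat \<Rightarrow> 'e"
    and z :: "nat \<Rightarrow> 'c"
    and P :: "(nat \<Rightarrow> nat) \<Rightarrow> nat \<Rightarrow> nat \<Rightarrow> 'e gmap"
    and P_deg :: "(nat \<Rightarrow> nat) \<Rightarrow> nat \<Rightarrow> nat \<Rightarrow> int"
    and \<I> :: "(nat \<Rightarrow> nat) set"
    and \<D> :: "('p, 'e gmap, 'c) gmodule"
  assumes "graded_manifold X C nd"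
    and "graded_vector_bundle X C E rk"
    and "graded_chart X C nd U n dz \<phi> pb"
    and "local_frame X C E rk {..<r} d\<theta> U \<Phi>"
    and z_def: "z = chart_coord U n dz \<phi> pb"
    and P_def: "P = frame_op C E U n dz z r d\<theta> \<Phi>"
    and P_deg_def: "P_deg = (\<lambda>I l m. d\<theta> m - d\<theta> l - exponent_degree n dz I)"
    and \<I>_def: "\<I> = (\<Union>q\<in>{0..k}. multi_indices n dz q)"
    and \<D>_def: "\<D> = diff_op_sheaf C E k"
  shows "(\<forall>I\<in>\<I>. \<forall>l<r. \<forall>m<r. P I l m \<in> diff_ops C E k U (P_deg I l m)) \<and>
    (\<forall>d. \<forall>D\<in>diff_ops C E k U d. \<exists>c.
       (\<forall>I\<in>\<I>. \<forall>m<r. \<forall>l<r. c I m l \<in> gsec C U (d - P_deg I l m)) \<and>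
       (\<forall>I\<in>\<I>. \<forall>l<r.
          coord_commutator E U n dz z I d D
            (d\<theta> l) (\<Phi> l) = (\<Sum>m<r. gact E (c I m l) (\<Phi> m))) \<and>
       D = (\<Sum>q=0..k. \<Sum>I\<in>multi_indices n dz q. \<Sum>m<r. \<Sum>l<r.
              (1 / multi_fact n I) *\<^sub>R gact \<D> (c I m l) (P I l m)) \<and>
       (\<forall>c'. (\<forall>I\<in>\<I>. \<forall>m<r. \<forall>l<r. c' I m l \<in> gsec C U (d - P_deg I l m)) \<and>
          D = (\<Sum>q=0..k. \<Sum>I\<in>multi_indices n dz q. \<Sum>m<r. \<Sum>l<r.
                 (1 / multi_fact n I) *\<^sub>R gact \<D> (c' I m l) (P I l m)) \<longrightarrow>
          (\<forall>I\<in>\<I>. \<forall>m<r. \<forall>l<r. c' I m l = c I m l))) \<and>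
    graded_vector_bundle X C \<D>
      (\<lambda>j. card {(I, m, l) \<in> \<I> \<times> {..<r} \<times> {..<r}. P_deg I l m = j}) \<and>
    local_frame X C \<D>
      (\<lambda>j. card {(I, m, l) \<in> \<I> \<times> {..<r} \<times> {..<r}. P_deg I l m = j})
      (\<I> \<times> {..<r} \<times> {..<r}) (\<lambda>(I, m, l). P_deg I l m) U (\<lambda>(I, m, l). P I l m)"
proof -
  interpret module_sheaf_with_bumps X C E
    by (rule module_sheaf_with_bumpsI[OF assms(1)]) (use assms(2) in \<open>simp add: graded_vector_bundle_def\<close>)
  \<comment> \<open>Here chart and frame are given over the same set.\<close>
  interpret F: framed_chart X C E nd rk n r dz d\<theta> U U \<phi> pb \<Phi>
    by unfold_locales (use assms(3,4) in auto)
  interpret G: graded_frame C U n dz z "F.dV U" E r d\<theta> \<Phi> unfolding z_def by (rule F.graded_frame_self)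
  have rank: "(\<lambda>j. card {(I, m, l) \<in> \<I> \<times> {..<r} \<times> {..<r}. P_deg I l m = j}) = op_rank k n dz r d\<theta>"
    unfolding op_rank_def op_indices_def op_degree_def \<I>_def P_deg_def
    by (intro ext arg_cong[where f = card]) auto
  have frame: "local_frame X C \<D> (op_rank k n dz r d\<theta>) (\<I> \<times> {..<r} \<times> {..<r})
      (\<lambda>(I, m, l). P_deg I l m) U (\<lambda>(I, m, l). P I l m)"
    using F.diff_op_frame unfolding op_indices_def op_degree_def \<I>_def P_deg_def P_def z_def \<D>_def .
  have "has_degrees {..<n} dz nd" using assms(3) by (simp add: graded_chart_def)
  then have vector_bundle: "graded_vector_bundle X C \<D> (op_rank k n dz r d\<theta>)"
    unfolding \<D>_def by (rule diff_op_bundle[OF assms(1,2) _ local_frameD(1)[OF assms(4)]])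
  have ops: "\<forall>I\<in>\<I>. \<forall>l<r. \<forall>m<r. P I l m \<in> diff_ops C E k U (P_deg I l m)"
    unfolding \<I>_def P_def P_deg_def by (intro ballI allI impI G.frame_op_diff_op)
  have decomp: "\<exists>c.
       (\<forall>I\<in>\<I>. \<forall>m<r. \<forall>l<r. c I m l \<in> gsec C U (d - P_deg I l m)) \<and>
       (\<forall>I\<in>\<I>. \<forall>l<r.
          coord_commutator E U n dz z I d D
            (d\<theta> l) (\<Phi> l) = (\<Sum>m<r. gact E (c I m l) (\<Phi> m))) \<and>
       D = (\<Sum>q=0..k. \<Sum>I\<in>multi_indices n dz q. \<Sum>m<r. \<Sum>l<r.
              (1 / multi_fact n I) *\<^sub>R gact \<D> (c I m l) (P I l m)) \<and>
       (\<forall>c'. (\<forall>I\<in>\<I>. \<forall>m<r. \<forall>l<r. c' I m l \<in> gsec C U (d - P_deg I l m)) \<and>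
          D = (\<Sum>q=0..k. \<Sum>I\<in>multi_indices n dz q. \<Sum>m<r. \<Sum>l<r.
                 (1 / multi_fact n I) *\<^sub>R gact \<D> (c' I m l) (P I l m)) \<longrightarrow>
          (\<forall>I\<in>\<I>. \<forall>m<r. \<forall>l<r. c' I m l = c I m l))"
    if D: "D \<in> diff_ops C E k U d" for d D
    unfolding \<D>_def diff_op_sheaf_simps(2) \<I>_def P_def P_deg_def
  proof (intro exI[of _ "G.coeff d D"] conjI allI impI; (elim conjE)?)
    show "\<forall>I\<in>G.indices k. \<forall>m<r. \<forall>l<r. G.coeff d D I m l \<in> gsec C U (d - G.P_deg I l m)"
      using G.coeff_in[OF D] unfolding G.coeffs_in_def .
    show "\<forall>I\<in>G.indices k. \<forall>l<r. G.cc I d D (d\<theta> l) (\<Phi> l) = (\<Sum>m<r. gact E (G.coeff d D I m l) (\<Phi> m))"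
      by (intro ballI allI impI G.cc_frame[OF D])
    show "D = G.decomp k (G.coeff d D)" by (rule G.decomposition[OF D])
    fix c' assume c': "\<forall>I\<in>G.indices k. \<forall>m<r. \<forall>l<r. c' I m l \<in> gsec C U (d - G.P_deg I l m)"
      and eq: "D = G.decomp k c'"
    show "\<forall>I\<in>G.indices k. \<forall>m<r. \<forall>l<r. c' I m l = G.coeff d D I m l"
    proof (intro ballI allI impI)
      fix I m l assume I: "I \<in> G.indices k" and ml: "m < r" "l < r"
      have "G.coeff d (G.decomp k c') I m l = c' I m l"
        by (rule G.coeff_unique[OF _ I ml]) (use c' in \<open>simp only: G.coeffs_in_def\<close>)
      then show "c' I m l = G.coeff d D I m l" unfolding eq[symmetric] by (rule sym)
    qed
  qed
  show ?thesis
    unfolding rank by (intro conjI ballI allI decomp ops frame vector_bundle)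
qed

end
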